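(* Let $\mathcal H$ be the double affine Hecke algebra at critical level associated to the affine root system $R$, and let $\mathcal A\,\#\,W$ be the smash product, both as defined in the context. The assignments $T_j\mapsto \check T_j$ ($j\in\{0,\dots,n\}$), $T_u\mapsto u$ ($u\in\Omega$) and $X^\lambda\mapsto X^\lambda$ ($\lambda\in P$) uniquely extend to an injective homomorphism $\jmath:\mathcal H\to \mathcal A\,\#\,W$ of $\mathbb L$-algebras, where $$\check T_j:=\tau_j s_j+\frac{\tau_j-\tau_j^{-1}}{1-X^{-\alpha_j}}(1-s_j)\in \mathcal A\,\#\,W\qquad (j=0,\dots,n).$$
   Context: **Affine root system.** Let $V$ be a real finite-dimensional Euclidean space with inner product $\langle\cdot,\cdot\rangle$. Identify affine-linear functions on $V$ with $V+\mathbb R$ via $(v+r)(x):=\langle v,x\rangle+r$; the gradient is $(v+r)':=v$. Let $R_0\subset V$ be an irreducible reduced crystallographic root system of full rank $n$ in $V$, with Weyl group $W_0$, root lattice $Q$, weight lattice $P=\{\lambda\in V\mid \langle\lambda,\alpha^\vee\rangle\in\mathbb Z\ \forall\alpha\in R_0\}$, where $\alpha^\vee=2\alpha/\langle\alpha,\alpha\rangle$. Fix positive roots $R_0^+$ with simple basis $\alpha_1,\dots,\alpha_n$, and let $\varphi$, $\vartheta$ be the highest root and the highest short root of $R_0^+$ (if $R_0$ is simply laced, all roots are called both short and long). Fix a real number $c>0$. Put $\alpha_0:=-\vartheta$ (twisted case) or $\alpha_0:=-\varphi$ (untwisted case). For $\alpha\in R_0$ let $m_\alpha:=1$ if $\alpha$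 is short and $m_\alpha:=\langle\varphi,\varphi\rangle/\langle\alpha_0,\alpha_0\rangle$ if $\alpha$ is long. The (irreducible reduced) affine root system with reduced gradient root system $R_0$ is $R=\{\alpha+m_\alpha rc\mid \alpha\in R_0,\ r\in\mathbb Z\}$, twisted or untwisted accordingly; both types are allowed. It has basis $a_0:=\alpha_0+c$, $a_j:=\alpha_j$ ($1\le j\le n$). **Affine Weyl groups.** For $a=\alpha+m_\alpha rc\in R$ let $s_a(x):=x-a(x)\alpha^\vee$ ($x\in V$), and put $s_j:=s_{a_j}$ ($0\le j\le n$). The affine Weyl group $W^a$ is generated by all $s_a$, $a\in R$. For $y\in V$ let $t_y(x)=x+y$. Let $\hat R_0:=\{m_\alpha\alpha^\vee\mid\alpha\in R_0\}$ and let $\hat P$ be the weight lattice of the root system $\hat R_0$. The extended affine Weyl group is $W=W_0\ltimes t(c\hat P)$, the group of all $vt_{c\lambda}$ with $v\in W_0$, $\lambda\in\hat P$; it contains $W^a$. Put $(vt_{c\lambda})':=v$; so $s_j'=s_j$ for $1\le j\le n$ and $s_0'$ is the orthogonal reflection associated with $\alpha_0$. $W$ acts on functions on $V$ by $(wf)(x)=f(w^{-1}x)$, and this preserves $R$. Let $\Omega\subset W$ be the subgroup of elements that permute the simple affine roots $\{a_0,\dots,a_n\}$; for $u\in\Omega$ write $ua_j=a_{u_j}$. Let $m_{jk}$ denote the order of $s_js_k$ (for $n=1$, $m_{01}=m_{10}=\infty$, and the corresponding braid relation below is void). **Parameters.** Let $\tau_\alpha$ ($\alpha\in R_0$) be indeterminates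 with $\tau_{w\alpha}=\tau_\alpha$ for $w\in W_0$ (one independent indeterminate per $W_0$-orbit), and let $\mathbb L$ be the complex algebra of Laurent polynomials in the $\tau_\alpha$. Put $\tau_j:=\tau_{\alpha_j}$ for $0\le j\le n$. **Algebra $\mathcal H$.** The double affine Hecke algebra at critical level $\mathcal H$ is the unital associative $\mathbb L$-algebra with invertible generators $T_u$ ($u\in\Omega$), $T_j$ ($0\le j\le n$) and commuting elements $X^\lambda$ ($\lambda\in P$), subject to the relations: - $T_uT_{\tilde u}=T_{u\tilde u}$ and $T_uT_j=T_{u_j}T_u$ ($u,\tilde u\in\Omega$, $0\le j\le n$); - $(T_j-\tau_j)(T_j+\tau_j^{-1})=0$ ($0\le j\le n$); - $T_jT_kT_j\cdots=T_kT_jT_k\cdots$ with $m_{jk}$ factors on each side ($0\le j\ne k\le n$); - $T_uX^\lambda=X^{u'\lambda}T_u$ ($u\in\Omega$, $\lambda\in P$); - $T_jX^\lambda=X^{s_j'\lambda}T_j+(\tau_j-\tau_j^{-1})\dfrac{X^\lambda-X^{s_j'\lambda}}{1-X^{-\alpha_j}}$ ($0\le j\le n$, $\lambda\in P$), where the fraction denotes the quotient, which is a $\mathbb Z$-linear combination of elements $X^\mu$, $\mu\in P$; - $X^\lambda X^{\tilde\lambda}=X^{\lambda+\tilde\lambda}$ ($\lambda,\tilde\lambda\in P$), and $X^0=1$. **Smash product.** Let $\mathbb L[P]$ be the group algebra of $P$ with basis $X^\lambda$ ($\lambda\in P$), on which $W_0$ acts by $wX^\lambda=X^{w\lambda}$.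 Let $\mathcal A$ be the localization of $\mathbb L[P]$ at $\delta=\prod_{\alpha\in R_0}(1-X^\alpha)$; the $W_0$-action extends to $\mathcal A$ by $\mathbb L$-algebra automorphisms, written $f\mapsto f^w$. The smash product $\mathcal A\,\#\,W$ is the associative unital $\mathbb L$-algebra characterized by: (i) it contains $\mathcal A$ and the group algebra $\mathbb L[W]$ as subalgebras; (ii) multiplication defines an isomorphism $\mathcal A\otimes_{\mathbb L}\mathbb L[W]\to\mathcal A\,\#\,W$ of $\mathbb L$-modules; (iii) $(fv)(gw)=fg^{v'}vw$ for all $f,g\in\mathcal A$ and $v,w\in W$. *)

theory Defs
  imports
    "HOL-Analysis.Euclidean_Space"
    "HOL-Library.Poly_Mapping"
    "HOL-Algebra.QuotRing"
    "HOL-Algebra.Multiplicative_Group"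
begin

unbundle inner_syntax

section \<open>Root systems\<close>

definition coroot :: "'v::euclidean_space \<Rightarrow> 'v" where
  "coroot \<alpha> = (2 / (\<alpha> \<bullet> \<alpha>)) *\<^sub>R \<alpha>"

definition affine_fun :: "'v::euclidean_space \<Rightarrow> real \<Rightarrow> 'v \<Rightarrow> real" where
  "affine_fun v r = (\<lambda>x. v \<bullet> x + r)"

definition affine_reflection :: "'v::euclidean_space \<Rightarrow> real \<Rightarrow> 'v \<Rightarrow> 'v" where
  "affine_reflection \<alpha> r = (\<lambda>x. x - affine_fun \<alpha> r x *\<^sub>R coroot \<alpha>)"

abbreviation reflection :: "'v::euclidean_space \<Rightarrow> 'v \<Rightarrow> 'v" where
  "reflection \<alpha> \<equiv> affine_reflection \<alpha> 0"

definition root_system :: "'v::euclidean_space set \<Rightarrow> bool" where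
  "root_system R \<longleftrightarrow> finite R \<and> 0 \<notin> R \<and> span R = UNIV \<and>
     (\<forall>\<alpha>\<in>R. reflection \<alpha> ` R = R) \<and>
     (\<forall>\<alpha>\<in>R. \<forall>\<beta>\<in>R. \<beta> \<bullet> coroot \<alpha> \<in> \<int>)"

definition reduced_roots :: "'v::euclidean_space set \<Rightarrow> bool" where
  "reduced_roots R \<longleftrightarrow> (\<forall>\<alpha>\<in>R. \<forall>t. t *\<^sub>R \<alpha> \<in> R \<longrightarrow> t = 1 \<or> t = -1)"

definition irreducible_roots :: "'v::euclidean_space set \<Rightarrow> bool" where
  "irreducible_roots R \<longleftrightarrow> R \<noteq> {} \<and>
     \<not> (\<exists>A B. A \<noteq> {} \<and> B \<noteq> {} \<and> A \<inter> B = {} \<and> A \<union> B = R \<and>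
            (\<forall>\<alpha>\<in>A. \<forall>\<beta>\<in>B. \<alpha> \<bullet> \<beta> = 0))"

text \<open>Reflections are involutions, so the monoid they generate is the Weyl group.\<close>

inductive_set weyl_group :: "'v::euclidean_space set \<Rightarrow> ('v \<Rightarrow> 'v) set"
  for R where
  id: "id \<in> weyl_group R"
| refl: "\<alpha> \<in> R \<Longrightarrow> w \<in> weyl_group R \<Longrightarrow> reflection \<alpha> \<circ> w \<in> weyl_group R"

definition weight_lattice :: "'v::euclidean_space set \<Rightarrow> 'v set" where
  "weight_lattice R = {\<nu>. \<forall>\<alpha>\<in>R. \<nu> \<bullet> coroot \<alpha> \<in> \<int>}"

definition short_root :: "'v::euclidean_space set \<Rightarrow> 'v \<Rightarrow> bool" where
  "short_root R \<alpha> \<longleftrightarrow> \<alpha> \<in> R \<and> (\<forall>\<beta>\<in>R. \<alpha> \<bullet> \<alpha> \<le> \<beta> \<bullet> \<beta>)"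


section \<open>Affine root data\<close>

text \<open>The simple roots are \<open>simple_root D 1, \<dots>, simple_root D DIM('v)\<close>; the other values
  of \<open>simple_root D\<close> are irrelevant. The positive roots are determined by the simple ones.\<close>

record 'v affine_datum =
  roots :: "'v set"
  simple_root :: "nat \<Rightarrow> 'v"
  scale :: real
  twisted :: bool

definition nonneg_comb :: "(nat \<Rightarrow> 'v::euclidean_space) \<Rightarrow> 'v \<Rightarrow> bool" where
  "nonneg_comb \<alpha> v \<longleftrightarrow> (\<exists>k::nat \<Rightarrow> nat. v = (\<Sum>i=1..DIM('v). real (k i) *\<^sub>R \<alpha> i))"

definition root_base :: "'v::euclidean_space set \<Rightarrow> (nat \<Rightarrow> 'v) \<Rightarrow> bool" where
  "root_base R \<alpha> \<longleftrightarrow> inj_on \<alpha> {1..DIM('v)} \<and> \<alpha> ` {1..DIM('v)} \<subseteq> R \<and>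
     independent (\<alpha> ` {1..DIM('v)}) \<and>
     (\<forall>\<beta>\<in>R. nonneg_comb \<alpha> \<beta> \<or> nonneg_comb \<alpha> (- \<beta>))"

definition affine_datum :: "'v::euclidean_space affine_datum \<Rightarrow> bool" where
  "affine_datum D \<longleftrightarrow> root_system (roots D) \<and> reduced_roots (roots D) \<and>
     irreducible_roots (roots D) \<and> root_base (roots D) (simple_root D) \<and> scale D > 0"

definition highest_root :: "'v::euclidean_space affine_datum \<Rightarrow> 'v" where
  "highest_root D = (THE \<phi>. \<phi> \<in> roots D \<and>
     (\<forall>\<beta>\<in>roots D. nonneg_comb (simple_root D) (\<phi> - \<beta>)))"

definition highest_short_root :: "'v::euclidean_space affine_datum \<Rightarrow> 'v" where
  "highest_short_root D = (THE \<theta>. short_root (roots D) \<theta> \<and>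
     (\<forall>\<beta>. short_root (roots D) \<beta> \<longrightarrow> nonneg_comb (simple_root D) (\<theta> - \<beta>)))"

definition alpha :: "'v::euclidean_space affine_datum \<Rightarrow> nat \<Rightarrow> 'v" where
  "alpha D j = (if j = 0 then - (if twisted D then highest_short_root D else highest_root D)
                else simple_root D j)"

definition shift :: "'v affine_datum \<Rightarrow> nat \<Rightarrow> real" where
  "shift D j = (if j = 0 then scale D else 0)"

definition simple_affine_root :: "'v::euclidean_space affine_datum \<Rightarrow> nat \<Rightarrow> 'v \<Rightarrow> real" where
  "simple_affine_root D j = affine_fun (alpha D j) (shift D j)"

definition simple_reflection :: "'v::euclidean_space affine_datum \<Rightarrow> nat \<Rightarrow> 'v \<Rightarrow> 'v" where
  "simple_reflection D j = affine_reflection (alpha D j) (shift D j)"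

text \<open>A root that is both short and long (simply laced case) has multiplicity \<open>1\<close> by either
  clause, since then all roots have the same length.\<close>

definition mult_root :: "'v::euclidean_space affine_datum \<Rightarrow> 'v \<Rightarrow> real" where
  "mult_root D \<alpha> = (if short_root (roots D) \<alpha> then 1
     else (highest_root D \<bullet> highest_root D) / (alpha D 0 \<bullet> alpha D 0))"

definition affine_roots :: "'v::euclidean_space affine_datum \<Rightarrow> ('v \<Rightarrow> real) set" where
  "affine_roots D =
     {affine_fun \<alpha> (mult_root D \<alpha> * of_int r * scale D) |\<alpha> r. \<alpha> \<in> roots D}"

definition weights :: "'v::euclidean_space affine_datum \<Rightarrow> 'v set" where
  "weights D = weight_lattice (roots D)"

definition hat_roots :: "'v::euclidean_space affine_datum \<Rightarrow> 'v set" where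
  "hat_roots D = (\<lambda>\<alpha>. mult_root D \<alpha> *\<^sub>R coroot \<alpha>) ` roots D"

definition translation :: "'v::euclidean_space \<Rightarrow> 'v \<Rightarrow> 'v" where
  "translation y = (\<lambda>x. x + y)"

definition ext_weyl :: "'v::euclidean_space affine_datum \<Rightarrow> ('v \<Rightarrow> 'v) monoid" where
  "ext_weyl D =
     \<lparr>carrier = {v \<circ> translation (scale D *\<^sub>R \<nu>) |v \<nu>.
                   v \<in> weyl_group (roots D) \<and> \<nu> \<in> weight_lattice (hat_roots D)},
      mult = (\<circ>), one = id\<rparr>"

text \<open>For linear \<open>v\<close>, \<open>gradient (v \<circ> translation y) = v\<close>.\<close>

definition gradient :: "('v::euclidean_space \<Rightarrow> 'v) \<Rightarrow> 'v \<Rightarrow> 'v" where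
  "gradient w = (\<lambda>x. w x - w 0)"

definition fun_act :: "('v \<Rightarrow> 'v) \<Rightarrow> ('v \<Rightarrow> real) \<Rightarrow> 'v \<Rightarrow> real" where
  "fun_act w f = (\<lambda>x. f (inv_into UNIV w x))"

definition Omega :: "'v::euclidean_space affine_datum \<Rightarrow> ('v \<Rightarrow> 'v) set" where
  "Omega D = {u \<in> carrier (ext_weyl D).
     fun_act u ` simple_affine_root D ` {0..DIM('v)} = simple_affine_root D ` {0..DIM('v)}}"

definition perm_index :: "'v::euclidean_space affine_datum \<Rightarrow> ('v \<Rightarrow> 'v) \<Rightarrow> nat \<Rightarrow> nat" where
  "perm_index D u j = (THE k. k \<in> {0..DIM('v)} \<and>
     fun_act u (simple_affine_root D j) = simple_affine_root D k)"

text \<open>\<^const>\<open>group.ord\<close> is \<open>0\<close> on elements of infinite order.\<close>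

definition coxeter_order :: "'v::euclidean_space affine_datum \<Rightarrow> nat \<Rightarrow> nat \<Rightarrow> nat" where
  "coxeter_order D j k =
     group.ord (ext_weyl D) (simple_reflection D j \<circ> simple_reflection D k)"


section \<open>Monoid algebras, localization and smash products\<close>

text \<open>The subring of the full monoid algebra consisting of the elements with coefficients in
  \<open>K\<close> and support in \<open>M\<close>.\<close>

definition monoid_algebra ::
    "'k::comm_ring_1 set \<Rightarrow> 'm::monoid_add set \<Rightarrow> ('m \<Rightarrow>\<^sub>0 'k) ring" where
  "monoid_algebra K M =
     \<lparr>carrier = {f. Poly_Mapping.keys f \<subseteq> M \<and> (\<forall>m. Poly_Mapping.lookup f m \<in> K)},
      mult = (*), one = 1, zero = 0, add = (+)\<rparr>"

abbreviation scalar :: "'k::comm_ring_1 \<Rightarrow> 'm::monoid_add \<Rightarrow>\<^sub>0 'k" where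
  "scalar l \<equiv> Poly_Mapping.single 0 l"

definition frac_rel :: "('a, 'b) ring_scheme \<Rightarrow> 'a set \<Rightarrow> (('a \<times> 'a) \<times> ('a \<times> 'a)) set" where
  "frac_rel R S = {((a, s), (b, t)). a \<in> carrier R \<and> b \<in> carrier R \<and> s \<in> S \<and> t \<in> S \<and>
     (\<exists>u\<in>S. u \<otimes>\<^bsub>R\<^esub> (a \<otimes>\<^bsub>R\<^esub> t) = u \<otimes>\<^bsub>R\<^esub> (b \<otimes>\<^bsub>R\<^esub> s))}"

text \<open>\<open>localization R S\<close> is \<open>S\<inverse>R\<close> for a commutative ring \<open>R\<close> and a submonoid \<open>S\<close> of \<open>R\<close>.\<close>

definition localization :: "('a, 'b) ring_scheme \<Rightarrow> 'a set \<Rightarrow> ('a \<times> 'a) set ring" where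
  "localization R S =
     \<lparr>carrier = (carrier R \<times> S) // frac_rel R S,
      mult = (\<lambda>X Y. frac_rel R S `` {(a \<otimes>\<^bsub>R\<^esub> b, s \<otimes>\<^bsub>R\<^esub> t) |a s b t. (a, s) \<in> X \<and> (b, t) \<in> Y}),
      one = frac_rel R S `` {(\<one>\<^bsub>R\<^esub>, \<one>\<^bsub>R\<^esub>)},
      zero = frac_rel R S `` {(\<zero>\<^bsub>R\<^esub>, \<one>\<^bsub>R\<^esub>)},
      add = (\<lambda>X Y. frac_rel R S ``
        {((a \<otimes>\<^bsub>R\<^esub> t) \<oplus>\<^bsub>R\<^esub> (b \<otimes>\<^bsub>R\<^esub> s), s \<otimes>\<^bsub>R\<^esub> t) |a s b t. (a, s) \<in> X \<and> (b, t) \<in> Y})\<rparr>"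

definition to_localization :: "('a, 'b) ring_scheme \<Rightarrow> 'a set \<Rightarrow> 'a \<Rightarrow> ('a \<times> 'a) set" where
  "to_localization R S a = frac_rel R S `` {(a, \<one>\<^bsub>R\<^esub>)}"

text \<open>The map \<open>a/s \<mapsto> h(a)/h(s)\<close> induced by a ring endomorphism \<open>h\<close> with \<open>h ` S \<subseteq> S\<close>.\<close>

definition localization_map ::
    "('a, 'b) ring_scheme \<Rightarrow> 'a set \<Rightarrow> ('a \<Rightarrow> 'a) \<Rightarrow> ('a \<times> 'a) set \<Rightarrow> ('a \<times> 'a) set" where
  "localization_map R S h X = frac_rel R S `` {(h a, h s) |a s. (a, s) \<in> X}"

text \<open>The smash product of \<open>A\<close> with a group \<open>G\<close> acting on \<open>A\<close> through \<open>act\<close>: the free left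
  \<open>A\<close>-module with basis \<open>G\<close>, a finitely supported \<open>F\<close> standing for \<open>\<Sum>\<^sub>x F(x) x\<close>, and
  \<open>(f x) (g y) = (f act\<^sub>x(g)) (x y)\<close>.\<close>

definition smash_product ::
    "('a, 'c) ring_scheme \<Rightarrow> ('g, 'd) monoid_scheme \<Rightarrow> ('g \<Rightarrow> 'a \<Rightarrow> 'a) \<Rightarrow> ('g \<Rightarrow> 'a) ring" where
  "smash_product A G act =
     \<lparr>carrier = {F. (\<forall>x. F x \<in> carrier A) \<and> (\<forall>x. x \<notin> carrier G \<longrightarrow> F x = \<zero>\<^bsub>A\<^esub>) \<and>
                   finite {x. F x \<noteq> \<zero>\<^bsub>A\<^esub>}},
      mult = (\<lambda>F H z. if z \<in> carrier G
        then \<Oplus>\<^bsub>A\<^esub>x\<in>{x. F x \<noteq> \<zero>\<^bsub>A\<^esub>}. F x \<otimes>\<^bsub>A\<^esub> act x (H (inv\<^bsub>G\<^esub> x \<otimes>\<^bsub>G\<^esub> z))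
        else \<zero>\<^bsub>A\<^esub>),
      one = (\<lambda>x. if x = \<one>\<^bsub>G\<^esub> then \<one>\<^bsub>A\<^esub> else \<zero>\<^bsub>A\<^esub>),
      zero = (\<lambda>x. \<zero>\<^bsub>A\<^esub>),
      add = (\<lambda>F H x. F x \<oplus>\<^bsub>A\<^esub> H x)\<rparr>"

definition smash_elem :: "('a, 'c) ring_scheme \<Rightarrow> 'a \<Rightarrow> 'g \<Rightarrow> 'g \<Rightarrow> 'a" where
  "smash_elem A f v = (\<lambda>x. if x = v then f else \<zero>\<^bsub>A\<^esub>)"

lemma smash_elem_mult:
  assumes "ring A" "group G" "f \<in> carrier A" "g \<in> carrier A" "v \<in> carrier G" "w \<in> carrier G"
    and act: "act v \<zero>\<^bsub>A\<^esub> = \<zero>\<^bsub>A\<^esub>" "act v g \<in> carrier A"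
  shows "smash_elem A f v \<otimes>\<^bsub>smash_product A G act\<^esub> smash_elem A g w =
    smash_elem A (f \<otimes>\<^bsub>A\<^esub> act v g) (v \<otimes>\<^bsub>G\<^esub> w)"
proof (rule ext)
  fix z
  interpret A: ring A by fact
  interpret G: group G by fact
  have eq: "inv\<^bsub>G\<^esub> v \<otimes>\<^bsub>G\<^esub> z = w \<longleftrightarrow> z = v \<otimes>\<^bsub>G\<^esub> w" if "z \<in> carrier G"
    using that assms(5,6) by (metis G.inv_closed G.inv_solve_left' G.m_closed G.inv_solve_left)
  show "(smash_elem A f v \<otimes>\<^bsub>smash_product A G act\<^esub> smash_elem A g w) z =
    smash_elem A (f \<otimes>\<^bsub>A\<^esub> act v g) (v \<otimes>\<^bsub>G\<^esub> w) z"
  proof (cases "f = \<zero>\<^bsub>A\<^esub>")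
    case True
    then show ?thesis
      using assms by (auto simp: smash_product_def smash_elem_def)
  next
    case False
    then have "{x. smash_elem A f v x \<noteq> \<zero>\<^bsub>A\<^esub>} = {v}"
      by (auto simp: smash_elem_def)
    then show ?thesis
      using assms eq by (auto simp: smash_product_def smash_elem_def)
  qed
qed

text \<open>An \<open>L\<close>-algebra is given by its underlying ring \<open>A\<close> and the structure map
  \<open>\<eta> :: L \<rightarrow> A\<close>, \<open>\<eta> l = l \<cdot> 1\<close>.\<close>

definition algebra_hom ::
    "('l, 'k) ring_scheme \<Rightarrow> ('a, 'c) ring_scheme \<Rightarrow> ('l \<Rightarrow> 'a) \<Rightarrow>
     ('b, 'd) ring_scheme \<Rightarrow> ('l \<Rightarrow> 'b) \<Rightarrow> ('a \<Rightarrow> 'b) set" where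
  "algebra_hom L A \<eta> B \<theta> = {h \<in> ring_hom A B. \<forall>l\<in>carrier L. h (\<eta> l) = \<theta> l}"


section \<open>Coefficients\<close>

text \<open>One indeterminate per Weyl group orbit; a Laurent monomial is an integer-valued function
  on the orbits, so \<open>\<tau>\<^sub>\<alpha>\<close> is invariant under the Weyl group by construction.\<close>

type_synonym 'v coeff = "('v set \<Rightarrow>\<^sub>0 int) \<Rightarrow>\<^sub>0 complex"

definition weyl_orbit :: "'v::euclidean_space affine_datum \<Rightarrow> 'v \<Rightarrow> 'v set" where
  "weyl_orbit D \<alpha> = (\<lambda>w. w \<alpha>) ` weyl_group (roots D)"

definition coeff_ring :: "'v::euclidean_space affine_datum \<Rightarrow> 'v coeff ring" where
  "coeff_ring D =
     monoid_algebra UNIV {m. Poly_Mapping.keys m \<subseteq> weyl_orbit D ` roots D}"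

definition tau :: "'v::euclidean_space affine_datum \<Rightarrow> nat \<Rightarrow> 'v coeff" where
  "tau D j = Poly_Mapping.single (Poly_Mapping.single (weyl_orbit D (alpha D j)) 1) 1"

definition tau_inv :: "'v::euclidean_space affine_datum \<Rightarrow> nat \<Rightarrow> 'v coeff" where
  "tau_inv D j = Poly_Mapping.single (Poly_Mapping.single (weyl_orbit D (alpha D j)) (-1)) 1"


section \<open>The double affine Hecke algebra at critical level\<close>

datatype 'g free_word = Word (letters: "'g list")

instantiation free_word :: (type) monoid_add
begin

definition zero_free_word :: "'a free_word" where
  "0 = Word []"

definition plus_free_word :: "'a free_word \<Rightarrow> 'a free_word \<Rightarrow> 'a free_word" where
  "u + v = Word (letters u @ letters v)"

instance
  by standard (simp_all add: zero_free_word_def plus_free_word_def)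

end

datatype 'v daha_gen =
    Gen_T nat | Gen_T_inv nat
  | Gen_Om "'v \<Rightarrow> 'v" | Gen_Om_inv "'v \<Rightarrow> 'v"
  | Gen_X 'v

type_synonym 'v free_alg = "'v daha_gen free_word \<Rightarrow>\<^sub>0 'v coeff"

definition daha_gens :: "'v::euclidean_space affine_datum \<Rightarrow> 'v daha_gen set" where
  "daha_gens D = Gen_T ` {0..DIM('v)} \<union> Gen_T_inv ` {0..DIM('v)} \<union>
     Gen_Om ` Omega D \<union> Gen_Om_inv ` Omega D \<union> Gen_X ` weights D"

definition free_algebra :: "'v::euclidean_space affine_datum \<Rightarrow> 'v free_alg ring" where
  "free_algebra D =
     monoid_algebra (carrier (coeff_ring D)) {w. set (letters w) \<subseteq> daha_gens D}"

definition gen :: "'v daha_gen \<Rightarrow> 'v free_alg" where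
  "gen g = Poly_Mapping.single (Word [g]) 1"

fun alternating :: "nat \<Rightarrow> 'a::monoid_mult \<Rightarrow> 'a \<Rightarrow> 'a" where
  "alternating 0 x y = 1"
| "alternating (Suc m) x y = x * alternating m y x"

text \<open>\<open>divided_difference \<alpha> \<nu>\<close> is the quotient of \<open>X\<^sup>\<nu> - X\<^sup>s\<^sup>\<nu>\<close> by \<open>1 - X\<^sup>-\<^sup>\<alpha>\<close>, \<open>s\<close> the reflection in
  \<open>\<alpha>\<close>. It is unique because the integral group ring of the vector space has no zero
  divisors.\<close>

definition divided_difference :: "'v::euclidean_space \<Rightarrow> 'v \<Rightarrow> 'v \<Rightarrow>\<^sub>0 int" where
  "divided_difference \<alpha> \<nu> = (THE q. q * (1 - Poly_Mapping.single (- \<alpha>) 1) =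
     Poly_Mapping.single \<nu> 1 - Poly_Mapping.single (reflection \<alpha> \<nu>) 1)"

definition eval_X :: "('v \<Rightarrow>\<^sub>0 int) \<Rightarrow> 'v free_alg" where
  "eval_X q = (\<Sum>\<mu>\<in>Poly_Mapping.keys q. of_int (Poly_Mapping.lookup q \<mu>) * gen (Gen_X \<mu>))"

inductive daha_rel ::
    "'v::euclidean_space affine_datum \<Rightarrow> 'v free_alg \<Rightarrow> 'v free_alg \<Rightarrow> bool"
  for D :: "'v affine_datum" where
  T_inv_right: "j \<le> DIM('v) \<Longrightarrow> daha_rel D (gen (Gen_T j) * gen (Gen_T_inv j)) 1"
| T_inv_left: "j \<le> DIM('v) \<Longrightarrow> daha_rel D (gen (Gen_T_inv j) * gen (Gen_T j)) 1"
| Om_inv_right: "u \<in> Omega D \<Longrightarrow> daha_rel D (gen (Gen_Om u) * gen (Gen_Om_inv u)) 1"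
| Om_inv_left: "u \<in> Omega D \<Longrightarrow> daha_rel D (gen (Gen_Om_inv u) * gen (Gen_Om u)) 1"
| Om_mult: "u \<in> Omega D \<Longrightarrow> u' \<in> Omega D \<Longrightarrow>
    daha_rel D (gen (Gen_Om u) * gen (Gen_Om u')) (gen (Gen_Om (u \<circ> u')))"
| Om_T: "u \<in> Omega D \<Longrightarrow> j \<le> DIM('v) \<Longrightarrow>
    daha_rel D (gen (Gen_Om u) * gen (Gen_T j)) (gen (Gen_T (perm_index D u j)) * gen (Gen_Om u))"
| quadratic: "j \<le> DIM('v) \<Longrightarrow>
    daha_rel D ((gen (Gen_T j) - scalar (tau D j)) * (gen (Gen_T j) + scalar (tau_inv D j))) 0"
| braid: "j \<le> DIM('v) \<Longrightarrow> k \<le> DIM('v) \<Longrightarrow> j \<noteq> k \<Longrightarrow> coxeter_order D j k \<noteq> 0 \<Longrightarrow>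
    daha_rel D (alternating (coxeter_order D j k) (gen (Gen_T j)) (gen (Gen_T k)))
               (alternating (coxeter_order D j k) (gen (Gen_T k)) (gen (Gen_T j)))"
| Om_X: "u \<in> Omega D \<Longrightarrow> \<nu> \<in> weights D \<Longrightarrow>
    daha_rel D (gen (Gen_Om u) * gen (Gen_X \<nu>)) (gen (Gen_X (gradient u \<nu>)) * gen (Gen_Om u))"
| T_X: "j \<le> DIM('v) \<Longrightarrow> \<nu> \<in> weights D \<Longrightarrow>
    daha_rel D (gen (Gen_T j) * gen (Gen_X \<nu>))
      (gen (Gen_X (gradient (simple_reflection D j) \<nu>)) * gen (Gen_T j) +
       scalar (tau D j - tau_inv D j) * eval_X (divided_difference (alpha D j) \<nu>))"
| X_add: "\<nu> \<in> weights D \<Longrightarrow> \<mu> \<in> weights D \<Longrightarrow>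
    daha_rel D (gen (Gen_X \<nu>) * gen (Gen_X \<mu>)) (gen (Gen_X (\<nu> + \<mu>)))"
| X_zero: "daha_rel D (gen (Gen_X 0)) 1"

definition daha_ideal :: "'v::euclidean_space affine_datum \<Rightarrow> 'v free_alg set" where
  "daha_ideal D = Idl\<^bsub>free_algebra D\<^esub> {p - q |p q. daha_rel D p q}"

definition DAHA :: "'v::euclidean_space affine_datum \<Rightarrow> 'v free_alg set ring" where
  "DAHA D = free_algebra D Quot daha_ideal D"

definition daha_class :: "'v::euclidean_space affine_datum \<Rightarrow> 'v free_alg \<Rightarrow> 'v free_alg set" where
  "daha_class D p = daha_ideal D +>\<^bsub>free_algebra D\<^esub> p"

definition DAHA_scalar :: "'v::euclidean_space affine_datum \<Rightarrow> 'v coeff \<Rightarrow> 'v free_alg set" where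
  "DAHA_scalar D l = daha_class D (scalar l)"

definition DAHA_T :: "'v::euclidean_space affine_datum \<Rightarrow> nat \<Rightarrow> 'v free_alg set" where
  "DAHA_T D j = daha_class D (gen (Gen_T j))"

definition DAHA_Om :: "'v::euclidean_space affine_datum \<Rightarrow> ('v \<Rightarrow> 'v) \<Rightarrow> 'v free_alg set" where
  "DAHA_Om D u = daha_class D (gen (Gen_Om u))"

definition DAHA_X :: "'v::euclidean_space affine_datum \<Rightarrow> 'v \<Rightarrow> 'v free_alg set" where
  "DAHA_X D \<nu> = daha_class D (gen (Gen_X \<nu>))"


section \<open>The smash product of the localized weight lattice algebra with \<open>W\<close>\<close>

type_synonym 'v weight_alg = "'v \<Rightarrow>\<^sub>0 'v coeff"

type_synonym 'v loc_alg = "('v weight_alg \<times> 'v weight_alg) set"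

definition weight_algebra :: "'v::euclidean_space affine_datum \<Rightarrow> 'v weight_alg ring" where
  "weight_algebra D = monoid_algebra (carrier (coeff_ring D)) (weights D)"

definition X_pow :: "'v \<Rightarrow> 'v weight_alg" where
  "X_pow \<nu> = Poly_Mapping.single \<nu> 1"

definition delta :: "'v::euclidean_space affine_datum \<Rightarrow> 'v weight_alg" where
  "delta D = (\<Prod>\<alpha>\<in>roots D. 1 - X_pow \<alpha>)"

definition denominators :: "'v::euclidean_space affine_datum \<Rightarrow> 'v weight_alg set" where
  "denominators D = range (\<lambda>k. delta D ^ k)"

definition weight_act :: "('v \<Rightarrow> 'v) \<Rightarrow> 'v weight_alg \<Rightarrow> 'v weight_alg" where
  "weight_act w f =
     (\<Sum>\<nu>\<in>Poly_Mapping.keys f. Poly_Mapping.single (w \<nu>) (Poly_Mapping.lookup f \<nu>))"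

definition loc_algebra :: "'v::euclidean_space affine_datum \<Rightarrow> 'v loc_alg ring" where
  "loc_algebra D = localization (weight_algebra D) (denominators D)"

definition loc_embed :: "'v::euclidean_space affine_datum \<Rightarrow> 'v weight_alg \<Rightarrow> 'v loc_alg" where
  "loc_embed D = to_localization (weight_algebra D) (denominators D)"

definition loc_act ::
    "'v::euclidean_space affine_datum \<Rightarrow> ('v \<Rightarrow> 'v) \<Rightarrow> 'v loc_alg \<Rightarrow> 'v loc_alg" where
  "loc_act D w = localization_map (weight_algebra D) (denominators D) (weight_act w)"

type_synonym 'v smash_alg = "('v \<Rightarrow> 'v) \<Rightarrow> 'v loc_alg"

definition smash :: "'v::euclidean_space affine_datum \<Rightarrow> 'v smash_alg ring" where
  "smash D = smash_product (loc_algebra D) (ext_weyl D) (\<lambda>w. loc_act D (gradient w))"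

definition smash_loc :: "'v::euclidean_space affine_datum \<Rightarrow> 'v loc_alg \<Rightarrow> 'v smash_alg" where
  "smash_loc D f = smash_elem (loc_algebra D) f id"

definition smash_grp :: "'v::euclidean_space affine_datum \<Rightarrow> ('v \<Rightarrow> 'v) \<Rightarrow> 'v smash_alg" where
  "smash_grp D w = smash_elem (loc_algebra D) \<one>\<^bsub>loc_algebra D\<^esub> w"

definition smash_scalar :: "'v::euclidean_space affine_datum \<Rightarrow> 'v coeff \<Rightarrow> 'v smash_alg" where
  "smash_scalar D l = smash_loc D (loc_embed D (scalar l))"

definition smash_X :: "'v::euclidean_space affine_datum \<Rightarrow> 'v \<Rightarrow> 'v smash_alg" where
  "smash_X D \<nu> = smash_loc D (loc_embed D (X_pow \<nu>))"

definition T_check :: "'v::euclidean_space affine_datum \<Rightarrow> nat \<Rightarrow> 'v smash_alg" where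
  "T_check D j =
     smash_scalar D (tau D j) \<otimes>\<^bsub>smash D\<^esub> smash_grp D (simple_reflection D j) \<oplus>\<^bsub>smash D\<^esub>
     smash_loc D (loc_embed D (scalar (tau D j - tau_inv D j)) \<otimes>\<^bsub>loc_algebra D\<^esub>
                  inv\<^bsub>loc_algebra D\<^esub> (loc_embed D (1 - X_pow (- alpha D j)))) \<otimes>\<^bsub>smash D\<^esub>
     (\<one>\<^bsub>smash D\<^esub> \<ominus>\<^bsub>smash D\<^esub> smash_grp D (simple_reflection D j))"

end

theory Submission
  imports Defs
begin

text \<open>The images of the \<open>T\<^sub>j\<close> act on the weight algebra as Demazure--Lusztig operators, and an
  element of the smash product supported on the stabilizer of a point is determined by this action,
  because the gradient is injective on the stabilizer and characters are independent. Each relation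
  involving the \<open>T\<^sub>j\<close> only concerns reflections in affine hyperplanes with a common point, so it may
  be checked on Demazure--Lusztig operators; for the braid relations one shows that the elements on
  which both alternating products agree form a submodule stable under multiplication by all \<open>X\<^sup>\<lambda>\<close>.

  For injectivity, the relations and Matsumoto's theorem write every element as a sum of terms
  \<open>g T\<^sub>u T\<^sub>w\<close> with \<open>g\<close> in the weight algebra, \<open>u \<in> \<Omega>\<close> and one reduced word per \<open>w \<in> W\<^sup>a\<close>. The
  image of such a term is \<open>g c uw\<close> plus elements \<open>uw'\<close> with \<open>w'\<close> shorter than \<open>w\<close>, where \<open>c\<close> is not a
  zero divisor; hence the terms with \<open>w\<close> of maximal length cannot cancel.\<close>

section \<open>Crystallographic root systems\<close>

text \<open>Translations have trivial gradient, so at critical level the extended group acts on the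
  localized weight algebra only through the finite group \<open>W0\<close>, and the action of the
  smash product has a large kernel. This obstacle shapes both halves: relations may be tested on the
  action only for elements confined to the stabilizer of a point, and injectivity has to be read off
  from supports. Simple reflections with parallel hyperplanes have no common fixed point, but their
  product has infinite order, so there is no braid relation to check. The relation between
  \<open>T_u\<close> and \<open>T_j\<close> is compared coefficientwise instead.

  The stable submodule in the braid relations is everything because constants are common
  eigenvectors of the two operators and all weights are generated, up to vectors orthogonal to both
  roots, by Weyl orbits along which moving \<open>X\<close> past an operator inverts it. Such
  minuscule orbits exist for A1 x A1, A2 and B2; G2 only offers the quasi-minuscule orbit of short
  roots.

  The exchange condition for the affine Weyl group is derived from the geometry of the fundamental
  alcove.\<close>

lemma reflection_eq: "reflection \<alpha> x = x - (\<alpha> \<bullet> x) *\<^sub>R coroot \<alpha>"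
  by (simp add: affine_reflection_def affine_fun_def)

lemma inner_coroot: "x \<bullet> coroot \<alpha> = 2 * (x \<bullet> \<alpha>) / (\<alpha> \<bullet> \<alpha>)"
  by (simp add: coroot_def)

lemma inner_coroot_self: "\<alpha> \<noteq> 0 \<Longrightarrow> \<alpha> \<bullet> coroot \<alpha> = 2"
  by (simp add: inner_coroot)

lemma coroot_scale: "t \<noteq> 0 \<Longrightarrow> coroot (t *\<^sub>R \<alpha>) = (1 / t) *\<^sub>R coroot \<alpha>"
  by (simp add: coroot_def)

lemma coroot_minus: "coroot (- \<alpha>) = - coroot \<alpha>"
  by (simp add: coroot_def)

lemma coroot_coroot: "coroot (coroot \<alpha>) = \<alpha>"
  by (cases "\<alpha> = 0") (simp_all add: coroot_def)

lemma reflection_scale: "t \<noteq> 0 \<Longrightarrow> reflection (t *\<^sub>R \<alpha>) = reflection \<alpha>"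
  by (rule ext) (simp add: reflection_eq coroot_scale)

lemma reflection_self: "\<alpha> \<noteq> 0 \<Longrightarrow> reflection \<alpha> \<alpha> = - \<alpha>"
  by (simp add: reflection_eq coroot_def algebra_simps scaleR_2)

lemma linear_reflection: "linear (reflection \<alpha>)"
  by (rule linearI) (simp_all add: reflection_eq inner_add_right algebra_simps)

lemma reflection_inner: "reflection \<alpha> x \<bullet> reflection \<alpha> y = x \<bullet> y"
proof (cases "\<alpha> = 0")
  case False
  then show ?thesis
    by (simp add: reflection_eq coroot_def inner_diff_left inner_diff_right inner_commute field_simps)
qed (simp add: reflection_eq)

lemma reflection_involution: "reflection \<alpha> (reflection \<alpha> x) = x"
proof (cases "\<alpha> = 0")
  case False
  then show ?thesis
    by (simp add: reflection_eq inner_diff_right inner_coroot_self)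
qed (simp add: reflection_eq)

lemma coroot_isometry:
  assumes "linear v" "v x \<bullet> v x = x \<bullet> x"
  shows "coroot (v x) = v (coroot x)"
  by (simp add: coroot_def assms linear_cmul)

text \<open>These axioms hold for \<open>roots D\<close> and for its set of coroots alike; the
  second instance produces the highest short root.\<close>

locale crystallographic =
  fixes \<Phi> :: "'v::euclidean_space set"
  assumes finite_\<Phi>: "finite \<Phi>" and zero_\<Phi>: "0 \<notin> \<Phi>"
    and refl_\<Phi>: "\<alpha> \<in> \<Phi> \<Longrightarrow> \<beta> \<in> \<Phi> \<Longrightarrow> reflection \<alpha> \<beta> \<in> \<Phi>"
    and int_\<Phi>: "\<alpha> \<in> \<Phi> \<Longrightarrow> \<beta> \<in> \<Phi> \<Longrightarrow> \<beta> \<bullet> coroot \<alpha> \<in> \<int>"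
begin

lemma nonzero: "\<alpha> \<in> \<Phi> \<Longrightarrow> \<alpha> \<noteq> 0"
  using zero_\<Phi> by blast

lemma uminus_\<Phi>: "\<alpha> \<in> \<Phi> \<Longrightarrow> - \<alpha> \<in> \<Phi>"
  using refl_\<Phi>[of \<alpha> \<alpha>] nonzero by (simp add: reflection_self)

text \<open>The product of the two Cartan integers is four times the squared cosine of the angle, so
  Cauchy--Schwarz bounds it by 4. Positivity of the inner product makes both integers at least 1,
  which leaves finitely many cases.\<close>

lemma pairing_ints:
  assumes "\<alpha> \<in> \<Phi>" "\<beta> \<in> \<Phi>" "\<alpha> \<bullet> \<beta> > 0"
  obtains p q :: int where "\<alpha> \<bullet> coroot \<beta> = of_int p" "\<beta> \<bullet> coroot \<alpha> = of_int q"
    "p \<ge> 1" "q \<ge> 1" "p * q \<le> 4" "\<alpha> \<bullet> \<alpha> * of_int q = \<beta> \<bullet> \<beta> * of_int p"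
    "2 * (\<alpha> \<bullet> \<beta>) = of_int p * (\<beta> \<bullet> \<beta>)"
proof -
  have a: "\<alpha> \<bullet> \<alpha> > 0" and b: "\<beta> \<bullet> \<beta> > 0"
    using nonzero assms by auto
  obtain p q where p: "\<alpha> \<bullet> coroot \<beta> = of_int p" and q: "\<beta> \<bullet> coroot \<alpha> = of_int q"
    using int_\<Phi> assms by (meson Ints_cases)
  have pe: "of_int p = 2 * (\<alpha> \<bullet> \<beta>) / (\<beta> \<bullet> \<beta>)" and qe: "of_int q = 2 * (\<alpha> \<bullet> \<beta>) / (\<alpha> \<bullet> \<alpha>)"
    using p q by (simp_all add: inner_coroot inner_commute)
  have "real_of_int p > 0" "real_of_int q > 0"
    unfolding pe qe using a b assms(3) by simp_all
  then have pq: "p \<ge> 1" "q \<ge> 1"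
    by simp_all
  have "real_of_int (p * q) = 4 * ((\<alpha> \<bullet> \<beta>)\<^sup>2 / ((\<alpha> \<bullet> \<alpha>) * (\<beta> \<bullet> \<beta>)))"
    by (simp add: pe qe power2_eq_square)
  also have "\<dots> \<le> 4 * 1"
    using Cauchy_Schwarz_ineq[of \<alpha> \<beta>] a b by (intro mult_left_mono) (simp_all add: divide_le_eq)
  finally have "real_of_int (p * q) \<le> 4"
    by simp
  then have "p * q \<le> 4"
    by linarith
  then show ?thesis
    using that[OF p q pq] a b by (simp add: pe qe field_simps)
qed

text \<open>If one of the two Cartan integers is 1, the difference is, up to sign, a reflected
  root.\<close>

lemma diff_\<Phi>:
  assumes "\<alpha> \<in> \<Phi>" "\<beta> \<in> \<Phi>" "\<alpha> \<bullet> \<beta> > 0" "\<alpha> \<noteq> \<beta>"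
  shows "\<alpha> - \<beta> \<in> \<Phi>"
proof -
  obtain p q :: int where pq: "\<alpha> \<bullet> coroot \<beta> = of_int p" "\<beta> \<bullet> coroot \<alpha> = of_int q"
    "p \<ge> 1" "q \<ge> 1" "p * q \<le> 4" "\<alpha> \<bullet> \<alpha> * of_int q = \<beta> \<bullet> \<beta> * of_int p"
    "2 * (\<alpha> \<bullet> \<beta>) = of_int p * (\<beta> \<bullet> \<beta>)"
    using pairing_ints[OF assms(1-3)] .
  have refl: "reflection x y = y - (y \<bullet> coroot x) *\<^sub>R x" for x y :: 'v
    by (simp add: reflection_eq coroot_def inner_commute)
  consider "p = 1" | "q = 1" | "p \<ge> 2" "q \<ge> 2"
    using pq by linarith
  then show ?thesis
  proof cases
    case 1
    then show ?thesis
      using refl_\<Phi>[OF assms(2,1)] pq by (simp add: refl)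
  next
    case 2
    then have "\<beta> - \<alpha> \<in> \<Phi>"
      using refl_\<Phi>[OF assms(1,2)] pq by (simp add: refl)
    from uminus_\<Phi>[OF this] show ?thesis by simp
  next
    \<comment> \<open>The bound 4 on the product forces both integers to be 2, the equality case of
      Cauchy--Schwarz; the two roots then coincide.\<close>
    case 3
    then have "p * q \<ge> 2 * q" "p * q \<ge> p * 2"
      by (auto intro: mult_right_mono mult_left_mono)
    then have "p = 2" "q = 2"
      using pq(5) 3 by linarith+
    then have "(\<alpha> - \<beta>) \<bullet> (\<alpha> - \<beta>) = 0"
      using pq(6,7) by (simp add: inner_diff_left inner_diff_right inner_commute)
    then show ?thesis
      using assms(4) by simp
  qed
qed

text \<open>The ratio of the squared lengths is \<open>p / q\<close>. The value 4 is the equality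
  case of Cauchy--Schwarz and would make the longer root twice the shorter one, which
  \<open>red\<close> excludes.\<close>

lemma length_ratio:
  assumes "\<alpha> \<in> \<Phi>" "\<beta> \<in> \<Phi>" "\<alpha> \<bullet> \<beta> > 0" "\<beta> \<bullet> \<beta> \<le> \<alpha> \<bullet> \<alpha>" and red: "2 *\<^sub>R \<beta> \<notin> \<Phi>"
  shows "\<alpha> \<bullet> \<alpha> \<in> {\<beta> \<bullet> \<beta>, 2 * (\<beta> \<bullet> \<beta>), 3 * (\<beta> \<bullet> \<beta>)}"
proof -
  obtain p q :: int where pq: "\<alpha> \<bullet> coroot \<beta> = of_int p" "\<beta> \<bullet> coroot \<alpha> = of_int q"
    "p \<ge> 1" "q \<ge> 1" "p * q \<le> 4" "\<alpha> \<bullet> \<alpha> * of_int q = \<beta> \<bullet> \<beta> * of_int p"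
    "2 * (\<alpha> \<bullet> \<beta>) = of_int p * (\<beta> \<bullet> \<beta>)"
    using pairing_ints[OF assms(1-3)] .
  have b: "\<beta> \<bullet> \<beta> > 0"
    using nonzero[OF assms(2)] by simp
  have "(\<beta> \<bullet> \<beta>) * of_int q \<le> (\<alpha> \<bullet> \<alpha>) * of_int q"
    using assms(4) pq(4) by (intro mult_right_mono) auto
  then have "(\<beta> \<bullet> \<beta>) * of_int q \<le> (\<beta> \<bullet> \<beta>) * real_of_int p"
    using pq(6) by simp
  then have qp: "q \<le> p"
    using b by simp
  then have "q * q \<le> p * q"
    using pq(4) by (intro mult_right_mono) auto
  then have "q * q \<le> 4"
    using pq(5) by linarith
  moreover have "q \<ge> 3 \<Longrightarrow> q * q \<ge> 3 * 3"
    by (intro mult_mono) auto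
  ultimately have "q = 1 \<or> q = 2"
    using pq(4) by linarith
  then consider "q = 1" "p = 4" | "q = 1" "p \<in> {1, 2, 3}" | "q = 2" "p = 2"
    using pq(3,5) qp by fastforce
  then show ?thesis
  proof cases
    case 1
    then have "(\<alpha> - 2 *\<^sub>R \<beta>) \<bullet> (\<alpha> - 2 *\<^sub>R \<beta>) = 0"
      using pq(6,7) by (simp add: inner_diff_left inner_diff_right inner_commute)
    then show ?thesis
      using red assms(1) by simp
  next
    case 2
    then show ?thesis using pq(6) by auto
  next
    case 3
    then show ?thesis using pq(6) by auto
  qed
qed

end

lemma crystallographic_coroot:
  assumes "crystallographic \<Phi>"
  shows "crystallographic (coroot ` \<Phi>)"
proof -
  interpret crystallographic \<Phi> by fact
  have *: "reflection (coroot \<alpha>) = reflection \<alpha>" if "\<alpha> \<in> \<Phi>" for \<alpha>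
    using reflection_scale[of "2 / (\<alpha> \<bullet> \<alpha>)" \<alpha>] nonzero[OF that] by (simp add: coroot_def)
  show ?thesis
  proof
    show "0 \<notin> coroot ` \<Phi>"
      using nonzero by (auto simp: coroot_def)
    show "reflection \<alpha> \<beta> \<in> coroot ` \<Phi>" if "\<alpha> \<in> coroot ` \<Phi>" "\<beta> \<in> coroot ` \<Phi>" for \<alpha> \<beta>
      using that refl_\<Phi> by (auto simp: * coroot_isometry[OF linear_reflection reflection_inner, symmetric])
    show "\<beta> \<bullet> coroot \<alpha> \<in> \<int>" if "\<alpha> \<in> coroot ` \<Phi>" "\<beta> \<in> coroot ` \<Phi>" for \<alpha> \<beta>
      using that int_\<Phi> by (auto simp: coroot_coroot inner_commute)
  qed (simp add: finite_\<Phi>)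
qed

lemma dual_basis_exists:
  fixes \<alpha> :: "nat \<Rightarrow> 'v::euclidean_space"
  assumes inj: "inj_on \<alpha> {1..DIM('v)}" and ind: "independent (\<alpha> ` {1..DIM('v)})"
  shows "\<exists>\<omega>. (\<forall>i\<in>{1..DIM('v)}. \<forall>j\<in>{1..DIM('v)}. \<omega> i \<bullet> \<alpha> j = (if i = j then 1 else 0)) \<and>
    (\<forall>v. v = (\<Sum>i=1..DIM('v). (\<omega> i \<bullet> v) *\<^sub>R \<alpha> i))"
proof -
  let ?I = "{1..DIM('v)}"
  have "\<exists>w. \<forall>j\<in>?I. w \<bullet> \<alpha> j = (if i = j then 1 else 0)" if "i \<in> ?I" for i
  proof -
    obtain f :: "'v \<Rightarrow> real" where f: "linear f" "\<forall>x\<in>\<alpha> ` ?I. f x = (if x = \<alpha> i then 1 else 0)"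
      using linear_independent_extend[OF ind, of "\<lambda>x. if x = \<alpha> i then 1 else (0::real)"] by auto
    \<comment> \<open>Riesz representation: the vector with coordinates \<open>f b\<close>
      represents the functional \<open>f\<close>.\<close>
    have fx: "(\<Sum>b\<in>Basis. f b *\<^sub>R b) \<bullet> x = f x" for x
    proof -
      have "f x = f (\<Sum>b\<in>Basis. (x \<bullet> b) *\<^sub>R b)"
        by (simp add: euclidean_representation)
      also have "\<dots> = (\<Sum>b\<in>Basis. (x \<bullet> b) * f b)"
        using f(1) by (simp add: linear_sum linear_cmul)
      finally show ?thesis
        by (simp add: inner_sum_right inner_commute[of _ x] mult.commute)
    qed
    show ?thesis
      using f(2) that inj by (intro exI[of _ "\<Sum>b\<in>Basis. f b *\<^sub>R b"]) (auto simp: fx inj_on_eq_iff)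
  qed
  then obtain \<omega> where \<omega>: "\<omega> i \<bullet> \<alpha> j = (if i = j then 1 else 0)" if "i \<in> ?I" "j \<in> ?I" for i j
    by metis
  have "v = (\<Sum>i\<in>?I. (\<omega> i \<bullet> v) *\<^sub>R \<alpha> i)" for v
  proof -
    have "card (\<alpha> ` ?I) = DIM('v)"
      using card_image[OF inj] by simp
    then have "span (\<alpha> ` ?I) = UNIV"
      using ind by (metis card_ge_dim_independent dim_UNIV subset_UNIV order_refl top.extremum_unique)
    then obtain u where u: "v = (\<Sum>x\<in>\<alpha> ` ?I. u x *\<^sub>R x)"
      using span_finite[of "\<alpha> ` ?I"] by blast
    then have v: "v = (\<Sum>j\<in>?I. u (\<alpha> j) *\<^sub>R \<alpha> j)"
      using sum.reindex[OF inj, of "\<lambda>x. u x *\<^sub>R x"] by simp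
    have "\<omega> i \<bullet> v = u (\<alpha> i)" if "i \<in> ?I" for i
    proof -
      have "\<omega> i \<bullet> v = (\<Sum>j\<in>?I. u (\<alpha> j) * (if i = j then 1 else 0))"
        unfolding v inner_sum_right by (rule sum.cong) (use that in \<open>auto simp: \<omega>\<close>)
      then show ?thesis
        using that by (simp add: if_distrib cong: if_cong)
    qed
    then show ?thesis
      by (simp add: v)
  qed
  then show ?thesis
    using \<omega> by (intro exI[of _ \<omega>]) auto
qed

lemma finite_has_maximizer:
  fixes f :: "'a \<Rightarrow> real"
  assumes "finite S" "x \<in> S"
  shows "\<exists>y\<in>S. \<forall>z\<in>S. f z \<le> f y"
proof -
  have "Max (f ` S) \<in> f ` S"
    using assms by (intro Max_in) auto
  then obtain y where "y \<in> S" "f y = Max (f ` S)"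
    by auto
  then show ?thesis
    using assms by (intro bexI[of _ y]) auto
qed

section \<open>Simple-root coordinates, positivity and dominance\<close>

locale affine_data =
  fixes D :: "'v::euclidean_space affine_datum"
  assumes datum: "affine_datum D"
begin

abbreviation "R0 \<equiv> roots D"
abbreviation "\<alpha> \<equiv> simple_root D"

sublocale crystallographic R0
  using datum by unfold_locales (auto simp: affine_datum_def root_system_def)

lemma reduced: "\<beta> \<in> R0 \<Longrightarrow> t *\<^sub>R \<beta> \<in> R0 \<Longrightarrow> t = 1 \<or> t = -1"
  using datum by (auto simp: affine_datum_def reduced_roots_def)

lemma simple_in: "i \<in> {1..DIM('v)} \<Longrightarrow> \<alpha> i \<in> R0"
  using datum by (auto simp: affine_datum_def root_base_def)

text \<open>The basis dual to the simple roots, that is, the fundamental coweights;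
  \<open>\<omega> i \<bullet> v\<close> is the coefficient of the \<open>i\<close>-th simple root in
  \<open>v\<close>.\<close>

definition \<omega> :: "nat \<Rightarrow> 'v" where
  "\<omega> = (SOME \<omega>. (\<forall>i\<in>{1..DIM('v)}. \<forall>j\<in>{1..DIM('v)}. \<omega> i \<bullet> \<alpha> j = (if i = j then 1 else 0)) \<and>
    (\<forall>v. v = (\<Sum>i\<in>{1..DIM('v)}. (\<omega> i \<bullet> v) *\<^sub>R \<alpha> i)))"

lemma \<omega>_ex: "(\<forall>i\<in>{1..DIM('v)}. \<forall>j\<in>{1..DIM('v)}. \<omega> i \<bullet> \<alpha> j = (if i = j then 1 else 0)) \<and>
    (\<forall>v. v = (\<Sum>i\<in>{1..DIM('v)}. (\<omega> i \<bullet> v) *\<^sub>R \<alpha> i))"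
proof -
  have "inj_on \<alpha> {1..DIM('v)}" "independent (\<alpha> ` {1..DIM('v)})"
    using datum by (auto simp: affine_datum_def root_base_def)
  from someI_ex[OF dual_basis_exists[OF this]] show ?thesis
    unfolding \<omega>_def .
qed

lemma \<omega>_simple: "i \<in> {1..DIM('v)} \<Longrightarrow> j \<in> {1..DIM('v)} \<Longrightarrow> \<omega> i \<bullet> \<alpha> j = (if i = j then 1 else 0)"
  using \<omega>_ex by blast

lemma expand: "v = (\<Sum>i\<in>{1..DIM('v)}. (\<omega> i \<bullet> v) *\<^sub>R \<alpha> i)"
  using \<omega>_ex by blast

lemma inner_expand: "x \<bullet> v = (\<Sum>i\<in>{1..DIM('v)}. (\<omega> i \<bullet> v) * (x \<bullet> \<alpha> i))"
  by (subst expand[of v]) (simp add: inner_sum_right)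

lemma eq_zero_iff: "v = 0 \<longleftrightarrow> (\<forall>i\<in>{1..DIM('v)}. \<omega> i \<bullet> v = 0)"
  using expand[of v] by (auto simp: sum.neutral)

text \<open>Real rather than natural coefficients make the order stable under positive rescaling, so
  that it can compare coroots as well as roots.\<close>

definition pos :: "'v \<Rightarrow> bool" where
  "pos v \<longleftrightarrow> (\<forall>i\<in>{1..DIM('v)}. 0 \<le> \<omega> i \<bullet> v)"

lemma pos_add: "pos v \<Longrightarrow> pos w \<Longrightarrow> pos (v + w)"
  by (auto simp: pos_def inner_add_right)

lemma pos_scale: "0 \<le> t \<Longrightarrow> pos v \<Longrightarrow> pos (t *\<^sub>R v)"
  by (auto simp: pos_def)

lemma pos_antisym: "pos v \<Longrightarrow> pos (- v) \<Longrightarrow> v = 0"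
  by (force simp: pos_def eq_zero_iff)

lemma nonneg_comb_iff: "nonneg_comb \<alpha> v \<longleftrightarrow> (\<forall>i\<in>{1..DIM('v)}. \<omega> i \<bullet> v \<in> \<nat>)"
proof
  assume "nonneg_comb \<alpha> v"
  then obtain k :: "nat \<Rightarrow> nat" where k: "v = (\<Sum>i\<in>{1..DIM('v)}. real (k i) *\<^sub>R \<alpha> i)"
    by (auto simp: nonneg_comb_def)
  have "\<omega> i \<bullet> v = real (k i)" if "i \<in> {1..DIM('v)}" for i
  proof -
    have "\<omega> i \<bullet> v = (\<Sum>j\<in>{1..DIM('v)}. real (k j) * (if i = j then 1 else 0))"
      unfolding k inner_sum_right by (rule sum.cong) (use that in \<open>auto simp: \<omega>_simple\<close>)
    then show ?thesis
      using that by (simp add: if_distrib cong: if_cong)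
  qed
  then show "\<forall>i\<in>{1..DIM('v)}. \<omega> i \<bullet> v \<in> \<nat>"
    by simp
next
  assume "\<forall>i\<in>{1..DIM('v)}. \<omega> i \<bullet> v \<in> \<nat>"
  then have "\<forall>i\<in>{1..DIM('v)}. \<exists>k. \<omega> i \<bullet> v = real k"
    by (meson Nats_cases)
  then obtain k :: "nat \<Rightarrow> nat" where k: "\<forall>i\<in>{1..DIM('v)}. \<omega> i \<bullet> v = real (k i)"
    by (rule bchoice[THEN exE])
  show "nonneg_comb \<alpha> v"
    unfolding nonneg_comb_def by (rule exI[of _ k], subst expand[of v]) (simp add: k)
qed

lemma root_cases: "\<beta> \<in> R0 \<Longrightarrow> nonneg_comb \<alpha> \<beta> \<or> nonneg_comb \<alpha> (- \<beta>)"
  using datum by (auto simp: affine_datum_def root_base_def)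

lemma nonneg_comb_pos: "nonneg_comb \<alpha> v \<Longrightarrow> pos v"
  by (force simp: nonneg_comb_iff pos_def elim: Nats_cases)

lemma root_pos: "\<beta> \<in> R0 \<Longrightarrow> pos \<beta> \<or> pos (- \<beta>)"
  using root_cases nonneg_comb_pos by blast

lemma root_coord_Ints:
  assumes "\<beta> \<in> R0" "i \<in> {1..DIM('v)}"
  shows "\<omega> i \<bullet> \<beta> \<in> \<int>"
  using root_cases[OF assms(1)]
proof
  assume "nonneg_comb \<alpha> (- \<beta>)"
  then have "\<omega> i \<bullet> (- \<beta>) \<in> \<int>"
    using assms(2) Nats_subset_Ints by (auto simp: nonneg_comb_iff simp del: inner_minus_right)
  then show ?thesis
    by simp
qed (use assms(2) Nats_subset_Ints in \<open>auto simp: nonneg_comb_iff\<close>)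

text \<open>Simple-root coordinates of roots are integers, so real nonnegativity of a difference
  already means natural coefficients. This translates between \<open>pos\<close> and the order in
  the definitions of the highest roots.\<close>

lemma pos_diff_nonneg_comb:
  assumes "\<beta> \<in> R0" "\<gamma> \<in> R0" "pos (\<beta> - \<gamma>)"
  shows "nonneg_comb \<alpha> (\<beta> - \<gamma>)"
  unfolding nonneg_comb_iff
proof
  fix i assume i: "i \<in> {1..DIM('v)}"
  have "\<omega> i \<bullet> (\<beta> - \<gamma>) \<in> \<int>"
    using root_coord_Ints[OF assms(1) i] root_coord_Ints[OF assms(2) i] by (simp add: inner_diff_right)
  moreover have "0 \<le> \<omega> i \<bullet> (\<beta> - \<gamma>)"
    using assms(3) i by (simp add: pos_def)
  ultimately show "\<omega> i \<bullet> (\<beta> - \<gamma>) \<in> \<nat>"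
    by (simp add: Nats_altdef2)
qed

definition ht :: "'v \<Rightarrow> real" where
  "ht v = (\<Sum>i\<in>{1..DIM('v)}. \<omega> i \<bullet> v)"

lemma ht_pos:
  assumes "pos v" "v \<noteq> 0"
  shows "0 < ht v"
proof -
  obtain i where "i \<in> {1..DIM('v)}" "0 < \<omega> i \<bullet> v"
    using assms by (force simp: pos_def eq_zero_iff)
  then show ?thesis
    using assms(1) sum_pos2[of "{1..DIM('v)}" i "\<lambda>i. \<omega> i \<bullet> v"] by (auto simp: ht_def pos_def)
qed

lemma ht_diff: "ht (v - w) = ht v - ht w"
  by (simp add: ht_def inner_diff_right sum_subtractf)

definition dominant :: "'v \<Rightarrow> bool" where
  "dominant v \<longleftrightarrow> (\<forall>i\<in>{1..DIM('v)}. 0 \<le> v \<bullet> \<alpha> i)"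

lemma pos_dominant_inner:
  assumes "pos v" "dominant w"
  shows "0 \<le> w \<bullet> v"
  unfolding inner_expand[of w v] using assms by (intro sum_nonneg) (auto simp: pos_def dominant_def)

lemma reflection_simple_coord:
  "i \<in> {1..DIM('v)} \<Longrightarrow> j \<in> {1..DIM('v)} \<Longrightarrow> i \<noteq> j \<Longrightarrow> \<omega> j \<bullet> reflection (\<alpha> i) x = \<omega> j \<bullet> x"
  by (simp add: reflection_eq coroot_def inner_diff_right \<omega>_simple)

lemma reflection_simple_coord_self:
  "i \<in> {1..DIM('v)} \<Longrightarrow> \<omega> i \<bullet> reflection (\<alpha> i) x = \<omega> i \<bullet> x - 2 * (x \<bullet> \<alpha> i) / (\<alpha> i \<bullet> \<alpha> i)"
  by (simp add: reflection_eq coroot_def inner_diff_right \<omega>_simple inner_commute[of x])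

lemma simple_norm_pos: "i \<in> {1..DIM('v)} \<Longrightarrow> 0 < \<alpha> i \<bullet> \<alpha> i"
  using nonzero[OF simple_in] by simp

text \<open>A root \<open>\<beta>\<close> of minimal height supported on both \<open>J\<close> and its complement could be lowered by a
  reflection in some \<open>\<alpha> i\<close>, \<open>i \<in> J\<close>, without changing its support off \<open>J\<close>.\<close>

lemma support_split:
  assumes J: "J \<subseteq> {1..DIM('v)}" and orth: "\<And>i j. i \<in> J \<Longrightarrow> j \<in> {1..DIM('v)} - J \<Longrightarrow> \<alpha> i \<bullet> \<alpha> j = 0"
    and "\<beta> \<in> R0"
  shows "(\<forall>i\<in>J. \<omega> i \<bullet> \<beta> = 0) \<or> (\<forall>i\<in>{1..DIM('v)} - J. \<omega> i \<bullet> \<beta> = 0)"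
proof -
  define mixed where "mixed \<beta> \<longleftrightarrow> (\<exists>i\<in>J. \<omega> i \<bullet> \<beta> \<noteq> 0) \<and> (\<exists>i\<in>{1..DIM('v)} - J. \<omega> i \<bullet> \<beta> \<noteq> 0)" for \<beta>
  have no: "\<not> mixed \<beta>" if "\<beta> \<in> R0" "pos \<beta>" for \<beta>
  proof
    assume "mixed \<beta>"
    let ?M = "{\<beta> \<in> R0. pos \<beta> \<and> mixed \<beta>}"
    have "finite ?M" "?M \<noteq> {}"
      using finite_\<Phi> that \<open>mixed \<beta>\<close> by auto
    then obtain \<gamma> where \<gamma>: "\<gamma> \<in> R0" "pos \<gamma>" "mixed \<gamma>" and min: "\<And>\<delta>. \<delta> \<in> ?M \<Longrightarrow> ht \<gamma> \<le> ht \<delta>"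
      using arg_min_if_finite(1)[of ?M ht] arg_min_least[of ?M _ ht] by (metis (mono_tags, lifting) mem_Collect_eq)
    \<comment> \<open>The part of \<open>\<gamma>\<close> supported on \<open>J\<close>.
      Orthogonality to the complement gives it the same inner products as \<open>\<gamma>\<close>
      with the simple roots in \<open>J\<close>.\<close>
    define \<gamma>0 where "\<gamma>0 = (\<Sum>i\<in>J. (\<omega> i \<bullet> \<gamma>) *\<^sub>R \<alpha> i)"
    have fJ: "finite J"
      using J finite_subset by auto
    have \<omega>\<gamma>0: "\<omega> i \<bullet> \<gamma>0 = (if i \<in> J then \<omega> i \<bullet> \<gamma> else 0)" if "i \<in> {1..DIM('v)}" for i
    proof -
      have "\<omega> i \<bullet> \<gamma>0 = (\<Sum>j\<in>J. (\<omega> j \<bullet> \<gamma>) * (if i = j then 1 else 0))"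
        unfolding \<gamma>0_def inner_sum_right by (rule sum.cong) (use that J in \<open>auto simp: \<omega>_simple subset_iff\<close>)
      then show ?thesis
        using fJ by (simp add: if_distrib cong: if_cong)
    qed
    have "\<gamma>0 \<noteq> 0"
      using \<gamma>(3) \<omega>\<gamma>0 J unfolding mixed_def eq_zero_iff by (metis subsetD)
    have \<gamma>\<gamma>0: "\<gamma> \<bullet> \<alpha> i = \<gamma>0 \<bullet> \<alpha> i" if "i \<in> J" for i
    proof -
      have "(\<gamma> - \<gamma>0) \<bullet> \<alpha> i = \<alpha> i \<bullet> (\<gamma> - \<gamma>0)"
        by (simp add: inner_commute)
      also have "\<dots> = (\<Sum>j\<in>{1..DIM('v)}. (\<omega> j \<bullet> (\<gamma> - \<gamma>0)) * (\<alpha> i \<bullet> \<alpha> j))"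
        by (rule inner_expand)
      also have "\<dots> = 0"
        by (rule sum.neutral) (use that orth in \<open>auto simp: inner_diff_right \<omega>\<gamma>0\<close>)
      finally show ?thesis
        by (simp add: inner_diff_left)
    qed
    have "0 < \<gamma>0 \<bullet> \<gamma>0"
      using \<open>\<gamma>0 \<noteq> 0\<close> by simp
    also have "\<gamma>0 \<bullet> \<gamma>0 = (\<Sum>i\<in>J. (\<omega> i \<bullet> \<gamma>) * (\<gamma> \<bullet> \<alpha> i))"
      by (subst (2) \<gamma>0_def) (simp add: inner_sum_right \<gamma>\<gamma>0)
    finally obtain i where i: "i \<in> J" "0 < (\<omega> i \<bullet> \<gamma>) * (\<gamma> \<bullet> \<alpha> i)"
      by (meson not_le sum_nonpos)
    then have iI: "i \<in> {1..DIM('v)}"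
      using J by blast
    have g: "0 < \<gamma> \<bullet> \<alpha> i"
      using i(2) \<gamma>(2) iI by (force simp: pos_def zero_less_mult_iff)
    let ?\<delta> = "reflection (\<alpha> i) \<gamma>"
    have \<delta>: "?\<delta> \<in> R0"
      using refl_\<Phi> simple_in iI \<gamma>(1) by blast
    obtain j where j: "j \<in> {1..DIM('v)} - J" "\<omega> j \<bullet> \<gamma> \<noteq> 0"
      using \<gamma>(3) by (auto simp: mixed_def)
    have \<omega>j: "\<omega> j \<bullet> ?\<delta> = \<omega> j \<bullet> \<gamma>"
      using j i iI by (intro reflection_simple_coord) auto
    \<comment> \<open>The coordinate at \<open>j\<close>, outside \<open>J\<close>, is positive and
      unchanged, and a root cannot have coordinates of both signs.\<close>
    have pos\<delta>: "pos ?\<delta>"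
    proof (rule ccontr)
      assume "\<not> pos ?\<delta>"
      then have "pos (- ?\<delta>)"
        using root_pos[OF \<delta>] by blast
      then have "\<omega> j \<bullet> ?\<delta> \<le> 0"
        using j by (auto simp: pos_def)
      then show False
        using \<gamma>(2) j unfolding \<omega>j by (force simp: pos_def)
    qed
    have "ht ?\<delta> = ht \<gamma> - 2 * (\<gamma> \<bullet> \<alpha> i) / (\<alpha> i \<bullet> \<alpha> i)"
    proof -
      have "ht ?\<delta> = (\<Sum>k\<in>{1..DIM('v)}. \<omega> k \<bullet> \<gamma> - (if k = i then 2 * (\<gamma> \<bullet> \<alpha> i) / (\<alpha> i \<bullet> \<alpha> i) else 0))"
        unfolding ht_def by (rule sum.cong)
          (use iI in \<open>auto simp: reflection_simple_coord reflection_simple_coord_self\<close>)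
      then show ?thesis
        using iI by (simp add: sum_subtractf ht_def)
    qed
    then have "ht ?\<delta> < ht \<gamma>"
      using g simple_norm_pos[OF iI] by simp
    then have "\<not> mixed ?\<delta>"
      using min[of ?\<delta>] \<delta> pos\<delta> by force
    \<comment> \<open>The lowered root keeps its support outside \<open>J\<close>, so by minimality
      it has none inside \<open>J\<close>. This reduces \<open>\<gamma>0\<close> to a multiple of
      one simple root, whose coordinate the reflection only negates: a contradiction.\<close>
    then have \<delta>J: "\<omega> k \<bullet> ?\<delta> = 0" if "k \<in> J" for k
      using that j \<omega>j by (auto simp: mixed_def)
    have "\<omega> k \<bullet> \<gamma> = 0" if "k \<in> J" "k \<noteq> i" for k
      using \<delta>J[OF that(1)] reflection_simple_coord[OF iI, of k \<gamma>] that J by auto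
    then have "\<gamma>0 = (\<omega> i \<bullet> \<gamma>) *\<^sub>R \<alpha> i"
      unfolding \<gamma>0_def using fJ i(1)
      by (subst sum.mono_neutral_cong_right[of J "{i}" _ "\<lambda>i. (\<omega> i \<bullet> \<gamma>) *\<^sub>R \<alpha> i"]) auto
    then have "\<gamma> \<bullet> \<alpha> i = (\<omega> i \<bullet> \<gamma>) * (\<alpha> i \<bullet> \<alpha> i)"
      using \<gamma>\<gamma>0[OF i(1)] by simp
    then have "\<omega> i \<bullet> ?\<delta> = - (\<omega> i \<bullet> \<gamma>)"
      using simple_norm_pos[OF iI] reflection_simple_coord_self[OF iI, of \<gamma>] by simp
    then show False
      using \<delta>J[OF i(1)] i(2) by auto
  qed
  have "mixed (- \<beta>) \<longleftrightarrow> mixed \<beta>"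
    by (simp add: mixed_def)
  then have "\<not> mixed \<beta>"
    using root_pos[OF assms(3)] no[OF assms(3)] no[OF uminus_\<Phi>[OF assms(3)]] by blast
  then show ?thesis
    by (auto simp: mixed_def)
qed

text \<open>A positive inner product would make the difference of two simple roots a root, with
  coordinates 1 and -1.\<close>

lemma simple_inner_nonpos:
  assumes "i \<in> {1..DIM('v)}" "j \<in> {1..DIM('v)}" "i \<noteq> j"
  shows "\<alpha> i \<bullet> \<alpha> j \<le> 0"
proof (rule ccontr)
  assume "\<not> ?thesis"
  moreover have "\<alpha> i \<noteq> \<alpha> j"
    using \<omega>_simple[OF assms(1,1)] \<omega>_simple[OF assms(1,2)] assms(3) by auto
  ultimately have "\<alpha> i - \<alpha> j \<in> R0"
    using diff_\<Phi> simple_in assms by simp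
  from root_pos[OF this] show False
    using assms by (force simp: pos_def inner_diff_right \<omega>_simple)
qed

lemma dominant_pos:
  assumes "\<psi> \<in> R0" "dominant \<psi>"
  shows "pos \<psi>"
proof (rule ccontr)
  assume "\<not> pos \<psi>"
  then have "pos (- \<psi>)"
    using root_pos[OF assms(1)] by blast
  then have "\<psi> \<bullet> \<psi> \<le> 0"
    using pos_dominant_inner[OF _ assms(2)] by fastforce
  then show False
    using nonzero[OF assms(1)] inner_ge_zero[of \<psi>] by (simp add: order.antisym)
qed

text \<open>Let \<open>J\<close> be the set of vanishing coordinates. For \<open>k\<close> in
  \<open>J\<close> the nonnegative number \<open>\<alpha> k \<bullet> \<psi>\<close> is a sum of
  nonpositive terms, so \<open>J\<close> is orthogonal to its complement; by
  \<open>support_split\<close> the root system would then decompose, against irreducibility.\<close>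

lemma dominant_full:
  assumes "\<psi> \<in> R0" "dominant \<psi>" "i \<in> {1..DIM('v)}"
  shows "0 < \<omega> i \<bullet> \<psi>"
proof (rule ccontr)
  assume ni: "\<not> 0 < \<omega> i \<bullet> \<psi>"
  define J where "J = {i\<in>{1..DIM('v)}. \<omega> i \<bullet> \<psi> = 0}"
  have p: "pos \<psi>"
    by (rule dominant_pos) fact+
  then have iJ: "i \<in> J"
    using assms(3) ni by (force simp: J_def pos_def)
  have J: "J \<subseteq> {1..DIM('v)}"
    by (auto simp: J_def)
  have orth: "\<alpha> k \<bullet> \<alpha> j = 0" if k: "k \<in> J" and j: "j \<in> {1..DIM('v)} - J" for k j
  proof -
    have "0 \<le> \<alpha> k \<bullet> \<psi>"
      using assms(2) J k by (auto simp: dominant_def inner_commute)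
    also have "\<alpha> k \<bullet> \<psi> = (\<Sum>l\<in>{1..DIM('v)} - J. (\<omega> l \<bullet> \<psi>) * (\<alpha> k \<bullet> \<alpha> l))"
      unfolding inner_expand[of "\<alpha> k" \<psi>] by (rule sum.mono_neutral_right) (auto simp: J_def)
    finally have s: "0 \<le> (\<Sum>l\<in>{1..DIM('v)} - J. (\<omega> l \<bullet> \<psi>) * (\<alpha> k \<bullet> \<alpha> l))" .
    have np: "(\<omega> l \<bullet> \<psi>) * (\<alpha> k \<bullet> \<alpha> l) \<le> 0" if "l \<in> {1..DIM('v)} - J" for l
    proof (rule mult_nonneg_nonpos)
      show "0 \<le> \<omega> l \<bullet> \<psi>"
        using that p by (simp add: pos_def)
      show "\<alpha> k \<bullet> \<alpha> l \<le> 0"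
        using that k J by (intro simple_inner_nonpos) auto
    qed
    have "(\<omega> j \<bullet> \<psi>) * (\<alpha> k \<bullet> \<alpha> j) = 0"
    proof (rule ccontr)
      assume "\<not> ?thesis"
      then have "(\<omega> j \<bullet> \<psi>) * (\<alpha> k \<bullet> \<alpha> j) < 0"
        using np[OF j] by linarith
      then have "(\<Sum>l\<in>{1..DIM('v)} - J. (\<omega> l \<bullet> \<psi>) * (\<alpha> k \<bullet> \<alpha> l)) < (\<Sum>l\<in>{1..DIM('v)} - J. 0)"
        using np j by (intro sum_strict_mono_ex1) blast+
      with s show False by simp
    qed
    then show ?thesis
      using j by (auto simp: J_def)
  qed
  let ?A = "{\<beta>\<in>R0. \<forall>i\<in>J. \<omega> i \<bullet> \<beta> = 0}" and ?B = "{\<beta>\<in>R0. \<forall>i\<in>{1..DIM('v)} - J. \<omega> i \<bullet> \<beta> = 0}"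
  have A: "\<psi> \<in> ?A"
    using assms(1) by (auto simp: J_def)
  have B: "\<alpha> i \<in> ?B"
    using iJ J simple_in by (auto simp: \<omega>_simple)
  have AB: "?A \<inter> ?B = {}"
    using nonzero by (auto simp: eq_zero_iff)
  have ABR: "?A \<union> ?B = R0"
    using support_split[OF J orth] by blast
  have ort: "\<beta> \<bullet> \<gamma> = 0" if "\<beta> \<in> ?A" "\<gamma> \<in> ?B" for \<beta> \<gamma>
  proof -
    have *: "\<alpha> k \<bullet> \<beta> = 0" if "k \<in> J" for k
      unfolding inner_expand[of "\<alpha> k" \<beta>] by (rule sum.neutral) (use that \<open>\<beta> \<in> ?A\<close> orth in auto)
    show ?thesis
      unfolding inner_expand[of \<beta> \<gamma>] by (rule sum.neutral) (use * \<open>\<gamma> \<in> ?B\<close> in \<open>auto simp: inner_commute\<close>)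
  qed
  have "\<exists>A B. A \<noteq> {} \<and> B \<noteq> {} \<and> A \<inter> B = {} \<and> A \<union> B = R0 \<and> (\<forall>\<alpha>\<in>A. \<forall>\<beta>\<in>B. \<alpha> \<bullet> \<beta> = 0)"
    by (rule exI[of _ ?A], rule exI[of _ ?B], intro conjI ballI) (fact AB ABR | rule ort | use A B in blast)+
  then show False
    using datum by (auto simp: affine_datum_def irreducible_roots_def)
qed

text \<open>Every coordinate of \<open>\<psi>\<close> is positive by \<open>dominant_full\<close>,
  so one strictly positive pairing of \<open>\<beta>\<close> with a simple root suffices.
  Irreducibility enters the comparison of dominant roots here.\<close>

lemma dominant_inner_pos:
  assumes "\<psi> \<in> R0" "dominant \<psi>" "\<beta> \<noteq> 0" "dominant \<beta>"
  shows "0 < \<beta> \<bullet> \<psi>"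
proof -
  have "\<exists>i\<in>{1..DIM('v)}. \<beta> \<bullet> \<alpha> i \<noteq> 0"
    using assms(3) inner_expand[of \<beta> \<beta>] by (metis (no_types, lifting) inner_eq_zero_iff mult_zero_right sum.neutral)
  then obtain i where "i \<in> {1..DIM('v)}" "0 < \<beta> \<bullet> \<alpha> i"
    using assms(4) by (force simp: dominant_def)
  then show ?thesis
    unfolding inner_expand[of \<beta> \<psi>] using assms dominant_full[OF assms(1,2)]
    by (intro sum_pos2[of _ i]) (auto simp: dominant_def less_imp_le)
qed

section \<open>Elements of maximal height and highest elements\<close>

lemma dominant_scale: "0 < t \<Longrightarrow> dominant (t *\<^sub>R v) \<longleftrightarrow> dominant v"
  by (simp add: dominant_def zero_le_mult_iff)

text \<open>A negative pairing with a simple root would let its reflection raise the height. The set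
  \<open>S\<close> is left open because the lemma is applied both to the elements above a given one
  and to the elements of a given length.\<close>

lemma max_ht_dominant:
  assumes "\<beta> \<in> S" "\<And>\<gamma>. \<gamma> \<in> S \<Longrightarrow> ht \<gamma> \<le> ht \<beta>"
    and S: "\<And>i. i \<in> {1..DIM('v)} \<Longrightarrow> pos (reflection (\<alpha> i) \<beta> - \<beta>) \<Longrightarrow> reflection (\<alpha> i) \<beta> \<in> S"
  shows "dominant \<beta>"
  unfolding dominant_def
proof (rule ballI, rule ccontr)
  fix i assume i: "i \<in> {1..DIM('v)}" and "\<not> 0 \<le> \<beta> \<bullet> \<alpha> i"
  then have neg: "\<beta> \<bullet> \<alpha> i < 0"
    by simp
  have d: "reflection (\<alpha> i) \<beta> - \<beta> = (- 2 * (\<beta> \<bullet> \<alpha> i) / (\<alpha> i \<bullet> \<alpha> i)) *\<^sub>R \<alpha> i"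
    by (simp add: reflection_eq coroot_def inner_commute)
  have p: "pos (reflection (\<alpha> i) \<beta> - \<beta>)"
    unfolding d using neg i simple_norm_pos[OF i]
    by (intro pos_scale) (auto simp: pos_def \<omega>_simple divide_nonpos_pos)
  moreover have "reflection (\<alpha> i) \<beta> - \<beta> \<noteq> 0"
    unfolding d using neg simple_norm_pos[OF i] by auto
  ultimately have "ht \<beta> < ht (reflection (\<alpha> i) \<beta>)"
    using ht_pos[of "reflection (\<alpha> i) \<beta> - \<beta>"] by (simp add: ht_diff)
  then show False
    using assms(2)[OF S[OF i p]] by simp
qed

text \<open>Two dominant elements have positive inner product, so the difference of two distinct
  maximal ones lies in the system and its sign contradicts maximality. The hypotheses allow positive
  rescaling so that the coroots are covered too.\<close>

lemma highest_exists:
  assumes "crystallographic \<Phi>" "\<Phi> \<noteq> {}"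
    and scale: "\<And>\<beta>. \<beta> \<in> \<Phi> \<Longrightarrow> \<exists>t>0. t *\<^sub>R \<beta> \<in> R0"
    and simple: "\<And>i. i \<in> {1..DIM('v)} \<Longrightarrow> \<exists>t>0. t *\<^sub>R \<alpha> i \<in> \<Phi>"
  shows "\<exists>\<psi>\<in>\<Phi>. dominant \<psi> \<and> (\<forall>\<beta>\<in>\<Phi>. pos (\<psi> - \<beta>) \<and> \<beta> \<bullet> \<beta> \<le> \<psi> \<bullet> \<psi>)"
proof -
  interpret P: crystallographic \<Phi> by fact
  have refl: "reflection (\<alpha> i) \<beta> \<in> \<Phi>" if "i \<in> {1..DIM('v)}" "\<beta> \<in> \<Phi>" for i \<beta>
    using simple[OF that(1)] P.refl_\<Phi> that(2) by (metis less_irrefl reflection_scale)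
  have inner: "0 < \<beta> \<bullet> \<gamma>" if bg: "\<beta> \<in> \<Phi>" "\<gamma> \<in> \<Phi>" "dominant \<beta>" "dominant \<gamma>" for \<beta> \<gamma>
  proof -
    obtain t where t: "t > 0" "t *\<^sub>R \<gamma> \<in> R0"
      using scale bg by blast
    then have "0 < \<beta> \<bullet> (t *\<^sub>R \<gamma>)"
      using bg P.nonzero by (intro dominant_inner_pos) (auto simp: dominant_scale)
    then show ?thesis
      using t by (simp add: zero_less_mult_iff)
  qed
  have sgn: "pos \<beta> \<or> pos (- \<beta>)" if b: "\<beta> \<in> \<Phi>" for \<beta>
  proof -
    obtain t where t: "t > 0" "t *\<^sub>R \<beta> \<in> R0"
      using scale b by blast
    from root_pos[OF t(2)] t(1) show ?thesis
      by (auto simp: pos_def zero_le_mult_iff mult_le_0_iff)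
  qed
  have maximal: "\<exists>\<gamma>\<in>\<Phi>. pos (\<gamma> - \<beta>) \<and> dominant \<gamma> \<and> (\<forall>\<delta>\<in>\<Phi>. pos (\<delta> - \<gamma>) \<longrightarrow> \<delta> = \<gamma>)" if \<beta>: "\<beta> \<in> \<Phi>" for \<beta>
  proof -
    let ?S = "{\<gamma>\<in>\<Phi>. pos (\<gamma> - \<beta>)}"
    have "finite ?S" "\<beta> \<in> ?S"
      using P.finite_\<Phi> \<beta> by (auto simp: pos_def)
    then obtain \<gamma> where \<gamma>: "\<gamma> \<in> ?S" "\<And>\<delta>. \<delta> \<in> ?S \<Longrightarrow> ht \<delta> \<le> ht \<gamma>"
      using finite_has_maximizer[of ?S _ ht] by blast
    have up: "\<delta> \<in> ?S" if "\<delta> \<in> \<Phi>" "pos (\<delta> - \<gamma>)" for \<delta>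
      using that \<gamma>(1) pos_add[of "\<delta> - \<gamma>" "\<gamma> - \<beta>"] by simp
    have "dominant \<gamma>"
      by (rule max_ht_dominant[OF \<gamma>]) (use up refl \<gamma>(1) in auto)
    moreover have "\<delta> = \<gamma>" if "\<delta> \<in> \<Phi>" "pos (\<delta> - \<gamma>)" for \<delta>
      using \<gamma>(2)[OF up[OF that]] ht_pos[OF that(2)] by (force simp: ht_diff)
    ultimately show ?thesis
      using \<gamma>(1) by blast
  qed
  obtain \<beta>0 where "\<beta>0 \<in> \<Phi>"
    using assms(2) by blast
  from maximal[OF this] obtain \<psi> where \<psi>: "\<psi> \<in> \<Phi>" "dominant \<psi>" "\<And>\<delta>. \<delta> \<in> \<Phi> \<Longrightarrow> pos (\<delta> - \<psi>) \<Longrightarrow> \<delta> = \<psi>"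
    by blast
  have high: "pos (\<psi> - \<beta>)" if \<beta>: "\<beta> \<in> \<Phi>" for \<beta>
  proof -
    obtain \<gamma> where \<gamma>: "\<gamma> \<in> \<Phi>" "pos (\<gamma> - \<beta>)" "dominant \<gamma>" "\<And>\<delta>. \<delta> \<in> \<Phi> \<Longrightarrow> pos (\<delta> - \<gamma>) \<Longrightarrow> \<delta> = \<gamma>"
      using maximal[OF \<beta>] by blast
    have "\<gamma> = \<psi>"
    proof (rule ccontr)
      assume ne: "\<gamma> \<noteq> \<psi>"
      then have "\<gamma> - \<psi> \<in> \<Phi>"
        using P.diff_\<Phi> \<psi> \<gamma> inner by blast
      from sgn[OF this] show False
        using ne \<psi>(1,3) \<gamma>(1,4) by auto
    qed
    then show ?thesis
      using \<gamma>(2) by simp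
  qed
  have "\<beta> \<bullet> \<beta> \<le> \<psi> \<bullet> \<psi>" if \<beta>: "\<beta> \<in> \<Phi>" for \<beta>
  proof -
    let ?S = "{\<gamma>\<in>\<Phi>. \<gamma> \<bullet> \<gamma> = \<beta> \<bullet> \<beta>}"
    have "finite ?S" "\<beta> \<in> ?S"
      using P.finite_\<Phi> \<beta> by auto
    then obtain \<gamma> where \<gamma>: "\<gamma> \<in> ?S" "\<And>\<delta>. \<delta> \<in> ?S \<Longrightarrow> ht \<delta> \<le> ht \<gamma>"
      using finite_has_maximizer[of ?S _ ht] by blast
    have dom: "dominant \<gamma>"
      by (rule max_ht_dominant[OF \<gamma>]) (use refl \<gamma>(1) in \<open>auto simp: reflection_inner\<close>)
    have p: "pos (\<psi> - \<gamma>)"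
      using high \<gamma>(1) by simp
    \<comment> \<open>Both factors are dominant and \<open>\<psi> - \<gamma>\<close> is positive,
      whence \<open>\<gamma> \<bullet> \<gamma> \<le> \<psi> \<bullet> \<gamma> \<le> \<psi>
      \<bullet> \<psi>\<close>.\<close>
    have "0 \<le> \<psi> \<bullet> (\<psi> - \<gamma>)" "0 \<le> \<gamma> \<bullet> (\<psi> - \<gamma>)"
      using pos_dominant_inner[OF p] dom \<psi>(2) by auto
    then show ?thesis
      using \<gamma>(1) by (simp add: inner_diff_right inner_commute)
  qed
  then show ?thesis
    using high \<psi> by blast
qed

section \<open>The gradient of the affine simple root\<close>

lemma R0_nonempty: "R0 \<noteq> {}"
  using simple_in[of 1] DIM_positive[where 'a='v] by (auto simp: Suc_le_eq)

lemma nonneg_comb_antisym: "nonneg_comb \<alpha> v \<Longrightarrow> nonneg_comb \<alpha> (- v) \<Longrightarrow> v = 0"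
  using nonneg_comb_pos pos_antisym by blast

lemma highest_root_spec:
  shows "highest_root D \<in> R0" "dominant (highest_root D)" "\<beta> \<in> R0 \<Longrightarrow> pos (highest_root D - \<beta>)"
    "\<beta> \<in> R0 \<Longrightarrow> \<beta> \<bullet> \<beta> \<le> highest_root D \<bullet> highest_root D"
proof -
  have "\<exists>\<psi>\<in>R0. dominant \<psi> \<and> (\<forall>\<beta>\<in>R0. pos (\<psi> - \<beta>) \<and> \<beta> \<bullet> \<beta> \<le> \<psi> \<bullet> \<psi>)"
    by (rule highest_exists[OF crystallographic_axioms R0_nonempty])
      (use simple_in in \<open>auto intro!: exI[of _ 1]\<close>)
  then obtain \<psi> where \<psi>: "\<psi> \<in> R0" "dominant \<psi>" "\<And>\<beta>. \<beta> \<in> R0 \<Longrightarrow> pos (\<psi> - \<beta>)"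
    "\<And>\<beta>. \<beta> \<in> R0 \<Longrightarrow> \<beta> \<bullet> \<beta> \<le> \<psi> \<bullet> \<psi>"
    by blast
  have nc: "nonneg_comb \<alpha> (\<psi> - \<beta>)" if "\<beta> \<in> R0" for \<beta>
    using pos_diff_nonneg_comb \<psi> that by blast
  have "highest_root D = \<psi>"
    unfolding highest_root_def
  proof (rule the_equality)
    fix \<phi> assume \<phi>: "\<phi> \<in> R0 \<and> (\<forall>\<beta>\<in>R0. nonneg_comb \<alpha> (\<phi> - \<beta>))"
    then have "\<phi> - \<psi> = 0"
      using nc[of \<phi>] \<psi>(1) by (intro nonneg_comb_antisym) auto
    then show "\<phi> = \<psi>" by simp
  qed (use nc \<psi> in blast)
  with \<psi> show "highest_root D \<in> R0" "dominant (highest_root D)"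
    "\<beta> \<in> R0 \<Longrightarrow> pos (highest_root D - \<beta>)"
    "\<beta> \<in> R0 \<Longrightarrow> \<beta> \<bullet> \<beta> \<le> highest_root D \<bullet> highest_root D" by simp_all
qed

text \<open>The coroot of \<open>\<vartheta>\<close> is the highest root of the dual root system.\<close>

lemma highest_short_root_spec:
  shows "highest_short_root D \<in> R0" "dominant (highest_short_root D)"
    "\<beta> \<in> R0 \<Longrightarrow> pos (coroot (highest_short_root D) - coroot \<beta>)"
    "short_root R0 (highest_short_root D)"
proof -
  have norm: "coroot \<beta> \<bullet> coroot \<beta> = 4 / (\<beta> \<bullet> \<beta>)" if "\<beta> \<in> R0" for \<beta>
    using nonzero[OF that] by (simp add: coroot_def field_simps)
  have "\<exists>\<psi>\<in>coroot ` R0. dominant \<psi> \<and> (\<forall>\<beta>\<in>coroot ` R0. pos (\<psi> - \<beta>) \<and> \<beta> \<bullet> \<beta> \<le> \<psi> \<bullet> \<psi>)"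
  proof (rule highest_exists[OF crystallographic_coroot[OF crystallographic_axioms]])
    show "\<exists>t>0. t *\<^sub>R \<beta> \<in> R0" if "\<beta> \<in> coroot ` R0" for \<beta>
    proof -
      from that obtain \<gamma> where "\<gamma> \<in> R0" "\<beta> = coroot \<gamma>"
        by auto
      then show ?thesis
        using nonzero by (intro exI[of _ "(\<gamma> \<bullet> \<gamma>) / 2"]) (auto simp: coroot_def)
    qed
    show "\<exists>t>0. t *\<^sub>R \<alpha> i \<in> coroot ` R0" if "i \<in> {1..DIM('v)}" for i
      using simple_in[OF that] simple_norm_pos[OF that]
      by (intro exI[of _ "2 / (\<alpha> i \<bullet> \<alpha> i)"]) (auto simp: coroot_def)
  qed (use R0_nonempty in auto)
  then obtain \<psi> where \<psi>: "\<psi> \<in> R0" "dominant (coroot \<psi>)" "\<And>\<beta>. \<beta> \<in> R0 \<Longrightarrow> pos (coroot \<psi> - coroot \<beta>)"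
    "\<And>\<beta>. \<beta> \<in> R0 \<Longrightarrow> coroot \<beta> \<bullet> coroot \<beta> \<le> coroot \<psi> \<bullet> coroot \<psi>"
    by blast
  have "0 < \<psi> \<bullet> \<psi>"
    using nonzero[OF \<psi>(1)] by simp
  then have dom: "dominant \<psi>"
    using \<psi>(2) dominant_scale[of "2 / (\<psi> \<bullet> \<psi>)" \<psi>] by (simp add: coroot_def)
  have short: "short_root R0 \<psi>"
    unfolding short_root_def
  proof (intro conjI ballI)
    fix \<beta> assume "\<beta> \<in> R0"
    then show "\<psi> \<bullet> \<psi> \<le> \<beta> \<bullet> \<beta>"
      using \<psi>(4)[of \<beta>] \<psi>(1) nonzero norm by (auto simp: divide_le_eq_numeral field_simps)
  qed fact
  have nc: "nonneg_comb \<alpha> (\<psi> - \<beta>)" if "short_root R0 \<beta>" for \<beta>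
  proof (rule pos_diff_nonneg_comb)
    show \<beta>: "\<beta> \<in> R0"
      using that by (simp add: short_root_def)
    have eq: "\<beta> \<bullet> \<beta> = \<psi> \<bullet> \<psi>"
      using that short by (auto simp: short_root_def intro: order.antisym)
    \<comment> \<open>Short roots share one length, so the difference of two of them is a positive
      multiple of the difference of their coroots.\<close>
    have "\<psi> - \<beta> = ((\<psi> \<bullet> \<psi>) / 2) *\<^sub>R (coroot \<psi> - coroot \<beta>)"
      using \<open>0 < \<psi> \<bullet> \<psi>\<close> by (simp add: coroot_def eq algebra_simps)
    then show "pos (\<psi> - \<beta>)"
      using \<psi>(3)[OF \<beta>] \<open>0 < \<psi> \<bullet> \<psi>\<close> by (simp add: pos_scale)
  qed fact
  have "highest_short_root D = \<psi>"
    unfolding highest_short_root_def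
  proof (rule the_equality)
    fix \<phi> assume \<phi>: "short_root R0 \<phi> \<and> (\<forall>\<beta>. short_root R0 \<beta> \<longrightarrow> nonneg_comb \<alpha> (\<phi> - \<beta>))"
    then have "\<phi> - \<psi> = 0"
      using nc[of \<phi>] short by (intro nonneg_comb_antisym) auto
    then show "\<phi> = \<psi>" by simp
  qed (use nc short in blast)
  with \<psi> dom short show "highest_short_root D \<in> R0" "dominant (highest_short_root D)"
    "\<beta> \<in> R0 \<Longrightarrow> pos (coroot (highest_short_root D) - coroot \<beta>)"
    "short_root R0 (highest_short_root D)" by simp_all
qed

text \<open>Every length is attained by a dominant root and dominant roots are not orthogonal; as the
  squared lengths of non-orthogonal roots have ratio 1, 2 or 3, a third length is impossible.\<close>

lemma two_lengths:
  assumes "\<beta> \<in> R0"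
  shows "\<beta> \<bullet> \<beta> = highest_root D \<bullet> highest_root D \<or> short_root R0 \<beta>"
proof -
  let ?\<phi> = "highest_root D" and ?\<theta> = "highest_short_root D"
  let ?S = "{\<gamma>\<in>R0. \<gamma> \<bullet> \<gamma> = \<beta> \<bullet> \<beta>}"
  have "finite ?S" "\<beta> \<in> ?S"
    using finite_\<Phi> assms by auto
  then obtain \<gamma> where \<gamma>: "\<gamma> \<in> ?S" "\<And>\<delta>. \<delta> \<in> ?S \<Longrightarrow> ht \<delta> \<le> ht \<gamma>"
    using finite_has_maximizer[of ?S _ ht] by blast
  have dom: "dominant \<gamma>"
    by (rule max_ht_dominant[OF \<gamma>]) (use refl_\<Phi> simple_in \<gamma>(1) in \<open>auto simp: reflection_inner\<close>)
  have \<gamma>R: "\<gamma> \<in> R0" "\<gamma> \<bullet> \<gamma> = \<beta> \<bullet> \<beta>"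
    using \<gamma> by auto
  have red: "2 *\<^sub>R \<delta> \<notin> R0" if "\<delta> \<in> R0" for \<delta>
    using reduced[OF that, of 2] by auto
  have ratio: "x \<bullet> x \<in> {y \<bullet> y, 2 * (y \<bullet> y), 3 * (y \<bullet> y)}"
    if "x \<in> R0" "y \<in> R0" "dominant x" "dominant y" "y \<bullet> y \<le> x \<bullet> x" for x y
    using that nonzero by (intro length_ratio red dominant_inner_pos) auto
  have pos: "0 < ?\<theta> \<bullet> ?\<theta>"
    using nonzero highest_short_root_spec(1) by simp
  have le: "?\<theta> \<bullet> ?\<theta> \<le> \<gamma> \<bullet> \<gamma>" "\<gamma> \<bullet> \<gamma> \<le> ?\<phi> \<bullet> ?\<phi>" "?\<theta> \<bullet> ?\<theta> \<le> ?\<phi> \<bullet> ?\<phi>"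
    using highest_short_root_spec(4) highest_root_spec(1,4) \<gamma>R(1) by (auto simp: short_root_def)
  \<comment> \<open>Two ratios among 1, 2, 3 have a product that is again 1, 2 or 3; since 2 * 2
    already exceeds 3, one of them is 1.\<close>
  have "\<gamma> \<bullet> \<gamma> = ?\<phi> \<bullet> ?\<phi> \<or> \<gamma> \<bullet> \<gamma> = ?\<theta> \<bullet> ?\<theta>"
    using ratio[OF highest_root_spec(1) \<gamma>R(1) highest_root_spec(2) dom le(2)]
      ratio[OF \<gamma>R(1) highest_short_root_spec(1) dom highest_short_root_spec(2) le(1)]
      ratio[OF highest_root_spec(1) highest_short_root_spec(1) highest_root_spec(2) highest_short_root_spec(2) le(3)] pos
    by auto
  then show ?thesis
    using \<gamma>R(2) highest_short_root_spec(4) assms by (auto simp: short_root_def)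
qed

section \<open>Multiplicities of affine roots, uniformly in both types\<close>

definition \<theta> :: 'v where
  "\<theta> = (if twisted D then highest_short_root D else highest_root D)"

abbreviation "m \<equiv> mult_root D"

lemma alpha_0: "alpha D 0 = - \<theta>"
  by (simp add: alpha_def \<theta>_def)

lemma alpha_simple: "i \<in> {1..DIM('v)} \<Longrightarrow> alpha D i = \<alpha> i"
  by (simp add: alpha_def)

lemma \<theta>_in: "\<theta> \<in> R0" and \<theta>_dominant: "dominant \<theta>"
  using highest_root_spec(1,2) highest_short_root_spec(1,2) by (auto simp: \<theta>_def)

lemma alpha_in: "j \<le> DIM('v) \<Longrightarrow> alpha D j \<in> R0"
  using uminus_\<Phi>[OF \<theta>_in] simple_in by (cases "j = 0") (auto simp: alpha_0 alpha_simple)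

lemma mult_untwisted: "\<not> twisted D \<Longrightarrow> m \<beta> = 1"
  using nonzero[OF highest_root_spec(1)] by (simp add: mult_root_def alpha_0 \<theta>_def)

text \<open>By \<open>two_lengths\<close> a root is either short, like \<open>\<theta>\<close>, or
  as long as the highest root, so one ratio of squared lengths covers both clauses of
  \<open>mult_root\<close>.\<close>

lemma mult_twisted: "twisted D \<Longrightarrow> \<beta> \<in> R0 \<Longrightarrow> m \<beta> = (\<beta> \<bullet> \<beta>) / (\<theta> \<bullet> \<theta>)"
proof -
  assume t: "twisted D" "\<beta> \<in> R0"
  have "\<beta> \<bullet> \<beta> = \<theta> \<bullet> \<theta>" if "short_root R0 \<beta>"
    using that highest_short_root_spec(4) t by (auto simp: short_root_def \<theta>_def intro: order.antisym)
  then show ?thesis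
    using two_lengths[OF t(2)] t nonzero[OF \<theta>_in] by (auto simp: mult_root_def alpha_0 \<theta>_def)
qed

lemma mult_pos: "\<beta> \<in> R0 \<Longrightarrow> 0 < m \<beta>"
  using nonzero \<theta>_in by (cases "twisted D") (auto simp: mult_untwisted mult_twisted)

lemma mult_\<theta>: "m (- \<theta>) = 1" "m \<theta> = 1"
  using \<theta>_in uminus_\<Phi> nonzero by (cases "twisted D"; force simp: mult_untwisted mult_twisted)+

lemma mult_cong: "\<beta> \<in> R0 \<Longrightarrow> \<gamma> \<in> R0 \<Longrightarrow> \<beta> \<bullet> \<beta> = \<gamma> \<bullet> \<gamma> \<Longrightarrow> m \<beta> = m \<gamma>"
  by (cases "twisted D") (simp_all add: mult_untwisted mult_twisted)

text \<open>This will give the sign on the alcove of the affine roots with \<open>r = 1\<close>. In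
  the twisted case it is the maximality of the coroot of \<open>\<theta>\<close>, rescaled; in the
  untwisted case it is the maximality of \<open>\<theta>\<close> itself.\<close>

lemma pos_mult_\<theta>_add:
  assumes "\<beta> \<in> R0"
  shows "pos (m \<beta> *\<^sub>R \<theta> + \<beta>)"
proof (cases "twisted D")
  case True
  have "m \<beta> *\<^sub>R \<theta> + \<beta> = ((\<beta> \<bullet> \<beta>) / 2) *\<^sub>R (coroot \<theta> - coroot (- \<beta>))"
    using nonzero[OF assms] nonzero[OF \<theta>_in] mult_twisted[OF True assms]
    by (simp add: coroot_def algebra_simps)
  then show ?thesis
    using highest_short_root_spec(3)[OF uminus_\<Phi>[OF assms]] True by (simp add: pos_scale \<theta>_def)
next
  case False
  then show ?thesis
    using highest_root_spec(3)[OF uminus_\<Phi>[OF assms]] by (simp add: mult_untwisted \<theta>_def)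
qed

text \<open>Says that the coroot of \<open>\<theta>\<close> is an admissible translation, so that
  the affine reflection \<open>sr 0\<close> lies in the extended group.\<close>

lemma \<theta>_pairing_Ints:
  assumes "\<beta> \<in> R0"
  shows "coroot \<theta> \<bullet> \<beta> / m \<beta> \<in> \<int>"
proof (cases "twisted D")
  case True
  have "coroot \<theta> \<bullet> \<beta> / m \<beta> = \<theta> \<bullet> coroot \<beta>"
    using nonzero[OF assms] nonzero[OF \<theta>_in] mult_twisted[OF True assms]
    by (simp add: coroot_def inner_commute)
  then show ?thesis
    using int_\<Phi>[OF assms \<theta>_in] by simp
next
  case False
  then show ?thesis
    using int_\<Phi>[OF \<theta>_in assms] by (simp add: mult_untwisted inner_commute)
qed

lemma alpha_inner_nonpos:
  assumes "j \<le> DIM('v)" "k \<le> DIM('v)" "j \<noteq> k"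
  shows "alpha D j \<bullet> alpha D k \<le> 0"
proof -
  have *: "- \<theta> \<bullet> \<alpha> i \<le> 0" if "i \<in> {1..DIM('v)}" for i
    using \<theta>_dominant that by (simp add: dominant_def)
  show ?thesis
    using assms *[of j] *[of k] simple_inner_nonpos[of j k]
    by (cases "j = 0"; cases "k = 0") (auto simp: alpha_0 alpha_simple inner_commute)
qed

end

section \<open>Words, exchange and Matsumoto's theorem\<close>

fun altl :: "nat \<Rightarrow> 'a \<Rightarrow> 'a \<Rightarrow> 'a list" where
  "altl 0 a b = []"
| "altl (Suc n) a b = a # altl n b a"

lemma length_altl [simp]: "length (altl n a b) = n"
  by (induction n a b rule: altl.induct) auto

lemma set_altl: "set (altl n a b) \<subseteq> {a, b}"
  by (induction n a b rule: altl.induct) auto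

lemma altl_snoc: "altl (Suc n) a b = altl n a b @ [if even n then a else b]"
  by (induction n a b rule: altl.induct) auto

locale involutive_words =
  fixes s :: "nat \<Rightarrow> 'x \<Rightarrow> 'x" and S :: "nat set"
  assumes invol: "j \<in> S \<Longrightarrow> s j (s j x) = x"
begin

fun wd :: "nat list \<Rightarrow> 'x \<Rightarrow> 'x" where
  "wd [] = id"
| "wd (j # js) = s j \<circ> wd js"

lemma wd_append: "wd (xs @ ys) = wd xs \<circ> wd ys"
  by (induction xs) (auto simp: o_assoc)

definition reduced_word :: "nat list \<Rightarrow> bool" where
  "reduced_word js \<longleftrightarrow> set js \<subseteq> S \<and> (\<forall>ks. set ks \<subseteq> S \<longrightarrow> wd ks = wd js \<longrightarrow> length js \<le> length ks)"

lemma reduced_wordD: "reduced_word js \<Longrightarrow> set ks \<subseteq> S \<Longrightarrow> wd ks = wd js \<Longrightarrow> length js \<le> length ks"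
  by (auto simp: reduced_word_def)

lemma reduced_word_set: "reduced_word js \<Longrightarrow> set js \<subseteq> S"
  by (simp add: reduced_word_def)

lemma reduced_word_append:
  assumes "reduced_word (xs @ ys)"
  shows "reduced_word xs" "reduced_word ys"
proof -
  have S: "set xs \<subseteq> S" "set ys \<subseteq> S"
    using reduced_word_set[OF assms] by auto
  show "reduced_word xs"
    unfolding reduced_word_def
  proof (intro conjI allI impI S)
    fix ks assume "set ks \<subseteq> S" "wd ks = wd xs"
    then show "length xs \<le> length ks"
      using reduced_wordD[OF assms, of "ks @ ys"] S by (simp add: wd_append)
  qed
  show "reduced_word ys"
    unfolding reduced_word_def
  proof (intro conjI allI impI S)
    fix ks assume "set ks \<subseteq> S" "wd ks = wd ys"
    then show "length ys \<le> length ks"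
      using reduced_wordD[OF assms, of "xs @ ks"] S by (simp add: wd_append)
  qed
qed

lemma reduced_word_Cons: "reduced_word (j # js) \<Longrightarrow> reduced_word js"
  using reduced_word_append(2)[of "[j]" js] by simp

lemma reduced_word_same:
  assumes "reduced_word xs" "set ys \<subseteq> S" "wd ys = wd xs" "length ys \<le> length xs"
  shows "reduced_word ys"
  unfolding reduced_word_def using assms reduced_wordD[OF assms(1)] by (metis le_trans)

lemma reduced_word_length: "reduced_word xs \<Longrightarrow> reduced_word ys \<Longrightarrow> wd xs = wd ys \<Longrightarrow> length xs = length ys"
  by (metis le_antisym reduced_wordD reduced_word_set)

lemma wd_cancel: "j \<in> S \<Longrightarrow> s j \<circ> (s j \<circ> f) = f"
  by (auto simp: invol)

lemma wd_Cons_inj: "j \<in> S \<Longrightarrow> wd (j # xs) = wd (j # ys) \<longleftrightarrow> wd xs = wd ys"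
  using wd_cancel by (metis wd.simps(2))

lemma wd_snoc_inj:
  assumes "j \<in> S"
  shows "wd (xs @ [j]) = wd (ys @ [j]) \<longleftrightarrow> wd xs = wd ys"
proof
  assume eq: "wd (xs @ [j]) = wd (ys @ [j])"
  have "wd xs \<circ> s j \<circ> s j = wd ys \<circ> s j \<circ> s j"
    using eq by (simp add: wd_append)
  then show "wd xs = wd ys"
    by (simp add: fun_eq_iff invol[OF assms])
qed (simp add: wd_append)

lemma exists_reduced_word:
  assumes "set js \<subseteq> S"
  shows "\<exists>ks. reduced_word ks \<and> wd ks = wd js"
proof -
  let ?P = "\<lambda>ks. set ks \<subseteq> S \<and> wd ks = wd js"
  have "?P (arg_min length ?P)" "\<And>ks. ?P ks \<Longrightarrow> length (arg_min length ?P) \<le> length ks"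
    using arg_min_natI[of ?P js length] arg_min_nat_le[of ?P _ length] assms by auto
  then have "reduced_word (arg_min length ?P) \<and> wd (arg_min length ?P) = wd js"
    by (auto simp: reduced_word_def)
  then show ?thesis ..
qed

lemma wd_rev:
  assumes "set js \<subseteq> S"
  shows "wd js \<circ> wd (rev js) = id"
  using assms
proof (induction js)
  case (Cons j js)
  have "wd (j # js) \<circ> wd (rev (j # js)) = s j \<circ> (wd js \<circ> wd (rev js)) \<circ> s j"
    by (simp add: wd_append o_assoc)
  also have "\<dots> = id"
    using Cons by (auto simp: invol fun_eq_iff)
  finally show ?case .
qed simp

end

locale exchange_words = involutive_words +
  assumes exchange: "reduced_word js \<Longrightarrow> j \<in> S \<Longrightarrow> \<not> reduced_word (j # js) \<Longrightarrow>
    \<exists>t<length js. wd (j # js) = wd (take t js @ drop (Suc t) js)"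
begin

text \<open>The argument is that of Bourbaki (Lie IV, 1.5): two inequivalent reduced words of minimal length
  can be transformed by exchange into the two alternating words in their first letters.\<close>

theorem matsumoto:
  assumes rel_refl: "\<And>xs. rel xs xs" and rel_sym: "\<And>xs ys. rel xs ys \<Longrightarrow> rel ys xs"
    and rel_trans: "\<And>xs ys zs. rel xs ys \<Longrightarrow> rel ys zs \<Longrightarrow> rel xs zs"
    and rel_Cons: "\<And>j xs ys. j \<in> S \<Longrightarrow> rel xs ys \<Longrightarrow> rel (j # xs) (j # ys)"
    and rel_snoc: "\<And>j xs ys. j \<in> S \<Longrightarrow> rel xs ys \<Longrightarrow> rel (xs @ [j]) (ys @ [j])"
    and rel_braid: "\<And>a b q. a \<in> S \<Longrightarrow> b \<in> S \<Longrightarrow> a \<noteq> b \<Longrightarrow> reduced_word (altl q a b) \<Longrightarrow>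
      wd (altl q a b) = wd (altl q b a) \<Longrightarrow> rel (altl q a b) (altl q b a)"
    and "reduced_word xs" "reduced_word ys" "wd xs = wd ys"
  shows "rel xs ys"
  using assms(7-9)
proof (induction "length xs" arbitrary: xs ys rule: less_induct)
  case less
  define q where "q = length xs"
  have IH: "rel x y" if "length x < q" "reduced_word x" "reduced_word y" "wd x = wd y" for x y
    using less(1) that by (simp add: q_def)
  have same_first: "rel (a # x) (a # y)"
    if r: "reduced_word (a # x)" "reduced_word (a # y)" "wd (a # x) = wd (a # y)" "length (a # x) = q" for a x y
  proof -
    have a: "a \<in> S"
      using reduced_word_set[OF r(1)] by simp
    show ?thesis
      using r a by (intro rel_Cons IH reduced_word_Cons[of a x] reduced_word_Cons[of a y])
        (auto simp: wd_Cons_inj simp del: wd.simps)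
  qed
  have same_last: "rel (x @ [a]) (y @ [a])"
    if r: "reduced_word (x @ [a])" "reduced_word (y @ [a])" "wd (x @ [a]) = wd (y @ [a])" "length (x @ [a]) = q" for a x y
  proof -
    have a: "a \<in> S"
      using reduced_word_set[OF r(1)] by simp
    show ?thesis
      using r a reduced_word_append(1)[OF r(1)] reduced_word_append(1)[OF r(2)]
      by (intro rel_snoc IH) (auto simp: wd_snoc_inj)
  qed
  \<comment> \<open>Exchange puts \<open>a\<close> in front of \<open>y\<close> and deletes one
    letter of \<open>y\<close>. If the deleted letter is not the last one, the new word ends like
    \<open>y\<close> and the induction hypothesis joins the two; otherwise it is
    \<open>a # butlast y\<close>.\<close>
  have step: "\<exists>z. reduced_word z \<and> wd z = wd y \<and> rel (a # x) z \<and> (rel z y \<or> z = a # butlast y)"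
    if r: "reduced_word (a # x)" "reduced_word y" "wd (a # x) = wd y" "length (a # x) = q" for a x y
  proof -
    have a: "a \<in> S" and xS: "set x \<subseteq> S" and yS: "set y \<subseteq> S"
      using reduced_word_set[OF r(1)] reduced_word_set[OF r(2)] by auto
    have ly: "length y = q"
      using reduced_word_length[OF r(1,2,3)] r(4) by simp
    have wx: "wd (a # y) = wd x"
      using r(3) a by (metis wd.simps(2) wd_cancel)
    have "\<not> reduced_word (a # y)"
      using reduced_wordD[of "a # y" x] xS wx ly r(4) by auto
    then obtain t where t: "t < length y" "wd (a # y) = wd (take t y @ drop (Suc t) y)"
      using exchange[OF r(2) a] by blast
    define z where "z = a # take t y @ drop (Suc t) y"
    have "wd z = s a \<circ> wd (a # y)"
      unfolding z_def t(2) by simp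
    then have wz: "wd z = wd y"
      using wd_cancel[OF a] by simp
    have zS: "set z \<subseteq> S"
      using a yS set_take_subset[of t y] set_drop_subset[of "Suc t" y] by (auto simp: z_def)
    have lz: "length z = q"
      using t(1) ly by (simp add: z_def)
    have rz: "reduced_word z"
      using reduced_word_same[OF r(2) zS wz] lz ly by simp
    have "rel (a # x) z"
      unfolding z_def using rz wz r by (intro same_first) (auto simp: z_def)
    moreover have "rel z y \<or> z = a # butlast y"
    proof (cases "Suc t = length y")
      case True
      then have "butlast y = take t y" "drop (Suc t) y = []"
        by (auto simp: butlast_conv_take simp flip: True)
      then show ?thesis
        by (simp add: z_def)
    next
      case False
      then have "drop (Suc t) y \<noteq> []"
        using t(1) by simp
      then obtain d where d: "drop (Suc t) y = d @ [last y]"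
        by (metis append_butlast_last_id last_drop drop_eq_Nil not_le)
      then have y: "y = (take (Suc t) y @ d) @ [last y]"
        by (metis append_assoc append_take_drop_id)
      have z: "z = (a # take t y @ d) @ [last y]"
        by (simp add: z_def d)
      have "rel ((a # take t y @ d) @ [last y]) ((take (Suc t) y @ d) @ [last y])"
        using rz r(2) wz lz unfolding z[symmetric] y[symmetric] by (metis same_last y z)
      then show ?thesis
        unfolding z[symmetric] y[symmetric] ..
    qed
    ultimately show ?thesis
      using rz wz by blast
  qed
  \<comment> \<open>Downward induction on the length \<open>k\<close> of the alternating prefixes:
    two applications of \<open>step\<close> lengthen them by one, unless they already join the
    words. At \<open>k = q\<close> both words alternate and \<open>rel_braid\<close>
    applies.\<close>
  have alt: "rel x y"
    if "x = altl k a b @ u" "y = altl k b a @ u'" "1 \<le> k" "k \<le> q" "a \<noteq> b"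
      "reduced_word x" "reduced_word y" "wd x = wd y" "length x = q" for k a b u u' x y
    using that
  proof (induction "q - k" arbitrary: k u u' x y)
    case 0
    have "length y = q"
      using reduced_word_length 0 by metis
    with 0 have xy: "x = altl q a b" "y = altl q b a" and q: "1 \<le> q"
      by auto
    have "a \<in> S" "b \<in> S"
      using 0 reduced_word_set[of x] reduced_word_set[of y] by (cases k; auto)+
    then show ?case
      using rel_braid 0 xy by metis
  next
    case (Suc l)
    obtain k' where k': "k = Suc k'"
      using Suc.prems(3) by (cases k) auto
    have ly: "length y = q"
      using reduced_word_length Suc.prems by metis
    have kq: "k < q"
      using Suc.hyps(2) by simp
    have x: "x = a # altl k' b a @ u" and y: "y = b # altl k' a b @ u'"
      using Suc.prems k' by auto
    have u': "u' \<noteq> []"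
      using ly kq Suc.prems(2) by auto
    obtain z where z: "reduced_word z" "wd z = wd y" "rel x z" "rel z y \<or> z = a # butlast y"
      using step[of a "altl k' b a @ u" y] Suc.prems x by metis
    show ?case
    proof (cases "rel z y")
      case True
      then show ?thesis
        using z(3) rel_trans by blast
    next
      case False
      then have ze: "z = altl (Suc k) a b @ butlast u'"
        using z(4) Suc.prems(2) u' by (simp add: butlast_append)
      have lz: "length z = q"
        using reduced_word_length[OF z(1) Suc.prems(7) z(2)] ly by simp
      obtain z' where z': "reduced_word z'" "wd z' = wd z" "rel y z'" "rel z' z \<or> z' = b # butlast z"
        using step[of b "altl k' a b @ u'" z] Suc.prems y z ly by metis
      show ?thesis
      proof (cases "rel z' z")
        case True
        then show ?thesis
          using z(3) z'(3) rel_trans rel_sym by blast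
      next
        case False
        have "\<exists>v. z' = altl (Suc k) b a @ v"
        proof (cases "butlast u' = []")
          case True
          then have "butlast z = altl k a b"
            unfolding ze by (simp add: altl_snoc del: altl.simps)
          then show ?thesis
            using False z'(4) by auto
        next
          case F: False
          then have "butlast z = altl k a b @ [if even k then a else b] @ butlast (butlast u')"
            unfolding ze by (simp add: altl_snoc butlast_append del: altl.simps)
          then show ?thesis
            using False z'(4) by auto
        qed
        then obtain v where v: "z' = altl (Suc k) b a @ v" ..
        have "rel z z'"
          by (rule Suc.hyps(1)[OF _ ze v]) (use Suc.hyps(2) Suc.prems(5) kq z z' lz in auto)
        then show ?thesis
          using z(3) z'(3) rel_trans rel_sym by blast
      qed
    qed
  qed
  have lxy: "length ys = q"
    using reduced_word_length[OF less.prems] by (simp add: q_def)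
  show ?case
  proof (cases xs)
    case Nil
    then show ?thesis
      using lxy rel_refl by (simp add: q_def)
  next
    case (Cons a x)
    then obtain b y where y: "ys = b # y"
      using lxy by (cases ys) (auto simp: q_def)
    show ?thesis
    proof (cases "a = b")
      case True
      then show ?thesis
        unfolding Cons y using less.prems lxy reduced_word_length[OF less.prems] unfolding Cons y True
        by (intro same_first) simp_all
    next
      case False
      show ?thesis
        by (rule alt[of _ 1 a b x _ y]) (use less.prems Cons y False lxy in \<open>simp_all add: q_def\<close>)
    qed
  qed
qed

end

section \<open>The extended affine Weyl group\<close>

lemma weyl_group_comp: "v \<in> weyl_group R \<Longrightarrow> w \<in> weyl_group R \<Longrightarrow> v \<circ> w \<in> weyl_group R"
  by (induction v rule: weyl_group.induct) (auto simp: o_assoc[symmetric] intro: weyl_group.intros)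

lemma weyl_group_reflection: "\<beta> \<in> R \<Longrightarrow> reflection \<beta> \<in> weyl_group R"
  using weyl_group.refl[OF _ weyl_group.id] by fastforce

lemma weyl_group_inverse: "v \<in> weyl_group R \<Longrightarrow> \<exists>v'\<in>weyl_group R. v \<circ> v' = id \<and> v' \<circ> v = id"
proof (induction v rule: weyl_group.induct)
  case (refl \<beta> w)
  then obtain w' where w': "w' \<in> weyl_group R" "w \<circ> w' = id" "w' \<circ> w = id"
    by blast
  have "w' \<circ> reflection \<beta> \<in> weyl_group R"
    using weyl_group_comp[OF w'(1) weyl_group_reflection[OF refl(1)]] .
  moreover have "reflection \<beta> \<circ> w \<circ> (w' \<circ> reflection \<beta>) = id" "w' \<circ> reflection \<beta> \<circ> (reflection \<beta> \<circ> w) = id"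
    using w'(2,3) by (auto simp: fun_eq_iff reflection_involution)
  ultimately show ?case by blast
next
  case id
  show ?case
    by (rule bexI[of _ id]) (simp_all add: weyl_group.id)
qed

lemma weyl_group_linear: "v \<in> weyl_group R \<Longrightarrow> linear v"
  by (induction v rule: weyl_group.induct) (simp_all only: linear_id linear_compose linear_reflection)

lemma weyl_group_inner: "v \<in> weyl_group R \<Longrightarrow> v x \<bullet> v y = x \<bullet> y"
  by (induction v arbitrary: x y rule: weyl_group.induct) (simp_all add: reflection_inner)

lemma (in crystallographic) weyl_group_root: "v \<in> weyl_group \<Phi> \<Longrightarrow> \<beta> \<in> \<Phi> \<Longrightarrow> v \<beta> \<in> \<Phi>"
  by (induction v rule: weyl_group.induct) (simp_all add: refl_\<Phi>)

lemma affine_fun_eq_iff: "affine_fun v r = affine_fun w t \<longleftrightarrow> v = w \<and> r = t"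
proof
  assume eq: "affine_fun v r = affine_fun w t"
  have "r = t"
    using fun_cong[OF eq, of 0] by (simp add: affine_fun_def)
  moreover have "(v - w) \<bullet> (v - w) = 0"
    using fun_cong[OF eq, of "v - w"] \<open>r = t\<close> by (simp add: affine_fun_def inner_diff_left)
  ultimately show "v = w \<and> r = t"
    by simp
qed simp

definition affine_indices :: "'v::euclidean_space affine_datum \<Rightarrow> nat set" where
  "affine_indices D = {0..DIM('v)}"

lemma affine_indices_iff [simp]: "j \<in> affine_indices (D :: 'v::euclidean_space affine_datum) \<longleftrightarrow> j \<le> DIM('v)"
  by (simp add: affine_indices_def)

context affine_data
begin

abbreviation "W0 \<equiv> weyl_group R0"
abbreviation "c \<equiv> affine_datum.scale D"
abbreviation "sar \<equiv> simple_affine_root D"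
abbreviation "sr \<equiv> simple_reflection D"
abbreviation "W \<equiv> ext_weyl D"

lemma c_pos: "0 < c"
  using datum by (simp add: affine_datum_def)

text \<open>This is the weight lattice of \<open>hat_roots D\<close>, since the coroot of
  \<open>m \<beta> *\<^sub>R coroot \<beta>\<close> is \<open>\<beta>\<close> divided by
  \<open>m \<beta>\<close>.\<close>

definition transl_lattice :: "'v set" where
  "transl_lattice = {\<nu>. \<forall>\<beta>\<in>R0. \<nu> \<bullet> \<beta> / m \<beta> \<in> \<int>}"

lemma transl_lattice_eq: "weight_lattice (hat_roots D) = transl_lattice"
proof -
  have "coroot (m \<beta> *\<^sub>R coroot \<beta>) = (1 / m \<beta>) *\<^sub>R \<beta>" if "\<beta> \<in> R0" for \<beta>
    using mult_pos[OF that] by (simp add: coroot_scale coroot_coroot)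
  then show ?thesis
    by (auto simp: weight_lattice_def hat_roots_def transl_lattice_def)
qed

lemma carrier_W_iff:
  "w \<in> carrier W \<longleftrightarrow> (\<exists>v\<in>W0. \<exists>\<nu>\<in>transl_lattice. w = (\<lambda>x. v (x + c *\<^sub>R \<nu>)))"
  by (auto simp: ext_weyl_def transl_lattice_eq translation_def fun_eq_iff)

lemma W_sel [simp]: "mult W = (\<circ>)" "one W = id"
  by (simp_all add: ext_weyl_def)

lemma transl_lattice_add: "\<nu> \<in> transl_lattice \<Longrightarrow> \<mu> \<in> transl_lattice \<Longrightarrow> \<nu> + \<mu> \<in> transl_lattice"
  by (auto simp: transl_lattice_def inner_add_left add_divide_distrib)

lemma transl_lattice_minus: "\<nu> \<in> transl_lattice \<Longrightarrow> - \<nu> \<in> transl_lattice"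
  by (auto simp: transl_lattice_def)

lemma transl_lattice_W0:
  assumes "v \<in> W0" "\<nu> \<in> transl_lattice"
  shows "v \<nu> \<in> transl_lattice"
  unfolding transl_lattice_def mem_Collect_eq
proof
  fix \<beta> assume \<beta>: "\<beta> \<in> R0"
  obtain v' where v': "v' \<in> W0" "v \<circ> v' = id"
    using weyl_group_inverse[OF assms(1)] by blast
  have b: "v (v' \<beta>) = \<beta>" "v' \<beta> \<in> R0"
    using v' \<beta> weyl_group_root by (auto simp: fun_eq_iff)
  have "v \<nu> \<bullet> \<beta> = \<nu> \<bullet> v' \<beta>"
    using weyl_group_inner[OF assms(1), of \<nu> "v' \<beta>"] b by simp
  moreover have "m \<beta> = m (v' \<beta>)"
    using b weyl_group_inner[OF v'(1), of \<beta> \<beta>] \<beta> by (intro mult_cong) auto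
  ultimately show "v \<nu> \<bullet> \<beta> / m \<beta> \<in> \<int>"
    using assms(2) b(2) by (simp add: transl_lattice_def)
qed

lemma carrier_W_comp: "u \<in> carrier W \<Longrightarrow> w \<in> carrier W \<Longrightarrow> u \<circ> w \<in> carrier W"
proof -
  assume "u \<in> carrier W" "w \<in> carrier W"
  then obtain v v' \<nu> \<nu>' where v: "v \<in> W0" "v' \<in> W0" and \<nu>: "\<nu> \<in> transl_lattice" "\<nu>' \<in> transl_lattice"
    and u: "u = (\<lambda>x. v (x + c *\<^sub>R \<nu>))" and w: "w = (\<lambda>x. v' (x + c *\<^sub>R \<nu>'))"
    by (auto simp: carrier_W_iff)
  obtain v'' where v'': "v'' \<in> W0" "v' \<circ> v'' = id"
    using weyl_group_inverse[OF v(2)] by blast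
  have "u \<circ> w = (\<lambda>x. (v \<circ> v') (x + c *\<^sub>R (\<nu>' + v'' \<nu>)))"
    using v'' weyl_group_linear[OF v(2)]
    by (auto simp: u w fun_eq_iff linear_add linear_cmul algebra_simps)
  moreover have "\<nu>' + v'' \<nu> \<in> transl_lattice"
    using transl_lattice_add transl_lattice_W0 \<nu> v'' by blast
  ultimately show ?thesis
    using weyl_group_comp[OF v] unfolding carrier_W_iff by blast
qed

lemma W0_in_W: "v \<in> W0 \<Longrightarrow> v \<in> carrier W"
  unfolding carrier_W_iff by (rule bexI[of _ v], rule bexI[of _ 0]) (auto simp: transl_lattice_def)

lemma carrier_W_inverse:
  assumes "w \<in> carrier W"
  shows "\<exists>w'\<in>carrier W. w \<circ> w' = id \<and> w' \<circ> w = id"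
proof -
  obtain v \<nu> where v: "v \<in> W0" and \<nu>: "\<nu> \<in> transl_lattice" and w: "w = (\<lambda>x. v (x + c *\<^sub>R \<nu>))"
    using assms by (auto simp: carrier_W_iff)
  obtain v' where v': "v' \<in> W0" "v \<circ> v' = id" "v' \<circ> v = id"
    using weyl_group_inverse[OF v] by blast
  have "v' (v x) = x" "v (v' x) = x" for x
    using v' by (auto simp: fun_eq_iff)
  then have "w \<circ> (\<lambda>x. v' (x + c *\<^sub>R (- v \<nu>))) = id" "(\<lambda>x. v' (x + c *\<^sub>R (- v \<nu>))) \<circ> w = id"
    using weyl_group_linear[OF v] weyl_group_linear[OF v'(1)]
    by (auto simp: fun_eq_iff w linear_add linear_diff linear_cmul algebra_simps)
  moreover have "(\<lambda>x. v' (x + c *\<^sub>R (- v \<nu>))) \<in> carrier W"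
    unfolding carrier_W_iff using v' v \<nu> transl_lattice_minus transl_lattice_W0 by blast
  ultimately show ?thesis
    by blast
qed

lemma group_W: "group W"
proof (rule groupI)
  show "\<exists>y\<in>carrier W. y \<otimes>\<^bsub>W\<^esub> x = \<one>\<^bsub>W\<^esub>" if "x \<in> carrier W" for x
    using carrier_W_inverse[OF that] by auto
qed (auto simp: carrier_W_comp o_assoc W0_in_W weyl_group.id)

lemma gradient_W:
  assumes "w \<in> carrier W"
  shows "gradient w \<in> W0" "w x = gradient w x + w 0"
proof -
  obtain v \<nu> where v: "v \<in> W0" and w: "w = (\<lambda>x. v (x + c *\<^sub>R \<nu>))"
    using assms by (auto simp: carrier_W_iff)
  have "gradient w = v"
    using weyl_group_linear[OF v] linear_0[OF weyl_group_linear[OF v]]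
    by (simp add: gradient_def w fun_eq_iff linear_add)
  then show "gradient w \<in> W0" "w x = gradient w x + w 0"
    using v by (auto simp: gradient_def)
qed

lemma gradient_comp:
  assumes "u \<in> carrier W" "w \<in> carrier W"
  shows "gradient (u \<circ> w) = gradient u \<circ> gradient w"
proof
  fix x
  have "u (w x) = gradient u (gradient w x) + gradient u (w 0) + u 0"
    using gradient_W(2)[OF assms(1), of "w x"] gradient_W(2)[OF assms(2), of x]
      weyl_group_linear[OF gradient_W(1)[OF assms(1)]] by (simp add: linear_add)
  moreover have "u (w 0) = gradient u (w 0) + u 0"
    by (rule gradient_W(2)[OF assms(1)])
  ultimately show "gradient (u \<circ> w) x = (gradient u \<circ> gradient w) x"
    by (subst gradient_def) simp
qed

lemma gradient_W0: "v \<in> W0 \<Longrightarrow> gradient v = v"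
  using linear_0[OF weyl_group_linear[of v R0]] by (simp add: gradient_def fun_eq_iff)

lemma affine_fun_comp_W:
  assumes "w \<in> carrier W"
  shows "affine_fun (gradient w \<beta>) r \<circ> w = affine_fun \<beta> (gradient w \<beta> \<bullet> w 0 + r)"
proof
  fix x
  have "gradient w \<beta> \<bullet> gradient w x = \<beta> \<bullet> x"
    by (rule weyl_group_inner[OF gradient_W(1)[OF assms]])
  then show "(affine_fun (gradient w \<beta>) r \<circ> w) x = affine_fun \<beta> (gradient w \<beta> \<bullet> w 0 + r) x"
    using gradient_W(2)[OF assms, of x] by (simp add: affine_fun_def inner_add_right)
qed

lemma gradient_surj: "w \<in> carrier W \<Longrightarrow> \<exists>\<gamma>. gradient w \<gamma> = \<beta>"
  using weyl_group_inverse[OF gradient_W(1)] by (metis comp_apply id_apply)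

lemma affine_fun_comp_W_eqD:
  assumes "w \<in> carrier W" "affine_fun \<beta> r \<circ> w = affine_fun \<gamma> t"
  shows "\<beta> = gradient w \<gamma>"
  using assms gradient_surj[OF assms(1), of \<beta>] affine_fun_comp_W[OF assms(1)] by (metis affine_fun_eq_iff)

text \<open>The conjugation formula for affine reflections, written without inverses. Both the
  exchange condition and the relation between \<open>T_u\<close> and \<open>T_j\<close> rest on
  it.\<close>

lemma affine_reflection_conj:
  assumes w: "w \<in> carrier W" and eq: "affine_fun \<beta> r \<circ> w = affine_fun \<gamma> t"
  shows "affine_reflection \<beta> r \<circ> w = w \<circ> affine_reflection \<gamma> t"
proof
  fix x
  have v: "gradient w \<in> W0"
    by (rule gradient_W(1)[OF w])
  have \<beta>: "\<beta> = gradient w \<gamma>"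
    using affine_fun_comp_W_eqD[OF assms] .
  have "coroot \<beta> = gradient w (coroot \<gamma>)"
    unfolding \<beta> by (rule coroot_isometry[OF weyl_group_linear[OF v] weyl_group_inner[OF v]])
  moreover have "affine_fun \<beta> r (w x) = affine_fun \<gamma> t x"
    using fun_cong[OF eq, of x] by simp
  ultimately show "(affine_reflection \<beta> r \<circ> w) x = (w \<circ> affine_reflection \<gamma> t) x"
    using gradient_W(2)[OF w, of x] gradient_W(2)[OF w, of "x - affine_fun \<gamma> t x *\<^sub>R coroot \<gamma>"]
      weyl_group_linear[OF v]
    by (simp add: affine_reflection_def linear_diff linear_cmul)
qed

text \<open>Membership of \<open>\<nu>\<close> in the translation lattice says exactly that the
  constant term changes by an integer multiple of \<open>m \<gamma> * c\<close>; lengths, hence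
  multiplicities, are preserved by \<open>W0\<close>.\<close>

lemma affine_roots_comp_W:
  assumes "w \<in> carrier W" "f \<in> affine_roots D"
  shows "f \<circ> w \<in> affine_roots D"
proof -
  obtain v \<nu> where v: "v \<in> W0" and \<nu>: "\<nu> \<in> transl_lattice" and w: "w = (\<lambda>x. v (x + c *\<^sub>R \<nu>))"
    using assms by (auto simp: carrier_W_iff)
  obtain \<beta> r where \<beta>: "\<beta> \<in> R0" and f: "f = affine_fun \<beta> (m \<beta> * of_int r * c)"
    using assms(2) by (auto simp: affine_roots_def)
  obtain v' where v': "v' \<in> W0" "v \<circ> v' = id"
    using weyl_group_inverse[OF v] by blast
  define \<gamma> where "\<gamma> = v' \<beta>"
  have b: "v \<gamma> = \<beta>" "\<gamma> \<in> R0"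
    using v' \<beta> weyl_group_root by (auto simp: fun_eq_iff \<gamma>_def)
  have mm: "m \<beta> = m \<gamma>"
    using b weyl_group_inner[OF v'(1), of \<beta> \<beta>] \<beta> by (intro mult_cong) (auto simp: \<gamma>_def)
  have "\<nu> \<bullet> \<gamma> / m \<gamma> \<in> \<int>"
    using \<nu> b(2) by (simp add: transl_lattice_def)
  then obtain k where "\<nu> \<bullet> \<gamma> / m \<gamma> = of_int k"
    by (elim Ints_cases)
  then have k: "\<nu> \<bullet> \<gamma> = m \<gamma> * of_int k"
    using mult_pos[OF b(2)] by (simp add: field_simps)
  have "f \<circ> w = affine_fun \<gamma> (m \<gamma> * of_int (k + r) * c)"
  proof
    fix x
    have "\<beta> \<bullet> v (x + c *\<^sub>R \<nu>) = \<gamma> \<bullet> (x + c *\<^sub>R \<nu>)"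
      using weyl_group_inner[OF v, of \<gamma>] b by simp
    then show "(f \<circ> w) x = affine_fun \<gamma> (m \<gamma> * of_int (k + r) * c) x"
      using k by (simp add: f w affine_fun_def mm inner_add_right inner_commute[of \<gamma> \<nu>] algebra_simps)
  qed
  then show ?thesis
    using b(2) unfolding affine_roots_def by blast
qed

section \<open>Simple affine reflections and the fundamental alcove\<close>

lemma sr_eq: "sr j x = x - sar j x *\<^sub>R coroot (alpha D j)"
  by (simp add: simple_reflection_def simple_affine_root_def affine_reflection_def)

lemma sar_eq: "sar j x = alpha D j \<bullet> x + shift D j"
  by (simp add: simple_affine_root_def affine_fun_def)

lemma sar_sr: "j \<le> DIM('v) \<Longrightarrow> sar j (sr j x) = - sar j x"
  using inner_coroot_self[OF nonzero[OF alpha_in]] by (simp add: sar_eq sr_eq inner_diff_right algebra_simps)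

lemma sr_sr: "j \<le> DIM('v) \<Longrightarrow> sr j (sr j x) = x"
  using sar_sr by (simp add: sr_eq[of j "sr j x"]) (simp add: sr_eq)

lemma \<theta>_coroot_transl_lattice: "coroot \<theta> \<in> transl_lattice"
  using \<theta>_pairing_Ints by (auto simp: transl_lattice_def)

lemma sr_in_W: "j \<le> DIM('v) \<Longrightarrow> sr j \<in> carrier W"
proof (cases "j = 0")
  case True
  have ne: "\<theta> \<noteq> 0"
    using nonzero[OF \<theta>_in] .
  have "sr 0 = (\<lambda>x. reflection \<theta> (x + c *\<^sub>R (- coroot \<theta>)))"
    by (simp add: fun_eq_iff sr_eq sar_eq shift_def alpha_0 coroot_minus reflection_eq inner_diff_right
        inner_coroot_self[OF ne] algebra_simps flip: scaleR_2)
  moreover have "reflection \<theta> \<in> W0"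
    using weyl_group_reflection \<theta>_in by blast
  ultimately show ?thesis
    using True transl_lattice_minus[OF \<theta>_coroot_transl_lattice] unfolding carrier_W_iff by blast
next
  case False
  assume "j \<le> DIM('v)"
  with False show ?thesis
    using alpha_in by (auto simp: simple_reflection_def shift_def intro!: W0_in_W weyl_group_reflection)
qed

lemma gradient_sr: "gradient (sr j) = reflection (alpha D j)"
  by (simp add: fun_eq_iff gradient_def sr_eq sar_eq reflection_eq inner_commute algebra_simps)

lemma sar_in: "j \<le> DIM('v) \<Longrightarrow> sar j \<in> affine_roots D"
proof -
  assume j: "j \<le> DIM('v)"
  have "sar j = affine_fun (alpha D j) (m (alpha D j) * of_int (if j = 0 then 1 else 0) * c)"
    by (simp add: simple_affine_root_def shift_def alpha_0 mult_\<theta>)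
  then show ?thesis
    using alpha_in[OF j] unfolding affine_roots_def by blast
qed

text \<open>The vertices of the fundamental alcove. Vertex \<open>i\<close> is the common zero of
  all simple affine roots but the \<open>i\<close>-th: \<open>\<omega> i\<close> is orthogonal to
  the other simple roots, and the factor \<open>c / (\<omega> i \<bullet> \<theta>)\<close> puts it
  on the zero set of \<open>sar 0\<close>.\<close>

definition vert :: "nat \<Rightarrow> 'v" where
  "vert i = (if i = 0 then 0 else (c / (\<omega> i \<bullet> \<theta>)) *\<^sub>R \<omega> i)"

lemma \<theta>_full: "i \<in> {1..DIM('v)} \<Longrightarrow> 0 < \<omega> i \<bullet> \<theta>"
  by (rule dominant_full[OF \<theta>_in \<theta>_dominant])

lemma sar_vert: "i \<le> DIM('v) \<Longrightarrow> j \<le> DIM('v) \<Longrightarrow> i \<noteq> j \<Longrightarrow> sar i (vert j) = 0"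
  using \<theta>_full[of j] \<omega>_simple[of j i]
  by (cases "i = 0"; cases "j = 0") (auto simp: sar_eq alpha_0 alpha_simple shift_def vert_def inner_commute)

lemma sar_vert_self: "i \<le> DIM('v) \<Longrightarrow> 0 < sar i (vert i)"
  using \<theta>_full[of i] \<omega>_simple[of i i] c_pos
  by (cases "i = 0") (auto simp: sar_eq alpha_0 alpha_simple shift_def vert_def inner_commute)

text \<open>The vertices affinely span the space: vertex 0 detects the constant term, the others
  detect the coordinates of the gradient.\<close>

lemma affine_zero:
  assumes "\<And>i. i \<le> DIM('v) \<Longrightarrow> affine_fun v r (vert i) = 0"
  shows "affine_fun v r = (\<lambda>x. 0)"
proof -
  have r: "r = 0"
    using assms[of 0] by (simp add: affine_fun_def vert_def)
  have "\<omega> i \<bullet> v = 0" if "i \<in> {1..DIM('v)}" for i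
    using assms[of i] that \<theta>_full[OF that] c_pos by (auto simp: r affine_fun_def vert_def inner_commute)
  then have "v = 0"
    by (simp add: eq_zero_iff)
  then show ?thesis
    by (simp add: r affine_fun_def fun_eq_iff)
qed

text \<open>Nonnegativity on the closed fundamental alcove, tested at its vertices, which suffices
  for an affine function.\<close>

definition Pos :: "('v \<Rightarrow> real) \<Rightarrow> bool" where
  "Pos f \<longleftrightarrow> (\<forall>i\<le>DIM('v). 0 \<le> f (vert i))"

abbreviation neg :: "('v \<Rightarrow> real) \<Rightarrow> 'v \<Rightarrow> real" where
  "neg f \<equiv> (\<lambda>x. - f x)"

lemma Pos_sar: "j \<le> DIM('v) \<Longrightarrow> Pos (sar j)"
  using sar_vert sar_vert_self unfolding Pos_def by (metis less_eq_real_def)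

lemma affine_roots_not_both:
  assumes "f \<in> affine_roots D" "Pos f" "Pos (neg f)"
  shows False
proof -
  obtain \<beta> r where \<beta>: "\<beta> \<in> R0" and f: "f = affine_fun \<beta> r"
    using assms(1) by (auto simp: affine_roots_def)
  have "f = (\<lambda>x. 0)"
    unfolding f by (rule affine_zero) (use assms(2,3) f in \<open>force simp: Pos_def\<close>)
  then have "affine_fun \<beta> r = affine_fun 0 0"
    unfolding f by (simp add: affine_fun_def)
  then show False
    using nonzero[OF \<beta>] by (simp add: affine_fun_eq_iff)
qed

text \<open>No affine root hyperplane cuts through the alcove. For \<open>r \<ge> 1\<close> the
  worst case is \<open>r = 1\<close>, settled by \<open>pos_mult_\<theta>_add\<close>; for
  \<open>r = 0\<close> the sign is that of the gradient; negation covers the remaining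
  values.\<close>

lemma affine_roots_sign:
  assumes "f \<in> affine_roots D"
  shows "Pos f \<or> Pos (neg f)"
proof -
  have up: "Pos (affine_fun \<beta> (m \<beta> * of_int r * c))" if \<beta>: "\<beta> \<in> R0" and r: "r \<ge> 1" for \<beta> r
    unfolding Pos_def
  proof (intro allI impI)
    fix i assume i: "i \<le> DIM('v)"
    have mr: "m \<beta> \<le> m \<beta> * of_int r"
      using mult_pos[OF \<beta>] r by simp
    show "0 \<le> affine_fun \<beta> (m \<beta> * of_int r * c) (vert i)"
    proof (cases "i = 0")
      case True
      then show ?thesis
        using mult_pos[OF \<beta>] r c_pos by (simp add: affine_fun_def vert_def)
    next
      case False
      then have iI: "i \<in> {1..DIM('v)}"
        using i by simp
      note t = \<theta>_full[OF iI]
      have "0 \<le> \<omega> i \<bullet> \<beta> + m \<beta> * (\<omega> i \<bullet> \<theta>)"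
        using pos_mult_\<theta>_add[OF \<beta>] iI by (auto simp: pos_def inner_add_right add.commute)
      also have "\<dots> \<le> \<omega> i \<bullet> \<beta> + m \<beta> * of_int r * (\<omega> i \<bullet> \<theta>)"
        using mr t by (simp add: mult_right_mono)
      finally have "0 \<le> (c / (\<omega> i \<bullet> \<theta>)) * (\<omega> i \<bullet> \<beta> + m \<beta> * of_int r * (\<omega> i \<bullet> \<theta>))"
        using t c_pos by simp
      also have "\<dots> = affine_fun \<beta> (m \<beta> * of_int r * c) (vert i)"
        using False t by (simp add: affine_fun_def vert_def inner_commute field_simps)
      finally show ?thesis .
    qed
  qed
  have zero: "Pos (affine_fun \<beta> 0)" if "pos \<beta>" for \<beta>
    unfolding Pos_def
  proof (intro allI impI)
    fix i assume "i \<le> DIM('v)"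
    then show "0 \<le> affine_fun \<beta> 0 (vert i)"
      using that \<theta>_full[of i] c_pos by (auto simp: affine_fun_def vert_def pos_def inner_commute[of \<beta>])
  qed
  have neg_eq: "neg (affine_fun \<beta> t) = affine_fun (- \<beta>) (- t)" for \<beta> t
    by (simp add: affine_fun_def fun_eq_iff)
  obtain \<beta> r where \<beta>: "\<beta> \<in> R0" and f: "f = affine_fun \<beta> (m \<beta> * of_int r * c)"
    using assms by (auto simp: affine_roots_def)
  have mm: "m (- \<beta>) = m \<beta>"
    using \<beta> uminus_\<Phi> by (intro mult_cong) auto
  consider "r \<ge> 1" | "r = 0" | "r \<le> -1"
    by linarith
  then show ?thesis
  proof cases
    case 1
    then show ?thesis using up[OF \<beta>] by (simp add: f)
  next
    case 2
    then show ?thesis using root_pos[OF \<beta>] zero[of \<beta>] zero[of "- \<beta>"] by (auto simp: f neg_eq)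
  next
    case 3
    then have "Pos (affine_fun (- \<beta>) (m (- \<beta>) * of_int (- r) * c))"
      by (intro up uminus_\<Phi> \<beta>) simp
    then show ?thesis
      by (simp add: f neg_eq mm)
  qed
qed

text \<open>Values at the vertices determine an affine function, so \<open>f\<close> is a multiple
  of \<open>sar k\<close>; reducedness and the sign leave only the factor 1.\<close>

lemma affine_root_proportional:
  assumes "f \<in> affine_roots D" "k \<le> DIM('v)" "\<And>i. i \<le> DIM('v) \<Longrightarrow> i \<noteq> k \<Longrightarrow> f (vert i) = 0" "Pos f"
  shows "f = sar k"
proof -
  obtain \<beta> r where \<beta>: "\<beta> \<in> R0" and f: "f = affine_fun \<beta> r"
    using assms(1) by (auto simp: affine_roots_def)
  define t where "t = f (vert k) / sar k (vert k)"
  have t: "f (vert k) = t * sar k (vert k)" "0 \<le> t"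
    using sar_vert_self[OF assms(2)] assms(2,4) by (auto simp: t_def Pos_def)
  have "affine_fun (\<beta> - t *\<^sub>R alpha D k) (r - t * shift D k) = (\<lambda>x. 0)"
  proof (rule affine_zero)
    fix i assume i: "i \<le> DIM('v)"
    have "f (vert i) = t * sar k (vert i)"
      using assms(3)[OF i] sar_vert[OF assms(2) i] t by (cases "i = k") auto
    then show "affine_fun (\<beta> - t *\<^sub>R alpha D k) (r - t * shift D k) (vert i) = 0"
      by (simp add: f affine_fun_def sar_eq inner_diff_left algebra_simps)
  qed
  also have "(\<lambda>x. 0) = affine_fun (0::'v) 0"
    by (simp add: affine_fun_def)
  finally have e: "\<beta> = t *\<^sub>R alpha D k" "r = t * shift D k"
    by (simp_all add: affine_fun_eq_iff)
  then have "t = 1 \<or> t = -1"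
    using reduced[OF alpha_in[OF assms(2)]] \<beta> by blast
  then show ?thesis
    using t(2) e by (simp add: f simple_affine_root_def)
qed

text \<open>The reflection \<open>sr k\<close> fixes the vertices other than the
  \<open>k\<close>-th, so \<open>f\<close> is nonnegative and nonpositive there at once. In other
  words, \<open>sr k\<close> permutes the positive affine roots different from
  \<open>sar k\<close>.\<close>

lemma Pos_sr:
  assumes "f \<in> affine_roots D" "Pos f" "k \<le> DIM('v)" "\<not> Pos (f \<circ> sr k)"
  shows "f = sar k"
proof (rule affine_root_proportional[OF assms(1,3)])
  fix i assume i: "i \<le> DIM('v)" "i \<noteq> k"
  have "Pos (neg (f \<circ> sr k))"
    using affine_roots_sign[OF affine_roots_comp_W[OF sr_in_W[OF assms(3)] assms(1)]] assms(4) by blast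
  moreover have "sr k (vert i) = vert i"
    using sar_vert[OF assms(3) i(1)] i by (simp add: sr_eq)
  ultimately show "f (vert i) = 0"
    using assms(2) i by (force simp: Pos_def)
qed fact

section \<open>The exchange condition for words in the simple reflections\<close>

sublocale invol: involutive_words sr "affine_indices D"
  by unfold_locales (simp add: sr_sr)

abbreviation "wd \<equiv> invol.wd"

lemma wd_in_W: "set js \<subseteq> affine_indices D \<Longrightarrow> wd js \<in> carrier W"
  by (induction js) (auto simp: W0_in_W weyl_group.id intro!: carrier_W_comp sr_in_W)

lemma sr_conj:
  assumes "w \<in> carrier W" "sar j \<circ> w = sar k"
  shows "sr j \<circ> w = w \<circ> sr k"
  using affine_reflection_conj[OF assms(1)] assms(2) by (simp add: simple_affine_root_def simple_reflection_def)

text \<open>Follow the sign of \<open>sar j\<close> pulled back along the prefixes of the word. At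
  the letter \<open>k\<close> where it changes, the pulled-back root is positive and made negative
  by \<open>sr k\<close>, so it is \<open>sar k\<close>; conjugation then cancels
  \<open>sr j\<close> against that letter.\<close>

lemma wd_exchange:
  assumes "set js \<subseteq> affine_indices D" "j \<le> DIM('v)" "\<not> Pos (sar j \<circ> wd js)"
  shows "\<exists>t<length js. wd (j # js) = wd (take t js @ drop (Suc t) js)"
proof -
  let ?P = "\<lambda>t. Pos (sar j \<circ> wd (take t js))"
  have "\<not> ?P (length js)" "?P 0"
    using assms Pos_sar by auto
  then obtain t where t: "t < length js" "?P t" "\<not> ?P (Suc t)"
    using ex_least_nat_less[of "\<lambda>t. \<not> ?P t" "length js"] by (metis less_Suc_eq not_less_eq order_refl less_imp_le)
  define w k where "w = wd (take t js)" and "k = js ! t"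
  have js: "js = take t js @ k # drop (Suc t) js"
    unfolding k_def using t(1) by (rule id_take_nth_drop)
  have k: "k \<le> DIM('v)" and S: "set (take t js) \<subseteq> affine_indices D"
    using assms(1) t(1) set_take_subset[of t js] by (auto simp: k_def dest: nth_mem)
  have w: "w \<in> carrier W"
    unfolding w_def using S by (rule wd_in_W)
  have "wd (take (Suc t) js) = w \<circ> sr k"
    unfolding w_def k_def by (simp add: take_Suc_conv_app_nth[OF t(1)] invol.wd_append)
  then have "sar j \<circ> w = sar k"
    using t Pos_sr[OF affine_roots_comp_W[OF w sar_in[OF assms(2)]] _ k] by (simp add: w_def o_assoc)
  from sr_conj[OF w this] have "sr j \<circ> w = w \<circ> sr k" .
  then have "wd (j # take t js @ k # drop (Suc t) js) = w \<circ> (sr k \<circ> sr k) \<circ> wd (drop (Suc t) js)"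
    by (simp add: invol.wd_append o_assoc w_def)
  also have "\<dots> = wd (take t js @ drop (Suc t) js)"
    using sr_sr[OF k] by (simp add: invol.wd_append w_def fun_eq_iff)
  finally show ?thesis
    using t(1) js by auto
qed

lemma reduced_Pos:
  assumes "invol.reduced_word (j # js)"
  shows "Pos (sar j \<circ> wd js)"
proof (rule ccontr)
  have S: "set js \<subseteq> affine_indices D" "j \<le> DIM('v)"
    using invol.reduced_word_set[OF assms] by auto
  assume "\<not> ?thesis"
  from wd_exchange[OF S this] obtain t where t: "t < length js" "wd (j # js) = wd (take t js @ drop (Suc t) js)"
    by blast
  have "length (j # js) \<le> length (take t js @ drop (Suc t) js)"
    by (rule invol.reduced_wordD[OF assms])
      (use t S set_take_subset[of t js] set_drop_subset[of "Suc t" js] in auto)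
  then show False
    using t(1) by simp
qed

sublocale exch: exchange_words sr "affine_indices D"
proof
  fix js j assume r: "invol.reduced_word js" "j \<in> affine_indices D" and nr: "\<not> invol.reduced_word (j # js)"
  have S: "set js \<subseteq> affine_indices D" "j \<le> DIM('v)"
    using invol.reduced_word_set[OF r(1)] r(2) by auto
  show "\<exists>t<length js. wd (j # js) = wd (take t js @ drop (Suc t) js)"
  proof (rule wd_exchange[OF S], rule notI)
    assume P: "Pos (sar j \<circ> wd js)"
    obtain ks where ks: "invol.reduced_word ks" "wd ks = wd (j # js)"
      using invol.exists_reduced_word[of "j # js"] S by auto
    have le: "length ks \<le> length js"
    proof (rule ccontr)
      assume "\<not> ?thesis"
      then have "invol.reduced_word (j # js)"
        using S by (intro invol.reduced_word_same[OF ks(1)]) (auto simp: ks(2))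
      with nr show False ..
    qed
    have wj: "sr j \<circ> wd ks = wd js"
      using ks(2) invol.wd_cancel r(2) by simp
    \<comment> \<open>If \<open>sar j \<circ> wd js\<close> is positive, composing with
      \<open>sr j\<close> makes it negative, so \<open>wd_exchange\<close> applies to
      \<open>j # ks\<close>. The result is a word for \<open>wd js\<close> with fewer letters than
      \<open>ks\<close>, hence fewer than the reduced word \<open>js\<close>.\<close>
    have "sar j \<circ> wd ks = neg (sar j \<circ> wd js)"
      using sar_sr[OF S(2)] by (simp add: ks(2) fun_eq_iff)
    then have "\<not> Pos (sar j \<circ> wd ks)"
      using P affine_roots_not_both[OF affine_roots_comp_W[OF wd_in_W[OF S(1)] sar_in[OF S(2)]]] by metis
    from wd_exchange[OF invol.reduced_word_set[OF ks(1)] S(2) this]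
    obtain t where t: "t < length ks" "wd (j # ks) = wd (take t ks @ drop (Suc t) ks)"
      by blast
    have "length js \<le> length (take t ks @ drop (Suc t) ks)"
      by (rule invol.reduced_wordD[OF r(1)])
        (use t wj invol.reduced_word_set[OF ks(1)] set_take_subset[of t ks] set_drop_subset[of "Suc t" ks] in auto)
    then show False
      using le t(1) by simp
  qed
qed

end

context affine_data
begin

section \<open>The elements of length zero\<close>

lemma inv_W:
  assumes "w \<in> carrier W"
  shows "inv_into UNIV w \<in> carrier W" "w \<circ> inv_into UNIV w = id" "inv_into UNIV w \<circ> w = id"
proof -
  obtain w' where w': "w' \<in> carrier W" "w \<circ> w' = id" "w' \<circ> w = id"
    using carrier_W_inverse[OF assms] by blast
  have "inv_into UNIV w = w'"
    by (rule inv_unique_comp) fact+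
  with w' show "inv_into UNIV w \<in> carrier W" "w \<circ> inv_into UNIV w = id" "inv_into UNIV w \<circ> w = id"
    by simp_all
qed

lemma fun_act_eq: "fun_act w f = f \<circ> inv_into UNIV w"
  by (simp add: fun_act_def fun_eq_iff)

lemma sar_inj: "j \<le> DIM('v) \<Longrightarrow> k \<le> DIM('v) \<Longrightarrow> sar j = sar k \<Longrightarrow> j = k"
  using sar_vert[of j k] sar_vert_self[of k] by fastforce

lemma Omega_iff: "u \<in> Omega D \<longleftrightarrow>
    u \<in> carrier W \<and> fun_act u ` sar ` affine_indices D = sar ` affine_indices D"
  by (simp add: Omega_def affine_indices_def)

lemma Omega_in_W: "u \<in> Omega D \<Longrightarrow> u \<in> carrier W"
  by (simp add: Omega_iff)

lemma Omega_perm: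
  assumes "u \<in> Omega D" "j \<le> DIM('v)"
  shows "perm_index D u j \<le> DIM('v)" "sar (perm_index D u j) \<circ> u = sar j"
proof -
  have "\<exists>k. k \<in> {0..DIM('v)} \<and> fun_act u (sar j) = sar k"
  proof -
    have "fun_act u (sar j) \<in> fun_act u ` sar ` affine_indices D"
      using assms(2) by simp
    then have "fun_act u (sar j) \<in> sar ` affine_indices D"
      using assms(1) by (simp add: Omega_iff)
    then show ?thesis by auto
  qed
  then have "\<exists>!k. k \<in> {0..DIM('v)} \<and> fun_act u (sar j) = sar k"
    using sar_inj by (metis atLeastAtMost_iff)
  from theI'[OF this] have k: "perm_index D u j \<le> DIM('v)" "sar j \<circ> inv_into UNIV u = sar (perm_index D u j)"
    by (simp_all add: perm_index_def fun_act_eq)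
  then show "perm_index D u j \<le> DIM('v)" by simp
  show "sar (perm_index D u j) \<circ> u = sar j"
    using inv_W(3)[OF Omega_in_W[OF assms(1)]] by (simp add: k(2)[symmetric] o_assoc[symmetric])
qed

lemma Omega_perm_surj:
  assumes "u \<in> Omega D" "k \<le> DIM('v)"
  shows "\<exists>j\<le>DIM('v). perm_index D u j = k"
proof -
  have "sar k \<in> fun_act u ` sar ` affine_indices D"
    using assms by (auto simp: Omega_iff)
  then obtain j where j: "j \<le> DIM('v)" "sar k = sar j \<circ> inv_into UNIV u"
    by (auto simp: fun_act_eq)
  then have "sar k \<circ> u = sar j"
    using inv_W(3)[OF Omega_in_W[OF assms(1)]] by (simp add: o_assoc[symmetric])
  then have "sar k \<circ> u = sar (perm_index D u j) \<circ> u"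
    using Omega_perm(2)[OF assms(1) j(1)] by simp
  then have "sar k = sar (perm_index D u j)"
    using inv_W(2)[OF Omega_in_W[OF assms(1)]] by (metis comp_assoc comp_id)
  then show ?thesis
    using sar_inj[OF assms(2) Omega_perm(1)[OF assms(1) j(1)]] j(1) by auto
qed

text \<open>The hypothesis gives an inclusion between finite sets; injectivity of the action turns
  it into an equality.\<close>

lemma OmegaI:
  assumes "u \<in> carrier W" "\<And>j. j \<le> DIM('v) \<Longrightarrow> \<exists>k\<le>DIM('v). sar k \<circ> u = sar j"
  shows "u \<in> Omega D"
proof -
  have comp: "sar k \<circ> u = sar j \<Longrightarrow> sar j \<circ> inv_into UNIV u = sar k" for j k
    using inv_W(2)[OF assms(1)] by (metis comp_assoc comp_id)
  have sub: "fun_act u ` sar ` affine_indices D \<subseteq> sar ` affine_indices D"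
    using assms(2) comp by (fastforce simp: fun_act_eq)
  have "inj (fun_act u)"
    using inv_W(3)[OF assms(1)] by (intro injI) (metis fun_act_eq comp_assoc comp_id)
  then have "card (fun_act u ` sar ` affine_indices D) = card (sar ` affine_indices D)"
    by (intro card_image) (auto intro: inj_on_subset)
  then have "fun_act u ` sar ` affine_indices D = sar ` affine_indices D"
    using sub by (intro card_subset_eq) (auto simp: affine_indices_def)
  then show ?thesis
    using assms(1) by (simp add: Omega_iff)
qed

lemma Omega_comp:
  assumes "u \<in> Omega D" "v \<in> Omega D"
  shows "u \<circ> v \<in> Omega D"
proof (rule OmegaI)
  fix j assume "j \<le> DIM('v)"
  then show "\<exists>k\<le>DIM('v). sar k \<circ> (u \<circ> v) = sar j"
    using Omega_perm[OF assms(2)] Omega_perm[OF assms(1)] by (metis comp_assoc)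
qed (use assms Omega_in_W carrier_W_comp in blast)

lemma Omega_inverse:
  assumes "u \<in> Omega D"
  shows "inv_into UNIV u \<in> Omega D"
proof (rule OmegaI)
  note i = inv_W[OF Omega_in_W[OF assms]]
  fix k assume "k \<le> DIM('v)"
  then obtain j where "j \<le> DIM('v)" "sar k \<circ> u = sar j"
    using Omega_perm_surj[OF assms] Omega_perm(2)[OF assms] by metis
  then show "\<exists>j\<le>DIM('v). sar j \<circ> inv_into UNIV u = sar k"
    using i(2) by (metis comp_assoc comp_id)
qed (use inv_W Omega_in_W assms in blast)

lemma id_Omega: "id \<in> Omega D"
  by (rule OmegaI) (auto simp: W0_in_W weyl_group.id)

text \<open>If a reduced word for \<open>u\<close> began with \<open>j\<close>, the simple affine
  root that \<open>u\<close> sends to \<open>sar j\<close> would be minus a positive affine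
  root.\<close>

lemma Omega_wd_trivial:
  assumes "u \<in> Omega D" "set js \<subseteq> affine_indices D" "u = wd js"
  shows "u = id"
proof -
  obtain ks where ks: "invol.reduced_word ks" "wd ks = u"
    using invol.exists_reduced_word[OF assms(2)] assms(3) by auto
  show ?thesis
  proof (cases ks)
    case (Cons j ls)
    have j: "j \<le> DIM('v)" and ls: "set ls \<subseteq> affine_indices D"
      using invol.reduced_word_set[OF ks(1)] Cons by auto
    have P: "Pos (sar j \<circ> wd ls)"
      using reduced_Pos ks(1) Cons by simp
    obtain i where i: "i \<le> DIM('v)" "perm_index D u i = j"
      using Omega_perm_surj[OF assms(1) j] by blast
    have "sar i = sar j \<circ> wd (j # ls)"
      using Omega_perm(2)[OF assms(1) i(1)] i(2) ks(2) Cons by simp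
    also have "\<dots> = neg (sar j \<circ> wd ls)"
      using sar_sr[OF j] by (simp add: fun_eq_iff)
    finally have "Pos (neg (sar j \<circ> wd ls))"
      using Pos_sar[OF i(1)] by simp
    then show ?thesis
      using affine_roots_not_both[OF affine_roots_comp_W[OF wd_in_W[OF ls] sar_in[OF j]] P] by blast
  qed (use ks in simp)
qed

text \<open>Uniqueness of the factorization into an element of length zero and a product of simple
  reflections. It separates the leading group elements in the proof of injectivity.\<close>

lemma Omega_wd_unique:
  assumes "u \<in> Omega D" "v \<in> Omega D" "set js \<subseteq> affine_indices D" "set ks \<subseteq> affine_indices D"
    and eq: "u \<circ> wd js = v \<circ> wd ks"
  shows "u = v" "wd js = wd ks"
proof -
  note i = inv_W[OF Omega_in_W[OF assms(2)]]
  have "inv_into UNIV v \<circ> u \<circ> (wd js \<circ> wd (rev js)) = inv_into UNIV v \<circ> (u \<circ> wd js) \<circ> wd (rev js)"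
    by (simp add: o_assoc)
  also have "\<dots> = (inv_into UNIV v \<circ> v) \<circ> wd ks \<circ> wd (rev js)"
    unfolding eq by (simp add: o_assoc)
  also have "\<dots> = wd (ks @ rev js)"
    using i(3) by (simp add: invol.wd_append)
  finally have "inv_into UNIV v \<circ> u = wd (ks @ rev js)"
    using invol.wd_rev[OF assms(3)] by simp
  then have "inv_into UNIV v \<circ> u = id"
    using assms by (intro Omega_wd_trivial[of _ "ks @ rev js"] Omega_comp Omega_inverse) auto
  then have "v \<circ> (inv_into UNIV v \<circ> u) = v"
    by simp
  then show uv: "u = v"
    using i(2) by (simp add: o_assoc)
  have "inv_into UNIV v \<circ> v \<circ> wd js = inv_into UNIV v \<circ> v \<circ> wd ks"
    using eq uv by (simp add: o_assoc[symmetric])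
  then show "wd js = wd ks"
    using i(3) by simp
qed

section \<open>Coxeter exponents\<close>

lemma wd_altl_even:
  assumes ab: "a \<le> DIM('v)" "b \<le> DIM('v)"
  shows "wd (altl (2 * k) a b) = (sr a \<circ> sr b) [^]\<^bsub>W\<^esub> k"
proof (induction k)
  case 0
  show ?case by simp
next
  case (Suc k)
  interpret group W by (rule group_W)
  have "sr a \<circ> sr b \<in> carrier W"
    using ab by (intro carrier_W_comp sr_in_W)
  then have e1: "(sr a \<circ> sr b) [^]\<^bsub>W\<^esub> Suc k = (sr a \<circ> sr b) \<circ> (sr a \<circ> sr b) [^]\<^bsub>W\<^esub> k"
    by (simp only: nat_pow_Suc2 W_sel)
  have "altl (2 * Suc k) a b = a # b # altl (2 * k) a b"
    by simp
  then have e2: "wd (altl (2 * Suc k) a b) = (sr a \<circ> sr b) \<circ> wd (altl (2 * k) a b)"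
    by (simp only: invol.wd.simps o_assoc)
  show ?case
    by (simp only: e1 e2 Suc.IH)
qed

lemma altl_append:
  "altl (p + q) a b = altl p a b @ altl q (if even p then a else b) (if even p then b else a)"
  by (induction p a b rule: altl.induct) auto

lemma rev_altl: "rev (altl q b a) = altl q (if even q then a else b) (if even q then b else a)"
proof (induction q arbitrary: a b)
  case (Suc q)
  have "rev (altl (Suc q) b a) = rev (altl q a b) @ [b]"
    by simp
  also have "\<dots> = altl (Suc q) (if even (Suc q) then a else b) (if even (Suc q) then b else a)"
    unfolding altl_snoc Suc.IH by auto
  finally show ?case .
qed simp

lemma altl_append_rev: "altl q a b @ rev (altl q b a) = altl (2 * q) a b"
  by (simp only: mult_2 altl_append rev_altl)

text \<open>Composing one alternating word with the reversal of the other gives an alternating word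
  of \<open>2 * q\<close> letters, whatever the parity of \<open>q\<close>; its value is the
  \<open>q\<close>-th power of the product.\<close>

lemma wd_altl_eq_iff:
  assumes "a \<le> DIM('v)" "b \<le> DIM('v)"
  shows "wd (altl q a b) = wd (altl q b a) \<longleftrightarrow> (sr a \<circ> sr b) [^]\<^bsub>W\<^esub> q = id"
proof -
  have S: "set (altl q b a) \<subseteq> affine_indices D"
    using set_altl[of q b a] assms by auto
  have inv: "wd (rev (altl q b a)) \<circ> wd (altl q b a) = id" "wd (altl q b a) \<circ> wd (rev (altl q b a)) = id"
    using invol.wd_rev[of "rev (altl q b a)"] invol.wd_rev[OF S] S by simp_all
  have eq: "wd (altl q a b) \<circ> wd (rev (altl q b a)) = (sr a \<circ> sr b) [^]\<^bsub>W\<^esub> q"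
    by (simp add: wd_altl_even[OF assms, symmetric] altl_append_rev[symmetric] invol.wd_append)
  have "wd (altl q a b) = wd (altl q a b) \<circ> wd (rev (altl q b a)) \<circ> wd (altl q b a)"
    using inv(1) by (simp add: o_assoc[symmetric])
  then show ?thesis
    using inv(2) unfolding eq by (metis eq id_comp)
qed

text \<open>The order divides \<open>q\<close>. If it were a smaller number, the reduced word would
  contain an alternating prefix with one letter more than the order, and the braid identity would
  shorten that prefix by two letters.\<close>

lemma coxeter_order_reduced:
  assumes ab: "a \<le> DIM('v)" "b \<le> DIM('v)" and red: "invol.reduced_word (altl q a b)"
    and eq: "wd (altl q a b) = wd (altl q b a)" and "0 < q"
  shows "coxeter_order D a b = q"
proof -
  interpret group W by (rule group_W)
  let ?P = "sr a \<circ> sr b" and ?m = "coxeter_order D a b"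
  have P: "?P \<in> carrier W"
    using ab by (intro carrier_W_comp sr_in_W)
  have "?P [^]\<^bsub>W\<^esub> q = \<one>\<^bsub>W\<^esub>"
    using eq wd_altl_eq_iff[OF ab] by simp
  then have "?m dvd q"
    unfolding coxeter_order_def using pow_eq_id[OF P] by blast
  have m0: "0 < ?m" and mq: "?m \<le> q"
    using \<open>?m dvd q\<close> \<open>0 < q\<close> by (auto intro: dvd_imp_le gr0I)
  have "?P [^]\<^bsub>W\<^esub> ?m = \<one>\<^bsub>W\<^esub>"
    unfolding coxeter_order_def using pow_ord_eq_1[OF P] by simp
  then have eqm: "wd (altl ?m a b) = wd (altl ?m b a)"
    using wd_altl_eq_iff[OF ab] by simp
  show ?thesis
  proof (rule ccontr)
    assume "?m \<noteq> q"
    then have "?m < q"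
      using mq by simp
    then obtain l where "q = Suc ?m + l"
      by (metis add_Suc less_iff_Suc_add)
    then have r: "invol.reduced_word (altl (Suc ?m) a b)"
      using red invol.reduced_word_append(1) by (metis altl_append)
    obtain k where k: "?m = Suc k"
      using m0 by (cases ?m) auto
    have "wd (altl (Suc ?m) a b) = sr a \<circ> wd (altl ?m a b)"
      by (simp add: eqm)
    also have "\<dots> = wd (altl k b a)"
      unfolding k using invol.wd_cancel[of a] ab by simp
    finally have "length (altl (Suc ?m) a b) \<le> length (altl k b a)"
      using set_altl[of k b a] ab by (intro invol.reduced_wordD[OF r]) auto
    then show False
      using k by simp
  qed
qed

end

section \<open>Monoid algebras\<close>

text \<open>Coefficient rings and algebras are subsets of types with global ring operations, so the
  ring axioms come for free and only closure has to be checked.\<close>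

definition subring_set :: "'a::ring_1 set \<Rightarrow> bool" where
  "subring_set K \<longleftrightarrow> 1 \<in> K \<and> (\<forall>a\<in>K. \<forall>b\<in>K. a - b \<in> K \<and> a * b \<in> K)"

definition submonoid_set :: "'m::monoid_add set \<Rightarrow> bool" where
  "submonoid_set M \<longleftrightarrow> 0 \<in> M \<and> (\<forall>m\<in>M. \<forall>n\<in>M. m + n \<in> M)"

lemma subring_setD:
  assumes "subring_set K"
  shows "1 \<in> K" "0 \<in> K" "a \<in> K \<Longrightarrow> b \<in> K \<Longrightarrow> a - b \<in> K" "a \<in> K \<Longrightarrow> b \<in> K \<Longrightarrow> a * b \<in> K"
    "a \<in> K \<Longrightarrow> - a \<in> K" "a \<in> K \<Longrightarrow> b \<in> K \<Longrightarrow> a + b \<in> K"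
proof -
  show one: "1 \<in> K" and minus: "a \<in> K \<Longrightarrow> b \<in> K \<Longrightarrow> a - b \<in> K"
    and "a \<in> K \<Longrightarrow> b \<in> K \<Longrightarrow> a * b \<in> K" for a b
    using assms by (auto simp: subring_set_def)
  show zero: "0 \<in> K"
    using minus[OF one one] by simp
  show uminus: "a \<in> K \<Longrightarrow> - a \<in> K" for a
    using minus[OF zero, of a] by simp
  show "a \<in> K \<Longrightarrow> b \<in> K \<Longrightarrow> a + b \<in> K"
    using minus[of a "- b"] uminus[of b] by simp
qed

lemma subring_set_sum:
  assumes "subring_set K" "\<And>i. i \<in> I \<Longrightarrow> f i \<in> K"
  shows "sum f I \<in> K"
  using assms(2) by (induction I rule: infinite_finite_induct) (auto simp: subring_setD[OF assms(1)])

lemma poly_mapping_sum_single: "f = (\<Sum>m\<in>Poly_Mapping.keys f. Poly_Mapping.single m (Poly_Mapping.lookup f m))"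
  by (rule poly_mapping_eqI) (simp add: lookup_sum lookup_single when_def in_keys_iff)

lemma monoid_algebra_sel [simp]:
  "mult (monoid_algebra K M) = (*)" "one (monoid_algebra K M) = 1"
  "zero (monoid_algebra K M) = 0" "add (monoid_algebra K M) = (+)"
  by (simp_all add: monoid_algebra_def)

lemma carrier_monoid_algebra:
  "f \<in> carrier (monoid_algebra K M) \<longleftrightarrow> Poly_Mapping.keys f \<subseteq> M \<and> (\<forall>m. Poly_Mapping.lookup f m \<in> K)"
  by (simp add: monoid_algebra_def)

lemma single_in_monoid_algebra:
  "subring_set K \<Longrightarrow> m \<in> M \<Longrightarrow> k \<in> K \<Longrightarrow> Poly_Mapping.single m k \<in> carrier (monoid_algebra K M)"
  by (auto simp: carrier_monoid_algebra lookup_single when_def subring_setD)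

lemma subring_set_monoid_algebra:
  assumes "subring_set K" "submonoid_set M"
  shows "subring_set (carrier (monoid_algebra K M))"
proof -
  let ?C = "carrier (monoid_algebra K M)"
  have minus: "f - g \<in> ?C" if "f \<in> ?C" "g \<in> ?C" for f g
    using that assms keys_diff[of f g] by (auto simp: carrier_monoid_algebra lookup_minus subring_setD)
  have zero: "0 \<in> ?C"
    using assms by (auto simp: carrier_monoid_algebra subring_setD)
  have plus: "f + g \<in> ?C" if "f \<in> ?C" "g \<in> ?C" for f g
    using that assms keys_add[of f g] by (auto simp: carrier_monoid_algebra lookup_add subring_setD)
  have sums: "sum h I \<in> ?C" if "\<And>i. i \<in> I \<Longrightarrow> h i \<in> ?C" for I :: "'i set" and h
    using that by (induction I rule: infinite_finite_induct) (auto simp: zero plus)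
  have times: "f * g \<in> ?C" if f: "f \<in> ?C" and g: "g \<in> ?C" for f g
  proof -
    have "f * g = (\<Sum>m\<in>Poly_Mapping.keys f. \<Sum>n\<in>Poly_Mapping.keys g.
        Poly_Mapping.single (m + n) (Poly_Mapping.lookup f m * Poly_Mapping.lookup g n))"
      using poly_mapping_sum_single[of f] poly_mapping_sum_single[of g]
        sum_product[of "\<lambda>m. Poly_Mapping.single m (Poly_Mapping.lookup f m)" "Poly_Mapping.keys f"
          "\<lambda>m. Poly_Mapping.single m (Poly_Mapping.lookup g m)" "Poly_Mapping.keys g"]
      by (simp add: mult_single)
    moreover have "m + n \<in> M" if "m \<in> Poly_Mapping.keys f" "n \<in> Poly_Mapping.keys g" for m n
      using that f g assms(2) unfolding carrier_monoid_algebra submonoid_set_def by blast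
    moreover have "Poly_Mapping.lookup f m * Poly_Mapping.lookup g n \<in> K" for m n
      using f g assms(1) by (simp add: carrier_monoid_algebra subring_setD)
    ultimately show ?thesis
      by (simp add: sums single_in_monoid_algebra assms)
  qed
  have "1 \<in> ?C"
    using assms by (auto simp: carrier_monoid_algebra lookup_one when_def subring_setD submonoid_set_def)
  then show ?thesis
    by (simp add: subring_set_def minus times)
qed

lemma ring_subring_set:
  assumes "subring_set (carrier R)" "mult R = (*)" "one R = 1" "zero R = 0" "add R = (+)"
  shows "ring R"
proof (rule ringI)
  show "abelian_group R"
  proof (rule abelian_groupI)
    fix x assume "x \<in> carrier R"
    then show "\<exists>y\<in>carrier R. y \<oplus>\<^bsub>R\<^esub> x = \<zero>\<^bsub>R\<^esub>"
      using assms by (intro bexI[of _ "- x"]) (auto simp: subring_setD)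
  qed (simp_all add: assms(2-) subring_setD[OF assms(1)] algebra_simps)
  show "Group.monoid R"
    by (rule monoidI) (simp_all add: assms(2-) subring_setD[OF assms(1)] algebra_simps)
qed (simp_all add: assms(2-) algebra_simps)

lemma ring_monoid_algebra:
  assumes "subring_set K" "submonoid_set M"
  shows "ring (monoid_algebra K M)"
  by (rule ring_subring_set) (simp_all add: subring_set_monoid_algebra assms)

lemma a_inv_subring_set:
  assumes "ring R" "subring_set (carrier R)" "zero R = 0" "add R = (+)" "x \<in> carrier R"
  shows "\<ominus>\<^bsub>R\<^esub> x = - x"
proof -
  interpret ring R by fact
  show ?thesis
    by (rule minus_equality) (use assms in \<open>auto simp: subring_setD\<close>)
qed

lemma monoid_algebra_induct [consumes 1, case_names zero add_single]:
  assumes f: "f \<in> carrier (monoid_algebra K M)"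
    and zero: "P 0"
    and step: "\<And>m k g. m \<in> M \<Longrightarrow> k \<in> K \<Longrightarrow> g \<in> carrier (monoid_algebra K M) \<Longrightarrow> P g \<Longrightarrow>
       P (Poly_Mapping.single m k + g)"
    and K: "subring_set K"
  shows "P f"
proof -
  have "P (\<Sum>m\<in>S. Poly_Mapping.single m (Poly_Mapping.lookup f m)) \<and>
        (\<Sum>m\<in>S. Poly_Mapping.single m (Poly_Mapping.lookup f m)) \<in> carrier (monoid_algebra K M)"
    if "finite S" "S \<subseteq> Poly_Mapping.keys f" for S
    using that
  proof (induction S)
    case empty
    then show ?case
      using zero K by (auto simp: carrier_monoid_algebra subring_setD)
  next
    case (insert m S)
    have m: "m \<in> M" "Poly_Mapping.lookup f m \<in> K"
      using insert.prems f by (auto simp: carrier_monoid_algebra)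
    let ?g = "\<Sum>m\<in>S. Poly_Mapping.single m (Poly_Mapping.lookup f m)"
    have IH: "P ?g" "?g \<in> carrier (monoid_algebra K M)"
      using insert by auto
    have "Poly_Mapping.single m (Poly_Mapping.lookup f m) + ?g \<in> carrier (monoid_algebra K M)"
      using single_in_monoid_algebra[OF K m] IH(2) K
        keys_add[of "Poly_Mapping.single m (Poly_Mapping.lookup f m)" ?g]
      by (auto simp: carrier_monoid_algebra lookup_add subring_setD)
    then show ?case
      using step[OF m IH(2,1)] insert.hyps by simp
  qed
  from this[of "Poly_Mapping.keys f"] show ?thesis
    using poly_mapping_sum_single[of f] by auto
qed

section \<open>The universal property of monoid algebras\<close>

definition monoid_algebra_lift ::
  "('b, 'c) ring_scheme \<Rightarrow> ('k \<Rightarrow> 'b) \<Rightarrow> ('m \<Rightarrow> 'b) \<Rightarrow> ('m \<Rightarrow>\<^sub>0 'k::zero) \<Rightarrow> 'b" where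
  "monoid_algebra_lift B \<eta> \<phi> f =
     (\<Oplus>\<^bsub>B\<^esub>m\<in>Poly_Mapping.keys f. \<eta> (Poly_Mapping.lookup f m) \<otimes>\<^bsub>B\<^esub> \<phi> m)"

text \<open>The target need not be commutative: images of coefficients have to commute with images
  of monoid elements, which is what makes the lift multiplicative.\<close>

locale monoid_algebra_maps = B: ring B
  for B :: "('b, 'c) ring_scheme" (structure)
    and K :: "'k::comm_ring_1 set" and M :: "'m::monoid_add set"
    and \<eta> :: "'k \<Rightarrow> 'b" and \<phi> :: "'m \<Rightarrow> 'b" +
  assumes K: "subring_set K" and M: "submonoid_set M"
    and \<eta>_closed: "k \<in> K \<Longrightarrow> \<eta> k \<in> carrier B"
    and \<eta>_add: "k \<in> K \<Longrightarrow> l \<in> K \<Longrightarrow> \<eta> (k + l) = \<eta> k \<oplus> \<eta> l"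
    and \<eta>_mult: "k \<in> K \<Longrightarrow> l \<in> K \<Longrightarrow> \<eta> (k * l) = \<eta> k \<otimes> \<eta> l"
    and \<eta>_one: "\<eta> 1 = \<one>"
    and \<phi>_closed: "m \<in> M \<Longrightarrow> \<phi> m \<in> carrier B"
    and \<phi>_add: "m \<in> M \<Longrightarrow> n \<in> M \<Longrightarrow> \<phi> (m + n) = \<phi> m \<otimes> \<phi> n"
    and \<phi>_zero: "\<phi> 0 = \<one>"
    and comm: "k \<in> K \<Longrightarrow> m \<in> M \<Longrightarrow> \<eta> k \<otimes> \<phi> m = \<phi> m \<otimes> \<eta> k"
begin

abbreviation "MA \<equiv> monoid_algebra K M"
abbreviation "h \<equiv> monoid_algebra_lift B \<eta> \<phi>"

lemma \<eta>_zero: "\<eta> 0 = \<zero>"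
proof -
  have "\<eta> 0 \<oplus> \<eta> 0 = \<eta> 0"
    using \<eta>_add[of 0 0] K by (simp add: subring_setD)
  then show ?thesis
    using \<eta>_closed[of 0] K by (simp add: subring_setD)
qed

lemma lift_superset:
  assumes "f \<in> carrier MA" "finite S" "Poly_Mapping.keys f \<subseteq> S" "S \<subseteq> M"
  shows "h f = (\<Oplus>m\<in>S. \<eta> (Poly_Mapping.lookup f m) \<otimes> \<phi> m)"
  unfolding monoid_algebra_lift_def
  by (rule B.add.finprod_mono_neutral_cong_left)
    (use assms in \<open>auto simp: in_keys_iff \<eta>_zero \<phi>_closed \<eta>_closed carrier_monoid_algebra subset_iff\<close>)

lemma lift_closed: "f \<in> carrier MA \<Longrightarrow> h f \<in> carrier B"
  by (auto simp: monoid_algebra_lift_def carrier_monoid_algebra subset_iff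
      intro!: B.finsum_closed \<phi>_closed \<eta>_closed)

lemma lift_add:
  assumes f: "f \<in> carrier MA" and g: "g \<in> carrier MA"
  shows "h (f + g) = h f \<oplus> h g"
proof -
  let ?S = "Poly_Mapping.keys f \<union> Poly_Mapping.keys g"
  have S: "finite ?S" "?S \<subseteq> M"
    using f g by (auto simp: carrier_monoid_algebra)
  have fg: "f + g \<in> carrier MA"
    using f g by (simp add: subring_setD[OF subring_set_monoid_algebra[OF K M]])
  have lk: "Poly_Mapping.lookup f m \<in> K" "Poly_Mapping.lookup g m \<in> K" for m
    using f g by (auto simp: carrier_monoid_algebra)
  have "h (f + g) = (\<Oplus>m\<in>?S. \<eta> (Poly_Mapping.lookup f m) \<otimes> \<phi> m \<oplus> \<eta> (Poly_Mapping.lookup g m) \<otimes> \<phi> m)"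
    unfolding lift_superset[OF fg S(1) keys_add S(2)]
    by (rule B.finsum_cong') (use S lk in \<open>auto simp: lookup_add \<eta>_add \<eta>_closed \<phi>_closed B.l_distr subset_iff\<close>)
  also have "\<dots> = h f \<oplus> h g"
    unfolding lift_superset[OF f S(1) _ S(2), simplified] lift_superset[OF g S(1) _ S(2), simplified]
    by (rule B.finsum_addf) (use S lk in \<open>auto simp: \<eta>_closed \<phi>_closed subset_iff\<close>)
  finally show ?thesis .
qed

lemma lift_single: "m \<in> M \<Longrightarrow> k \<in> K \<Longrightarrow> h (Poly_Mapping.single m k) = \<eta> k \<otimes> \<phi> m"
  by (subst lift_superset[of _ "{m}"]) (auto simp: single_in_monoid_algebra K \<eta>_closed \<phi>_closed)

lemma lift_zero: "h 0 = \<zero>"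
  by (simp add: monoid_algebra_lift_def)

lemma lift_mult:
  assumes f: "f \<in> carrier MA" and g: "g \<in> carrier MA"
  shows "h (f * g) = h f \<otimes> h g"
proof -
  note C = subring_setD[OF subring_set_monoid_algebra[OF K M]]
  have single: "h (Poly_Mapping.single m k * g) = \<eta> k \<otimes> \<phi> m \<otimes> h g"
    if mk: "m \<in> M" "k \<in> K" and g: "g \<in> carrier MA" for m k g
    using g
  proof (induction g rule: monoid_algebra_induct)
    case zero
    then show ?case
      using mk by (simp add: lift_zero \<eta>_closed \<phi>_closed)
  next
    case (add_single n l g)
    have c: "\<eta> k \<otimes> \<phi> m \<otimes> (\<eta> l \<otimes> \<phi> n) = \<eta> k \<otimes> \<eta> l \<otimes> (\<phi> m \<otimes> \<phi> n)"
      using mk add_single(1,2) comm[of l m] by (metis B.m_assoc B.m_closed \<eta>_closed \<phi>_closed)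
    have "h (Poly_Mapping.single m k * (Poly_Mapping.single n l + g)) =
        h (Poly_Mapping.single (m + n) (k * l)) \<oplus> h (Poly_Mapping.single m k * g)"
      using mk add_single M
      by (subst lift_add[symmetric])
        (auto simp: distrib_left mult_single submonoid_set_def intro!: C single_in_monoid_algebra K subring_setD[OF K])
    also have "\<dots> = \<eta> k \<otimes> \<eta> l \<otimes> (\<phi> m \<otimes> \<phi> n) \<oplus> \<eta> k \<otimes> \<phi> m \<otimes> h g"
      using mk add_single M
      by (simp add: lift_single submonoid_set_def subring_setD[OF K] \<eta>_mult \<phi>_add)
    also have "\<dots> = \<eta> k \<otimes> \<phi> m \<otimes> h (Poly_Mapping.single n l + g)"
      using mk add_single
      by (simp add: lift_add lift_single single_in_monoid_algebra K c[symmetric] B.r_distr \<eta>_closed \<phi>_closed lift_closed)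
    finally show ?case .
  qed (fact K)
  show ?thesis
    using f
  proof (induction f rule: monoid_algebra_induct)
    case zero
    then show ?case
      using g by (simp add: lift_zero lift_closed)
  next
    case (add_single m k f)
    then show ?case
      using g by (simp add: distrib_right lift_add single_in_monoid_algebra K C single lift_single
          B.l_distr \<eta>_closed \<phi>_closed lift_closed)
  qed (fact K)
qed

lemma lift_hom: "h \<in> ring_hom MA B"
proof (rule ring_hom_memI)
  show "h \<one>\<^bsub>MA\<^esub> = \<one>"
    using lift_single[of 0 1] K M by (simp add: \<phi>_zero \<eta>_one subring_setD submonoid_set_def)
qed (simp_all add: lift_closed lift_add lift_mult)

end

section \<open>Non-zero-divisors in commutative rings\<close>

definition regular :: "'a::comm_ring_1 \<Rightarrow> bool" where
  "regular s \<longleftrightarrow> (\<forall>x. s * x = 0 \<longrightarrow> x = 0)"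

lemma regularD: "regular s \<Longrightarrow> s * x = 0 \<Longrightarrow> x = 0"
  unfolding regular_def by blast

lemma regular_cancel:
  assumes "regular s" "s * x = s * y"
  shows "x = y"
  using regularD[OF assms(1), of "x - y"] assms(2) by (simp add: algebra_simps)

lemma regular_1: "regular 1"
  unfolding regular_def by simp

lemma regular_mult: "regular s \<Longrightarrow> regular t \<Longrightarrow> regular (s * t)"
  unfolding regular_def by (metis mult.assoc)

lemma regular_mult_left:
  assumes "regular (s * t)"
  shows "regular t"
  unfolding regular_def
proof (intro allI impI)
  fix x assume "t * x = 0"
  then have "s * t * x = 0"
    by (simp add: mult.assoc)
  then show "x = 0"
    by (rule regularD[OF assms])
qed

text \<open>If \<open>(1 - a X\<^sup>\<nu>) x = 0\<close>, the support of \<open>x\<close> is stable under translation by \<open>\<nu>\<close>, hence empty.\<close>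

lemma regular_binomial:
  fixes \<nu> :: "'v::real_vector" and a :: "'k::comm_ring_1"
  assumes "\<nu> \<noteq> 0"
  shows "regular (1 - Poly_Mapping.single \<nu> a)"
  unfolding regular_def
proof (intro allI impI, rule ccontr)
  fix x :: "'v \<Rightarrow>\<^sub>0 'k"
  assume "(1 - Poly_Mapping.single \<nu> a) * x = 0" "x \<noteq> 0"
  then have x: "Poly_Mapping.single \<nu> a * x = x"
    by (simp add: algebra_simps)
  have shift: "\<mu> - \<nu> \<in> Poly_Mapping.keys x" if "\<mu> \<in> Poly_Mapping.keys x" for \<mu>
  proof -
    have "\<mu> \<in> Poly_Mapping.keys (Poly_Mapping.single \<nu> a * x)"
      using that x by simp
    then obtain m where "\<mu> = \<nu> + m" "m \<in> Poly_Mapping.keys x"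
      using keys_mult[of "Poly_Mapping.single \<nu> a" x] by (auto split: if_splits)
    then show ?thesis by simp
  qed
  obtain \<mu> where \<mu>: "\<mu> \<in> Poly_Mapping.keys x"
    using \<open>x \<noteq> 0\<close> keys_eq_empty[of x] by blast
  have "\<mu> - real k *\<^sub>R \<nu> \<in> Poly_Mapping.keys x" for k
  proof (induction k)
    case (Suc k)
    from shift[OF this] show ?case
      by (simp add: algebra_simps)
  qed (use \<mu> in simp)
  then have "range (\<lambda>k::nat. \<mu> - real k *\<^sub>R \<nu>) \<subseteq> Poly_Mapping.keys x"
    by auto
  moreover have "inj (\<lambda>k::nat. \<mu> - real k *\<^sub>R \<nu>)"
    using \<open>\<nu> \<noteq> 0\<close> by (auto intro!: injI)
  ultimately show False
    by (meson finite_keys finite_subset range_inj_infinite)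
qed

section \<open>Braid relations for modules over a dihedral Hecke algebra\<close>

fun altf :: "nat \<Rightarrow> ('a \<Rightarrow> 'a) \<Rightarrow> ('a \<Rightarrow> 'a) \<Rightarrow> 'a \<Rightarrow> 'a" where
  "altf 0 F G x = x"
| "altf (Suc n) F G x = F (altf n G F x)"

text \<open>The maps \<open>c1\<close> and \<open>c2\<close> stand for multiplication by the scalars
  \<open>tau - 1/tau\<close>. Treating them as operators that commute with \<open>T1\<close> and
  \<open>T2\<close> avoids a module structure.\<close>

locale two_hecke_operators =
  fixes M :: "'m::ab_group_add set" and T1 T2 c1 c2 :: "'m \<Rightarrow> 'm"
  assumes M_diff: "x \<in> M \<Longrightarrow> y \<in> M \<Longrightarrow> x - y \<in> M" and M_zero: "0 \<in> M"
    and closed [simp]: "x \<in> M \<Longrightarrow> T1 x \<in> M" "x \<in> M \<Longrightarrow> T2 x \<in> M" "x \<in> M \<Longrightarrow> c1 x \<in> M" "x \<in> M \<Longrightarrow> c2 x \<in> M"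
    and additive: "x \<in> M \<Longrightarrow> y \<in> M \<Longrightarrow> T1 (x + y) = T1 x + T1 y" "x \<in> M \<Longrightarrow> y \<in> M \<Longrightarrow> T2 (x + y) = T2 x + T2 y"
    and quad: "x \<in> M \<Longrightarrow> T1 (T1 x) = c1 (T1 x) + x" "x \<in> M \<Longrightarrow> T2 (T2 x) = c2 (T2 x) + x"
    and comm: "x \<in> M \<Longrightarrow> T1 (c1 x) = c1 (T1 x)" "x \<in> M \<Longrightarrow> T1 (c2 x) = c2 (T1 x)"
      "x \<in> M \<Longrightarrow> T2 (c1 x) = c1 (T2 x)" "x \<in> M \<Longrightarrow> T2 (c2 x) = c2 (T2 x)"
begin

lemma M_add [simp]: "x \<in> M \<Longrightarrow> y \<in> M \<Longrightarrow> x + y \<in> M"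
  using M_diff[of x "0 - y"] M_diff[of 0 y] M_zero by simp

lemma M_minus [simp]: "x \<in> M \<Longrightarrow> y \<in> M \<Longrightarrow> x - y \<in> M"
  by (rule M_diff)

text \<open>The inverse of \<open>T1\<close>, read off from the quadratic relation.\<close>

definition V1 :: "'m \<Rightarrow> 'm" where "V1 x = T1 x - c1 x"
definition V2 :: "'m \<Rightarrow> 'm" where "V2 x = T2 x - c2 x"

lemma T_diff:
  assumes "x \<in> M" "y \<in> M"
  shows "T1 (x - y) = T1 x - T1 y" "T2 (x - y) = T2 x - T2 y"
  using additive[of "x - y" y] assms by (simp_all add: algebra_simps)

lemma V_closed [simp]: "x \<in> M \<Longrightarrow> V1 x \<in> M" "x \<in> M \<Longrightarrow> V2 x \<in> M"
  by (simp_all add: V1_def V2_def)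

lemma TV [simp]: "x \<in> M \<Longrightarrow> T1 (V1 x) = x" "x \<in> M \<Longrightarrow> V1 (T1 x) = x" "x \<in> M \<Longrightarrow> T2 (V2 x) = x" "x \<in> M \<Longrightarrow> V2 (T2 x) = x"
  by (simp_all add: V1_def V2_def T_diff quad comm)

lemma altf_closed [simp]: "x \<in> M \<Longrightarrow> altf k T1 T2 x \<in> M" "x \<in> M \<Longrightarrow> altf k T2 T1 x \<in> M"
  by (induction k) auto

lemma altf_diff:
  "x \<in> M \<Longrightarrow> y \<in> M \<Longrightarrow> altf k T1 T2 (x - y) = altf k T1 T2 x - altf k T1 T2 y \<and>
    altf k T2 T1 (x - y) = altf k T2 T1 x - altf k T2 T1 y"
  by (induction k) (auto simp: T_diff)

lemma altf_comm:
  "x \<in> M \<Longrightarrow> altf k T1 T2 (c1 x) = c1 (altf k T1 T2 x) \<and> altf k T2 T1 (c1 x) = c1 (altf k T2 T1 x) \<and>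
    altf k T1 T2 (c2 x) = c2 (altf k T1 T2 x) \<and> altf k T2 T1 (c2 x) = c2 (altf k T2 T1 x)"
  by (induction k) (auto simp: comm)

lemma altf_Suc_right:
  "altf (Suc k) F G x = altf k F G ((if even k then F else G) x)"
  by (induction k arbitrary: F G) auto

text \<open>The kernel of the difference of the two alternating products with \<open>k\<close>
  factors. For the right \<open>k\<close> it has to be shown to be all of \<open>M\<close>.\<close>

definition N :: "nat \<Rightarrow> 'm set" where
  "N k = {x \<in> M. altf k T1 T2 x = altf k T2 T1 x}"

lemma N_M [simp]: "x \<in> N k \<Longrightarrow> x \<in> M"
  by (simp add: N_def)

lemma N_D: "x \<in> N k \<Longrightarrow> altf k T1 T2 x = altf k T2 T1 x"
  unfolding N_def by blast

lemma N_I: "x \<in> M \<Longrightarrow> altf k T1 T2 x = altf k T2 T1 x \<Longrightarrow> x \<in> N k"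
  unfolding N_def by blast

lemma N_diff:
  assumes "x \<in> N k" "y \<in> N k"
  shows "x - y \<in> N k"
proof (rule N_I)
  show "altf k T1 T2 (x - y) = altf k T2 T1 (x - y)"
    using altf_diff[of x y k] N_D[OF assms(1)] N_D[OF assms(2)] N_M[OF assms(1)] N_M[OF assms(2)] by metis
qed (use assms in simp)

lemma N_c:
  assumes "x \<in> N k"
  shows "c1 x \<in> N k" "c2 x \<in> N k"
  using altf_comm[of x k] N_D[OF assms] N_M[OF assms] by (auto intro!: N_I)

lemma N_add: "x \<in> N k \<Longrightarrow> y \<in> N k \<Longrightarrow> x + y \<in> N k"
  using N_diff[of x k "0 - y"] N_diff[of 0 k y] N_diff[of y k y] by simp

text \<open>Write \<open>P, Q\<close> for the two alternating products of \<open>k + 1\<close> factors. Moving a factor through,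
  \<open>(P - Q) T = - T'\<inverse> (P - Q)\<close>, where \<open>T' = T\<close> or the other operator according to the parity of
  \<open>k + 1\<close>; so the kernel of \<open>P - Q\<close> is stable.\<close>

lemma N_T:
  assumes par: "odd k \<or> c1 = c2" and x: "x \<in> N (Suc k)"
  shows "T1 x \<in> N (Suc k)" "T2 x \<in> N (Suc k)"
proof -
  have xM: "x \<in> M"
    using x by simp
  have eq: "T1 (altf k T2 T1 x) = T2 (altf k T1 T2 x)"
    using N_D[OF x] by simp
  let ?p = "altf k T1 T2 x" and ?q = "altf k T2 T1 x"
  have pq: "?p \<in> M" "?q \<in> M"
    using xM by simp_all
  have dist: "altf k T1 T2 (c1 y + z) = c1 (altf k T1 T2 y) + altf k T1 T2 z"
    "altf k T2 T1 (c2 y + z) = c2 (altf k T2 T1 y) + altf k T2 T1 z"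
    "altf k T1 T2 (c2 y + z) = c2 (altf k T1 T2 y) + altf k T1 T2 z"
    "altf k T2 T1 (c1 y + z) = c1 (altf k T2 T1 y) + altf k T2 T1 z" if "y \<in> M" "z \<in> M" for y z
    using altf_diff[of "c1 y + z" z k] altf_diff[of "c2 y + z" z k] altf_comm[of y k] that
    by (auto simp: algebra_simps)
  show "T1 x \<in> N (Suc k)"
  proof (cases "even k")
    \<comment> \<open>With an odd number \<open>k + 1\<close> of factors, moving a factor through
      the product exchanges \<open>T1\<close> and \<open>T2\<close>, so both quadratic relations
      must have the same coefficient.\<close>
    case True
    then have c: "c1 = c2"
      using par by simp
    have "altf (Suc k) T1 T2 (T1 x) = altf k T1 T2 (T1 (T1 x))"
      using True by (simp only: altf_Suc_right if_True)
    also have "\<dots> = c1 (altf (Suc k) T1 T2 x) + ?p"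
      using xM True dist(1)[of "T1 x" x] by (simp only: quad altf_Suc_right if_True closed)
    finally have 1: "altf (Suc k) T1 T2 (T1 x) = c1 (T1 ?q) + ?p"
      by simp
    have "altf (Suc k) T2 T1 (T1 x) = T2 (altf (Suc k) T1 T2 x)"
      using True by (subst (2) altf_Suc_right) (simp only: altf.simps if_True)
    also have "\<dots> = T2 (T2 ?p)"
      by (simp add: eq)
    also have "\<dots> = c1 (T1 ?q) + ?p"
      using pq by (simp add: quad c eq)
    finally show ?thesis
      using 1 xM by (intro N_I closed) (simp_all only:)
  next
    case False
    have "altf (Suc k) T2 T1 (T1 x) = altf k T2 T1 (T1 (T1 x))"
      using False by (simp only: altf_Suc_right if_False)
    also have "\<dots> = c1 (altf (Suc k) T2 T1 x) + ?q"
      using xM False dist(4)[of "T1 x" x] by (simp only: quad altf_Suc_right if_False closed)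
    finally have 1: "altf (Suc k) T2 T1 (T1 x) = c1 (T1 ?q) + ?q"
      by (simp add: eq)
    have "altf (Suc k) T1 T2 (T1 x) = T1 (altf (Suc k) T2 T1 x)"
      using False by (subst (2) altf_Suc_right) (simp only: altf.simps if_False)
    also have "\<dots> = T1 (T1 ?q)"
      by (simp add: eq)
    also have "\<dots> = c1 (T1 ?q) + ?q"
      using pq by (simp add: quad)
    finally show ?thesis
      using 1 xM by (intro N_I closed) (simp_all only:)
  qed
  show "T2 x \<in> N (Suc k)"
  proof (cases "even k")
    case True
    then have c: "c1 = c2"
      using par by simp
    have "altf (Suc k) T2 T1 (T2 x) = altf k T2 T1 (T2 (T2 x))"
      using True by (simp only: altf_Suc_right if_True)
    also have "\<dots> = c2 (altf (Suc k) T2 T1 x) + ?q"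
      using xM True dist(2)[of "T2 x" x] by (simp only: quad altf_Suc_right if_True closed)
    finally have 1: "altf (Suc k) T2 T1 (T2 x) = c2 (T1 ?q) + ?q"
      by (simp add: eq)
    have "altf (Suc k) T1 T2 (T2 x) = T1 (altf (Suc k) T2 T1 x)"
      using True by (subst (2) altf_Suc_right) (simp only: altf.simps if_True)
    also have "\<dots> = T1 (T1 ?q)"
      by (simp add: eq)
    also have "\<dots> = c2 (T1 ?q) + ?q"
      using pq by (simp add: quad c)
    finally show ?thesis
      using 1 xM by (intro N_I closed) (simp_all only:)
  next
    case False
    have "altf (Suc k) T1 T2 (T2 x) = altf k T1 T2 (T2 (T2 x))"
      using False by (simp only: altf_Suc_right if_False)
    also have "\<dots> = c2 (altf (Suc k) T1 T2 x) + ?p"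
      using xM False dist(3)[of "T2 x" x] by (simp only: quad altf_Suc_right if_False closed)
    finally have 1: "altf (Suc k) T1 T2 (T2 x) = c2 (T2 ?p) + ?p"
      by (simp add: eq)
    have "altf (Suc k) T2 T1 (T2 x) = T2 (altf (Suc k) T1 T2 x)"
      using False by (subst (2) altf_Suc_right) (simp only: altf.simps if_False)
    also have "\<dots> = T2 (T2 ?p)"
      by (simp add: eq)
    also have "\<dots> = c2 (T2 ?p) + ?p"
      using pq by (simp add: quad)
    finally show ?thesis
      using 1 xM by (intro N_I closed) (simp_all only:)
  qed
qed

lemma N_V:
  assumes par: "odd k \<or> c1 = c2" and x: "x \<in> N (Suc k)"
  shows "V1 x \<in> N (Suc k)" "V2 x \<in> N (Suc k)"
  unfolding V1_def V2_def using N_T[OF assms] N_c[OF x] by (auto intro: N_diff)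

text \<open>In the following lemmas \<open>E\<^sub>0, E\<^sub>1, \<dots>\<close> stand for multiplication by \<open>X\<^sup>\<lambda>\<close> for the weights \<open>\<lambda>\<close> of an
  orbit, starting with the antidominant one, which is fixed by the second reflection.\<close>

lemma N_orbit_2:
  assumes E: "\<And>x. x \<in> M \<Longrightarrow> E0 x \<in> M" "\<And>x. x \<in> M \<Longrightarrow> E1 x \<in> M"
    and rel: "\<And>x. x \<in> M \<Longrightarrow> T1 (E0 x) = E1 (V1 x)" "\<And>x. x \<in> M \<Longrightarrow> T2 (E0 x) = E0 (T2 x)"
      "\<And>x. x \<in> M \<Longrightarrow> T2 (E1 x) = E1 (T2 x)"
    and x: "x \<in> N 2"
  shows "E0 x \<in> N 2" "E1 x \<in> N 2"
proof -
  have x2: "x \<in> N (Suc 1)"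
    using x by (simp add: numeral_2_eq_2)
  have E0: "E0 y \<in> N 2" if y: "y \<in> N (Suc 1)" for y
  proof -
    have "V1 y \<in> N 2"
      using N_V[OF _ y] by (simp add: numeral_2_eq_2)
    then have "T1 (T2 (V1 y)) = T2 y"
      using y N_D[of "V1 y" 2] by (simp add: numeral_eq_Suc)
    then have "V1 (T2 y) = T2 (V1 y)"
      using y by (metis TV(2) V_closed(1) N_M closed(2))
    then show ?thesis
      using N_M[OF y] by (intro N_I) (simp_all add: numeral_eq_Suc rel E)
  qed
  show "E0 x \<in> N 2"
    by (rule E0[OF x2])
  have "E1 x = T1 (E0 (T1 x))"
    using x by (simp add: rel)
  moreover have "E0 (T1 x) \<in> N (Suc 1)"
    using E0 N_T[OF _ x2] by (simp add: numeral_2_eq_2)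
  ultimately show "E1 x \<in> N 2"
    using N_T[of 1 "E0 (T1 x)"] by (simp add: numeral_2_eq_2)
qed

lemma N_orbit_3:
  assumes E: "\<And>x. x \<in> M \<Longrightarrow> E0 x \<in> M" "\<And>x. x \<in> M \<Longrightarrow> E1 x \<in> M" "\<And>x. x \<in> M \<Longrightarrow> E2 x \<in> M"
    and rel: "\<And>x. x \<in> M \<Longrightarrow> T1 (E0 x) = E1 (V1 x)" "\<And>x. x \<in> M \<Longrightarrow> T2 (E1 x) = E2 (V2 x)"
      "\<And>x. x \<in> M \<Longrightarrow> T2 (E0 x) = E0 (T2 x)" "\<And>x. x \<in> M \<Longrightarrow> T1 (E2 x) = E2 (T1 x)"
    and c: "c1 = c2" and x: "x \<in> N 3"
  shows "E0 x \<in> N 3" "E1 x \<in> N 3" "E2 x \<in> N 3"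
proof -
  have par: "odd (2::nat) \<or> c1 = c2"
    using c by simp
  note NT = N_T[OF par, unfolded Suc_numeral, simplified] and NV = N_V[OF par, unfolded Suc_numeral, simplified]
  have E0: "E0 y \<in> N 3" if y: "y \<in> N 3" for y
  proof -
    have yM: "y \<in> M"
      using y by simp
    \<comment> \<open>The two alternating products send \<open>E0 y\<close> to \<open>E2\<close> of
      \<open>T1 (V2 (V1 y))\<close> and \<open>E2\<close> of \<open>V2 (V1 (T2 y))\<close>. The
      braid relation for \<open>h\<close>, which \<open>T1\<close> after \<open>T2\<close> sends to
      \<open>y\<close>, shows that the two arguments agree. The longer orbits follow the same
      pattern.\<close>
    define h where "h = V2 (V1 y)"
    have h: "h \<in> N 3" "h \<in> M" "T1 (T2 h) = y"
      using y NV by (auto simp: h_def)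
    have "T2 y = T1 (T2 (T1 h))"
      using N_D[OF h(1)] h(3) by (simp add: numeral_eq_Suc)
    then have "V2 (V1 (T2 y)) = T1 (V2 (V1 y))"
      using h(2) by (simp add: h_def[symmetric])
    then show ?thesis
      using yM by (intro N_I) (simp_all add: numeral_eq_Suc rel E)
  qed
  show "E0 x \<in> N 3"
    by (rule E0[OF x])
  have E1: "E1 y \<in> N 3" if y: "y \<in> N 3" for y
  proof -
    \<comment> \<open>Each further member of the orbit is the previous one between two operators
      that preserve \<open>N 3\<close>, so only \<open>E0\<close> needs the braid relation.\<close>
    have "E1 y = T1 (E0 (T1 y))"
      using y by (simp add: rel)
    then show ?thesis
      using NT(1)[OF E0[OF NT(1)[OF y]]] by simp
  qed
  show "E1 x \<in> N 3"
    by (rule E1[OF x])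
  have "E2 x = T2 (E1 (T2 x))"
    using x by (simp add: rel)
  then show "E2 x \<in> N 3"
    using NT(2)[OF E1[OF NT(2)[OF x]]] by simp
qed

lemma N_orbit_4:
  assumes E: "\<And>x. x \<in> M \<Longrightarrow> E0 x \<in> M" "\<And>x. x \<in> M \<Longrightarrow> E1 x \<in> M" "\<And>x. x \<in> M \<Longrightarrow> E2 x \<in> M"
      "\<And>x. x \<in> M \<Longrightarrow> E3 x \<in> M"
    and rel: "\<And>x. x \<in> M \<Longrightarrow> T1 (E0 x) = E1 (V1 x)" "\<And>x. x \<in> M \<Longrightarrow> T2 (E1 x) = E2 (V2 x)"
      "\<And>x. x \<in> M \<Longrightarrow> T1 (E2 x) = E3 (V1 x)"
      "\<And>x. x \<in> M \<Longrightarrow> T2 (E0 x) = E0 (T2 x)" "\<And>x. x \<in> M \<Longrightarrow> T2 (E3 x) = E3 (T2 x)"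
    and x: "x \<in> N 4"
  shows "E0 x \<in> N 4" "E1 x \<in> N 4" "E2 x \<in> N 4" "E3 x \<in> N 4"
proof -
  have par: "odd (3::nat) \<or> c1 = c2"
    by simp
  note NT = N_T[OF par, unfolded Suc_numeral, simplified] and NV = N_V[OF par, unfolded Suc_numeral, simplified]
  have E0: "E0 y \<in> N 4" if y: "y \<in> N 4" for y
  proof -
    have yM: "y \<in> M"
      using y by simp
    define h where "h = V1 (V2 (V1 y))"
    have h: "h \<in> N 4" "h \<in> M" "T1 (T2 (T1 h)) = y"
      using y NV by (auto simp: h_def)
    have "T2 y = T1 (T2 (T1 (T2 h)))"
      using N_D[OF h(1)] h(3) by (simp add: numeral_eq_Suc)
    then have "V1 (V2 (V1 (T2 y))) = T2 (V1 (V2 (V1 y)))"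
      using h(2) by (simp add: h_def[symmetric])
    then show ?thesis
      using yM by (intro N_I) (simp_all add: numeral_eq_Suc rel E)
  qed
  have E1: "E1 y \<in> N 4" if y: "y \<in> N 4" for y
  proof -
    have "E1 y = T1 (E0 (T1 y))"
      using y by (simp add: rel)
    then show ?thesis
      using NT(1)[OF E0[OF NT(1)[OF y]]] by simp
  qed
  have E2: "E2 y \<in> N 4" if y: "y \<in> N 4" for y
  proof -
    have "E2 y = T2 (E1 (T2 y))"
      using y by (simp add: rel)
    then show ?thesis
      using NT(2)[OF E1[OF NT(2)[OF y]]] by simp
  qed
  have "E3 x = T1 (E2 (T1 x))"
    using x by (simp add: rel)
  then show "E0 x \<in> N 4" "E1 x \<in> N 4" "E2 x \<in> N 4" "E3 x \<in> N 4"
    using NT(1)[OF E2[OF NT(1)[OF x]]] E0[OF x] E1[OF x] E2[OF x] by simp_all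
qed

text \<open>For \<open>G\<^sub>2\<close> there is no minuscule weight; for the quasi-minuscule one, an additional term
  \<open>- c\<^sub>1\<close> appears in the middle of the orbit and contributes equally to both products.\<close>

lemma N_orbit_6:
  assumes E: "\<And>x. x \<in> M \<Longrightarrow> E0 x \<in> M" "\<And>x. x \<in> M \<Longrightarrow> E1 x \<in> M" "\<And>x. x \<in> M \<Longrightarrow> E2 x \<in> M"
      "\<And>x. x \<in> M \<Longrightarrow> E3 x \<in> M" "\<And>x. x \<in> M \<Longrightarrow> E4 x \<in> M" "\<And>x. x \<in> M \<Longrightarrow> E5 x \<in> M"
    and rel: "\<And>x. x \<in> M \<Longrightarrow> T1 (E0 x) = E1 (V1 x)" "\<And>x. x \<in> M \<Longrightarrow> T2 (E1 x) = E2 (V2 x)"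
      "\<And>x. x \<in> M \<Longrightarrow> T1 (E2 x) = E3 (V1 x) - c1 x"
      "\<And>x. x \<in> M \<Longrightarrow> T2 (E3 x) = E4 (V2 x)" "\<And>x. x \<in> M \<Longrightarrow> T1 (E4 x) = E5 (V1 x)"
      "\<And>x. x \<in> M \<Longrightarrow> T2 (E0 x) = E0 (T2 x)" "\<And>x. x \<in> M \<Longrightarrow> T2 (E5 x) = E5 (T2 x)"
    and x: "x \<in> N 6"
  shows "E0 x \<in> N 6" "E1 x \<in> N 6" "E2 x \<in> N 6" "E3 x \<in> N 6" "E4 x \<in> N 6" "E5 x \<in> N 6"
proof -
  have par: "odd (5::nat) \<or> c1 = c2"
    by simp
  note NT = N_T[OF par, unfolded Suc_numeral, simplified] and NV = N_V[OF par, unfolded Suc_numeral, simplified]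
  have E0: "E0 y \<in> N 6" if y: "y \<in> N 6" for y
  proof -
    have yM: "y \<in> M"
      using y by simp
    define h where "h = V1 (V2 (V1 (V2 (V1 y))))"
    have h: "h \<in> N 6" "h \<in> M" "T1 (T2 (T1 (T2 (T1 h)))) = y"
      using y NV by (auto simp: h_def)
    have "T2 y = T1 (T2 (T1 (T2 (T1 (T2 h)))))"
      using N_D[OF h(1)] h(3) by (simp add: numeral_eq_Suc)
    then have "V1 (V2 (V1 (V2 (V1 (T2 y))))) = T2 (V1 (V2 (V1 (V2 (V1 y)))))"
      using h(2) by (simp add: h_def[symmetric])
    then show ?thesis
      using yM by (intro N_I) (simp_all add: numeral_eq_Suc rel E T_diff comm)
  qed
  have E1: "E1 y \<in> N 6" if y: "y \<in> N 6" for y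
  proof -
    have "E1 y = T1 (E0 (T1 y))"
      using y by (simp add: rel)
    then show ?thesis
      using NT(1)[OF E0[OF NT(1)[OF y]]] by simp
  qed
  have E2: "E2 y \<in> N 6" if y: "y \<in> N 6" for y
  proof -
    have "E2 y = T2 (E1 (T2 y))"
      using y by (simp add: rel)
    then show ?thesis
      using NT(2)[OF E1[OF NT(2)[OF y]]] by simp
  qed
  have E3: "E3 y \<in> N 6" if y: "y \<in> N 6" for y
  proof -
    have "E3 y = T1 (E2 (T1 y)) + c1 (T1 y)"
      using y by (simp add: rel)
    then show ?thesis
      using N_add[OF NT(1)[OF E2[OF NT(1)[OF y]]] N_c(1)[OF NT(1)[OF y]]] by simp
  qed
  have E4: "E4 y \<in> N 6" if y: "y \<in> N 6" for y
  proof -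
    have "E4 y = T2 (E3 (T2 y))"
      using y by (simp add: rel)
    then show ?thesis
      using NT(2)[OF E3[OF NT(2)[OF y]]] by simp
  qed
  have "E5 x = T1 (E4 (T1 x))"
    using x by (simp add: rel)
  then show "E0 x \<in> N 6" "E1 x \<in> N 6" "E2 x \<in> N 6" "E3 x \<in> N 6" "E4 x \<in> N 6" "E5 x \<in> N 6"
    using NT(1)[OF E4[OF NT(1)[OF x]]] E0[OF x] E1[OF x] E2[OF x] E3[OF x] E4[OF x] by simp_all
qed

end

section \<open>Demazure--Lusztig operators\<close>

lemma poly_mapping_single_induct [case_names zero add_single]:
  fixes f :: "'m::monoid_add \<Rightarrow>\<^sub>0 'k::comm_ring_1"
  assumes "P 0" "\<And>m k g. P g \<Longrightarrow> P (Poly_Mapping.single m k + g)"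
  shows "P f"
proof -
  have "f \<in> carrier (monoid_algebra UNIV UNIV)"
    by (simp add: carrier_monoid_algebra)
  then show ?thesis
    by (induction f rule: monoid_algebra_induct) (use assms in \<open>auto simp: subring_set_def\<close>)
qed

lemma sum_keys_superset:
  assumes "\<And>\<nu>. F \<nu> 0 = 0" "finite A" "Poly_Mapping.keys f \<subseteq> A"
  shows "(\<Sum>\<nu>\<in>Poly_Mapping.keys f. F \<nu> (Poly_Mapping.lookup f \<nu>)) = (\<Sum>\<nu>\<in>A. F \<nu> (Poly_Mapping.lookup f \<nu>))"
  by (rule sum.mono_neutral_left) (use assms in \<open>auto simp: in_keys_iff\<close>)

lemma sum_keys_add:
  fixes F :: "'m \<Rightarrow> 'k::comm_monoid_add \<Rightarrow> 'b::comm_monoid_add"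
  assumes "\<And>\<nu>. F \<nu> 0 = 0" "\<And>\<nu> a b. F \<nu> (a + b) = F \<nu> a + F \<nu> b"
  shows "(\<Sum>\<nu>\<in>Poly_Mapping.keys (f + g). F \<nu> (Poly_Mapping.lookup (f + g) \<nu>)) =
    (\<Sum>\<nu>\<in>Poly_Mapping.keys f. F \<nu> (Poly_Mapping.lookup f \<nu>)) +
    (\<Sum>\<nu>\<in>Poly_Mapping.keys g. F \<nu> (Poly_Mapping.lookup g \<nu>))"
proof -
  let ?A = "Poly_Mapping.keys f \<union> Poly_Mapping.keys g"
  have s: "(\<Sum>\<nu>\<in>Poly_Mapping.keys h. F \<nu> (Poly_Mapping.lookup h \<nu>)) = (\<Sum>\<nu>\<in>?A. F \<nu> (Poly_Mapping.lookup h \<nu>))"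
    if "Poly_Mapping.keys h \<subseteq> ?A" for h
    by (rule sum_keys_superset) (use assms that in auto)
  show ?thesis
    using s[OF keys_add] s[of f] s[of g] by (simp add: lookup_add assms sum.distrib)
qed

lemma sum_keys_single:
  "F \<nu> 0 = 0 \<Longrightarrow> (\<Sum>\<mu>\<in>Poly_Mapping.keys (Poly_Mapping.single \<nu> l). F \<mu> (Poly_Mapping.lookup (Poly_Mapping.single \<nu> l) \<mu>)) = F \<nu> l"
  by (cases "l = 0") auto

lemma weight_act_add: "weight_act w (f + g) = weight_act w f + weight_act w g"
  unfolding weight_act_def by (rule sum_keys_add) (simp_all add: single_add)

lemma weight_act_single [simp]: "weight_act w (Poly_Mapping.single \<nu> l) = Poly_Mapping.single (w \<nu>) l"
  unfolding weight_act_def by (rule sum_keys_single) simp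

lemma weight_act_zero [simp]: "weight_act w 0 = 0"
  by (simp add: weight_act_def)

lemma weight_act_diff: "weight_act w (f - g) = weight_act w f - weight_act w g"
  using weight_act_add[of w "f - g" g] by (simp add: algebra_simps)

lemma weight_act_one: "w 0 = 0 \<Longrightarrow> weight_act w 1 = 1"
  using weight_act_single[of w 0 1] by simp

lemma weight_act_comp:
  fixes f :: "'v::monoid_add weight_alg"
  shows "weight_act v (weight_act w f) = weight_act (v \<circ> w) f"
  by (induction f rule: poly_mapping_single_induct) (simp_all add: weight_act_add)

lemma weight_act_id:
  fixes f :: "'v::monoid_add weight_alg"
  shows "weight_act id f = f"
  by (induction f rule: poly_mapping_single_induct) (simp_all add: weight_act_add)

lemma weight_act_mult:
  assumes "\<And>x y. w (x + y) = w x + w y"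
  shows "weight_act w (f * g) = weight_act w f * weight_act w g"
proof (induction f rule: poly_mapping_single_induct)
  case (add_single m k f)
  have "weight_act w (Poly_Mapping.single m k * g) = Poly_Mapping.single (w m) k * weight_act w g"
    by (induction g rule: poly_mapping_single_induct)
      (simp_all add: weight_act_add distrib_left mult_single assms)
  then show ?case
    using add_single by (simp add: distrib_right weight_act_add)
qed simp

lemma reflection_alt: "reflection \<alpha> x = x - (x \<bullet> coroot \<alpha>) *\<^sub>R \<alpha>"
  by (simp add: reflection_eq coroot_def inner_commute)

text \<open>The divided difference as an explicit geometric sum: it descends from
  \<open>\<nu>\<close> for a nonnegative pairing and, with a sign, from its reflection otherwise. It
  is polymorphic in the coefficients because the relations use integers and the operators use
  \<open>coeff\<close>.\<close>

definition root_string :: "'v::euclidean_space \<Rightarrow> 'v \<Rightarrow> 'v \<Rightarrow>\<^sub>0 'k::comm_ring_1" where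
  "root_string \<alpha> \<nu> = (let k = \<lfloor>\<nu> \<bullet> coroot \<alpha>\<rfloor> in
     if 0 \<le> k then \<Sum>i<nat k. Poly_Mapping.single (\<nu> - real i *\<^sub>R \<alpha>) 1
     else - (\<Sum>i<nat (- k). Poly_Mapping.single (reflection \<alpha> \<nu> - real i *\<^sub>R \<alpha>) 1))"

lemma root_string_telescope:
  fixes \<nu> :: "'v::real_vector"
  shows "(\<Sum>i<p. Poly_Mapping.single (\<nu> - real i *\<^sub>R \<alpha>) 1) * (1 - Poly_Mapping.single (- \<alpha>) 1) =
    Poly_Mapping.single \<nu> (1::'k::comm_ring_1) - Poly_Mapping.single (\<nu> - real p *\<^sub>R \<alpha>) 1"
proof (induction p)
  case (Suc p)
  have "Poly_Mapping.single (\<nu> - real p *\<^sub>R \<alpha>) 1 * (1 - Poly_Mapping.single (- \<alpha>) 1) =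
      Poly_Mapping.single (\<nu> - real p *\<^sub>R \<alpha>) (1::'k) - Poly_Mapping.single (\<nu> - real (Suc p) *\<^sub>R \<alpha>) 1"
    by (simp add: right_diff_distrib mult_single) (simp add: algebra_simps)
  then show ?case
    by (simp add: distrib_right Suc)
qed simp

lemma root_string_spec:
  assumes "\<nu> \<bullet> coroot \<alpha> \<in> \<int>"
  shows "root_string \<alpha> \<nu> * (1 - Poly_Mapping.single (- \<alpha>) (1::'k::comm_ring_1)) =
    Poly_Mapping.single \<nu> 1 - Poly_Mapping.single (reflection \<alpha> \<nu>) 1"
proof -
  obtain k where k: "\<nu> \<bullet> coroot \<alpha> = of_int k"
    using assms by (elim Ints_cases)
  show ?thesis
  proof (cases "0 \<le> k")
    case True
    then have "reflection \<alpha> \<nu> = \<nu> - real (nat k) *\<^sub>R \<alpha>"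
      by (simp add: reflection_alt k)
    then show ?thesis
      using True by (simp add: root_string_def k root_string_telescope)
  next
    case False
    then have "reflection \<alpha> \<nu> - real (nat (- k)) *\<^sub>R \<alpha> = \<nu>"
      by (simp add: reflection_alt k)
    then show ?thesis
      using False by (simp add: root_string_def k root_string_telescope)
  qed
qed

lemma divided_difference_eq:
  assumes "\<alpha> \<noteq> 0" "\<nu> \<bullet> coroot \<alpha> \<in> \<int>"
  shows "divided_difference \<alpha> \<nu> = root_string \<alpha> \<nu>"
  unfolding divided_difference_def
proof (rule the_equality)
  have r: "regular (1 - Poly_Mapping.single (- \<alpha>) (1::int))"
    using assms(1) by (intro regular_binomial) simp
  fix q assume q: "q * (1 - Poly_Mapping.single (- \<alpha>) 1) = Poly_Mapping.single \<nu> 1 - Poly_Mapping.single (reflection \<alpha> \<nu>) (1::int)"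
  show "q = root_string \<alpha> \<nu>"
  proof (rule regular_cancel[OF r])
    show "(1 - Poly_Mapping.single (- \<alpha>) 1) * q = (1 - Poly_Mapping.single (- \<alpha>) 1) * root_string \<alpha> \<nu>"
      unfolding mult.commute[of "1 - Poly_Mapping.single (- \<alpha>) 1"] q root_string_spec[OF assms(2)] ..
  qed
qed (rule root_string_spec[OF assms(2)])

lemma root_string_closed:
  assumes K: "subring_set K" and S: "submonoid_set S" "\<And>\<nu>. \<nu> \<in> S \<Longrightarrow> - \<nu> \<in> S" "\<alpha> \<in> S" "\<nu> \<in> S" "reflection \<alpha> \<nu> \<in> S"
  shows "root_string \<alpha> \<nu> \<in> carrier (monoid_algebra K S)"
proof -
  have d: "\<mu> - real i *\<^sub>R \<alpha> \<in> S" if "\<mu> \<in> S" for \<mu> i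
  proof (induction i)
    case (Suc i)
    then have "(\<mu> - real i *\<^sub>R \<alpha>) + - \<alpha> \<in> S"
      using S by (auto simp: submonoid_set_def simp del: add_uminus_conv_diff)
    then show ?case
      by (simp add: algebra_simps)
  qed (use that in simp)
  note C = subring_set_monoid_algebra[OF K S(1)]
  have s: "(\<Sum>i<p. Poly_Mapping.single (\<mu> - real i *\<^sub>R \<alpha>) 1) \<in> carrier (monoid_algebra K S)" if "\<mu> \<in> S" for p \<mu>
    by (intro subring_set_sum[OF C] single_in_monoid_algebra K d that subring_setD)
  then show ?thesis
    using subring_setD(5)[OF C s[of "reflection \<alpha> \<nu>"]] S by (simp add: root_string_def Let_def)
qed

section \<open>Demazure and Demazure--Lusztig operators for one root\<close>

definition demazure :: "'v::euclidean_space \<Rightarrow> 'v weight_alg \<Rightarrow> 'v weight_alg" where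
  "demazure \<alpha> f = (\<Sum>\<nu>\<in>Poly_Mapping.keys f. scalar (Poly_Mapping.lookup f \<nu>) * root_string \<alpha> \<nu>)"

lemma demazure_add: "demazure \<alpha> (f + g) = demazure \<alpha> f + demazure \<alpha> g"
  unfolding demazure_def by (rule sum_keys_add) (simp_all add: single_add distrib_right)

lemma demazure_single: "demazure \<alpha> (Poly_Mapping.single \<nu> l) = scalar l * root_string \<alpha> \<nu>"
  unfolding demazure_def by (rule sum_keys_single) simp

text \<open>The operator by which the image of \<open>T_j\<close> acts, with \<open>t\<close> in the
  role of \<open>tau - 1/tau\<close>. The relation between the two parameters is imposed only in
  \<open>DL_quadratic\<close>.\<close>

definition DL :: "'v::euclidean_space \<Rightarrow> 'v coeff \<Rightarrow> 'v coeff \<Rightarrow> 'v weight_alg \<Rightarrow> 'v weight_alg" where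
  "DL \<alpha> \<tau> t f = scalar \<tau> * weight_act (reflection \<alpha>) f + scalar t * demazure \<alpha> f"

text \<open>The lattice is abstract because it has two instances: the weight lattice, and the larger
  group \<open>LS\<close> of vectors that are integral for a given pair of roots.\<close>

locale reflection_lattice =
  fixes K :: "'v::euclidean_space coeff set" and S :: "'v set" and \<alpha> :: 'v
  assumes K: "subring_set K" and S: "submonoid_set S" and S_uminus: "\<nu> \<in> S \<Longrightarrow> - \<nu> \<in> S"
    and \<alpha>_S: "\<alpha> \<in> S" and \<alpha>_nz: "\<alpha> \<noteq> 0" and S_refl: "\<nu> \<in> S \<Longrightarrow> reflection \<alpha> \<nu> \<in> S"
    and S_int: "\<nu> \<in> S \<Longrightarrow> \<nu> \<bullet> coroot \<alpha> \<in> \<int>"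
begin

abbreviation "MS \<equiv> carrier (monoid_algebra K S)"
abbreviation "s \<equiv> weight_act (reflection \<alpha>)"
abbreviation "d \<equiv> demazure \<alpha>"
abbreviation "u \<equiv> 1 - X_pow (- \<alpha>) :: 'v weight_alg"

lemmas MS_closed = subring_setD[OF subring_set_monoid_algebra[OF K S]]

lemma u_regular: "regular u"
  unfolding X_pow_def using \<alpha>_nz by (intro regular_binomial) simp

lemma refl_add: "reflection \<alpha> (x + y) = reflection \<alpha> x + reflection \<alpha> y"
  using linear_reflection by (rule linear_add)

lemma refl_0: "reflection \<alpha> 0 = 0"
  using linear_reflection by (rule linear_0)

lemmas s_mult = weight_act_mult[OF refl_add]

lemma s_s: "s (s f) = f"
proof -
  have "reflection \<alpha> \<circ> reflection \<alpha> = id"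
    by (simp add: fun_eq_iff reflection_involution)
  then show ?thesis
    by (simp add: weight_act_comp weight_act_id)
qed

lemma weight_act_closed:
  assumes "f \<in> MS" "\<And>\<nu>. \<nu> \<in> S \<Longrightarrow> w \<nu> \<in> S"
  shows "weight_act w f \<in> MS"
  using assms(1)
  by (induction f rule: monoid_algebra_induct)
    (use K in \<open>auto simp: weight_act_add MS_closed intro!: MS_closed single_in_monoid_algebra assms(2)\<close>)

lemma s_closed: "f \<in> MS \<Longrightarrow> s f \<in> MS"
  by (rule weight_act_closed) (simp_all add: S_refl)

lemma scalar_closed: "l \<in> K \<Longrightarrow> scalar l \<in> MS"
  using K S by (intro single_in_monoid_algebra) (auto simp: submonoid_set_def)

lemma X_pow_closed: "\<nu> \<in> S \<Longrightarrow> X_pow \<nu> \<in> MS"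
  unfolding X_pow_def using K by (intro single_in_monoid_algebra) (auto simp: subring_setD)

lemma d_closed: "f \<in> MS \<Longrightarrow> d f \<in> MS"
proof (induction f rule: monoid_algebra_induct)
  case zero
  then show ?case
    by (simp add: demazure_def MS_closed)
next
  case (add_single m k g)
  have "root_string \<alpha> m \<in> MS"
    using add_single by (intro root_string_closed K S S_uminus \<alpha>_S S_refl)
  then show ?case
    using add_single by (simp add: demazure_add demazure_single MS_closed scalar_closed)
qed (fact K)

lemma d_spec: "f \<in> MS \<Longrightarrow> u * d f = f - s f"
proof (induction f rule: monoid_algebra_induct)
  case zero
  then show ?case
    by (simp add: demazure_def)
next
  case (add_single m k g)
  have "u * (scalar k * root_string \<alpha> m) = scalar k * (root_string \<alpha> m * u)"
    by (simp add: ac_simps)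
  also have "\<dots> = Poly_Mapping.single m k - s (Poly_Mapping.single m k)"
    unfolding X_pow_def by (subst root_string_spec[OF S_int[OF add_single(1)]])
      (simp add: right_diff_distrib mult_single)
  finally show ?case
    using add_single by (simp add: demazure_add demazure_single distrib_left weight_act_add)
qed (fact K)

text \<open>Since \<open>u\<close> is regular, \<open>d f\<close> is characterized by
  \<open>u * d f = f - s f\<close>; the identities below are verified after multiplication by
  \<open>u\<close>.\<close>

lemma dI: "f \<in> MS \<Longrightarrow> u * h = f - s f \<Longrightarrow> d f = h"
  by (rule regular_cancel[OF u_regular]) (simp add: d_spec)

lemma s_u: "s u = - (X_pow \<alpha> * u)"
  using refl_0 reflection_self[OF \<alpha>_nz] linear_neg[OF linear_reflection, of \<alpha> \<alpha>]
  by (simp add: weight_act_diff weight_act_one X_pow_def right_diff_distrib mult_single)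

lemma s_d: "f \<in> MS \<Longrightarrow> X_pow \<alpha> * s (d f) = d f"
proof -
  assume f: "f \<in> MS"
  have "s u * s (d f) = s f - f"
    using arg_cong[OF d_spec[OF f], of s] by (simp add: s_mult weight_act_diff s_s)
  then have "u * (X_pow \<alpha> * s (d f)) = f - s f"
    by (simp add: s_u algebra_simps)
  from dI[OF f this] show ?thesis by simp
qed

lemma d_d: "f \<in> MS \<Longrightarrow> d (d f) = d f"
proof (rule dI)
  assume f: "f \<in> MS"
  have "X_pow (- \<alpha>) * d f = X_pow (- \<alpha>) * X_pow \<alpha> * s (d f)"
    using s_d[OF f] by (simp add: mult.assoc)
  also have "\<dots> = s (d f)"
    by (simp add: X_pow_def mult_single)
  finally show "u * d f = d f - s (d f)"
    by (simp add: left_diff_distrib)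
qed (rule d_closed)

lemma d_s: "f \<in> MS \<Longrightarrow> d (s f) = - d f"
  by (rule dI) (simp_all add: s_closed d_spec s_s)

text \<open>A Leibniz rule twisted by the reflection. It yields both linearity over the coefficients
  and the commutation of \<open>DL\<close> with \<open>X_pow\<close>.\<close>

lemma d_mult:
  assumes "f \<in> MS" "g \<in> MS"
  shows "d (f * g) = s f * d g + d f * g"
proof (rule dI)
  have "u * (s f * d g + d f * g) = s f * (u * d g) + (u * d f) * g"
    by (simp add: algebra_simps)
  also have "\<dots> = f * g - s f * s g"
    unfolding d_spec[OF assms(1)] d_spec[OF assms(2)] by (simp add: algebra_simps)
  finally show "u * (s f * d g + d f * g) = f * g - s (f * g)"
    by (simp add: s_mult)
qed (simp add: assms MS_closed)

lemma d_scalar: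
  assumes "l \<in> K"
  shows "d (scalar l) = 0"
  by (rule dI[OF scalar_closed[OF assms]]) (simp add: refl_0)

lemma DL_closed: "f \<in> MS \<Longrightarrow> \<tau> \<in> K \<Longrightarrow> t \<in> K \<Longrightarrow> DL \<alpha> \<tau> t f \<in> MS"
  by (simp add: DL_def MS_closed s_closed d_closed scalar_closed)

lemma DL_add: "DL \<alpha> \<tau> t (f + g) = DL \<alpha> \<tau> t f + DL \<alpha> \<tau> t g"
  by (simp add: DL_def weight_act_add demazure_add algebra_simps)

lemma DL_scalar:
  assumes "l \<in> K" "f \<in> MS"
  shows "DL \<alpha> \<tau> t (scalar l * f) = scalar l * DL \<alpha> \<tau> t f"
  using assms by (simp add: DL_def s_mult refl_0 d_mult scalar_closed d_scalar algebra_simps)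

lemma DL_quadratic:
  assumes f: "f \<in> MS" and \<tau>: "\<tau> * \<tau> - \<tau> * t = 1" and K': "\<tau> \<in> K" "t \<in> K"
  shows "DL \<alpha> \<tau> t (DL \<alpha> \<tau> t f) = scalar t * DL \<alpha> \<tau> t f + f"
proof -
  let ?\<tau> = "scalar \<tau> :: 'v weight_alg" and ?t = "scalar t :: 'v weight_alg"
  have \<tau>': "?\<tau> * ?\<tau> - ?\<tau> * ?t = 1"
    using arg_cong[OF \<tau>, of "scalar :: _ \<Rightarrow> 'v weight_alg"] by (simp add: mult_single single_diff)
  have s1: "s (DL \<alpha> \<tau> t f) = ?\<tau> * f + ?t * s (d f)"
    by (simp add: DL_def weight_act_add s_mult refl_0 s_s)
  have d1: "d (DL \<alpha> \<tau> t f) = - (?\<tau> * d f) + ?t * d f"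
    using f K' by (simp add: DL_def demazure_add d_mult scalar_closed d_scalar s_closed d_closed refl_0 d_s d_d)
  \<comment> \<open>Both sides equal \<open>u * d f\<close>, because \<open>d\<close> is
    idempotent.\<close>
  have e: "d f - s (d f) = f - s f"
    using d_spec[OF d_closed[OF f]] d_spec[OF f] by (simp add: d_d f)
  have "DL \<alpha> \<tau> t (DL \<alpha> \<tau> t f) = ?\<tau> * (?\<tau> * f + ?t * s (d f)) + ?t * (- (?\<tau> * d f) + ?t * d f)"
    unfolding DL_def[of \<alpha> \<tau> t "DL \<alpha> \<tau> t f"] s1 d1 ..
  also have "\<dots> = ?\<tau> * ?\<tau> * f - ?\<tau> * ?t * (d f - s (d f)) + ?t * ?t * d f"
    by (simp add: algebra_simps)
  also have "\<dots> = (?\<tau> * ?\<tau> - ?\<tau> * ?t) * f + ?t * (?\<tau> * s f + ?t * d f)"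
    unfolding e by (simp add: algebra_simps)
  finally show ?thesis
    unfolding \<tau>' by (simp add: DL_def)
qed

lemma DL_X:
  assumes "\<mu> \<in> S" "f \<in> MS"
  shows "DL \<alpha> \<tau> t (X_pow \<mu> * f) = X_pow (reflection \<alpha> \<mu>) * DL \<alpha> \<tau> t f + scalar t * d (X_pow \<mu>) * f"
proof -
  have "s (X_pow \<mu>) = X_pow (reflection \<alpha> \<mu>)"
    by (simp add: X_pow_def)
  then show ?thesis
    unfolding DL_def s_mult d_mult[OF X_pow_closed[OF assms(1)] assms(2)] by (simp add: algebra_simps)
qed

lemma DL_X_0:
  assumes "\<mu> \<in> S" "f \<in> MS" "\<mu> \<bullet> coroot \<alpha> = 0"
  shows "DL \<alpha> \<tau> t (X_pow \<mu> * f) = X_pow \<mu> * DL \<alpha> \<tau> t f"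
proof -
  have r: "reflection \<alpha> \<mu> = \<mu>"
    by (simp add: reflection_alt assms)
  have "d (X_pow \<mu>) = 0"
    by (rule dI[OF X_pow_closed[OF assms(1)]]) (simp add: X_pow_def r)
  then show ?thesis
    using DL_X[OF assms(1,2)] r by simp
qed

text \<open>The minuscule step: by the quadratic relation \<open>DL\<close> minus the scalar
  \<open>t\<close> is the inverse of \<open>DL\<close>, so moving an exponent of pairing -1 across
  the operator inverts it.\<close>

lemma DL_X_m1:
  assumes "\<mu> \<in> S" "f \<in> MS" "\<mu> \<bullet> coroot \<alpha> = -1"
  shows "DL \<alpha> \<tau> t (X_pow \<mu> * f) = X_pow (\<mu> + \<alpha>) * (DL \<alpha> \<tau> t f - scalar t * f)"
proof -
  have r: "reflection \<alpha> \<mu> = \<mu> + \<alpha>"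
    by (simp add: reflection_alt assms)
  have "d (X_pow \<mu>) = - X_pow (\<mu> + \<alpha>)"
    by (rule dI[OF X_pow_closed[OF assms(1)]]) (simp add: X_pow_def r left_diff_distrib mult_single)
  then show ?thesis
    using DL_X[OF assms(1,2)] r by (simp add: algebra_simps)
qed

text \<open>Pairing -2 occurs in the middle of the orbit of short roots of G2; the root string then
  has two members, and the second gives the additional term.\<close>

lemma DL_X_m2:
  assumes "f \<in> MS"
  shows "DL \<alpha> \<tau> t (X_pow (- \<alpha>) * f) = X_pow \<alpha> * (DL \<alpha> \<tau> t f - scalar t * f) - scalar t * f"
proof -
  have r: "reflection \<alpha> (- \<alpha>) = \<alpha>"
    using reflection_self[OF \<alpha>_nz] linear_neg[OF linear_reflection, of \<alpha> \<alpha>] by simp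
  have e: "d (X_pow (- \<alpha>)) = - X_pow \<alpha> - 1"
    by (rule dI[OF X_pow_closed[OF S_uminus[OF \<alpha>_S]]])
      (simp add: X_pow_def r algebra_simps mult_single)
  show ?thesis
    unfolding DL_X[OF S_uminus[OF \<alpha>_S] assms] r e by (simp add: algebra_simps)
qed

end

section \<open>Rank two: stable weights and the braid relation\<close>

locale reflection_pair =
  fixes \<alpha> \<beta> :: "'v::euclidean_space" and \<tau>1 t1 \<tau>2 t2 :: "'v coeff"
  assumes nz: "\<alpha> \<noteq> 0" "\<beta> \<noteq> 0" and int: "\<beta> \<bullet> coroot \<alpha> \<in> \<int>" "\<alpha> \<bullet> coroot \<beta> \<in> \<int>"
    and \<tau>: "\<tau>1 * \<tau>1 - \<tau>1 * t1 = 1" "\<tau>2 * \<tau>2 - \<tau>2 * t2 = 1"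
begin

text \<open>Besides weights this contains the fractional weights of the rank two system, such as
  half of a root, and all vectors orthogonal to both roots. A general element can therefore be
  decomposed into these pieces.\<close>

definition LS :: "'v set" where
  "LS = {\<nu>. \<nu> \<bullet> coroot \<alpha> \<in> \<int> \<and> \<nu> \<bullet> coroot \<beta> \<in> \<int>}"

lemma LS_refl: "reflection_lattice UNIV LS \<alpha>" "reflection_lattice UNIV LS \<beta>"
  by (unfold_locales; use nz int in \<open>auto simp: subring_set_def submonoid_set_def LS_def inner_add_left
        inner_diff_left reflection_alt inner_coroot_self intro!: Ints_add Ints_diff Ints_mult\<close>)+

sublocale A: reflection_lattice UNIV LS \<alpha>
  by (rule LS_refl)

sublocale B: reflection_lattice UNIV LS \<beta>
  by (rule LS_refl)

abbreviation "MM \<equiv> carrier (monoid_algebra UNIV LS) :: 'v weight_alg set"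
abbreviation "TA \<equiv> DL \<alpha> \<tau>1 t1"
abbreviation "TB \<equiv> DL \<beta> \<tau>2 t2"

sublocale H: two_hecke_operators MM TA TB "\<lambda>f. scalar t1 * f" "\<lambda>f. scalar t2 * f"
  by unfold_locales
    (auto simp: A.MS_closed A.scalar_closed A.DL_closed B.DL_closed A.DL_add B.DL_add A.DL_scalar B.DL_scalar
      A.DL_quadratic B.DL_quadratic \<tau>)

definition stab :: "nat \<Rightarrow> 'v set" where
  "stab k = {\<mu> \<in> LS. \<forall>g\<in>H.N k. X_pow \<mu> * g \<in> H.N k}"

lemma X_pow_add: "X_pow (\<mu> + \<nu>) = X_pow \<mu> * X_pow \<nu>"
  by (simp add: X_pow_def mult_single)

lemma stab_add: "\<mu> \<in> stab k \<Longrightarrow> \<nu> \<in> stab k \<Longrightarrow> \<mu> + \<nu> \<in> stab k"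
  using A.S by (auto simp: stab_def X_pow_add mult.assoc submonoid_set_def)

lemma stab_orth:
  assumes "\<mu> \<bullet> coroot \<alpha> = 0" "\<mu> \<bullet> coroot \<beta> = 0"
  shows "\<mu> \<in> stab k"
proof -
  have \<mu>: "\<mu> \<in> LS"
    using assms by (simp add: LS_def)
  have "altf k TA TB (X_pow \<mu> * g) = X_pow \<mu> * altf k TA TB g \<and> altf k TB TA (X_pow \<mu> * g) = X_pow \<mu> * altf k TB TA g"
    if "g \<in> MM" for g
    by (induction k) (use that \<mu> assms in \<open>auto simp: A.DL_X_0 B.DL_X_0\<close>)
  then show ?thesis
    using \<mu> by (auto simp: stab_def A.MS_closed A.X_pow_closed H.N_D intro!: H.N_I)
qed

text \<open>Since \<open>stab k\<close> is only known to be closed under addition, both signs of the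
  two fundamental weights must be supplied. Subtracting multiples of them leaves a vector orthogonal
  to both roots, and \<open>stab_orth\<close> applies.\<close>

lemma stab_all:
  assumes "\<And>p q. (p, q) \<in> {(1, 0), (-1, 0), (0, 1), (0, -1)} \<Longrightarrow>
      \<exists>\<mu>\<in>stab k. \<mu> \<bullet> coroot \<alpha> = p \<and> \<mu> \<bullet> coroot \<beta> = q"
    and "\<mu> \<in> LS"
  shows "\<mu> \<in> stab k"
proof -
  have scale: "real n *\<^sub>R \<nu> \<in> stab k" if "\<nu> \<in> stab k" for n \<nu>
  proof (induction n)
    case (Suc n)
    then show ?case
      using stab_add[OF that Suc] by (simp add: algebra_simps)
  qed (simp add: stab_orth)
  have intscale: "\<exists>\<nu>\<in>stab k. \<nu> \<bullet> coroot \<alpha> = of_int z * p \<and> \<nu> \<bullet> coroot \<beta> = of_int z * q"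
    if pq: "(p, q) \<in> {(1, 0), (0, 1)}" for z p q
  proof (cases "0 \<le> z")
    case True
    obtain \<nu> where "\<nu> \<in> stab k" "\<nu> \<bullet> coroot \<alpha> = p" "\<nu> \<bullet> coroot \<beta> = q"
      using assms(1)[of p q] pq by auto
    then show ?thesis
      using scale[of \<nu> "nat z"] True by (intro bexI[of _ "real (nat z) *\<^sub>R \<nu>"]) auto
  next
    case False
    obtain \<nu> where "\<nu> \<in> stab k" "\<nu> \<bullet> coroot \<alpha> = - p" "\<nu> \<bullet> coroot \<beta> = - q"
      using assms(1)[of "- p" "- q"] pq by auto
    then show ?thesis
      using scale[of \<nu> "nat (- z)"] False by (intro bexI[of _ "real (nat (- z)) *\<^sub>R \<nu>"]) auto
  qed
  obtain y z where yz: "\<mu> \<bullet> coroot \<alpha> = of_int y" "\<mu> \<bullet> coroot \<beta> = of_int z"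
    using assms(2) by (auto simp: LS_def elim!: Ints_cases)
  obtain \<nu>1 where \<nu>1: "\<nu>1 \<in> stab k" "\<nu>1 \<bullet> coroot \<alpha> = of_int y" "\<nu>1 \<bullet> coroot \<beta> = 0"
    using intscale[of 1 0 y] by auto
  obtain \<nu>2 where \<nu>2: "\<nu>2 \<in> stab k" "\<nu>2 \<bullet> coroot \<alpha> = 0" "\<nu>2 \<bullet> coroot \<beta> = of_int z"
    using intscale[of 0 1 z] by auto
  have "\<mu> - \<nu>1 - \<nu>2 \<in> stab k"
    using yz \<nu>1 \<nu>2 by (intro stab_orth) (simp_all add: inner_diff_left)
  from stab_add[OF stab_add[OF this \<nu>1(1)] \<nu>2(1)] show ?thesis
    by simp
qed

lemma TA_one: "TA (scalar l) = scalar (l * \<tau>1)" and TB_one: "TB (scalar l) = scalar (l * \<tau>2)"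
  by (simp_all add: DL_def A.refl_0 B.refl_0 A.d_scalar B.d_scalar mult_single mult.commute)

text \<open>Constants are common eigenvectors with eigenvalues \<open>\<tau>1\<close> and
  \<open>\<tau>2\<close>. Both products contain each eigenvalue equally often when \<open>k\<close>
  is even; for three factors the parameters are assumed equal. Stability then spreads the relation
  from constants to all exponents.\<close>

lemma braid_of_stab:
  assumes k: "k \<in> {2, 3, 4, 6}" "k = 3 \<Longrightarrow> \<tau>1 = \<tau>2" and st: "LS \<subseteq> stab k" and g: "g \<in> MM"
  shows "altf k TA TB g = altf k TB TA g"
proof -
  have one: "altf k TA TB (scalar l) = altf k TB TA (scalar l)" for l
  proof (cases "k = 3")
    case True
    have "TA (TB (TA (scalar l))) = TB (TA (TB (scalar l)))"
      unfolding TA_one TB_one unfolding k(2)[OF True] ..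
    then show ?thesis
      by (simp add: True numeral_eq_Suc)
  next
    case False
    then show ?thesis
      using k(1) by (auto simp: numeral_eq_Suc TA_one TB_one ac_simps)
  qed
  have "g \<in> H.N k"
    using g
  proof (induction g rule: monoid_algebra_induct)
    case zero
    then show ?case
      using one[of 0] by (intro H.N_I) (simp_all add: A.MS_closed)
  next
    case (add_single m l g)
    have "scalar l \<in> H.N k"
      by (intro H.N_I one A.scalar_closed) simp
    then have "X_pow m * scalar l \<in> H.N k"
      using st add_single(1) by (auto simp: stab_def)
    then show ?case
      using add_single by (intro H.N_add) (simp_all add: X_pow_def mult_single)
  qed (simp add: subring_set_def)
  then show ?thesis
    by (rule H.N_D)
qed

lemma orbit_rel:
  assumes "g \<in> MM"
  shows "\<mu> \<in> LS \<Longrightarrow> \<mu> \<bullet> coroot \<alpha> = -1 \<Longrightarrow> TA (X_pow \<mu> * g) = X_pow (\<mu> + \<alpha>) * H.V1 g"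
    "\<mu> \<in> LS \<Longrightarrow> \<mu> \<bullet> coroot \<beta> = -1 \<Longrightarrow> TB (X_pow \<mu> * g) = X_pow (\<mu> + \<beta>) * H.V2 g"
    "\<mu> \<in> LS \<Longrightarrow> \<mu> \<bullet> coroot \<alpha> = 0 \<Longrightarrow> TA (X_pow \<mu> * g) = X_pow \<mu> * TA g"
    "\<mu> \<in> LS \<Longrightarrow> \<mu> \<bullet> coroot \<beta> = 0 \<Longrightarrow> TB (X_pow \<mu> * g) = X_pow \<mu> * TB g"
    "TA (X_pow (- \<alpha>) * g) = X_pow \<alpha> * H.V1 g - scalar t1 * g"
  using assms by (simp_all add: A.DL_X_m1 B.DL_X_m1 A.DL_X_0 B.DL_X_0 A.DL_X_m2 H.V1_def H.V2_def)

lemmas pairings = inner_diff_left inner_add_left inner_coroot_self[OF nz(1)] inner_coroot_self[OF nz(2)]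

lemma mult_closed: "\<mu> \<in> LS \<Longrightarrow> g \<in> MM \<Longrightarrow> X_pow \<mu> * g \<in> MM"
  by (simp add: A.MS_closed A.X_pow_closed)

lemma stabI: "\<mu> \<in> LS \<Longrightarrow> (\<And>g. g \<in> H.N k \<Longrightarrow> X_pow \<mu> * g \<in> H.N k) \<Longrightarrow> \<mu> \<in> stab k"
  by (simp add: stab_def)

text \<open>The two-element orbit of the minuscule weight of one factor A1; multiplication by it
  commutes with the operator of the other factor.\<close>

lemma half_stab_2:
  assumes "\<beta> \<bullet> coroot \<alpha> = 0" "\<alpha> \<bullet> coroot \<beta> = 0"
  shows "(-1/2) *\<^sub>R \<alpha> \<in> stab 2" "(1/2) *\<^sub>R \<alpha> \<in> stab 2"
proof -
  let ?\<mu> = "(-1/2) *\<^sub>R \<alpha>"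
  have L: "?\<mu> \<in> LS" "?\<mu> + \<alpha> \<in> LS" "?\<mu> \<bullet> coroot \<alpha> = -1" "?\<mu> \<bullet> coroot \<beta> = 0" "(?\<mu> + \<alpha>) \<bullet> coroot \<beta> = 0"
    using assms by (simp_all add: LS_def pairings)
  have "X_pow ?\<mu> * g \<in> H.N 2 \<and> X_pow (?\<mu> + \<alpha>) * g \<in> H.N 2" if "g \<in> H.N 2" for g
    using H.N_orbit_2[where ?E0.0 = "\<lambda>g. X_pow ?\<mu> * g" and ?E1.0 = "\<lambda>g. X_pow (?\<mu> + \<alpha>) * g"] that L
    by (simp add: orbit_rel mult_closed)
  moreover have "?\<mu> + \<alpha> = (1/2) *\<^sub>R \<alpha>"
    by (simp add: algebra_simps flip: scaleR_left.add scaleR_2)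
  ultimately show "(-1/2) *\<^sub>R \<alpha> \<in> stab 2" "(1/2) *\<^sub>R \<alpha> \<in> stab 2"
    using L by (auto intro!: stabI)
qed

lemma stab_3:
  assumes "\<beta> \<bullet> coroot \<alpha> = -1" "\<alpha> \<bullet> coroot \<beta> = -1" "t1 = t2"
  shows "LS \<subseteq> stab 3"
proof
  \<comment> \<open>Minus the fundamental weight attached to \<open>\<alpha>\<close> in type A2, so
    it pairs to -1 and 0 with the two coroots. Sums of two members of its orbit give the weights
    missing from the orbit itself.\<close>
  define \<mu>0 where "\<mu>0 = (-1/3) *\<^sub>R (\<alpha> + \<alpha> + \<beta>)"
  define \<mu>1 \<mu>2 where "\<mu>1 = \<mu>0 + \<alpha>" and "\<mu>2 = \<mu>1 + \<beta>"
  have p: "\<mu>0 \<bullet> coroot \<alpha> = -1" "\<mu>0 \<bullet> coroot \<beta> = 0" "\<mu>1 \<bullet> coroot \<alpha> = 1" "\<mu>1 \<bullet> coroot \<beta> = -1"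
      "\<mu>2 \<bullet> coroot \<alpha> = 0" "\<mu>2 \<bullet> coroot \<beta> = 1"
    using assms by (simp_all add: \<mu>0_def \<mu>1_def \<mu>2_def pairings)
  then have L: "\<mu>0 \<in> LS" "\<mu>1 \<in> LS" "\<mu>2 \<in> LS"
    by (simp_all add: LS_def)
  have "X_pow \<mu>0 * g \<in> H.N 3 \<and> X_pow \<mu>1 * g \<in> H.N 3 \<and> X_pow \<mu>2 * g \<in> H.N 3" if g: "g \<in> H.N 3" for g
  proof -
    have c: "(\<lambda>f. scalar t1 * f) = (\<lambda>f. scalar t2 * f)"
      using assms(3) by simp
    note o = H.N_orbit_3[where ?E0.0 = "\<lambda>g. X_pow \<mu>0 * g" and ?E1.0 = "\<lambda>g. X_pow \<mu>1 * g"
        and ?E2.0 = "\<lambda>g. X_pow \<mu>2 * g", OF _ _ _ _ _ _ _ c g]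
    show ?thesis
      by (intro conjI o) (simp_all add: orbit_rel mult_closed p L \<mu>1_def[symmetric] \<mu>2_def[symmetric])
  qed
  then have st: "\<mu>0 \<in> stab 3" "\<mu>1 \<in> stab 3" "\<mu>2 \<in> stab 3"
    using L by (auto intro!: stabI)
  fix \<mu> assume "\<mu> \<in> LS"
  then show "\<mu> \<in> stab 3"
  proof (rule stab_all[rotated])
    fix p' q' :: real assume "(p', q') \<in> {(1, 0), (-1, 0), (0, 1), (0, -1)}"
    then consider "p' = 1" "q' = 0" | "p' = -1" "q' = 0" | "p' = 0" "q' = 1" | "p' = 0" "q' = -1"
      by auto
    then show "\<exists>\<mu>\<in>stab 3. \<mu> \<bullet> coroot \<alpha> = p' \<and> \<mu> \<bullet> coroot \<beta> = q'"
    proof cases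
      case 1 with st p stab_add[OF st(2,3)] show ?thesis
        by (intro bexI[of _ "\<mu>1 + \<mu>2"]) (simp_all add: pairings)
    next
      case 2 with st p show ?thesis by (intro bexI[of _ "\<mu>0"]) simp_all
    next
      case 3 with st p show ?thesis by (intro bexI[of _ "\<mu>2"]) simp_all
    next
      case 4 with st p stab_add[OF st(1,2)] show ?thesis
        by (intro bexI[of _ "\<mu>0 + \<mu>1"]) (simp_all add: pairings)
    qed
  qed
qed

text \<open>Common end of types B2 and G2: the four weights are the first two and the last two of
  the orbit. The sum within each pair supplies the weights pairing to zero with the coroot of
  \<open>\<alpha>\<close>.\<close>

lemma stab_of_chain:
  assumes "\<mu> \<in> stab k" "\<mu>' \<in> stab k" "\<nu> \<in> stab k" "\<nu>' \<in> stab k"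
    and "\<mu> \<bullet> coroot \<alpha> = -1" "\<mu> \<bullet> coroot \<beta> = 0" "\<mu>' \<bullet> coroot \<alpha> = 1" "\<mu>' \<bullet> coroot \<beta> = -1"
    and "\<nu> \<bullet> coroot \<alpha> = -1" "\<nu> \<bullet> coroot \<beta> = 1" "\<nu>' \<bullet> coroot \<alpha> = 1" "\<nu>' \<bullet> coroot \<beta> = 0"
  shows "LS \<subseteq> stab k"
proof
  fix \<rho> assume "\<rho> \<in> LS"
  then show "\<rho> \<in> stab k"
  proof (rule stab_all[rotated])
    fix p' q' :: real assume "(p', q') \<in> {(1, 0), (-1, 0), (0, 1), (0, -1)}"
    then consider "p' = 1" "q' = 0" | "p' = -1" "q' = 0" | "p' = 0" "q' = 1" | "p' = 0" "q' = -1"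
      by auto
    then show "\<exists>\<mu>\<in>stab k. \<mu> \<bullet> coroot \<alpha> = p' \<and> \<mu> \<bullet> coroot \<beta> = q'"
    proof cases
      case 1 with assms show ?thesis by (intro bexI[of _ \<nu>']) simp_all
    next
      case 2 with assms show ?thesis by (intro bexI[of _ \<mu>]) simp_all
    next
      case 3 with assms stab_add[OF assms(3,4)] show ?thesis
        by (intro bexI[of _ "\<nu> + \<nu>'"]) (simp_all add: pairings)
    next
      case 4 with assms stab_add[OF assms(1,2)] show ?thesis
        by (intro bexI[of _ "\<mu> + \<mu>'"]) (simp_all add: pairings)
    qed
  qed
qed

lemma stab_4:
  assumes "\<beta> \<bullet> coroot \<alpha> = -2" "\<alpha> \<bullet> coroot \<beta> = -1"
  shows "LS \<subseteq> stab 4"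
proof -
  \<comment> \<open>Minus the spin weight of B2, where \<open>\<alpha>\<close> is the short root;
    its orbit has four elements and is minuscule.\<close>
  define \<mu>0 where "\<mu>0 = (-1/2) *\<^sub>R (\<alpha> + \<alpha> + \<beta>)"
  define \<mu>1 \<mu>2 \<mu>3 where "\<mu>1 = \<mu>0 + \<alpha>" and "\<mu>2 = \<mu>1 + \<beta>" and "\<mu>3 = \<mu>2 + \<alpha>"
  have p: "\<mu>0 \<bullet> coroot \<alpha> = -1" "\<mu>0 \<bullet> coroot \<beta> = 0" "\<mu>1 \<bullet> coroot \<alpha> = 1" "\<mu>1 \<bullet> coroot \<beta> = -1"
      "\<mu>2 \<bullet> coroot \<alpha> = -1" "\<mu>2 \<bullet> coroot \<beta> = 1" "\<mu>3 \<bullet> coroot \<alpha> = 1" "\<mu>3 \<bullet> coroot \<beta> = 0"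
    using assms by (simp_all add: \<mu>0_def \<mu>1_def \<mu>2_def \<mu>3_def pairings)
  then have L: "\<mu>0 \<in> LS" "\<mu>1 \<in> LS" "\<mu>2 \<in> LS" "\<mu>3 \<in> LS"
    by (simp_all add: LS_def)
  have "X_pow \<mu>0 * g \<in> H.N 4 \<and> X_pow \<mu>1 * g \<in> H.N 4 \<and> X_pow \<mu>2 * g \<in> H.N 4 \<and> X_pow \<mu>3 * g \<in> H.N 4"
    if "g \<in> H.N 4" for g
    using H.N_orbit_4[where ?E0.0 = "\<lambda>g. X_pow \<mu>0 * g" and ?E1.0 = "\<lambda>g. X_pow \<mu>1 * g"
        and ?E2.0 = "\<lambda>g. X_pow \<mu>2 * g" and ?E3.0 = "\<lambda>g. X_pow \<mu>3 * g"] that p L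
    by (simp add: orbit_rel mult_closed \<mu>1_def[symmetric] \<mu>2_def[symmetric] \<mu>3_def[symmetric])
  then have "\<mu>0 \<in> stab 4" "\<mu>1 \<in> stab 4" "\<mu>2 \<in> stab 4" "\<mu>3 \<in> stab 4"
    using L by (auto intro!: stabI)
  then show ?thesis
    by (rule stab_of_chain) (rule p)+
qed

lemma stab_6:
  assumes "\<beta> \<bullet> coroot \<alpha> = -3" "\<alpha> \<bullet> coroot \<beta> = -1"
  shows "LS \<subseteq> stab 6"
proof -
  \<comment> \<open>Minus the highest short root of G2. Its orbit consists of the six short roots,
    with \<open>- \<alpha>\<close> and \<open>\<alpha>\<close> in the middle.\<close>
  define \<mu>0 where "\<mu>0 = - (\<alpha> + \<alpha> + \<beta>)"
  define \<mu>1 \<mu>4 \<mu>5 where "\<mu>1 = \<mu>0 + \<alpha>" and "\<mu>4 = \<alpha> + \<beta>" and "\<mu>5 = \<mu>4 + \<alpha>"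
  have e: "\<mu>1 + \<beta> = - \<alpha>"
    by (simp add: \<mu>1_def \<mu>0_def)
  have p: "\<mu>0 \<bullet> coroot \<alpha> = -1" "\<mu>0 \<bullet> coroot \<beta> = 0" "\<mu>1 \<bullet> coroot \<alpha> = 1" "\<mu>1 \<bullet> coroot \<beta> = -1"
      "\<mu>4 \<bullet> coroot \<alpha> = -1" "\<mu>4 \<bullet> coroot \<beta> = 1" "\<mu>5 \<bullet> coroot \<alpha> = 1" "\<mu>5 \<bullet> coroot \<beta> = 0"
    using assms by (simp_all add: \<mu>0_def \<mu>1_def \<mu>4_def \<mu>5_def pairings)
  then have L: "\<mu>0 \<in> LS" "\<mu>1 \<in> LS" "\<mu>4 \<in> LS" "\<mu>5 \<in> LS" "\<alpha> \<in> LS" "- \<alpha> \<in> LS"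
    using A.\<alpha>_S A.S_uminus by (simp_all add: LS_def)
  have "X_pow \<mu>0 * g \<in> H.N 6 \<and> X_pow \<mu>1 * g \<in> H.N 6 \<and> X_pow \<mu>4 * g \<in> H.N 6 \<and> X_pow \<mu>5 * g \<in> H.N 6"
    if "g \<in> H.N 6" for g
    using H.N_orbit_6[where ?E0.0 = "\<lambda>g. X_pow \<mu>0 * g" and ?E1.0 = "\<lambda>g. X_pow \<mu>1 * g"
        and ?E2.0 = "\<lambda>g. X_pow (- \<alpha>) * g" and ?E3.0 = "\<lambda>g. X_pow \<alpha> * g"
        and ?E4.0 = "\<lambda>g. X_pow \<mu>4 * g" and ?E5.0 = "\<lambda>g. X_pow \<mu>5 * g"] that p L assms
    by (simp add: orbit_rel mult_closed \<mu>1_def[symmetric] e \<mu>4_def[symmetric] \<mu>5_def[symmetric])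
  then have "\<mu>0 \<in> stab 6" "\<mu>1 \<in> stab 6" "\<mu>4 \<in> stab 6" "\<mu>5 \<in> stab 6"
    using L by (auto intro!: stabI)
  then show ?thesis
    by (rule stab_of_chain) (rule p)+
qed

end

lemma (in reflection_pair) stab_2:
  assumes "\<beta> \<bullet> coroot \<alpha> = 0" "\<alpha> \<bullet> coroot \<beta> = 0"
  shows "LS \<subseteq> stab 2"
proof
  \<comment> \<open>Exchanging the two roots provides the half multiples of the other root;
    \<open>N 2\<close> and \<open>stab 2\<close> are symmetric under the exchange.\<close>
  interpret r: reflection_pair \<beta> \<alpha> \<tau>2 t2 \<tau>1 t1
    by unfold_locales (use nz int \<tau> in auto)
  have rLS: "r.LS = LS"
    by (auto simp: r.LS_def LS_def)
  have "r.H.N 2 = H.N 2"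
    unfolding r.H.N_def H.N_def unfolding rLS by (intro Collect_cong conj_cong HOL.refl eq_commute)
  then have rs: "r.stab 2 = stab 2"
    by (simp add: r.stab_def stab_def rLS)
  note st = half_stab_2[OF assms] r.half_stab_2[OF assms(2,1), unfolded rs]
  fix \<mu> assume "\<mu> \<in> LS"
  then show "\<mu> \<in> stab 2"
  proof (rule stab_all[rotated])
    fix p' q' :: real assume "(p', q') \<in> {(1, 0), (-1, 0), (0, 1), (0, -1)}"
    then consider "p' = 1" "q' = 0" | "p' = -1" "q' = 0" | "p' = 0" "q' = 1" | "p' = 0" "q' = -1"
      by auto
    then show "\<exists>\<mu>\<in>stab 2. \<mu> \<bullet> coroot \<alpha> = p' \<and> \<mu> \<bullet> coroot \<beta> = q'"
    proof cases
      case 1 with st assms show ?thesis by (intro bexI[of _ "(1/2) *\<^sub>R \<alpha>"]) (simp_all add: pairings)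
    next
      case 2 with st assms show ?thesis by (intro bexI[of _ "(-1/2) *\<^sub>R \<alpha>"]) (simp_all add: pairings)
    next
      case 3 with st assms show ?thesis by (intro bexI[of _ "(1/2) *\<^sub>R \<beta>"]) (simp_all add: pairings)
    next
      case 4 with st assms show ?thesis by (intro bexI[of _ "(-1/2) *\<^sub>R \<beta>"]) (simp_all add: pairings)
    qed
  qed
qed

theorem (in reflection_pair) braid_DL:
  assumes "(\<beta> \<bullet> coroot \<alpha>, \<alpha> \<bullet> coroot \<beta>, k) \<in> {(0, 0, 2), (-1, -1, 3), (-2, -1, 4), (-3, -1, 6)}"
    and "k = 3 \<Longrightarrow> \<tau>1 = \<tau>2 \<and> t1 = t2" and "g \<in> MM"
  shows "altf k TA TB g = altf k TB TA g"
proof (rule braid_of_stab)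
  show "LS \<subseteq> stab k"
    using assms(1,2) stab_2 stab_3 stab_4 stab_6 by auto
qed (use assms in auto)

section \<open>Rank two subsystems\<close>

context affine_data
begin

lemma weyl_orbit_W0:
  assumes "w \<in> W0"
  shows "weyl_orbit D (w \<beta>) = weyl_orbit D \<beta>"
proof -
  obtain w' where w': "w' \<in> W0" "w \<circ> w' = id" "w' \<circ> w = id"
    using weyl_group_inverse[OF assms] by blast
  have "v (w \<beta>) \<in> weyl_orbit D \<beta>" if "v \<in> W0" for v
    using weyl_group_comp[OF that assms] unfolding weyl_orbit_def
    by (intro image_eqI[of _ _ "v \<circ> w"]) simp_all
  moreover have "v \<beta> \<in> weyl_orbit D (w \<beta>)" if "v \<in> W0" for v
  proof -
    have "v \<beta> = (v \<circ> w') (w \<beta>)"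
      using w'(3) by (simp add: fun_eq_iff)
    then show ?thesis
      using weyl_group_comp[OF that w'(1)] unfolding weyl_orbit_def by blast
  qed
  ultimately show ?thesis
    by (auto simp: weyl_orbit_def)
qed

abbreviation "cartan j k \<equiv> alpha D k \<bullet> coroot (alpha D j)"

lemma cartan_Ints: "j \<le> DIM('v) \<Longrightarrow> k \<le> DIM('v) \<Longrightarrow> cartan j k \<in> \<int>"
  by (rule int_\<Phi>) (rule alpha_in; assumption)+

lemma alpha_norm_pos: "j \<le> DIM('v) \<Longrightarrow> 0 < alpha D j \<bullet> alpha D j"
  using nonzero[OF alpha_in] by simp

lemma sar_sr_other: "sar j (sr k x) = sar j x - sar k x * cartan k j"
  by (simp add: sar_eq sr_eq inner_diff_right)

lemma opposite_translation:
  assumes j: "j \<le> DIM('v)" and opp: "alpha D k = - alpha D j"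
  shows "(sr j \<circ> sr k) x = x - (shift D j + shift D k) *\<^sub>R coroot (alpha D j)"
proof -
  have "alpha D j \<bullet> coroot (alpha D j) = 2"
    using inner_coroot_self[OF nonzero[OF alpha_in[OF j]]] .
  then have 1: "sar j (sr k x) = - sar j x + 2 * (sar j x + sar k x)"
    by (simp add: sar_sr_other opp coroot_minus)
  have 2: "sr k x = x + sar k x *\<^sub>R coroot (alpha D j)"
    by (simp add: sr_eq opp coroot_minus)
  have "sr j (sr k x) = x + sar k x *\<^sub>R coroot (alpha D j)
      - (- sar j x + 2 * (sar j x + sar k x)) *\<^sub>R coroot (alpha D j)"
    unfolding sr_eq[of j "sr k x"] 1 unfolding 2 ..
  also have "\<dots> = x - (sar j x + sar k x) *\<^sub>R coroot (alpha D j)"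
    by (simp add: algebra_simps) (simp flip: scaleR_left_distrib)
  also have "sar j x + sar k x = shift D j + shift D k"
    by (simp add: sar_eq opp)
  finally show ?thesis
    by simp
qed

text \<open>The product of reflections in two parallel hyperplanes is a translation. It is nonzero
  because distinct simple roots are never opposite, so index 0 and its positive shift must be
  involved; the order is therefore infinite, encoded as 0.\<close>

lemma opposite_order:
  assumes jk: "j \<le> DIM('v)" "k \<le> DIM('v)" "j \<noteq> k" and opp: "alpha D k = - alpha D j"
  shows "coxeter_order D j k = 0"
proof (rule ccontr)
  interpret group W by (rule group_W)
  let ?P = "sr j \<circ> sr k" and ?q = "coxeter_order D j k" and ?v = "(shift D j + shift D k) *\<^sub>R coroot (alpha D j)"
  assume "?q \<noteq> 0"
  have P: "?P \<in> carrier W"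
    using jk by (intro carrier_W_comp sr_in_W)
  have pow: "(?P [^]\<^bsub>W\<^esub> l) x = x - real l *\<^sub>R ?v" for l x
  proof (induction l)
    case (Suc l)
    have "?P [^]\<^bsub>W\<^esub> Suc l = ?P \<circ> ?P [^]\<^bsub>W\<^esub> l"
      using P by (simp only: nat_pow_Suc2 W_sel)
    then have "(?P [^]\<^bsub>W\<^esub> Suc l) x = ?P ((?P [^]\<^bsub>W\<^esub> l) x)"
      by simp
    then show ?case
      unfolding Suc opposite_translation[OF jk(1) opp] by (simp add: algebra_simps)
  qed simp
  have "?P [^]\<^bsub>W\<^esub> ?q = id"
    unfolding coxeter_order_def using pow_ord_eq_1[OF P] by simp
  then have "real ?q *\<^sub>R ?v = 0"
    using pow[of ?q 0] by simp
  moreover have "coroot (alpha D j) \<noteq> 0"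
    using nonzero[OF alpha_in[OF jk(1)]] by (simp add: coroot_def)
  ultimately have "shift D j + shift D k = 0"
    using \<open>?q \<noteq> 0\<close> by simp
  then have "j \<noteq> 0" "k \<noteq> 0"
    using c_pos jk(3) by (auto simp: shift_def split: if_splits)
  then have jI: "j \<in> {1..DIM('v)}" and kI: "k \<in> {1..DIM('v)}"
    using jk by auto
  have "\<omega> k \<bullet> \<alpha> k = - (\<omega> k \<bullet> \<alpha> j)"
    using opp by (simp add: alpha_simple[OF jI] alpha_simple[OF kI])
  then show False
    using \<omega>_simple[OF kI kI] \<omega>_simple[OF kI jI] jk(3) by simp
qed

lemma cartan_zero_iff: "j \<le> DIM('v) \<Longrightarrow> k \<le> DIM('v) \<Longrightarrow> cartan j k = 0 \<longleftrightarrow> cartan k j = 0"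
  using alpha_norm_pos[of j] alpha_norm_pos[of k] by (simp add: inner_coroot inner_commute)

text \<open>As in \<open>pairing_ints\<close>, but the product 4 has to be excluded: the equality
  case of Cauchy--Schwarz makes the gradients proportional, hence opposite by reducedness and the
  sign, and then the order would be 0.\<close>

lemma cartan_cases:
  assumes jk: "j \<le> DIM('v)" "k \<le> DIM('v)" "j \<noteq> k" and ord: "coxeter_order D j k \<noteq> 0"
  shows "(cartan j k, cartan k j) \<in> {(0, 0), (-1, -1), (-2, -1), (-1, -2), (-3, -1), (-1, -3)}"
proof -
  let ?a = "alpha D j" and ?b = "alpha D k"
  have a: "0 < ?a \<bullet> ?a" and b: "0 < ?b \<bullet> ?b"
    using alpha_norm_pos jk by auto
  obtain p q :: int where p: "cartan j k = of_int p" and q: "cartan k j = of_int q"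
    using cartan_Ints jk by (meson Ints_cases)
  have np: "?b \<bullet> ?a \<le> 0"
    using alpha_inner_nonpos[of k j] jk by simp
  then have "real_of_int p \<le> 0" "real_of_int q \<le> 0"
    using a b by (simp_all add: p[symmetric] q[symmetric] inner_coroot inner_commute divide_nonpos_pos)
  then have pq: "p \<le> 0" "q \<le> 0"
    by simp_all
  have prod: "real_of_int (p * q) * ((?a \<bullet> ?a) * (?b \<bullet> ?b)) = 4 * (?a \<bullet> ?b)\<^sup>2"
    using a b by (simp add: p[symmetric] q[symmetric] inner_coroot inner_commute power2_eq_square)
  have "p * q < 4"
  proof (rule ccontr)
    assume "\<not> p * q < 4"
    then have "(4::real) \<le> real_of_int (p * q)"
      by (metis not_less of_int_le_iff of_int_numeral)
    then have "4 * ((?a \<bullet> ?a) * (?b \<bullet> ?b)) \<le> real_of_int (p * q) * ((?a \<bullet> ?a) * (?b \<bullet> ?b))"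
      using a b by (intro mult_right_mono) (auto intro: less_imp_le)
    then have "(?a \<bullet> ?a) * (?b \<bullet> ?b) \<le> (?a \<bullet> ?b)\<^sup>2"
      unfolding prod by simp
    then have "(?a \<bullet> ?b)\<^sup>2 = (?a \<bullet> ?a) * (?b \<bullet> ?b)"
      using Cauchy_Schwarz_ineq[of ?a ?b] by simp
    then have "(?b - ((?a \<bullet> ?b) / (?a \<bullet> ?a)) *\<^sub>R ?a) \<bullet> (?b - ((?a \<bullet> ?b) / (?a \<bullet> ?a)) *\<^sub>R ?a) = 0"
      using a by (simp add: inner_diff_left inner_diff_right inner_commute power2_eq_square field_simps)
    then have ba: "?b = ((?a \<bullet> ?b) / (?a \<bullet> ?a)) *\<^sub>R ?a"
      by simp
    moreover define r where "r = (?a \<bullet> ?b) / (?a \<bullet> ?a)"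
    ultimately have br: "?b = r *\<^sub>R ?a"
      by simp
    have "r \<le> 0"
      using np a by (simp add: r_def inner_commute divide_nonpos_pos)
    moreover have "r = 1 \<or> r = -1"
      using reduced[OF alpha_in[OF jk(1)]] alpha_in[OF jk(2)] br by simp
    ultimately have "?b = - ?a"
      using br by auto
    then show False
      using opposite_order[OF jk] ord by simp
  qed
  moreover have "p = 0 \<longleftrightarrow> q = 0"
    using cartan_zero_iff[OF jk(1,2)] p q by simp
  moreover have "p < 0 \<Longrightarrow> q < 0 \<Longrightarrow> - q \<le> p * q \<and> - p \<le> p * q"
    using mult_right_mono_neg[of p "-1" q] mult_left_mono_neg[of q "-1" p] by auto
  ultimately have "p > -4" "q > -4" "p * q < 4" "p = 0 \<longleftrightarrow> q = 0"
    using pq by linarith+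
  then have "p \<in> {-3, -2, -1, 0}" "q \<in> {-3, -2, -1, 0}"
    using pq by auto
  then show ?thesis
    using \<open>p * q < 4\<close> \<open>p = 0 \<longleftrightarrow> q = 0\<close> by (auto simp: p q)
qed

lemma braid_reflections:
  assumes jk: "j \<le> DIM('v)" "k \<le> DIM('v)"
    and C: "(cartan j k, cartan k j, q) \<in> {(0, 0, 2), (-1, -1, 3), (-2, -1, 4), (-3, -1, 6)}"
  shows "wd (altl q j k) = wd (altl q k j)"
proof
  fix x
  \<comment> \<open>Both reflections preserve the plane through \<open>x\<close> spanned by the two
    coroots. In the coordinates \<open>y\<close>, \<open>z\<close> the braid identity becomes a
    finite computation with the Cartan integers.\<close>
  define st where "st y z = x - y *\<^sub>R coroot (alpha D j) - z *\<^sub>R coroot (alpha D k)" for y z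
  have self: "alpha D j \<bullet> coroot (alpha D j) = 2" "alpha D k \<bullet> coroot (alpha D k) = 2"
    using inner_coroot_self nonzero[OF alpha_in] jk by auto
  have sj: "sr j (st y z) = st (sar j x - y - z * cartan k j) z"
    and sk: "sr k (st y z) = st y (sar k x - z - y * cartan j k)" for y z
    by (simp_all add: sr_eq sar_eq st_def inner_diff_right self algebra_simps) (simp_all flip: scaleR_2 scaleR_left.add)
  have "x = st 0 0"
    by (simp add: st_def)
  moreover have "wd (altl q j k) (st 0 0) = wd (altl q k j) (st 0 0)"
    using C by (auto simp: numeral_eq_Suc sj sk algebra_simps)
  ultimately show "wd (altl q j k) x = wd (altl q k j) x"
    by simp
qed

text \<open>The order of the product divides \<open>q\<close>, so the proper divisors are the values
  to be ruled out. The two images of vertex \<open>j\<close>, where \<open>sar j\<close> is positive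
  and \<open>sar k\<close> vanishes, are told apart by \<open>sar j\<close>.\<close>

lemma wd_altl_lower:
  assumes jk: "j \<le> DIM('v)" "k \<le> DIM('v)" "j \<noteq> k"
    and C: "(cartan j k, cartan k j, q) \<in> {(0, 0, 2), (-1, -1, 3), (-2, -1, 4), (-3, -1, 6)}"
    and l: "0 < l" "l dvd q" "l \<noteq> q"
  shows "wd (altl l j k) \<noteq> wd (altl l k j)"
proof
  assume eq: "wd (altl l j k) = wd (altl l k j)"
  define p where "p = sar j (vert j)"
  have p: "0 < p" "sar k (vert j) = 0"
    using sar_vert_self[OF jk(1)] sar_vert[of k j] jk by (auto simp: p_def)
  have s: "sar j (sr j x) = - sar j x" "sar k (sr k x) = - sar k x" for x
    using sar_sr jk by auto
  have "sar j (wd (altl l j k) (vert j)) = sar j (wd (altl l k j) (vert j))"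
    by (simp add: eq)
  moreover have "(q, l) \<in> {(2, 1), (3, 1), (4, 1), (4, 2), (6, 1), (6, 2), (6, 3)}"
  proof -
    have q: "q \<in> {2, 3, 4, 6}"
      using C by auto
    then have "l \<le> 6"
      using dvd_imp_le[OF l(2)] by auto
    then have "l \<in> {1, 2, 3, 4, 5, 6}"
      using l(1) by auto
    then show ?thesis
      using q l(2,3) by (elim insertE emptyE) simp_all
  qed
  ultimately show False
    using C p by (auto simp: numeral_eq_Suc s sar_sr_other[of j k] sar_sr_other[of k j] p_def[symmetric])
qed

lemma coxeter_order_sym:
  assumes "j \<le> DIM('v)" "k \<le> DIM('v)"
  shows "coxeter_order D j k = coxeter_order D k j"
proof -
  interpret group W by (rule group_W)
  have P: "sr j \<circ> sr k \<in> carrier W" "sr k \<circ> sr j \<in> carrier W"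
    using assms by (auto intro: carrier_W_comp sr_in_W)
  have "(sr j \<circ> sr k) [^]\<^bsub>W\<^esub> q = id \<longleftrightarrow> (sr k \<circ> sr j) [^]\<^bsub>W\<^esub> q = id" for q :: nat
    using wd_altl_eq_iff[OF assms, of q] wd_altl_eq_iff[OF assms(2,1), of q] by metis
  then have "ord (sr j \<circ> sr k) dvd q \<longleftrightarrow> ord (sr k \<circ> sr j) dvd q" for q :: nat
    using pow_eq_id[OF P(1), of q] pow_eq_id[OF P(2), of q] by simp
  then show ?thesis
    unfolding coxeter_order_def by (meson dvd_antisym dvd_refl)
qed

lemma coxeter_order_cartan:
  assumes jk: "j \<le> DIM('v)" "k \<le> DIM('v)" "j \<noteq> k"
    and C: "(cartan j k, cartan k j, q) \<in> {(0, 0, 2), (-1, -1, 3), (-2, -1, 4), (-3, -1, 6)}"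
  shows "coxeter_order D j k = q"
proof (rule ccontr)
  interpret group W by (rule group_W)
  have P: "sr j \<circ> sr k \<in> carrier W"
    using jk by (auto intro: carrier_W_comp sr_in_W)
  assume ne: "coxeter_order D j k \<noteq> q"
  have "(sr j \<circ> sr k) [^]\<^bsub>W\<^esub> q = \<one>\<^bsub>W\<^esub>"
    using braid_reflections[OF jk(1,2) C] wd_altl_eq_iff[OF jk(1,2), of q] by simp
  then have d: "coxeter_order D j k dvd q"
    unfolding coxeter_order_def using pow_eq_id[OF P] by blast
  have "(sr j \<circ> sr k) [^]\<^bsub>W\<^esub> coxeter_order D j k = id"
    unfolding coxeter_order_def using pow_ord_eq_1[OF P] by simp
  then have "wd (altl (coxeter_order D j k) j k) = wd (altl (coxeter_order D j k) k j)"
    using wd_altl_eq_iff[OF jk(1,2)] by blast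
  moreover have "0 < coxeter_order D j k"
    using d C by (auto intro!: gr0I)
  ultimately show False
    using wd_altl_lower[OF jk C _ d ne] by blast
qed

lemma rank_two:
  assumes jk: "j \<le> DIM('v)" "k \<le> DIM('v)" "j \<noteq> k" and ord: "coxeter_order D j k \<noteq> 0"
  defines "S \<equiv> {(0, 0, 2), (-1, -1, 3), (-2, -1, 4), (-3, -1, 6)}"
  shows "(cartan j k, cartan k j, coxeter_order D j k) \<in> S \<or> (cartan k j, cartan j k, coxeter_order D j k) \<in> S"
proof -
  obtain q where "(cartan j k, cartan k j, q) \<in> S \<or> (cartan k j, cartan j k, q) \<in> S"
    using cartan_cases[OF jk ord] unfolding S_def by blast
  then show ?thesis
    using coxeter_order_cartan[of j k q] coxeter_order_cartan[of k j q] coxeter_order_sym[of j k] jk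
    unfolding S_def by metis
qed

text \<open>In type A2 the product of the two reflections carries one root to the other, so the
  parameters agree in the braid relation with three factors.\<close>

lemma weyl_orbit_cartan:
  assumes jk: "j \<le> DIM('v)" "k \<le> DIM('v)" and C: "cartan j k = -1" "cartan k j = -1"
  shows "weyl_orbit D (alpha D j) = weyl_orbit D (alpha D k)"
proof -
  have "reflection (alpha D j) (reflection (alpha D k) (alpha D j)) = alpha D k"
    using C inner_coroot_self[OF nonzero[OF alpha_in[OF jk(1)]]]
    by (simp add: reflection_alt inner_add_left scaleR_2)
  moreover have "reflection (alpha D j) \<circ> reflection (alpha D k) \<in> W0"
    using alpha_in jk by (intro weyl_group_comp weyl_group_reflection)
  ultimately show ?thesis
    using weyl_orbit_W0[of "reflection (alpha D j) \<circ> reflection (alpha D k)" "alpha D j"] by simp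
qed

lemma common_zero:
  assumes jk: "j \<le> DIM('v)" "k \<le> DIM('v)" "j \<noteq> k" and ord: "coxeter_order D j k \<noteq> 0"
  shows "\<exists>x. sar j x = 0 \<and> sar k x = 0"
proof -
  let ?a = "alpha D j" and ?b = "alpha D k"
  define d where "d = (?a \<bullet> ?a) * (?b \<bullet> ?b) - (?a \<bullet> ?b)\<^sup>2"
  have n: "0 < ?a \<bullet> ?a" "0 < ?b \<bullet> ?b"
    using alpha_norm_pos jk by auto
  have "cartan j k * cartan k j * ((?a \<bullet> ?a) * (?b \<bullet> ?b)) = 4 * (?a \<bullet> ?b)\<^sup>2"
    using n by (simp add: inner_coroot inner_commute power2_eq_square)
  moreover have "cartan j k * cartan k j \<noteq> 4"
    using cartan_cases[OF jk ord] by auto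
  ultimately have d: "d \<noteq> 0"
    using n by (auto simp: d_def)
  \<comment> \<open>Cramer's rule in the span of the two gradients; \<open>d\<close> is their Gram
    determinant.\<close>
  define x where "x = ((shift D k * (?a \<bullet> ?b) - shift D j * (?b \<bullet> ?b)) / d) *\<^sub>R ?a
      + ((shift D j * (?a \<bullet> ?b) - shift D k * (?a \<bullet> ?a)) / d) *\<^sub>R ?b"
  have "d * (?a \<bullet> x) = (shift D k * (?a \<bullet> ?b) - shift D j * (?b \<bullet> ?b)) * (?a \<bullet> ?a)
      + (shift D j * (?a \<bullet> ?b) - shift D k * (?a \<bullet> ?a)) * (?a \<bullet> ?b)"
    using d by (simp add: x_def inner_add_right field_simps)
  also have "\<dots> = d * (- shift D j)"
    by (simp add: d_def algebra_simps power2_eq_square)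
  finally have 1: "?a \<bullet> x = - shift D j"
    using mult_left_cancel[OF d] by blast
  have "d * (?b \<bullet> x) = (shift D k * (?a \<bullet> ?b) - shift D j * (?b \<bullet> ?b)) * (?a \<bullet> ?b)
      + (shift D j * (?a \<bullet> ?b) - shift D k * (?a \<bullet> ?a)) * (?b \<bullet> ?b)"
    using d by (simp add: x_def inner_add_right inner_commute[of ?b ?a] field_simps)
  also have "\<dots> = d * (- shift D k)"
    by (simp add: d_def algebra_simps power2_eq_square)
  finally have 2: "?b \<bullet> x = - shift D k"
    using mult_left_cancel[OF d] by blast
  show ?thesis
    using 1 2 by (intro exI[of _ x]) (simp add: sar_eq)
qed

end

section \<open>Localization at regular elements\<close>

text \<open>All denominators are non-zero-divisors, so the auxiliary factor in
  \<open>frac_rel\<close> cancels and the ring embeds into its localization.\<close>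

locale regular_localization =
  fixes R :: "('a::comm_ring_1, 'b) ring_scheme" and S :: "'a set"
  assumes sub: "subring_set (carrier R)"
    and R_sel [simp]: "mult R = (*)" "one R = 1" "zero R = 0" "add R = (+)"
    and S_sub: "S \<subseteq> carrier R" and S_one: "1 \<in> S"
    and S_mult: "s \<in> S \<Longrightarrow> t \<in> S \<Longrightarrow> s * t \<in> S"
    and S_reg: "s \<in> S \<Longrightarrow> regular s"
begin

abbreviation "fr a s \<equiv> frac_rel R S `` {(a, s)}"
abbreviation "L \<equiv> localization R S"

lemma S_carrier: "s \<in> S \<Longrightarrow> s \<in> carrier R"
  using S_sub by blast

lemmas R_closed = subring_setD[OF sub]

lemma frac_rel_iff:
  "((a, s), (b, t)) \<in> frac_rel R S \<longleftrightarrow>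
     a \<in> carrier R \<and> b \<in> carrier R \<and> s \<in> S \<and> t \<in> S \<and> a * t = b * s"
proof -
  have "u * (a * t) = u * (b * s) \<longleftrightarrow> a * t = b * s" if "u \<in> S" for u
    using regular_cancel[OF S_reg[OF that]] by auto
  then show ?thesis
    using S_one by (auto simp: frac_rel_def)
qed

lemma equiv_frac_rel: "equiv (carrier R \<times> S) (frac_rel R S)"
proof (rule equivI)
  show "frac_rel R S \<subseteq> (carrier R \<times> S) \<times> carrier R \<times> S"
    by (auto simp: frac_rel_iff)
  show "refl_on (carrier R \<times> S) (frac_rel R S)"
    by (rule refl_onI) (auto simp: frac_rel_iff)
  show "sym (frac_rel R S)"
    by (rule symI) (auto simp: frac_rel_iff)
  show "trans (frac_rel R S)"
  proof (rule transI)
    fix x y z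
    assume xy: "(x, y) \<in> frac_rel R S" and yz: "(y, z) \<in> frac_rel R S"
    obtain a s b t c u where [simp]: "x = (a, s)" "y = (b, t)" "z = (c, u)"
      by (metis prod.exhaust)
    have "t * (a * u) = u * (a * t)"
      by (simp add: ac_simps)
    also have "\<dots> = u * (b * s)"
      using xy by (simp add: frac_rel_iff)
    also have "\<dots> = s * (b * u)"
      by (simp add: ac_simps)
    also have "\<dots> = s * (c * t)"
      using yz by (simp add: frac_rel_iff)
    finally have "t * (a * u) = t * (c * s)"
      by (simp add: ac_simps)
    then show "(x, z) \<in> frac_rel R S"
      using xy yz regular_cancel[OF S_reg] by (auto simp: frac_rel_iff)
  qed
qed

lemma fr_eq_iff:
  assumes "a \<in> carrier R" "b \<in> carrier R" "s \<in> S" "t \<in> S"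
  shows "fr a s = fr b t \<longleftrightarrow> a * t = b * s"
  using eq_equiv_class_iff[OF equiv_frac_rel, of "(a, s)" "(b, t)"] assms by (simp add: frac_rel_iff)

lemma fr_closed: "a \<in> carrier R \<Longrightarrow> s \<in> S \<Longrightarrow> fr a s \<in> carrier L"
  by (auto simp: localization_def intro: quotientI)

lemma fr_cases:
  assumes "x \<in> carrier L"
  obtains a s where "a \<in> carrier R" "s \<in> S" "x = fr a s"
  using assms by (auto simp: localization_def elim!: quotientE)

text \<open>Operations on fractions are unions over all choices of representatives; when the
  possible results are equivalent, one choice computes the whole class.\<close>

lemma Image_related:
  assumes "p \<in> X" "\<And>q. q \<in> X \<Longrightarrow> (p, q) \<in> frac_rel R S"
  shows "frac_rel R S `` X = frac_rel R S `` {p}"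
proof -
  have "frac_rel R S `` {q} = frac_rel R S `` {p}" if "q \<in> X" for q
    using equiv_class_eq[OF equiv_frac_rel assms(2)[OF that]] by simp
  then show ?thesis
    using assms(1) by blast
qed

lemma fr_mult:
  assumes "a \<in> carrier R" "b \<in> carrier R" "s \<in> S" "t \<in> S"
  shows "fr a s \<otimes>\<^bsub>L\<^esub> fr b t = fr (a * b) (s * t)"
proof -
  have "a * b * (s' * t') = a' * b' * (s * t)" if "a * s' = a' * s" "b * t' = b' * t" for a' s' b' t'
  proof -
    have "a * b * (s' * t') = (a * s') * (b * t')"
      by (simp add: ac_simps)
    then show ?thesis
      unfolding that by (simp add: ac_simps)
  qed
  then show ?thesis
    unfolding localization_def monoid.simps R_sel
    by (intro Image_related) (use assms in \<open>fastforce simp: frac_rel_iff R_closed S_mult\<close>)+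
qed

lemma fr_add:
  assumes "a \<in> carrier R" "b \<in> carrier R" "s \<in> S" "t \<in> S"
  shows "fr a s \<oplus>\<^bsub>L\<^esub> fr b t = fr (a * t + b * s) (s * t)"
proof -
  have "(a * t + b * s) * (s' * t') = (a' * t' + b' * s') * (s * t)"
    if "a * s' = a' * s" "b * t' = b' * t" for a' s' b' t'
  proof -
    have "(a * t + b * s) * (s' * t') = (a * s') * (t * t') + (b * t') * (s * s')"
      by (simp add: algebra_simps)
    then show ?thesis
      unfolding that by (simp add: algebra_simps)
  qed
  then show ?thesis
    unfolding localization_def ring.simps R_sel
    by (intro Image_related) (use assms S_carrier in \<open>fastforce simp: frac_rel_iff R_closed S_mult\<close>)+
qed

lemma one_L: "\<one>\<^bsub>L\<^esub> = fr 1 1" and zero_L: "\<zero>\<^bsub>L\<^esub> = fr 0 1"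
  by (simp_all add: localization_def)

lemma cring_L: "cring L"
proof (rule cringI)
  note C = R_closed S_carrier S_mult S_one
  show "abelian_group L"
  proof (rule abelian_groupI)
    fix x y z assume "x \<in> carrier L" "y \<in> carrier L" "z \<in> carrier L"
    then obtain a b c s t u where
      x: "a \<in> carrier R" "s \<in> S" "x = fr a s" and y: "b \<in> carrier R" "t \<in> S" "y = fr b t" and
      z: "c \<in> carrier R" "u \<in> S" "z = fr c u"
      by (metis fr_cases)
    show "x \<oplus>\<^bsub>L\<^esub> y \<in> carrier L"
      using x y by (simp add: fr_add fr_closed C)
    show "x \<oplus>\<^bsub>L\<^esub> y \<oplus>\<^bsub>L\<^esub> z = x \<oplus>\<^bsub>L\<^esub> (y \<oplus>\<^bsub>L\<^esub> z)"
      using x y z by (auto simp: fr_add C algebra_simps)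
    show "x \<oplus>\<^bsub>L\<^esub> y = y \<oplus>\<^bsub>L\<^esub> x"
      using x y by (auto simp: fr_add algebra_simps)
    show "\<zero>\<^bsub>L\<^esub> \<oplus>\<^bsub>L\<^esub> x = x"
      using x by (auto simp: fr_add zero_L C)
    show "\<exists>y\<in>carrier L. y \<oplus>\<^bsub>L\<^esub> x = \<zero>\<^bsub>L\<^esub>"
    proof (rule bexI)
      show "fr (- a) s \<oplus>\<^bsub>L\<^esub> x = \<zero>\<^bsub>L\<^esub>"
        unfolding x(3) zero_L using x by (simp add: fr_add fr_eq_iff C)
    qed (use x in \<open>simp add: fr_closed C\<close>)
  qed (simp add: zero_L fr_closed C)
  show "comm_monoid L"
  proof (rule comm_monoidI)
    fix x y z assume "x \<in> carrier L" "y \<in> carrier L" "z \<in> carrier L"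
    then obtain a b c s t u where
      x: "a \<in> carrier R" "s \<in> S" "x = fr a s" and y: "b \<in> carrier R" "t \<in> S" "y = fr b t" and
      z: "c \<in> carrier R" "u \<in> S" "z = fr c u"
      by (metis fr_cases)
    show "x \<otimes>\<^bsub>L\<^esub> y \<in> carrier L"
      using x y by (simp add: fr_mult fr_closed C)
    show "x \<otimes>\<^bsub>L\<^esub> y \<otimes>\<^bsub>L\<^esub> z = x \<otimes>\<^bsub>L\<^esub> (y \<otimes>\<^bsub>L\<^esub> z)"
      using x y z by (auto simp: fr_mult C algebra_simps)
    show "x \<otimes>\<^bsub>L\<^esub> y = y \<otimes>\<^bsub>L\<^esub> x"
      using x y by (auto simp: fr_mult algebra_simps)
    show "\<one>\<^bsub>L\<^esub> \<otimes>\<^bsub>L\<^esub> x = x"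
      using x by (auto simp: fr_mult one_L C)
  qed (simp add: one_L fr_closed C)
  fix x y z assume "x \<in> carrier L" "y \<in> carrier L" "z \<in> carrier L"
  then obtain a b c s t u where
    x: "a \<in> carrier R" "s \<in> S" "x = fr a s" and y: "b \<in> carrier R" "t \<in> S" "y = fr b t" and
    z: "c \<in> carrier R" "u \<in> S" "z = fr c u"
    by (metis fr_cases)
  show "(x \<oplus>\<^bsub>L\<^esub> y) \<otimes>\<^bsub>L\<^esub> z = x \<otimes>\<^bsub>L\<^esub> z \<oplus>\<^bsub>L\<^esub> y \<otimes>\<^bsub>L\<^esub> z"
    unfolding x(3) y(3) z(3) using x(1,2) y(1,2) z(1,2)
    by (simp add: fr_mult fr_add C fr_eq_iff) (simp add: algebra_simps)
qed

abbreviation "emb \<equiv> to_localization R S"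

lemma emb_fr: "emb a = fr a 1"
  by (simp add: to_localization_def)

lemma emb_closed: "a \<in> carrier R \<Longrightarrow> emb a \<in> carrier L"
  by (simp add: emb_fr fr_closed S_one)

lemma emb_add: "a \<in> carrier R \<Longrightarrow> b \<in> carrier R \<Longrightarrow> emb (a + b) = emb a \<oplus>\<^bsub>L\<^esub> emb b"
  by (simp add: emb_fr fr_add S_one)

lemma emb_mult: "a \<in> carrier R \<Longrightarrow> b \<in> carrier R \<Longrightarrow> emb (a * b) = emb a \<otimes>\<^bsub>L\<^esub> emb b"
  by (simp add: emb_fr fr_mult S_one)

lemma emb_one: "emb 1 = \<one>\<^bsub>L\<^esub>" and emb_zero: "emb 0 = \<zero>\<^bsub>L\<^esub>"
  by (simp_all add: emb_fr one_L zero_L)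

lemma emb_inj: "a \<in> carrier R \<Longrightarrow> b \<in> carrier R \<Longrightarrow> emb a = emb b \<longleftrightarrow> a = b"
  by (simp add: emb_fr fr_eq_iff S_one)

lemma emb_minus:
  assumes "a \<in> carrier R"
  shows "emb (- a) = \<ominus>\<^bsub>L\<^esub> emb a"
proof -
  interpret L: cring L by (rule cring_L)
  have "emb (- a) \<oplus>\<^bsub>L\<^esub> emb a = \<zero>\<^bsub>L\<^esub>"
    using assms by (simp add: emb_add[symmetric] R_closed emb_zero)
  then show ?thesis
    using assms by (intro L.minus_equality[symmetric]) (auto simp: emb_closed R_closed)
qed

lemma emb_diff:
  assumes "a \<in> carrier R" "b \<in> carrier R"
  shows "emb (a - b) = emb a \<ominus>\<^bsub>L\<^esub> emb b"
  using assms emb_add[of a "- b"] by (simp add: emb_minus a_minus_def R_closed)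

lemma emb_cancel:
  assumes "regular a" "a \<in> carrier R" "x \<in> carrier L" "emb a \<otimes>\<^bsub>L\<^esub> x = \<zero>\<^bsub>L\<^esub>"
  shows "x = \<zero>\<^bsub>L\<^esub>"
proof -
  obtain b s where x: "b \<in> carrier R" "s \<in> S" "x = fr b s"
    using assms(3) by (rule fr_cases)
  have "a * b = 0"
    using assms x by (simp add: emb_fr fr_mult zero_L fr_eq_iff S_one R_closed)
  then have "b = 0"
    using regularD[OF assms(1)] by simp
  then show ?thesis
    using x by (simp add: zero_L fr_eq_iff S_one R_closed)
qed

lemma emb_Units:
  assumes "a \<in> carrier R" "b \<in> carrier R" "a * b \<in> S"
  shows "emb a \<in> Units L"
proof -
  interpret L: cring L by (rule cring_L)
  have "emb a \<otimes>\<^bsub>L\<^esub> fr b (a * b) = \<one>\<^bsub>L\<^esub>"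
    using assms by (simp add: emb_fr fr_mult S_one one_L fr_eq_iff R_closed)
  then show ?thesis
    using assms L.m_comm[of "emb a" "fr b (a * b)"] emb_closed[of a] fr_closed[of b "a * b"]
    by (auto simp: Units_def intro!: bexI[of _ "fr b (a * b)"])
qed

end

locale regular_localization_map = regular_localization +
  fixes h :: "'a \<Rightarrow> 'a"
  assumes h_closed: "a \<in> carrier R \<Longrightarrow> h a \<in> carrier R"
    and h_S: "s \<in> S \<Longrightarrow> h s \<in> S"
    and h_add: "a \<in> carrier R \<Longrightarrow> b \<in> carrier R \<Longrightarrow> h (a + b) = h a + h b"
    and h_mult: "a \<in> carrier R \<Longrightarrow> b \<in> carrier R \<Longrightarrow> h (a * b) = h a * h b"
    and h_one: "h 1 = 1"
begin

abbreviation "hL \<equiv> localization_map R S h"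

lemma hL_fr:
  assumes "a \<in> carrier R" "s \<in> S"
  shows "hL (fr a s) = fr (h a) (h s)"
  unfolding localization_map_def
proof (rule Image_related)
  show "(h a, h s) \<in> {(h a', h s') |a' s'. (a', s') \<in> fr a s}"
    using assms by (force simp: frac_rel_iff)
next
  fix q assume "q \<in> {(h a', h s') |a' s'. (a', s') \<in> fr a s}"
  then obtain a' s' where q: "q = (h a', h s')" and "a' \<in> carrier R" "s' \<in> S" "a * s' = a' * s"
    by (auto simp: frac_rel_iff)
  moreover from this have "h a * h s' = h a' * h s"
    using assms S_carrier by (metis h_mult)
  ultimately show "((h a, h s), q) \<in> frac_rel R S"
    using assms by (simp add: frac_rel_iff h_closed h_S)
qed

lemma hL_emb: "a \<in> carrier R \<Longrightarrow> hL (emb a) = emb (h a)"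
  by (simp add: emb_fr hL_fr S_one h_one)

lemma hL_hom: "hL \<in> ring_hom L L"
proof (rule ring_hom_memI)
  note C = R_closed S_carrier S_mult S_one h_closed h_S
  fix x y assume "x \<in> carrier L" "y \<in> carrier L"
  then obtain a b s t where
    x: "a \<in> carrier R" "s \<in> S" "x = fr a s" and y: "b \<in> carrier R" "t \<in> S" "y = fr b t"
    by (metis fr_cases)
  show "hL x \<in> carrier L"
    using x by (simp add: hL_fr fr_closed C)
  show "hL (x \<otimes>\<^bsub>L\<^esub> y) = hL x \<otimes>\<^bsub>L\<^esub> hL y"
    using x y by (simp add: hL_fr fr_mult C h_mult)
  show "hL (x \<oplus>\<^bsub>L\<^esub> y) = hL x \<oplus>\<^bsub>L\<^esub> hL y"
    using x y by (simp add: hL_fr fr_add C h_mult h_add)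
qed (simp add: one_L hL_fr R_closed S_one h_one)

end

section \<open>Smash products\<close>

locale smash_setting = A: cring A + G: group G
  for A :: "('a, 'c) ring_scheme" and G :: "('g, 'd) monoid_scheme" and act :: "'g \<Rightarrow> 'a \<Rightarrow> 'a" +
  assumes act_hom: "x \<in> carrier G \<Longrightarrow> act x \<in> ring_hom A A"
    and act_one: "a \<in> carrier A \<Longrightarrow> act \<one>\<^bsub>G\<^esub> a = a"
    and act_mult: "x \<in> carrier G \<Longrightarrow> y \<in> carrier G \<Longrightarrow> a \<in> carrier A \<Longrightarrow>
      act (x \<otimes>\<^bsub>G\<^esub> y) a = act x (act y a)"
begin

abbreviation "SP \<equiv> smash_product A G act"
abbreviation "el \<equiv> smash_elem A"

lemma act_closed [simp]: "x \<in> carrier G \<Longrightarrow> a \<in> carrier A \<Longrightarrow> act x a \<in> carrier A"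
  using act_hom by (auto dest: ring_hom_closed)

lemma act_zero [simp]: "x \<in> carrier G \<Longrightarrow> act x \<zero>\<^bsub>A\<^esub> = \<zero>\<^bsub>A\<^esub>"
  using ring_hom_zero[OF act_hom A.ring_axioms A.ring_axioms] .

lemma act_add [simp]: "x \<in> carrier G \<Longrightarrow> a \<in> carrier A \<Longrightarrow> b \<in> carrier A \<Longrightarrow>
    act x (a \<oplus>\<^bsub>A\<^esub> b) = act x a \<oplus>\<^bsub>A\<^esub> act x b"
  by (rule ring_hom_add[OF act_hom])

lemma act_times [simp]: "x \<in> carrier G \<Longrightarrow> a \<in> carrier A \<Longrightarrow> b \<in> carrier A \<Longrightarrow>
    act x (a \<otimes>\<^bsub>A\<^esub> b) = act x a \<otimes>\<^bsub>A\<^esub> act x b"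
  by (rule ring_hom_mult[OF act_hom])

lemma act_unit [simp]: "x \<in> carrier G \<Longrightarrow> act x \<one>\<^bsub>A\<^esub> = \<one>\<^bsub>A\<^esub>"
  by (rule ring_hom_one[OF act_hom])

lemma carrier_SP: "F \<in> carrier SP \<longleftrightarrow>
    (\<forall>x. F x \<in> carrier A) \<and> (\<forall>x. x \<notin> carrier G \<longrightarrow> F x = \<zero>\<^bsub>A\<^esub>) \<and> finite {x. F x \<noteq> \<zero>\<^bsub>A\<^esub>}"
  by (simp add: smash_product_def)

lemma add_SP: "F \<oplus>\<^bsub>SP\<^esub> H = (\<lambda>x. F x \<oplus>\<^bsub>A\<^esub> H x)"
  by (simp add: smash_product_def)

lemma zero_SP: "\<zero>\<^bsub>SP\<^esub> = (\<lambda>x. \<zero>\<^bsub>A\<^esub>)"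
  by (simp add: smash_product_def)

lemma one_SP: "\<one>\<^bsub>SP\<^esub> = el \<one>\<^bsub>A\<^esub> \<one>\<^bsub>G\<^esub>"
  by (simp add: smash_product_def smash_elem_def)

lemma mult_SP_notin: "z \<notin> carrier G \<Longrightarrow> (F \<otimes>\<^bsub>SP\<^esub> H) z = \<zero>\<^bsub>A\<^esub>"
  by (simp add: smash_product_def)

text \<open>Enlarging the index set of the convolution provides one common set for several factors,
  as distributivity requires.\<close>

lemma mult_SP_superset:
  assumes "F \<in> carrier SP" "H \<in> carrier SP" "finite S" "{x. F x \<noteq> \<zero>\<^bsub>A\<^esub>} \<subseteq> S" "S \<subseteq> carrier G" "z \<in> carrier G"
  shows "(F \<otimes>\<^bsub>SP\<^esub> H) z = (\<Oplus>\<^bsub>A\<^esub>x\<in>S. F x \<otimes>\<^bsub>A\<^esub> act x (H (inv\<^bsub>G\<^esub> x \<otimes>\<^bsub>G\<^esub> z)))"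
proof -
  have "(F \<otimes>\<^bsub>SP\<^esub> H) z = (\<Oplus>\<^bsub>A\<^esub>x\<in>{x. F x \<noteq> \<zero>\<^bsub>A\<^esub>}. F x \<otimes>\<^bsub>A\<^esub> act x (H (inv\<^bsub>G\<^esub> x \<otimes>\<^bsub>G\<^esub> z)))"
    using assms(6) by (simp add: smash_product_def)
  also have "\<dots> = (\<Oplus>\<^bsub>A\<^esub>x\<in>S. F x \<otimes>\<^bsub>A\<^esub> act x (H (inv\<^bsub>G\<^esub> x \<otimes>\<^bsub>G\<^esub> z)))"
    by (rule A.add.finprod_mono_neutral_cong_left)
      (use assms in \<open>auto simp: carrier_SP subset_iff intro!: A.m_closed act_closed\<close>)
  finally show ?thesis .
qed

lemma supp_G: "F \<in> carrier SP \<Longrightarrow> {x. F x \<noteq> \<zero>\<^bsub>A\<^esub>} \<subseteq> carrier G"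
  by (auto simp: carrier_SP)

lemma mult_SP_closed:
  assumes F: "F \<in> carrier SP" and H: "H \<in> carrier SP"
  shows "F \<otimes>\<^bsub>SP\<^esub> H \<in> carrier SP"
proof -
  let ?SF = "{x. F x \<noteq> \<zero>\<^bsub>A\<^esub>}" and ?SH = "{x. H x \<noteq> \<zero>\<^bsub>A\<^esub>}"
  have fin: "finite ?SF" "finite ?SH" and SF: "?SF \<subseteq> carrier G"
    using F H supp_G[OF F] by (auto simp: carrier_SP)
  have cl: "F x \<in> carrier A" "H x \<in> carrier A" for x
    using F H by (auto simp: carrier_SP)
  have supp: "{z. (F \<otimes>\<^bsub>SP\<^esub> H) z \<noteq> \<zero>\<^bsub>A\<^esub>} \<subseteq> (\<lambda>(x, y). x \<otimes>\<^bsub>G\<^esub> y) ` (?SF \<times> ?SH)"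
  proof (rule subsetI, rule ccontr)
    fix z assume z: "z \<in> {z. (F \<otimes>\<^bsub>SP\<^esub> H) z \<noteq> \<zero>\<^bsub>A\<^esub>}" and
      nz: "z \<notin> (\<lambda>(x, y). x \<otimes>\<^bsub>G\<^esub> y) ` (?SF \<times> ?SH)"
    then have zG: "z \<in> carrier G"
      using mult_SP_notin by auto
    have H0: "H (inv\<^bsub>G\<^esub> x \<otimes>\<^bsub>G\<^esub> z) = \<zero>\<^bsub>A\<^esub>" if "x \<in> ?SF" for x
    proof (rule ccontr)
      assume "H (inv\<^bsub>G\<^esub> x \<otimes>\<^bsub>G\<^esub> z) \<noteq> \<zero>\<^bsub>A\<^esub>"
      moreover have "z = x \<otimes>\<^bsub>G\<^esub> (inv\<^bsub>G\<^esub> x \<otimes>\<^bsub>G\<^esub> z)"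
        using that SF zG by (simp add: G.m_assoc[symmetric] subset_iff)
      ultimately show False
        using nz that by force
    qed
    have "(F \<otimes>\<^bsub>SP\<^esub> H) z = \<zero>\<^bsub>A\<^esub>"
      unfolding mult_SP_superset[OF F H fin(1) subset_refl SF zG]
      by (rule A.add.finprod_one_eqI) (use H0 SF cl in \<open>auto simp: subset_iff\<close>)
    with z show False by simp
  qed
  have "(F \<otimes>\<^bsub>SP\<^esub> H) z \<in> carrier A" for z
  proof (cases "z \<in> carrier G")
    case True
    then show ?thesis
      unfolding mult_SP_superset[OF F H fin(1) subset_refl SF True]
      using SF cl by (intro A.finsum_closed) (auto simp: subset_iff)
  qed (simp add: mult_SP_notin)
  then show ?thesis
    using finite_subset[OF supp] fin by (auto simp: carrier_SP mult_SP_notin)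
qed

lemma SP_eqI:
  "F \<in> carrier SP \<Longrightarrow> H \<in> carrier SP \<Longrightarrow> (\<And>x. x \<in> carrier G \<Longrightarrow> F x = H x) \<Longrightarrow> F = H"
  by (rule ext) (metis carrier_SP)

lemma supp_add: "F \<in> carrier SP \<Longrightarrow> H \<in> carrier SP \<Longrightarrow>
    {x. F x \<oplus>\<^bsub>A\<^esub> H x \<noteq> \<zero>\<^bsub>A\<^esub>} \<subseteq> {x. F x \<noteq> \<zero>\<^bsub>A\<^esub>} \<union> {x. H x \<noteq> \<zero>\<^bsub>A\<^esub>}"
  by (auto simp: carrier_SP)

lemma add_SP_closed:
  assumes "F \<in> carrier SP" "H \<in> carrier SP"
  shows "F \<oplus>\<^bsub>SP\<^esub> H \<in> carrier SP"
  using assms finite_subset[OF supp_add[OF assms]] by (auto simp: carrier_SP add_SP)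

lemma abelian_group_SP: "abelian_group SP"
proof (rule abelian_groupI)
  fix F assume F: "F \<in> carrier SP"
  have "{x. \<ominus>\<^bsub>A\<^esub> F x \<noteq> \<zero>\<^bsub>A\<^esub>} \<subseteq> {x. F x \<noteq> \<zero>\<^bsub>A\<^esub>}"
    by auto
  then have "(\<lambda>x. \<ominus>\<^bsub>A\<^esub> F x) \<in> carrier SP"
    using F finite_subset by (fastforce simp: carrier_SP)
  then show "\<exists>H\<in>carrier SP. H \<oplus>\<^bsub>SP\<^esub> F = \<zero>\<^bsub>SP\<^esub>"
    using F by (intro bexI[of _ "\<lambda>x. \<ominus>\<^bsub>A\<^esub> F x"]) (auto simp: add_SP zero_SP carrier_SP A.l_neg)
qed (simp_all only: add_SP_closed, auto simp: add_SP zero_SP carrier_SP A.a_ac)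

lemma el_closed: "a \<in> carrier A \<Longrightarrow> x \<in> carrier G \<Longrightarrow> el a x \<in> carrier SP"
  by (auto simp: carrier_SP smash_elem_def intro: finite_subset[of _ "{x}"])

lemma el_add: "a \<in> carrier A \<Longrightarrow> b \<in> carrier A \<Longrightarrow> el (a \<oplus>\<^bsub>A\<^esub> b) x = el a x \<oplus>\<^bsub>SP\<^esub> el b x"
  by (rule ext) (simp add: smash_elem_def add_SP)

lemma el_mult:
  "a \<in> carrier A \<Longrightarrow> b \<in> carrier A \<Longrightarrow> x \<in> carrier G \<Longrightarrow> y \<in> carrier G \<Longrightarrow>
     el a x \<otimes>\<^bsub>SP\<^esub> el b y = el (a \<otimes>\<^bsub>A\<^esub> act x b) (x \<otimes>\<^bsub>G\<^esub> y)"
  by (rule smash_elem_mult) (auto simp: A.ring_axioms G.group_axioms)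

lemma SP_induct [consumes 1, case_names zero add_el]:
  assumes F: "F \<in> carrier SP" and zero: "P \<zero>\<^bsub>SP\<^esub>"
    and step: "\<And>a x H. a \<in> carrier A \<Longrightarrow> x \<in> carrier G \<Longrightarrow> H \<in> carrier SP \<Longrightarrow> P H \<Longrightarrow> P (el a x \<oplus>\<^bsub>SP\<^esub> H)"
  shows "P F"
proof -
  have "P F" if "F \<in> carrier SP" "{x. F x \<noteq> \<zero>\<^bsub>A\<^esub>} \<subseteq> S" "finite S" for F S
    using that(3,1,2)
  proof (induction S arbitrary: F)
    case empty
    then have "F = \<zero>\<^bsub>SP\<^esub>"
      by (auto simp: zero_SP)
    then show ?case
      using zero by simp
  next
    case (insert y S)
    let ?H = "\<lambda>x. if x = y then \<zero>\<^bsub>A\<^esub> else F x"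
    have "finite {x. ?H x \<noteq> \<zero>\<^bsub>A\<^esub>}"
      by (rule finite_subset[of _ "{x. F x \<noteq> \<zero>\<^bsub>A\<^esub>}"]) (use insert.prems in \<open>auto simp: carrier_SP\<close>)
    then have H: "?H \<in> carrier SP"
      using insert.prems by (auto simp: carrier_SP)
    have PH: "P ?H"
      using insert.prems H by (intro insert.IH) auto
    show ?case
    proof (cases "F y = \<zero>\<^bsub>A\<^esub>")
      case True
      then have "F = ?H"
        by auto
      then show ?thesis
        using PH by simp
    next
      case False
      then have "y \<in> carrier G" "F y \<in> carrier A"
        using insert.prems by (auto simp: carrier_SP)
      moreover have "F = el (F y) y \<oplus>\<^bsub>SP\<^esub> ?H"
        using insert.prems by (auto simp: smash_elem_def add_SP carrier_SP)
      ultimately show ?thesis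
        using step[OF _ _ H PH] by metis
    qed
  qed
  from this[OF F subset_refl] F show ?thesis
    by (simp add: carrier_SP)
qed

lemma SP_l_distr:
  assumes F: "F \<in> carrier SP" and H: "H \<in> carrier SP" and K: "K \<in> carrier SP"
  shows "(F \<oplus>\<^bsub>SP\<^esub> H) \<otimes>\<^bsub>SP\<^esub> K = F \<otimes>\<^bsub>SP\<^esub> K \<oplus>\<^bsub>SP\<^esub> H \<otimes>\<^bsub>SP\<^esub> K"
proof (rule SP_eqI)
  fix z assume z: "z \<in> carrier G"
  let ?S = "{x. F x \<noteq> \<zero>\<^bsub>A\<^esub>} \<union> {x. H x \<noteq> \<zero>\<^bsub>A\<^esub>}"
  have S: "finite ?S" "?S \<subseteq> carrier G"
    using F H by (auto simp: carrier_SP)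
  have cl: "F x \<in> carrier A" "H x \<in> carrier A" "K x \<in> carrier A" for x
    using F H K by (auto simp: carrier_SP)
  have "((F \<oplus>\<^bsub>SP\<^esub> H) \<otimes>\<^bsub>SP\<^esub> K) z =
      (\<Oplus>\<^bsub>A\<^esub>x\<in>?S. F x \<otimes>\<^bsub>A\<^esub> act x (K (inv\<^bsub>G\<^esub> x \<otimes>\<^bsub>G\<^esub> z)) \<oplus>\<^bsub>A\<^esub> H x \<otimes>\<^bsub>A\<^esub> act x (K (inv\<^bsub>G\<^esub> x \<otimes>\<^bsub>G\<^esub> z)))"
    unfolding mult_SP_superset[OF add_SP_closed[OF F H] K S(1) _ S(2) z, unfolded add_SP, OF supp_add[OF F H]] add_SP
    by (rule A.finsum_cong') (use S cl in \<open>auto simp: A.l_distr subset_iff\<close>)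
  also have "\<dots> = (F \<otimes>\<^bsub>SP\<^esub> K \<oplus>\<^bsub>SP\<^esub> H \<otimes>\<^bsub>SP\<^esub> K) z"
    unfolding add_SP mult_SP_superset[OF F K S(1) Un_upper1 S(2) z] mult_SP_superset[OF H K S(1) Un_upper2 S(2) z]
    by (rule A.finsum_addf) (use S cl in \<open>auto simp: subset_iff\<close>)
  finally show "((F \<oplus>\<^bsub>SP\<^esub> H) \<otimes>\<^bsub>SP\<^esub> K) z = (F \<otimes>\<^bsub>SP\<^esub> K \<oplus>\<^bsub>SP\<^esub> H \<otimes>\<^bsub>SP\<^esub> K) z" .
qed (use assms in \<open>simp_all add: add_SP_closed mult_SP_closed\<close>)

lemma SP_r_distr:
  assumes F: "F \<in> carrier SP" and H: "H \<in> carrier SP" and K: "K \<in> carrier SP"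
  shows "K \<otimes>\<^bsub>SP\<^esub> (F \<oplus>\<^bsub>SP\<^esub> H) = K \<otimes>\<^bsub>SP\<^esub> F \<oplus>\<^bsub>SP\<^esub> K \<otimes>\<^bsub>SP\<^esub> H"
proof (rule SP_eqI)
  fix z assume z: "z \<in> carrier G"
  let ?S = "{x. K x \<noteq> \<zero>\<^bsub>A\<^esub>}"
  have S: "finite ?S" "?S \<subseteq> carrier G"
    using K by (auto simp: carrier_SP)
  have cl: "F x \<in> carrier A" "H x \<in> carrier A" "K x \<in> carrier A" for x
    using F H K by (auto simp: carrier_SP)
  have "(K \<otimes>\<^bsub>SP\<^esub> (F \<oplus>\<^bsub>SP\<^esub> H)) z =
      (\<Oplus>\<^bsub>A\<^esub>x\<in>?S. K x \<otimes>\<^bsub>A\<^esub> act x (F (inv\<^bsub>G\<^esub> x \<otimes>\<^bsub>G\<^esub> z)) \<oplus>\<^bsub>A\<^esub> K x \<otimes>\<^bsub>A\<^esub> act x (H (inv\<^bsub>G\<^esub> x \<otimes>\<^bsub>G\<^esub> z)))"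
    unfolding mult_SP_superset[OF K add_SP_closed[OF F H] S(1) subset_refl S(2) z]
    unfolding add_SP by (rule A.finsum_cong') (use S cl in \<open>auto simp: A.r_distr subset_iff\<close>)
  also have "\<dots> = (K \<otimes>\<^bsub>SP\<^esub> F \<oplus>\<^bsub>SP\<^esub> K \<otimes>\<^bsub>SP\<^esub> H) z"
    unfolding add_SP mult_SP_superset[OF K F S(1) subset_refl S(2) z] mult_SP_superset[OF K H S(1) subset_refl S(2) z]
    by (rule A.finsum_addf) (use S cl in \<open>auto simp: subset_iff\<close>)
  finally show "(K \<otimes>\<^bsub>SP\<^esub> (F \<oplus>\<^bsub>SP\<^esub> H)) z = (K \<otimes>\<^bsub>SP\<^esub> F \<oplus>\<^bsub>SP\<^esub> K \<otimes>\<^bsub>SP\<^esub> H) z" .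
qed (use assms in \<open>simp_all add: add_SP_closed mult_SP_closed\<close>)

lemma ring_SP: "ring SP"
proof -
  interpret SP: abelian_group SP by (rule abelian_group_SP)
  have l_zero: "\<zero>\<^bsub>SP\<^esub> \<otimes>\<^bsub>SP\<^esub> F = \<zero>\<^bsub>SP\<^esub>" and r_zero: "F \<otimes>\<^bsub>SP\<^esub> \<zero>\<^bsub>SP\<^esub> = \<zero>\<^bsub>SP\<^esub>" if "F \<in> carrier SP" for F
    using SP_l_distr[of "\<zero>\<^bsub>SP\<^esub>" "\<zero>\<^bsub>SP\<^esub>" F] SP_r_distr[of "\<zero>\<^bsub>SP\<^esub>" "\<zero>\<^bsub>SP\<^esub>" F] that
    by (simp_all add: mult_SP_closed)
  \<comment> \<open>Associativity is additive in each of the three arguments, so it is reduced to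
    monomials by one induction per argument.\<close>
  have el1: "el a x \<otimes>\<^bsub>SP\<^esub> el b y \<otimes>\<^bsub>SP\<^esub> H = el a x \<otimes>\<^bsub>SP\<^esub> (el b y \<otimes>\<^bsub>SP\<^esub> H)"
    if "a \<in> carrier A" "x \<in> carrier G" "b \<in> carrier A" "y \<in> carrier G" and H: "H \<in> carrier SP" for a x b y H
    using H
  proof (induction H rule: SP_induct)
    case zero
    then show ?case
      using that by (simp add: r_zero el_closed mult_SP_closed)
  next
    case (add_el c z H)
    have "el a x \<otimes>\<^bsub>SP\<^esub> el b y \<otimes>\<^bsub>SP\<^esub> el c z = el a x \<otimes>\<^bsub>SP\<^esub> (el b y \<otimes>\<^bsub>SP\<^esub> el c z)"
      using that add_el by (simp add: el_mult act_mult A.m_assoc G.m_assoc)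
    then show ?case
      using that add_el by (simp add: SP_r_distr el_closed mult_SP_closed)
  qed
  have el2: "el a x \<otimes>\<^bsub>SP\<^esub> K \<otimes>\<^bsub>SP\<^esub> H = el a x \<otimes>\<^bsub>SP\<^esub> (K \<otimes>\<^bsub>SP\<^esub> H)"
    if "a \<in> carrier A" "x \<in> carrier G" "H \<in> carrier SP" and K: "K \<in> carrier SP" for a x H K
    using K
  proof (induction K rule: SP_induct)
    case zero
    then show ?case
      using that by (simp add: l_zero r_zero el_closed mult_SP_closed)
  next
    case (add_el c z K)
    then show ?case
      using that by (simp add: el1 SP_l_distr SP_r_distr el_closed mult_SP_closed)
  qed
  have assoc: "F \<otimes>\<^bsub>SP\<^esub> K \<otimes>\<^bsub>SP\<^esub> H = F \<otimes>\<^bsub>SP\<^esub> (K \<otimes>\<^bsub>SP\<^esub> H)"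
    if F: "F \<in> carrier SP" and "H \<in> carrier SP" "K \<in> carrier SP" for F H K
    using F
  proof (induction F rule: SP_induct)
    case zero
    then show ?case
      using that by (simp add: l_zero mult_SP_closed)
  next
    case (add_el c z K)
    then show ?case
      using that by (simp add: el2 SP_l_distr el_closed mult_SP_closed)
  qed
  have one_closed: "\<one>\<^bsub>SP\<^esub> \<in> carrier SP"
    by (simp add: one_SP el_closed)
  have l_one: "\<one>\<^bsub>SP\<^esub> \<otimes>\<^bsub>SP\<^esub> F = F" if "F \<in> carrier SP" for F
    using that
  proof (induction F rule: SP_induct)
    case (add_el a x H)
    then show ?case
      by (simp add: SP_r_distr one_SP el_closed el_mult act_one)
  qed (simp add: r_zero one_closed)
  have r_one: "F \<otimes>\<^bsub>SP\<^esub> \<one>\<^bsub>SP\<^esub> = F" if "F \<in> carrier SP" for F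
    using that
  proof (induction F rule: SP_induct)
    case (add_el a x H)
    then show ?case
      by (simp add: SP_l_distr one_SP el_closed el_mult)
  qed (simp add: l_zero one_closed)
  show ?thesis
    by (intro ringI abelian_group_SP monoidI)
      (simp_all add: mult_SP_closed one_closed assoc l_one r_one SP_l_distr SP_r_distr)
qed

end

section \<open>The action of the smash product on its coefficients\<close>

context smash_setting
begin

definition ACT :: "('g \<Rightarrow> 'a) \<Rightarrow> 'a \<Rightarrow> 'a" where
  "ACT F f = (\<Oplus>\<^bsub>A\<^esub>x\<in>{x. F x \<noteq> \<zero>\<^bsub>A\<^esub>}. F x \<otimes>\<^bsub>A\<^esub> act x f)"

lemma SP_D: "F \<in> carrier SP \<Longrightarrow> F x \<in> carrier A" "F \<in> carrier SP \<Longrightarrow> finite {x. F x \<noteq> \<zero>\<^bsub>A\<^esub>}"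
  by (simp_all add: carrier_SP)

lemma ACT_superset:
  assumes "F \<in> carrier SP" "f \<in> carrier A" "finite S" "{x. F x \<noteq> \<zero>\<^bsub>A\<^esub>} \<subseteq> S" "S \<subseteq> carrier G"
  shows "ACT F f = (\<Oplus>\<^bsub>A\<^esub>x\<in>S. F x \<otimes>\<^bsub>A\<^esub> act x f)"
  unfolding ACT_def
  by (rule A.add.finprod_mono_neutral_cong_left)
    (use assms in \<open>auto simp: carrier_SP subset_iff intro!: A.m_closed act_closed\<close>)

lemma ACT_closed: "F \<in> carrier SP \<Longrightarrow> f \<in> carrier A \<Longrightarrow> ACT F f \<in> carrier A"
  unfolding ACT_def using supp_G[of F]
  by (intro A.finsum_closed) (auto simp: carrier_SP intro!: A.m_closed act_closed)

lemma ACT_add_left: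
  assumes F: "F \<in> carrier SP" and H: "H \<in> carrier SP" and f: "f \<in> carrier A"
  shows "ACT (F \<oplus>\<^bsub>SP\<^esub> H) f = ACT F f \<oplus>\<^bsub>A\<^esub> ACT H f"
proof -
  let ?S = "{x. F x \<noteq> \<zero>\<^bsub>A\<^esub>} \<union> {x. H x \<noteq> \<zero>\<^bsub>A\<^esub>}"
  have S: "finite ?S" "?S \<subseteq> carrier G"
    using F H by (auto simp: carrier_SP)
  have cl: "F x \<in> carrier A" "H x \<in> carrier A" for x
    using F H by (auto simp: carrier_SP)
  have "ACT (F \<oplus>\<^bsub>SP\<^esub> H) f = (\<Oplus>\<^bsub>A\<^esub>x\<in>?S. F x \<otimes>\<^bsub>A\<^esub> act x f \<oplus>\<^bsub>A\<^esub> H x \<otimes>\<^bsub>A\<^esub> act x f)"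
    unfolding ACT_superset[OF add_SP_closed[OF F H] f S(1) _ S(2), unfolded add_SP, OF supp_add[OF F H]] add_SP
    by (rule A.finsum_cong') (use S cl f in \<open>auto simp: A.l_distr subset_iff\<close>)
  also have "\<dots> = ACT F f \<oplus>\<^bsub>A\<^esub> ACT H f"
    unfolding ACT_superset[OF F f S(1) Un_upper1 S(2)] ACT_superset[OF H f S(1) Un_upper2 S(2)]
    by (rule A.finsum_addf) (use S cl f in \<open>auto simp: subset_iff\<close>)
  finally show ?thesis .
qed

lemma ACT_zero_left: "ACT \<zero>\<^bsub>SP\<^esub> f = \<zero>\<^bsub>A\<^esub>"
  by (simp add: ACT_def zero_SP)

lemma ACT_el: "a \<in> carrier A \<Longrightarrow> x \<in> carrier G \<Longrightarrow> f \<in> carrier A \<Longrightarrow> ACT (el a x) f = a \<otimes>\<^bsub>A\<^esub> act x f"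
  using el_closed[of a x] by (subst ACT_superset[of _ _ "{x}"]) (auto simp: smash_elem_def)

lemma ACT_scale:
  assumes F: "F \<in> carrier SP" and f: "f \<in> carrier A" and a: "a \<in> carrier A" and x: "x \<in> carrier G"
  shows "ACT (el a x \<otimes>\<^bsub>SP\<^esub> F) f = a \<otimes>\<^bsub>A\<^esub> act x (ACT F f)"
proof -
  interpret SP: ring SP by (rule ring_SP)
  show ?thesis
    using F
  proof (induction F rule: SP_induct)
    case zero
    then show ?case
      using a x by (simp add: ACT_zero_left el_closed)
  next
    case (add_el b y H)
    have "el a x \<otimes>\<^bsub>SP\<^esub> (el b y \<oplus>\<^bsub>SP\<^esub> H) = el (a \<otimes>\<^bsub>A\<^esub> act x b) (x \<otimes>\<^bsub>G\<^esub> y) \<oplus>\<^bsub>SP\<^esub> el a x \<otimes>\<^bsub>SP\<^esub> H"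
      using add_el a x by (simp add: SP.r_distr el_closed el_mult)
    then show ?case
      using add_el a x f
      by (simp add: ACT_add_left el_closed ACT_el ACT_closed act_mult A.r_distr A.m_assoc)
  qed
qed

lemma ACT_mult:
  assumes F: "F \<in> carrier SP" and H: "H \<in> carrier SP" and f: "f \<in> carrier A"
  shows "ACT (F \<otimes>\<^bsub>SP\<^esub> H) f = ACT F (ACT H f)"
proof -
  interpret SP: ring SP by (rule ring_SP)
  show ?thesis
    using F
  proof (induction F rule: SP_induct)
    case zero
    then show ?case
      using H by (simp add: ACT_zero_left)
  next
    case (add_el b y K)
    then show ?case
      using H f by (simp add: SP.l_distr el_closed ACT_add_left ACT_scale ACT_el ACT_closed)
  qed
qed

lemma ACT_minus:
  assumes F: "F \<in> carrier SP" and H: "H \<in> carrier SP" and f: "f \<in> carrier A" and "ACT F f = ACT H f"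
  shows "ACT (F \<ominus>\<^bsub>SP\<^esub> H) f = \<zero>\<^bsub>A\<^esub>"
proof -
  interpret SP: ring SP by (rule ring_SP)
  have "ACT (F \<ominus>\<^bsub>SP\<^esub> H) f \<oplus>\<^bsub>A\<^esub> ACT H f = ACT (F \<ominus>\<^bsub>SP\<^esub> H \<oplus>\<^bsub>SP\<^esub> H) f"
    using F H f by (simp add: ACT_add_left)
  also have "F \<ominus>\<^bsub>SP\<^esub> H \<oplus>\<^bsub>SP\<^esub> H = F"
    using F H by (simp add: a_minus_def SP.a_assoc SP.l_neg)
  finally have "ACT (F \<ominus>\<^bsub>SP\<^esub> H) f \<oplus>\<^bsub>A\<^esub> ACT H f = \<zero>\<^bsub>A\<^esub> \<oplus>\<^bsub>A\<^esub> ACT H f"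
    using F H f assms(4) by (simp add: ACT_closed)
  then show ?thesis
    using F H f by (simp only: A.add.right_cancel A.zero_closed ACT_closed SP.minus_closed)
qed

definition supported :: "'g set \<Rightarrow> ('g \<Rightarrow> 'a) set" where
  "supported B = {F \<in> carrier SP. \<forall>x. x \<notin> B \<longrightarrow> F x = \<zero>\<^bsub>A\<^esub>}"

lemma supported_carrier: "F \<in> supported B \<Longrightarrow> F \<in> carrier SP"
  by (simp add: supported_def)

lemma supported_el: "a \<in> carrier A \<Longrightarrow> x \<in> carrier G \<Longrightarrow> x \<in> B \<Longrightarrow> el a x \<in> supported B"
  using el_closed[of a x] by (auto simp: supported_def smash_elem_def)

lemma supported_add: "F \<in> supported B \<Longrightarrow> H \<in> supported B \<Longrightarrow> F \<oplus>\<^bsub>SP\<^esub> H \<in> supported B"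
  by (auto simp: supported_def add_SP_closed) (simp add: add_SP)

lemma a_inv_SP:
  assumes "F \<in> carrier SP"
  shows "(\<ominus>\<^bsub>SP\<^esub> F) x = \<ominus>\<^bsub>A\<^esub> F x"
proof -
  interpret SP: ring SP by (rule ring_SP)
  have "(\<ominus>\<^bsub>SP\<^esub> F \<oplus>\<^bsub>SP\<^esub> F) x = \<zero>\<^bsub>A\<^esub>"
    using assms by (simp add: SP.l_neg) (simp add: zero_SP)
  then have "(\<ominus>\<^bsub>SP\<^esub> F) x \<oplus>\<^bsub>A\<^esub> F x = \<zero>\<^bsub>A\<^esub>"
    by (simp add: add_SP)
  then show ?thesis
    using assms by (intro A.minus_equality[symmetric]) (auto simp: SP_D)
qed

lemma supported_minus:
  assumes "F \<in> supported B" "H \<in> supported B"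
  shows "F \<ominus>\<^bsub>SP\<^esub> H \<in> supported B"
proof -
  interpret SP: ring SP by (rule ring_SP)
  have "\<ominus>\<^bsub>SP\<^esub> H \<in> supported B"
    using assms(2) by (auto simp: supported_def a_inv_SP)
  then show ?thesis
    using supported_add[OF assms(1)] by (simp add: a_minus_def)
qed

lemma supported_mult:
  assumes "F \<in> supported B" "H \<in> supported B'"
    and BB: "\<And>x y. x \<in> B \<Longrightarrow> y \<in> B' \<Longrightarrow> x \<in> carrier G \<Longrightarrow> y \<in> carrier G \<Longrightarrow> x \<otimes>\<^bsub>G\<^esub> y \<in> C"
  shows "F \<otimes>\<^bsub>SP\<^esub> H \<in> supported C"
proof -
  have F: "F \<in> carrier SP" and H: "H \<in> carrier SP"
    using assms by (auto simp: supported_def)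
  have "(F \<otimes>\<^bsub>SP\<^esub> H) z = \<zero>\<^bsub>A\<^esub>" if z: "z \<notin> C" for z
  proof (cases "z \<in> carrier G")
    case True
    show ?thesis
      unfolding mult_SP_superset[OF F H SP_D(2)[OF F] subset_refl supp_G[OF F] True]
    proof (rule A.add.finprod_one_eqI)
      fix x assume "x \<in> {x. F x \<noteq> \<zero>\<^bsub>A\<^esub>}"
      then have x: "x \<in> B" "x \<in> carrier G"
        using assms(1) F by (auto simp: supported_def carrier_SP)
      have "x \<otimes>\<^bsub>G\<^esub> (inv\<^bsub>G\<^esub> x \<otimes>\<^bsub>G\<^esub> z) = z"
        using x True by (simp add: G.m_assoc[symmetric])
      then have "inv\<^bsub>G\<^esub> x \<otimes>\<^bsub>G\<^esub> z \<notin> B'"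
        using BB[OF x(1) _ x(2), of "inv\<^bsub>G\<^esub> x \<otimes>\<^bsub>G\<^esub> z"] z x True by auto
      then have "H (inv\<^bsub>G\<^esub> x \<otimes>\<^bsub>G\<^esub> z) = \<zero>\<^bsub>A\<^esub>"
        using assms(2) by (simp add: supported_def)
      then show "F x \<otimes>\<^bsub>A\<^esub> act x (H (inv\<^bsub>G\<^esub> x \<otimes>\<^bsub>G\<^esub> z)) = \<zero>\<^bsub>A\<^esub>"
        using x F by (simp add: SP_D)
    qed
  qed (simp add: mult_SP_notin)
  then show ?thesis
    using mult_SP_closed[OF F H] by (simp add: supported_def)
qed

end

section \<open>The localized weight algebra and its smash product\<close>

context affine_data
begin

abbreviation "KK \<equiv> carrier (coeff_ring D)"
abbreviation "PP \<equiv> weights D"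
abbreviation "WA \<equiv> weight_algebra D"
abbreviation "WAc \<equiv> carrier (weight_algebra D)"

lemma subring_KK: "subring_set KK"
proof -
  have "submonoid_set {m :: 'v set \<Rightarrow>\<^sub>0 int. Poly_Mapping.keys m \<subseteq> weyl_orbit D ` R0}"
    using keys_add by (fastforce simp: submonoid_set_def)
  then show ?thesis
    unfolding coeff_ring_def by (intro subring_set_monoid_algebra) (simp_all add: subring_set_def)
qed

lemma tau_closed: "j \<le> DIM('v) \<Longrightarrow> tau D j \<in> KK" "j \<le> DIM('v) \<Longrightarrow> tau_inv D j \<in> KK"
  using alpha_in[of j] unfolding coeff_ring_def tau_def tau_inv_def
  by (auto intro!: single_in_monoid_algebra simp: subring_set_def)

lemma tau_tau_inv: "tau D j * tau_inv D j = 1"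
  by (simp add: tau_def tau_inv_def mult_single flip: single_add)

abbreviation "tt j \<equiv> tau D j - tau_inv D j"

lemma tt_closed: "j \<le> DIM('v) \<Longrightarrow> tt j \<in> KK"
  using tau_closed subring_setD(3)[OF subring_KK] by blast

lemma tau_eq: "tau D j * tau D j - tau D j * tt j = 1"
  using tau_tau_inv[of j] by (simp add: algebra_simps)

lemma submonoid_PP: "submonoid_set PP"
  by (auto simp: submonoid_set_def weights_def weight_lattice_def inner_add_left)

lemma PP_uminus: "\<nu> \<in> PP \<Longrightarrow> - \<nu> \<in> PP"
  by (auto simp: weights_def weight_lattice_def)

lemma R0_PP: "\<beta> \<in> R0 \<Longrightarrow> \<beta> \<in> PP"
  using int_\<Phi> by (auto simp: weights_def weight_lattice_def)

lemma PP_W0: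
  assumes "v \<in> W0" "\<nu> \<in> PP"
  shows "v \<nu> \<in> PP"
  unfolding weights_def weight_lattice_def mem_Collect_eq
proof
  fix \<beta> assume \<beta>: "\<beta> \<in> R0"
  obtain v' where v': "v' \<in> W0" "v \<circ> v' = id"
    using weyl_group_inverse[OF assms(1)] by blast
  have b: "v (v' \<beta>) = \<beta>" "v' \<beta> \<in> R0"
    using v' \<beta> weyl_group_root by (auto simp: fun_eq_iff)
  have "v \<nu> \<bullet> coroot \<beta> = v \<nu> \<bullet> v (coroot (v' \<beta>))"
    using coroot_isometry[OF weyl_group_linear[OF assms(1)] weyl_group_inner[OF assms(1)], of "v' \<beta>"] b by simp
  then show "v \<nu> \<bullet> coroot \<beta> \<in> \<int>"
    using assms(2) b(2) weyl_group_inner[OF assms(1)] by (simp add: weights_def weight_lattice_def)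
qed

lemma WA_eq: "WA = monoid_algebra KK PP"
  by (simp add: weight_algebra_def)

lemma reflection_lattice_PP: "\<beta> \<in> R0 \<Longrightarrow> reflection_lattice KK PP \<beta>"
proof unfold_locales
  assume \<beta>: "\<beta> \<in> R0"
  show "subring_set KK"
    by (rule subring_KK)
  show "submonoid_set PP"
    by (rule submonoid_PP)
  show "- \<nu> \<in> PP" if "\<nu> \<in> PP" for \<nu>
    by (rule PP_uminus[OF that])
  show "\<beta> \<in> PP"
    by (rule R0_PP[OF \<beta>])
  show "\<beta> \<noteq> 0"
    by (rule nonzero[OF \<beta>])
  show "reflection \<beta> \<nu> \<in> PP" if "\<nu> \<in> PP" for \<nu>
    by (rule PP_W0[OF weyl_group_reflection[OF \<beta>] that])
  show "\<nu> \<bullet> coroot \<beta> \<in> \<int>" if "\<nu> \<in> PP" for \<nu>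
    using that \<beta> by (simp add: weights_def weight_lattice_def)
qed

lemmas WA_closed = subring_setD[OF subring_set_monoid_algebra[OF subring_KK submonoid_PP], folded WA_eq]

lemma X_pow_WA: "\<nu> \<in> PP \<Longrightarrow> X_pow \<nu> \<in> WAc"
  unfolding X_pow_def WA_eq using subring_KK by (intro single_in_monoid_algebra) (auto simp: subring_setD)

lemma scalar_WA: "l \<in> KK \<Longrightarrow> scalar l \<in> WAc"
  unfolding WA_eq using subring_KK submonoid_PP by (intro single_in_monoid_algebra) (auto simp: submonoid_set_def)

lemma weight_act_WA: "v \<in> W0 \<Longrightarrow> f \<in> WAc \<Longrightarrow> weight_act v f \<in> WAc"
  unfolding WA_eq using reflection_lattice.weight_act_closed[OF reflection_lattice_PP[OF \<theta>_in]] PP_W0 by blast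

lemma prod_WA: "(\<And>i. i \<in> B \<Longrightarrow> f i \<in> WAc) \<Longrightarrow> prod f B \<in> WAc"
  by (induction B rule: infinite_finite_induct) (auto simp: WA_closed)

lemma factor_WA: "\<beta> \<in> R0 \<Longrightarrow> 1 - X_pow \<beta> \<in> WAc"
  by (simp add: WA_closed X_pow_WA R0_PP)

lemma delta_WA: "delta D \<in> WAc"
  unfolding delta_def by (intro prod_WA factor_WA)

lemma delta_regular: "regular (delta D)"
proof -
  have "regular (\<Prod>\<beta>\<in>B. 1 - X_pow \<beta>)" if "finite B" "B \<subseteq> R0" for B
    using that
  proof (induction B)
    case (insert \<beta> B)
    have "regular (1 - X_pow \<beta>)"
      unfolding X_pow_def using nonzero insert.prems by (intro regular_binomial) auto
    then show ?case
      using insert by (simp add: regular_mult)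
  qed (simp add: regular_1)
  then show ?thesis
    using finite_\<Phi> by (simp add: delta_def)
qed

sublocale Lz: regular_localization "weight_algebra D" "denominators D"
proof
  show "subring_set WAc"
    using subring_set_monoid_algebra[OF subring_KK submonoid_PP] by (simp add: WA_eq)
  have pow: "delta D ^ k \<in> WAc" "regular (delta D ^ k)" for k
    by (induction k) (auto simp: WA_closed delta_WA regular_1 regular_mult delta_regular)
  show "denominators D \<subseteq> WAc"
    using pow by (auto simp: denominators_def)
  show "regular s" if "s \<in> denominators D" for s
    using that pow by (auto simp: denominators_def)
  show "s * t \<in> denominators D" if "s \<in> denominators D" "t \<in> denominators D" for s t
    using that by (auto simp: denominators_def simp flip: power_add)
  show "1 \<in> denominators D"
    unfolding denominators_def by (rule range_eqI[of _ _ 0]) simp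
qed (simp_all add: weight_algebra_def)

abbreviation "LA \<equiv> loc_algebra D"
abbreviation "\<iota> \<equiv> loc_embed D"

lemma LA_eq: "LA = Lz.L" and \<iota>_eq: "\<iota> = Lz.emb"
  by (simp_all add: loc_algebra_def loc_embed_def)

lemmas \<iota>_rules = Lz.emb_closed[folded LA_eq \<iota>_eq] Lz.emb_add[folded LA_eq \<iota>_eq] Lz.emb_mult[folded LA_eq \<iota>_eq]
  Lz.emb_one[folded LA_eq \<iota>_eq] Lz.emb_zero[folded LA_eq \<iota>_eq] Lz.emb_diff[folded LA_eq \<iota>_eq]

text \<open>The Weyl group permutes the roots. Invariance of \<open>delta D\<close> keeps the
  denominators stable, so the action extends to the localization.\<close>

lemma weight_act_delta:
  assumes "v \<in> W0"
  shows "weight_act v (delta D) = delta D"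
proof -
  have add: "v (x + y) = v x + v y" for x y
    using weyl_group_linear[OF assms] by (rule linear_add)
  have v0: "v 0 = 0"
    using weyl_group_linear[OF assms] by (rule linear_0)
  have prod: "weight_act v (prod f B) = (\<Prod>\<beta>\<in>B. weight_act v (f \<beta>))" for f :: "'v \<Rightarrow> 'v weight_alg" and B
    by (induction B rule: infinite_finite_induct) (simp_all add: weight_act_mult[OF add] weight_act_one v0)
  obtain v' where v': "v' \<in> W0" "v \<circ> v' = id" "v' \<circ> v = id"
    using weyl_group_inverse[OF assms] by blast
  have bij: "bij_betw v R0 R0"
    by (rule bij_betwI[of _ _ _ v']) (use v' assms weyl_group_root in \<open>auto simp: fun_eq_iff\<close>)
  have "weight_act v (delta D) = (\<Prod>\<beta>\<in>R0. 1 - X_pow (v \<beta>))"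
    by (simp add: delta_def prod weight_act_diff weight_act_one v0 X_pow_def)
  also have "\<dots> = delta D"
    unfolding delta_def by (rule prod.reindex_bij_betw[OF bij])
  finally show ?thesis .
qed

lemma localization_map_W0:
  assumes "v \<in> W0"
  shows "regular_localization_map WA (denominators D) (weight_act v)"
proof -
  have add: "v (x + y) = v x + v y" for x y
    using weyl_group_linear[OF assms] by (rule linear_add)
  have v0: "v 0 = 0"
    using weyl_group_linear[OF assms] by (rule linear_0)
  have pow: "weight_act v (delta D ^ k) = delta D ^ k" for k
    by (induction k) (simp_all add: weight_act_mult[OF add] weight_act_one v0 weight_act_delta[OF assms])
  show ?thesis
    by unfold_locales
      (use assms in \<open>auto simp: weight_act_WA weight_act_add weight_act_mult[OF add] weight_act_one v0 denominators_def pow\<close>)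
qed

sublocale SS: smash_setting "loc_algebra D" "ext_weyl D" "\<lambda>w. loc_act D (gradient w)"
proof -
  interpret A: cring LA
    unfolding LA_eq by (rule Lz.cring_L)
  interpret G: group W
    by (rule group_W)
  show "smash_setting LA W (\<lambda>w. loc_act D (gradient w))"
  proof
    fix x assume x: "x \<in> carrier W"
    interpret h: regular_localization_map WA "denominators D" "weight_act (gradient x)"
      by (rule localization_map_W0[OF gradient_W(1)[OF x]])
    show "loc_act D (gradient x) \<in> ring_hom LA LA"
      unfolding loc_act_def LA_eq by (rule h.hL_hom)
  next
    fix a assume "a \<in> carrier LA"
    then obtain b s where b: "b \<in> WAc" "s \<in> denominators D" "a = Lz.fr b s"
      unfolding LA_eq by (rule Lz.fr_cases)
    interpret h: regular_localization_map WA "denominators D" "weight_act id"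
      by (rule localization_map_W0[OF weyl_group.id])
    have "gradient (\<one>\<^bsub>W\<^esub>) = id"
      by (simp add: gradient_W0 weyl_group.id)
    then show "loc_act D (gradient \<one>\<^bsub>W\<^esub>) a = a"
      using b by (simp add: loc_act_def h.hL_fr weight_act_id del: W_sel)
  next
    fix x y a assume x: "x \<in> carrier W" and y: "y \<in> carrier W" and "a \<in> carrier LA"
    then obtain b s where b: "b \<in> WAc" "s \<in> denominators D" "a = Lz.fr b s"
      unfolding LA_eq using Lz.fr_cases by blast
    interpret hx: regular_localization_map WA "denominators D" "weight_act (gradient x)"
      by (rule localization_map_W0[OF gradient_W(1)[OF x]])
    interpret hy: regular_localization_map WA "denominators D" "weight_act (gradient y)"
      by (rule localization_map_W0[OF gradient_W(1)[OF y]])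
    interpret hxy: regular_localization_map WA "denominators D" "weight_act (gradient x \<circ> gradient y)"
      by (rule localization_map_W0[OF weyl_group_comp[OF gradient_W(1)[OF x] gradient_W(1)[OF y]]])
    show "loc_act D (gradient (x \<otimes>\<^bsub>W\<^esub> y)) a = loc_act D (gradient x) (loc_act D (gradient y) a)"
      using b by (simp add: loc_act_def hx.hL_fr hy.hL_fr hxy.hL_fr hy.h_closed hy.h_S weight_act_comp
          gradient_comp[OF x y] del: comp_apply)
  qed
qed

lemma smash_eq: "smash D = SS.SP"
  by (simp add: smash_def)

sublocale SM: ring "smash D"
  unfolding smash_eq by (rule SS.ring_SP)

lemma loc_act_\<iota>:
  assumes "v \<in> W0" "f \<in> WAc"
  shows "loc_act D v (\<iota> f) = \<iota> (weight_act v f)"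
proof -
  interpret h: regular_localization_map WA "denominators D" "weight_act v"
    by (rule localization_map_W0[OF assms(1)])
  show ?thesis
    unfolding loc_act_def \<iota>_eq by (rule h.hL_emb[OF assms(2)])
qed

section \<open>The coefficients of the images of the generators \<open>T_j\<close>\<close>

definition vv :: "nat \<Rightarrow> 'v loc_alg" where
  "vv j = inv\<^bsub>LA\<^esub> (\<iota> (1 - X_pow (- alpha D j)))"

lemma vv:
  assumes "j \<le> DIM('v)"
  shows "vv j \<in> carrier LA" "\<iota> (1 - X_pow (- alpha D j)) \<otimes>\<^bsub>LA\<^esub> vv j = \<one>\<^bsub>LA\<^esub>"
proof -
  have a: "- alpha D j \<in> R0"
    by (rule uminus_\<Phi>[OF alpha_in[OF assms]])
  have "\<iota> (1 - X_pow (- alpha D j)) \<in> Units LA"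
    unfolding LA_eq \<iota>_eq
  proof (rule Lz.emb_Units)
    \<comment> \<open>This element is one of the factors of \<open>delta D\<close>; the product of
      the remaining factors completes it to a denominator.\<close>
    show "(1 - X_pow (- alpha D j)) * (\<Prod>\<beta>\<in>R0 - {- alpha D j}. 1 - X_pow \<beta>) \<in> denominators D"
      using prod.remove[OF finite_\<Phi> a, of "\<lambda>\<beta>. 1 - X_pow \<beta>"] unfolding denominators_def
      by (intro range_eqI[of _ _ 1]) (simp add: delta_def)
  qed (use a in \<open>auto intro!: prod_WA factor_WA\<close>)
  then show "vv j \<in> carrier LA" "\<iota> (1 - X_pow (- alpha D j)) \<otimes>\<^bsub>LA\<^esub> vv j = \<one>\<^bsub>LA\<^esub>"
    by (simp_all add: vv_def)
qed

text \<open>The coefficient of the identity in \<open>T_check D j\<close>.\<close>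

definition dd :: "nat \<Rightarrow> 'v loc_alg" where
  "dd j = \<iota> (scalar (tt j)) \<otimes>\<^bsub>LA\<^esub> vv j"

text \<open>The coefficient of \<open>sr j\<close> in \<open>T_check D j\<close>. Over the common
  denominator \<open>1 - X_pow (- alpha D j)\<close> its numerator is
  \<open>1/tau - tau * X_pow (- alpha D j)\<close>, the numerator of the usual c-function.\<close>

definition cc :: "nat \<Rightarrow> 'v loc_alg" where
  "cc j = \<iota> (scalar (tau D j)) \<ominus>\<^bsub>LA\<^esub> dd j"

lemma cc_dd_closed: "j \<le> DIM('v) \<Longrightarrow> dd j \<in> carrier LA" "j \<le> DIM('v) \<Longrightarrow> cc j \<in> carrier LA"
  by (simp_all add: dd_def cc_def vv \<iota>_rules scalar_WA tt_closed tau_closed)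

lemma \<iota>_dd:
  assumes j: "j \<le> DIM('v)"
  shows "\<iota> (1 - X_pow (- alpha D j)) \<otimes>\<^bsub>LA\<^esub> dd j = \<iota> (scalar (tt j))"
proof -
  let ?u = "\<iota> (1 - X_pow (- alpha D j))" and ?t = "\<iota> (scalar (tt j))"
  have c: "?u \<in> carrier LA" "?t \<in> carrier LA" "vv j \<in> carrier LA"
    using vv(1)[OF j] by (simp_all add: \<iota>_rules(1) factor_WA uminus_\<Phi> alpha_in scalar_WA tt_closed j)
  have "?u \<otimes>\<^bsub>LA\<^esub> dd j = (?u \<otimes>\<^bsub>LA\<^esub> vv j) \<otimes>\<^bsub>LA\<^esub> ?t"
    unfolding dd_def using c by (simp add: SS.A.m_ac)
  then show ?thesis
    using c by (simp add: vv(2)[OF j])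
qed

lemma \<iota>_cc:
  assumes j: "j \<le> DIM('v)"
  shows "\<iota> (1 - X_pow (- alpha D j)) \<otimes>\<^bsub>LA\<^esub> cc j =
    \<iota> (1 - X_pow (- alpha D j)) \<otimes>\<^bsub>LA\<^esub> \<iota> (scalar (tau D j)) \<ominus>\<^bsub>LA\<^esub> \<iota> (scalar (tt j))"
proof -
  have c: "\<iota> (1 - X_pow (- alpha D j)) \<in> carrier LA" "\<iota> (scalar (tau D j)) \<in> carrier LA" "dd j \<in> carrier LA"
    using cc_dd_closed(1)[OF j] by (simp_all add: \<iota>_rules(1) factor_WA uminus_\<Phi> alpha_in scalar_WA tau_closed j)
  then show ?thesis
    unfolding cc_def by (simp add: a_minus_def SS.A.r_distr SS.A.r_minus \<iota>_dd[OF j])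
qed

abbreviation "el \<equiv> smash_elem LA"

lemma id_W: "id \<in> carrier W"
  by (simp add: W0_in_W weyl_group.id)

lemma act_id: "a \<in> carrier LA \<Longrightarrow> loc_act D (gradient id) a = a"
  using SS.act_one by simp

lemma T_check_eq:
  assumes j: "j \<le> DIM('v)"
  shows "T_check D j = el (cc j) (sr j) \<oplus>\<^bsub>smash D\<^esub> el (dd j) id"
proof -
  note cl = cc_dd_closed[OF j] sr_in_W[OF j] id_W \<iota>_rules(1)[OF scalar_WA[OF tau_closed(1)[OF j]]]
  have e1: "smash_scalar D (tau D j) \<otimes>\<^bsub>smash D\<^esub> smash_grp D (sr j) = el (\<iota> (scalar (tau D j))) (sr j)"
    unfolding smash_scalar_def smash_loc_def smash_grp_def smash_eq
    using cl by (simp add: SS.el_mult del: id_apply)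
  have one: "\<one>\<^bsub>smash D\<^esub> = el \<one>\<^bsub>LA\<^esub> id"
    by (simp add: smash_eq SS.one_SP)
  have e2: "smash_loc D (dd j) \<otimes>\<^bsub>smash D\<^esub> smash_grp D (sr j) = el (dd j) (sr j)"
    unfolding smash_loc_def smash_grp_def smash_eq using cl by (simp add: SS.el_mult del: id_apply)
  have mem: "smash_loc D (dd j) \<in> carrier (smash D)" "smash_grp D (sr j) \<in> carrier (smash D)"
    unfolding smash_loc_def smash_grp_def smash_eq using cl by (simp_all add: SS.el_closed)
  have "T_check D j = el (\<iota> (scalar (tau D j))) (sr j) \<oplus>\<^bsub>smash D\<^esub>
      smash_loc D (dd j) \<otimes>\<^bsub>smash D\<^esub> (\<one>\<^bsub>smash D\<^esub> \<ominus>\<^bsub>smash D\<^esub> smash_grp D (sr j))"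
    unfolding T_check_def e1 dd_def vv_def ..
  also have "smash_loc D (dd j) \<otimes>\<^bsub>smash D\<^esub> (\<one>\<^bsub>smash D\<^esub> \<ominus>\<^bsub>smash D\<^esub> smash_grp D (sr j)) =
      smash_loc D (dd j) \<ominus>\<^bsub>smash D\<^esub> el (dd j) (sr j)"
    using mem by (simp add: a_minus_def SM.r_distr SM.r_minus e2)
  also have "el (\<iota> (scalar (tau D j))) (sr j) \<oplus>\<^bsub>smash D\<^esub> (smash_loc D (dd j) \<ominus>\<^bsub>smash D\<^esub> el (dd j) (sr j)) =
      el (cc j) (sr j) \<oplus>\<^bsub>smash D\<^esub> smash_loc D (dd j)"
  proof -
    have "el (cc j) (sr j) \<oplus>\<^bsub>smash D\<^esub> el (dd j) (sr j) = el (\<iota> (scalar (tau D j))) (sr j)"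
      unfolding smash_eq using cl by (simp add: SS.el_add[symmetric] cc_def a_minus_def SS.A.a_assoc SS.A.l_neg)
    moreover have "el (cc j) (sr j) \<in> carrier (smash D)" "el (dd j) (sr j) \<in> carrier (smash D)"
      unfolding smash_eq using cl by (simp_all add: SS.el_closed)
    moreover have "(x \<oplus>\<^bsub>smash D\<^esub> y) \<oplus>\<^bsub>smash D\<^esub> (z \<ominus>\<^bsub>smash D\<^esub> y) = x \<oplus>\<^bsub>smash D\<^esub> z"
      if "x \<in> carrier (smash D)" "y \<in> carrier (smash D)" "z \<in> carrier (smash D)" for x y z
    proof -
      have "(x \<oplus>\<^bsub>smash D\<^esub> y) \<oplus>\<^bsub>smash D\<^esub> (z \<ominus>\<^bsub>smash D\<^esub> y) =
          x \<oplus>\<^bsub>smash D\<^esub> (z \<oplus>\<^bsub>smash D\<^esub> (y \<oplus>\<^bsub>smash D\<^esub> \<ominus>\<^bsub>smash D\<^esub> y))"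
        unfolding a_minus_def using that by (simp only: SM.a_ac SM.a_inv_closed SM.add.m_closed)
      then show ?thesis
        using that by (simp add: SM.r_neg)
    qed
    ultimately show ?thesis
      using mem(1) by metis
  qed
  finally show ?thesis
    by (simp add: smash_loc_def)
qed

lemma T_check_closed: "j \<le> DIM('v) \<Longrightarrow> T_check D j \<in> carrier (smash D)"
  using cc_dd_closed[of j] sr_in_W[of j] id_W unfolding smash_eq
  by (simp add: T_check_eq[unfolded smash_eq] SS.add_SP_closed SS.el_closed)

lemma smash_scalar_closed: "l \<in> KK \<Longrightarrow> smash_scalar D l \<in> carrier (smash D)"
  unfolding smash_scalar_def smash_loc_def smash_eq by (intro SS.el_closed) (simp_all add: \<iota>_rules scalar_WA id_W)

lemma smash_grp_closed: "w \<in> carrier W \<Longrightarrow> smash_grp D w \<in> carrier (smash D)"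
  unfolding smash_grp_def smash_eq by (intro SS.el_closed) simp_all

definition DLj :: "nat \<Rightarrow> 'v weight_alg \<Rightarrow> 'v weight_alg" where
  "DLj j = DL (alpha D j) (tau D j) (tt j)"

lemma DLj_closed: "j \<le> DIM('v) \<Longrightarrow> f \<in> WAc \<Longrightarrow> DLj j f \<in> WAc"
  unfolding DLj_def WA_eq
  by (rule reflection_lattice.DL_closed[OF reflection_lattice_PP[OF alpha_in]]) (simp_all add: tau_closed tt_closed)

text \<open>Both sides are multiplied by the unit \<open>1 - X\<^sup>-\<^sup>\<alpha>\<close>.\<close>

lemma ACT_T_check:
  assumes j: "j \<le> DIM('v)" and f: "f \<in> WAc"
  shows "SS.ACT (T_check D j) (\<iota> f) = \<iota> (DLj j f)"
proof -
  interpret RL: reflection_lattice KK PP "alpha D j"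
    by (rule reflection_lattice_PP[OF alpha_in[OF j]])
  have f': "f \<in> RL.MS"
    using f by (simp add: WA_eq)
  let ?u = "1 - X_pow (- alpha D j) :: 'v weight_alg"
  have u: "?u \<in> WAc"
    by (rule factor_WA[OF uminus_\<Phi>[OF alpha_in[OF j]]])
  have refl: "reflection (alpha D j) \<in> W0"
    by (rule weyl_group_reflection[OF alpha_in[OF j]])
  have sf: "RL.s f \<in> WAc"
    by (rule weight_act_WA[OF refl f])
  note cl = cc_dd_closed[OF j] sr_in_W[OF j] id_W
  have L: "SS.ACT (T_check D j) (\<iota> f) = cc j \<otimes>\<^bsub>LA\<^esub> \<iota> (RL.s f) \<oplus>\<^bsub>LA\<^esub> dd j \<otimes>\<^bsub>LA\<^esub> \<iota> f"
    unfolding T_check_eq[OF j, unfolded smash_eq] using cl f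
    by (simp add: SS.ACT_add_left SS.el_closed SS.ACT_el \<iota>_rules gradient_sr loc_act_\<iota> refl act_id)
  let ?t = "\<iota> (scalar (tt j))" and ?\<tau> = "\<iota> (scalar (tau D j))"
  have c: "\<iota> ?u \<in> carrier LA" "vv j \<in> carrier LA" "?t \<in> carrier LA" "?\<tau> \<in> carrier LA" "\<iota> f \<in> carrier LA"
    "\<iota> (RL.s f) \<in> carrier LA" "\<iota> (DLj j f) \<in> carrier LA"
    using u f sf j by (simp_all add: \<iota>_rules vv scalar_WA tt_closed tau_closed DLj_closed)
  note ud = \<iota>_dd[OF j] and uc = \<iota>_cc[OF j]
  have "\<iota> ?u \<otimes>\<^bsub>LA\<^esub> SS.ACT (T_check D j) (\<iota> f) =
      (\<iota> ?u \<otimes>\<^bsub>LA\<^esub> cc j) \<otimes>\<^bsub>LA\<^esub> \<iota> (RL.s f) \<oplus>\<^bsub>LA\<^esub> (\<iota> ?u \<otimes>\<^bsub>LA\<^esub> dd j) \<otimes>\<^bsub>LA\<^esub> \<iota> f"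
    unfolding L using c cl by (simp add: SS.A.r_distr SS.A.m_assoc)
  also have "\<dots> = \<iota> ((?u * scalar (tau D j) - scalar (tt j)) * RL.s f + scalar (tt j) * f)"
    unfolding uc ud using u f sf j by (simp add: \<iota>_rules WA_closed scalar_WA tt_closed tau_closed)
  also have "(?u * scalar (tau D j) - scalar (tt j)) * RL.s f + scalar (tt j) * f = ?u * DLj j f"
  proof -
    have "?u * DLj j f = scalar (tau D j) * (?u * RL.s f) + scalar (tt j) * (?u * RL.d f)"
      by (simp add: DLj_def DL_def algebra_simps)
    also have "\<dots> = scalar (tau D j) * (?u * RL.s f) + scalar (tt j) * (f - RL.s f)"
      by (simp only: RL.d_spec[OF f'])
    finally show ?thesis
      by (simp add: algebra_simps)
  qed
  also have "\<iota> (?u * DLj j f) = \<iota> ?u \<otimes>\<^bsub>LA\<^esub> \<iota> (DLj j f)"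
    using u f j by (simp add: \<iota>_rules DLj_closed)
  finally have eq: "\<iota> ?u \<otimes>\<^bsub>LA\<^esub> SS.ACT (T_check D j) (\<iota> f) = \<iota> ?u \<otimes>\<^bsub>LA\<^esub> \<iota> (DLj j f)" .
  have cancel: "x = y" if "\<iota> ?u \<otimes>\<^bsub>LA\<^esub> x = \<iota> ?u \<otimes>\<^bsub>LA\<^esub> y" "x \<in> carrier LA" "y \<in> carrier LA" for x y
  proof -
    have "vv j \<otimes>\<^bsub>LA\<^esub> \<iota> ?u = \<one>\<^bsub>LA\<^esub>"
      using c vv(2)[OF j] by (simp add: SS.A.m_comm)
    then show ?thesis
      using that c by (metis SS.A.m_assoc SS.A.l_one)
  qed
  have "SS.ACT (T_check D j) (\<iota> f) \<in> carrier LA"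
    using T_check_closed[OF j] c by (simp add: smash_eq SS.ACT_closed)
  then show ?thesis
    using cancel[OF eq] c by simp
qed

lemma ACT_smash_loc: "g \<in> WAc \<Longrightarrow> f \<in> WAc \<Longrightarrow> SS.ACT (smash_loc D (\<iota> g)) (\<iota> f) = \<iota> (g * f)"
  by (simp add: smash_loc_def SS.ACT_el \<iota>_rules id_W act_id)

text \<open>On the stabilizer of a point the gradient is injective, so by Dedekind's independence of the
  characters \<open>\<lambda> \<mapsto> X\<^sup>w\<^sup>\<lambda>\<close> elements supported there are determined by their action.\<close>

lemma gradient_stabilizer_inj:
  assumes "w \<in> carrier W" "u \<in> carrier W" "w x0 = x0" "u x0 = x0" "\<And>\<beta>. \<beta> \<in> R0 \<Longrightarrow> gradient w \<beta> = gradient u \<beta>"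
  shows "w = u"
proof
  fix x
  have lin: "linear (gradient w)" "linear (gradient u)"
    using weyl_group_linear[OF gradient_W(1)] assms(1,2) by auto
  have "gradient w y = gradient u y" for y
  proof -
    have "y \<in> span R0"
      using datum by (simp add: affine_datum_def root_system_def)
    then show ?thesis
      using linear_eq_on_span[OF lin, of R0 y] assms(5) by blast
  qed
  moreover have "w x = gradient w x - gradient w x0 + x0"
    using gradient_W(2)[OF assms(1), of x] gradient_W(2)[OF assms(1), of x0] assms(3) by (simp add: algebra_simps)
  moreover have "u x = gradient u x - gradient u x0 + x0"
    using gradient_W(2)[OF assms(2), of x] gradient_W(2)[OF assms(2), of x0] assms(4) by (simp add: algebra_simps)
  ultimately show "w x = u x"
    by simp
qed

lemma LA_cancel:
  "g \<in> WAc \<Longrightarrow> regular g \<Longrightarrow> x \<in> carrier LA \<Longrightarrow> \<iota> g \<otimes>\<^bsub>LA\<^esub> x = \<zero>\<^bsub>LA\<^esub> \<Longrightarrow> x = \<zero>\<^bsub>LA\<^esub>"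
  using Lz.emb_cancel[of g x] by (simp add: LA_eq \<iota>_eq)

lemma characters_independent:
  assumes "finite B" "B \<subseteq> carrier W" "\<And>w. w \<in> B \<Longrightarrow> w x0 = x0" "\<And>w. w \<in> B \<Longrightarrow> F w \<in> carrier LA"
    and "\<And>\<nu>. \<nu> \<in> PP \<Longrightarrow> (\<Oplus>\<^bsub>LA\<^esub>w\<in>B. F w \<otimes>\<^bsub>LA\<^esub> \<iota> (X_pow (gradient w \<nu>))) = \<zero>\<^bsub>LA\<^esub>"
    and "w \<in> B"
  shows "F w = \<zero>\<^bsub>LA\<^esub>"
  using assms
proof (induction B arbitrary: F w rule: finite_psubset_induct)
  case (psubset B)
  note B = psubset.prems
  have PPg: "gradient y \<nu> \<in> PP" if "y \<in> B" "\<nu> \<in> PP" for y \<nu>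
    using PP_W0[OF gradient_W(1)] that B(1) by blast
  have X: "\<iota> (X_pow (gradient y \<nu>)) \<in> carrier LA" if "y \<in> B" "\<nu> \<in> PP" for y \<nu>
    using PPg[OF that] by (simp add: \<iota>_rules X_pow_WA)
  show ?case
  proof (cases "B = {w}")
    case True
    have "F w \<otimes>\<^bsub>LA\<^esub> \<iota> (X_pow (gradient w 0)) = \<zero>\<^bsub>LA\<^esub>"
      using B(4)[of 0] X[of w 0] B(3) True submonoid_PP by (simp add: submonoid_set_def)
    moreover have "gradient w 0 = 0"
      using linear_0[OF weyl_group_linear[OF gradient_W(1)]] B(1,5) by blast
    ultimately show ?thesis
      using B(3,5) by (simp add: X_pow_def \<iota>_rules)
  next
    case False
    then obtain u where u: "u \<in> B" "u \<noteq> w"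
      using B(5) by blast
    have uw: "u \<in> carrier W" "w \<in> carrier W"
      using u B by auto
    obtain \<beta> where \<beta>: "\<beta> \<in> R0" "gradient w \<beta> \<noteq> gradient u \<beta>"
      using gradient_stabilizer_inj[OF uw(2,1) B(2)[OF B(5)] B(2)[OF u(1)]] u(2) by metis
    have \<beta>P: "\<beta> \<in> PP"
      by (rule R0_PP[OF \<beta>(1)])
    let ?h = "\<lambda>y. X_pow (gradient y \<beta>) - X_pow (gradient u \<beta>) :: 'v weight_alg"
    have h: "?h y \<in> WAc" "\<iota> (?h y) \<in> carrier LA" if "y \<in> B" for y
      using PPg[OF that \<beta>P] PPg[OF u(1) \<beta>P] by (simp_all add: \<iota>_rules X_pow_WA WA_closed)
    \<comment> \<open>The coefficients of the relation at \<open>\<nu> + \<beta>\<close> minus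
      \<open>X_pow (gradient u \<beta>)\<close> times the relation at \<open>\<nu>\<close>. The
      coefficient of \<open>u\<close> vanishes, so the induction hypothesis applies to the smaller
      set.\<close>
    define H where "H y = F y \<otimes>\<^bsub>LA\<^esub> \<iota> (?h y)" for y
    have Hc: "H y \<in> carrier LA" if "y \<in> B" for y
      using h(2)[OF that] B(3)[OF that] by (simp add: H_def)
    have Hu: "H u = \<zero>\<^bsub>LA\<^esub>"
      using B(3)[OF u(1)] by (simp add: H_def \<iota>_rules)
    have sum0: "(\<Oplus>\<^bsub>LA\<^esub>y\<in>B - {u}. H y \<otimes>\<^bsub>LA\<^esub> \<iota> (X_pow (gradient y \<nu>))) = \<zero>\<^bsub>LA\<^esub>" if \<nu>: "\<nu> \<in> PP" for \<nu>
    proof -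
      have \<nu>\<beta>: "\<nu> + \<beta> \<in> PP"
        using submonoid_PP \<nu> \<beta>P by (simp add: submonoid_set_def)
      have lin: "gradient y (\<nu> + \<beta>) = gradient y \<nu> + gradient y \<beta>" if "y \<in> B" for y
        using linear_add[OF weyl_group_linear[OF gradient_W(1)]] B(1) that by blast
      let ?c = "\<iota> (X_pow (gradient u \<beta>))"
      have term_eq: "H y \<otimes>\<^bsub>LA\<^esub> \<iota> (X_pow (gradient y \<nu>)) \<oplus>\<^bsub>LA\<^esub> ?c \<otimes>\<^bsub>LA\<^esub> (F y \<otimes>\<^bsub>LA\<^esub> \<iota> (X_pow (gradient y \<nu>))) =
          F y \<otimes>\<^bsub>LA\<^esub> \<iota> (X_pow (gradient y (\<nu> + \<beta>)))" if y: "y \<in> B" for y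
      proof -
        have "F y \<otimes>\<^bsub>LA\<^esub> \<iota> (X_pow (gradient y (\<nu> + \<beta>))) =
            F y \<otimes>\<^bsub>LA\<^esub> \<iota> ((?h y + X_pow (gradient u \<beta>)) * X_pow (gradient y \<nu>))"
          using lin[OF y] by (simp add: X_pow_def mult_single add.commute)
        also have "\<iota> ((?h y + X_pow (gradient u \<beta>)) * X_pow (gradient y \<nu>)) =
            \<iota> (?h y + X_pow (gradient u \<beta>)) \<otimes>\<^bsub>LA\<^esub> \<iota> (X_pow (gradient y \<nu>))"
          using h(1)[OF y] X_pow_WA[OF PPg[OF y \<nu>]] X_pow_WA[OF PPg[OF u(1) \<beta>P]]
          by (intro \<iota>_rules(3) WA_closed(6))
        also have "\<iota> (?h y + X_pow (gradient u \<beta>)) = \<iota> (?h y) \<oplus>\<^bsub>LA\<^esub> ?c"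
          using h(1)[OF y] X_pow_WA[OF PPg[OF u(1) \<beta>P]] by (rule \<iota>_rules(2))
        also have "F y \<otimes>\<^bsub>LA\<^esub> ((\<iota> (?h y) \<oplus>\<^bsub>LA\<^esub> ?c) \<otimes>\<^bsub>LA\<^esub> \<iota> (X_pow (gradient y \<nu>))) = H y \<otimes>\<^bsub>LA\<^esub> \<iota> (X_pow (gradient y \<nu>)) \<oplus>\<^bsub>LA\<^esub> ?c \<otimes>\<^bsub>LA\<^esub> (F y \<otimes>\<^bsub>LA\<^esub> \<iota> (X_pow (gradient y \<nu>)))"
          using h(2)[OF y] X[OF y \<nu>] X[OF u(1) \<beta>P] B(3)[OF y] unfolding H_def
          by (simp add: SS.A.l_distr SS.A.r_distr SS.A.m_ac)
        finally show ?thesis by simp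
      qed
      have cl: "H y \<otimes>\<^bsub>LA\<^esub> \<iota> (X_pow (gradient y \<nu>)) \<in> carrier LA"
        "F y \<otimes>\<^bsub>LA\<^esub> \<iota> (X_pow (gradient y \<nu>)) \<in> carrier LA" if "y \<in> B" for y
        using Hc[OF that] B(3)[OF that] X[OF that \<nu>] by simp_all
      have c: "?c \<in> carrier LA"
        by (rule X[OF u(1) \<beta>P])
      have "\<zero>\<^bsub>LA\<^esub> = (\<Oplus>\<^bsub>LA\<^esub>y\<in>B. H y \<otimes>\<^bsub>LA\<^esub> \<iota> (X_pow (gradient y \<nu>)) \<oplus>\<^bsub>LA\<^esub> ?c \<otimes>\<^bsub>LA\<^esub> (F y \<otimes>\<^bsub>LA\<^esub> \<iota> (X_pow (gradient y \<nu>))))"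
        unfolding B(4)[OF \<nu>\<beta>, symmetric]
        by (rule SS.A.finsum_cong') (use term_eq cl c in auto)
      also have "\<dots> = (\<Oplus>\<^bsub>LA\<^esub>y\<in>B. H y \<otimes>\<^bsub>LA\<^esub> \<iota> (X_pow (gradient y \<nu>))) \<oplus>\<^bsub>LA\<^esub>
          (\<Oplus>\<^bsub>LA\<^esub>y\<in>B. ?c \<otimes>\<^bsub>LA\<^esub> (F y \<otimes>\<^bsub>LA\<^esub> \<iota> (X_pow (gradient y \<nu>))))"
        by (rule SS.A.finsum_addf) (use cl c in auto)
      also have "(\<Oplus>\<^bsub>LA\<^esub>y\<in>B. ?c \<otimes>\<^bsub>LA\<^esub> (F y \<otimes>\<^bsub>LA\<^esub> \<iota> (X_pow (gradient y \<nu>)))) =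
          ?c \<otimes>\<^bsub>LA\<^esub> (\<Oplus>\<^bsub>LA\<^esub>y\<in>B. F y \<otimes>\<^bsub>LA\<^esub> \<iota> (X_pow (gradient y \<nu>)))"
        by (rule SS.A.finsum_rdistr[symmetric]) (use psubset.hyps cl c in auto)
      also have "\<dots> = \<zero>\<^bsub>LA\<^esub>"
        using B(4)[OF \<nu>] c by simp
      finally have "(\<Oplus>\<^bsub>LA\<^esub>y\<in>B. H y \<otimes>\<^bsub>LA\<^esub> \<iota> (X_pow (gradient y \<nu>))) = \<zero>\<^bsub>LA\<^esub>"
        using cl by (simp add: SS.A.finsum_closed)
      moreover have "(\<Oplus>\<^bsub>LA\<^esub>y\<in>B - {u}. H y \<otimes>\<^bsub>LA\<^esub> \<iota> (X_pow (gradient y \<nu>))) = (\<Oplus>\<^bsub>LA\<^esub>y\<in>B. H y \<otimes>\<^bsub>LA\<^esub> \<iota> (X_pow (gradient y \<nu>)))"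
        by (rule SS.A.add.finprod_mono_neutral_cong_left)
          (use psubset.hyps cl Hu X[OF u(1) \<nu>] in auto)
      ultimately show ?thesis
        by simp
    qed
    have "H w = \<zero>\<^bsub>LA\<^esub>"
      by (rule psubset.IH[of "B - {u}" H w]) (use u B Hc sum0 in auto)
    \<comment> \<open>Up to the unit \<open>X_pow (gradient u \<beta>)\<close> and a sign this is a
      binomial with nonzero exponent, so the vanishing of \<open>H w\<close> carries over to
      \<open>F w\<close>.\<close>
    moreover have "regular (?h w)"
    proof -
      have e: "?h w = X_pow (gradient u \<beta>) * (X_pow (gradient w \<beta> - gradient u \<beta>) - 1)"
        by (simp add: X_pow_def right_diff_distrib mult_single)
      have r1: "regular (X_pow \<mu>)" for \<mu> :: 'v
      proof -
        have "regular (X_pow (- \<mu>) * X_pow \<mu>)"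
          by (simp add: X_pow_def mult_single regular_1)
        then show ?thesis
          by (rule regular_mult_left)
      qed
      have "regular (1 - X_pow (gradient w \<beta> - gradient u \<beta>) :: 'v weight_alg)"
        unfolding X_pow_def using \<beta>(2) by (intro regular_binomial) simp
      then have "regular (X_pow (gradient w \<beta> - gradient u \<beta>) - 1 :: 'v weight_alg)"
        using regular_mult_left[of "- 1" "X_pow (gradient w \<beta> - gradient u \<beta>) - 1 :: 'v weight_alg"] by simp
      then show ?thesis
        unfolding e using r1 by (intro regular_mult)
    qed
    ultimately show ?thesis
      using LA_cancel[OF h(1)[OF B(5)] _ B(3)[OF B(5)]] h(2)[OF B(5)] B(3)[OF B(5)]
      by (simp add: H_def SS.A.m_comm)
  qed
qed

definition stabilizer :: "'v \<Rightarrow> ('v \<Rightarrow> 'v) set" where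
  "stabilizer x0 = {w \<in> carrier W. w x0 = x0}"

lemma ACT_faithful:
  assumes F: "F \<in> SS.supported (stabilizer x0)" and H: "H \<in> SS.supported (stabilizer x0)"
    and eq: "\<And>f. f \<in> WAc \<Longrightarrow> SS.ACT F (\<iota> f) = SS.ACT H (\<iota> f)"
  shows "F = H"
proof -
  let ?F = "F \<ominus>\<^bsub>smash D\<^esub> H"
  have Fs: "?F \<in> SS.supported (stabilizer x0)"
    unfolding smash_eq by (rule SS.supported_minus[OF F H])
  note c = SS.supported_carrier[OF F] SS.supported_carrier[OF H] SS.supported_carrier[OF Fs]
  let ?B = "{w. ?F w \<noteq> \<zero>\<^bsub>LA\<^esub>}"
  have B: "?B \<subseteq> stabilizer x0"
    using Fs by (auto simp: SS.supported_def)
  have "?F w = \<zero>\<^bsub>LA\<^esub>" if "w \<in> ?B" for w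
  proof (rule characters_independent[where B = ?B and ?x0.0 = x0 and F = ?F])
    show "finite ?B" "\<And>w. w \<in> ?B \<Longrightarrow> ?F w \<in> carrier LA"
      using SS.SP_D[OF c(3)] by auto
    show "?B \<subseteq> carrier W" "\<And>w. w \<in> ?B \<Longrightarrow> w x0 = x0"
      using B by (auto simp: stabilizer_def)
    fix \<nu> assume \<nu>: "\<nu> \<in> PP"
    have "(\<Oplus>\<^bsub>LA\<^esub>w\<in>?B. ?F w \<otimes>\<^bsub>LA\<^esub> \<iota> (X_pow (gradient w \<nu>))) = SS.ACT ?F (\<iota> (X_pow \<nu>))"
      unfolding SS.ACT_def
    proof (rule SS.A.finsum_cong')
      fix w assume w: "w \<in> ?B"
      then have "w \<in> carrier W"
        using B by (auto simp: stabilizer_def)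
      then have "loc_act D (gradient w) (\<iota> (X_pow \<nu>)) = \<iota> (X_pow (gradient w \<nu>))"
        using gradient_W(1) \<nu> by (simp add: loc_act_\<iota> X_pow_WA) (simp add: X_pow_def)
      then show "?F w \<otimes>\<^bsub>LA\<^esub> \<iota> (X_pow (gradient w \<nu>)) = ?F w \<otimes>\<^bsub>LA\<^esub> loc_act D (gradient w) (\<iota> (X_pow \<nu>))"
        by simp
    next
      show "(\<lambda>w. ?F w \<otimes>\<^bsub>LA\<^esub> loc_act D (gradient w) (\<iota> (X_pow \<nu>))) \<in> ?B \<rightarrow> carrier LA"
        using SS.SP_D[OF c(3)] B \<nu> by (auto simp: stabilizer_def \<iota>_rules X_pow_WA)
    qed simp
    also have "\<dots> = \<zero>\<^bsub>LA\<^esub>"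
      unfolding smash_eq using c \<nu> by (intro SS.ACT_minus eq) (simp_all add: \<iota>_rules X_pow_WA)
    finally show "(\<Oplus>\<^bsub>LA\<^esub>w\<in>?B. ?F w \<otimes>\<^bsub>LA\<^esub> \<iota> (X_pow (gradient w \<nu>))) = \<zero>\<^bsub>LA\<^esub>" .
  qed (use that in simp)
  then have "?F = \<zero>\<^bsub>smash D\<^esub>"
    by (auto simp: smash_eq SS.zero_SP)
  then show ?thesis
    using c(1,2) SM.r_right_minus_eq[of F H] by (simp add: smash_eq)
qed

end

section \<open>The defining relations in the smash product\<close>

definition list_mult :: "('a, 'b) monoid_scheme \<Rightarrow> 'a list \<Rightarrow> 'a" where
  "list_mult G xs = foldr (mult G) xs (one G)"

lemma list_mult_Nil [simp]: "list_mult G [] = \<one>\<^bsub>G\<^esub>"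
  by (simp add: list_mult_def)

lemma list_mult_Cons [simp]: "list_mult G (x # xs) = x \<otimes>\<^bsub>G\<^esub> list_mult G xs"
  by (simp add: list_mult_def)

lemma (in Group.monoid) list_mult_closed: "set xs \<subseteq> carrier G \<Longrightarrow> list_mult G xs \<in> carrier G"
  by (induction xs) auto

lemma (in Group.monoid) list_mult_append:
  "set xs \<subseteq> carrier G \<Longrightarrow> set ys \<subseteq> carrier G \<Longrightarrow> list_mult G (xs @ ys) = list_mult G xs \<otimes> list_mult G ys"
  by (induction xs) (auto simp: m_assoc list_mult_closed)

context affine_data
begin

abbreviation "SC \<equiv> carrier (smash D)"

abbreviation smash_plus (infixl \<open>\<boxplus>\<close> 65) where "x \<boxplus> y \<equiv> x \<oplus>\<^bsub>smash D\<^esub> y"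
abbreviation smash_times (infixl \<open>\<boxdot>\<close> 70) where "x \<boxdot> y \<equiv> x \<otimes>\<^bsub>smash D\<^esub> y"

section \<open>Scalars, weights and group elements inside the smash product\<close>

definition SL :: "'v weight_alg \<Rightarrow> 'v smash_alg" where
  "SL f = smash_loc D (\<iota> f)"

lemma smash_scalar_SL: "smash_scalar D l = SL (scalar l)"
  by (simp add: smash_scalar_def SL_def)

lemma smash_X_SL: "smash_X D \<nu> = SL (X_pow \<nu>)"
  by (simp add: smash_X_def SL_def)

lemma SL_el: "SL f = el (\<iota> f) id"
  by (simp add: SL_def smash_loc_def)

lemma SL_closed: "f \<in> WAc \<Longrightarrow> SL f \<in> SC"
  unfolding SL_el smash_eq by (intro SS.el_closed) (simp_all add: \<iota>_rules id_W del: id_apply)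

lemma SL_add: "f \<in> WAc \<Longrightarrow> g \<in> WAc \<Longrightarrow> SL (f + g) = SL f \<boxplus> SL g"
  unfolding SL_el smash_eq by (simp add: \<iota>_rules SS.el_add)

lemma SL_mult: "f \<in> WAc \<Longrightarrow> g \<in> WAc \<Longrightarrow> SL (f * g) = SL f \<boxdot> SL g"
  unfolding SL_el smash_eq by (simp add: SS.el_mult \<iota>_rules id_W act_id del: id_apply)

lemma SL_one: "SL 1 = \<one>\<^bsub>smash D\<^esub>"
  by (simp add: SL_el smash_eq SS.one_SP \<iota>_rules)

lemma smash_grp_mult: "x \<in> carrier W \<Longrightarrow> y \<in> carrier W \<Longrightarrow> smash_grp D x \<boxdot> smash_grp D y = smash_grp D (x \<circ> y)"
  unfolding smash_grp_def smash_eq by (simp add: SS.el_mult)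

lemma smash_grp_id: "smash_grp D id = \<one>\<^bsub>smash D\<^esub>"
  by (simp add: smash_grp_def smash_eq SS.one_SP)

lemma smash_grp_SL:
  assumes "w \<in> carrier W" "f \<in> WAc"
  shows "smash_grp D w \<boxdot> SL f = SL (weight_act (gradient w) f) \<boxdot> smash_grp D w"
proof -
  have "weight_act (gradient w) f \<in> WAc"
    by (rule weight_act_WA[OF gradient_W(1)[OF assms(1)] assms(2)])
  then show ?thesis
    unfolding SL_el smash_grp_def smash_eq using assms gradient_W(1)[OF assms(1)]
    by (simp add: SS.el_mult \<iota>_rules id_W loc_act_\<iota> del: id_apply)
qed

text \<open>Gradients are linear and fix the exponent 0, so constants are invariant under the
  action.\<close>

lemma smash_scalar_central:
  assumes l: "l \<in> KK" and F: "F \<in> SC"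
  shows "smash_scalar D l \<boxdot> F = F \<boxdot> smash_scalar D l"
  using F unfolding smash_eq
proof (induction F rule: SS.SP_induct)
  case zero
  show ?case
    using smash_scalar_closed[OF l] SM.l_null[of "smash_scalar D l"] SM.r_null[of "smash_scalar D l"]
    by (simp add: smash_eq)
next
  case (add_el a x H)
  have c: "el a x \<in> SC" "H \<in> SC" "smash_scalar D l \<in> SC" "\<iota> (scalar l) \<in> carrier LA"
    using add_el smash_scalar_closed[OF l] by (simp_all add: smash_eq SS.el_closed \<iota>_rules scalar_WA l)
  have fix_l: "loc_act D (gradient x) (\<iota> (scalar l)) = \<iota> (scalar l)"
    using linear_0[OF weyl_group_linear[OF gradient_W(1)[OF add_el(2)]]]
    by (simp add: loc_act_\<iota> gradient_W(1) add_el(2) scalar_WA l)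
  have "smash_scalar D l \<boxdot> el a x = el a x \<boxdot> smash_scalar D l"
    unfolding smash_scalar_SL SL_el smash_eq using c add_el
    by (simp add: SS.el_mult id_W act_id fix_l SS.A.m_comm del: id_apply)
  then show ?case
    using add_el(4) c by (simp add: SM.l_distr SM.r_distr flip: smash_eq)
qed

abbreviation "SUPP x0 \<equiv> SS.supported (stabilizer x0)"

lemma SUPP_mult: "F \<in> SUPP x0 \<Longrightarrow> H \<in> SUPP x0 \<Longrightarrow> F \<boxdot> H \<in> SUPP x0"
  unfolding smash_eq by (rule SS.supported_mult) (auto simp: stabilizer_def carrier_W_comp)

lemma SUPP_add: "F \<in> SUPP x0 \<Longrightarrow> H \<in> SUPP x0 \<Longrightarrow> F \<boxplus> H \<in> SUPP x0"
  unfolding smash_eq by (rule SS.supported_add)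

lemma SUPP_SC: "F \<in> SUPP x0 \<Longrightarrow> F \<in> SC"
  unfolding smash_eq by (rule SS.supported_carrier)

lemma SUPP_SL: "f \<in> WAc \<Longrightarrow> SL f \<in> SUPP x0"
  unfolding SL_el by (intro SS.supported_el) (simp_all add: \<iota>_rules id_W stabilizer_def del: id_apply, simp)

lemma SUPP_T:
  assumes "j \<le> DIM('v)" "sar j x0 = 0"
  shows "T_check D j \<in> SUPP x0"
proof -
  have "sr j \<in> stabilizer x0" "id \<in> stabilizer x0"
    using assms sr_in_W[OF assms(1)] id_W by (simp_all add: stabilizer_def sr_eq)
  then show ?thesis
    unfolding T_check_eq[OF assms(1)] using cc_dd_closed[OF assms(1)] sr_in_W[OF assms(1)] id_W
    by (intro SUPP_add SS.supported_el) auto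
qed

text \<open>Any vertex of the alcove other than the \<open>j\<close>-th lies on the hyperplane;
  index 0 or 1 is available since the dimension is positive.\<close>

lemma T_check_zero:
  assumes "j \<le> DIM('v)"
  obtains x0 where "sar j x0 = 0"
proof -
  have "(if j = 0 then 1 else 0) \<le> DIM('v)"
    by simp
  then have "sar j (vert (if j = 0 then 1 else 0)) = 0"
    using assms by (intro sar_vert) auto
  then show ?thesis
    by (rule that)
qed

lemma ACT_mult': "F \<in> SC \<Longrightarrow> H \<in> SC \<Longrightarrow> f \<in> WAc \<Longrightarrow> SS.ACT (F \<boxdot> H) (\<iota> f) = SS.ACT F (SS.ACT H (\<iota> f))"
  unfolding smash_eq by (rule SS.ACT_mult) (simp_all add: \<iota>_rules)

lemma ACT_add': "F \<in> SC \<Longrightarrow> H \<in> SC \<Longrightarrow> f \<in> WAc \<Longrightarrow>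
    SS.ACT (F \<boxplus> H) (\<iota> f) = SS.ACT F (\<iota> f) \<oplus>\<^bsub>LA\<^esub> SS.ACT H (\<iota> f)"
  unfolding smash_eq by (rule SS.ACT_add_left) (simp_all add: \<iota>_rules)

lemma ACT_SL: "g \<in> WAc \<Longrightarrow> f \<in> WAc \<Longrightarrow> SS.ACT (SL g) (\<iota> f) = \<iota> (g * f)"
  by (simp add: SL_def ACT_smash_loc)

lemma T_check_square:
  assumes j: "j \<le> DIM('v)"
  shows "T_check D j \<boxdot> T_check D j = SL (scalar (tt j)) \<boxdot> T_check D j \<boxplus> \<one>\<^bsub>smash D\<^esub>"
proof -
  interpret RL: reflection_lattice KK PP "alpha D j"
    by (rule reflection_lattice_PP[OF alpha_in[OF j]])
  obtain x0 where x0: "sar j x0 = 0"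
    using T_check_zero[OF j] .
  note T = SUPP_T[OF j x0] and s = scalar_WA[OF tt_closed[OF j]]
  show ?thesis
  proof (rule ACT_faithful[of _ x0])
    fix f assume f: "f \<in> WAc"
    note c = T_check_closed[OF j] SL_closed[OF s] DLj_closed[OF j] f s
    have "DLj j (DLj j f) = scalar (tt j) * DLj j f + f"
      unfolding DLj_def using f tau_eq tau_closed(1)[OF j] tt_closed[OF j] by (intro RL.DL_quadratic) (auto simp: WA_eq)
    then show "SS.ACT (T_check D j \<boxdot> T_check D j) (\<iota> f) =
        SS.ACT (SL (scalar (tt j)) \<boxdot> T_check D j \<boxplus> \<one>\<^bsub>smash D\<^esub>) (\<iota> f)"
      unfolding SL_one[symmetric] using c
      by (simp add: ACT_mult' ACT_add' ACT_T_check[OF j] ACT_SL SL_closed WA_closed \<iota>_rules)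
  qed (use T s in \<open>auto intro!: SUPP_mult SUPP_add SUPP_SL simp: SL_one[symmetric] WA_closed\<close>)
qed

lemma T_check_X:
  assumes j: "j \<le> DIM('v)" and \<nu>: "\<nu> \<in> PP"
  shows "T_check D j \<boxdot> SL (X_pow \<nu>) =
    SL (X_pow (reflection (alpha D j) \<nu>)) \<boxdot> T_check D j \<boxplus> SL (scalar (tt j) * demazure (alpha D j) (X_pow \<nu>))"
proof -
  interpret RL: reflection_lattice KK PP "alpha D j"
    by (rule reflection_lattice_PP[OF alpha_in[OF j]])
  obtain x0 where x0: "sar j x0 = 0"
    using T_check_zero[OF j] .
  have d: "scalar (tt j) * RL.d (X_pow \<nu>) \<in> WAc"
    using RL.d_closed[OF RL.X_pow_closed[OF \<nu>]] scalar_WA[OF tt_closed[OF j]] by (simp add: WA_closed flip: WA_eq)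
  note T = SUPP_T[OF j x0] and x = X_pow_WA[OF \<nu>] X_pow_WA[OF RL.S_refl[OF \<nu>]]
  show ?thesis
  proof (rule ACT_faithful[of _ x0])
    fix f assume f: "f \<in> WAc"
    note c = T_check_closed[OF j] SL_closed DLj_closed[OF j] f d x
    have "DLj j (X_pow \<nu> * f) = X_pow (reflection (alpha D j) \<nu>) * DLj j f + scalar (tt j) * RL.d (X_pow \<nu>) * f"
      unfolding DLj_def using f \<nu> by (intro RL.DL_X) (auto simp: WA_eq)
    then show "SS.ACT (T_check D j \<boxdot> SL (X_pow \<nu>)) (\<iota> f) =
        SS.ACT (SL (X_pow (reflection (alpha D j) \<nu>)) \<boxdot> T_check D j \<boxplus> SL (scalar (tt j) * RL.d (X_pow \<nu>))) (\<iota> f)"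
      using c by (simp add: ACT_mult' ACT_add' ACT_T_check[OF j] ACT_SL SL_closed WA_closed \<iota>_rules(1,2))
  qed (use T d x in \<open>auto intro!: SUPP_mult SUPP_add SUPP_SL\<close>)
qed

lemma T_word_altl:
  assumes j: "j \<le> DIM('v)" and k: "k \<le> DIM('v)" and x0: "sar j x0 = 0" "sar k x0 = 0"
  shows "list_mult (smash D) (map (T_check D) (altl q j k)) \<in> SUPP x0 \<and>
    (\<forall>f\<in>WAc. altf q (DLj j) (DLj k) f \<in> WAc \<and>
      SS.ACT (list_mult (smash D) (map (T_check D) (altl q j k))) (\<iota> f) = \<iota> (altf q (DLj j) (DLj k) f))"
  using assms
proof (induction q arbitrary: j k)
  case 0
  then show ?case
    using SUPP_SL[of 1 x0] ACT_SL[of 1] by (simp add: WA_closed SL_one)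
next
  case (Suc q)
  have IH: "list_mult (smash D) (map (T_check D) (altl q k j)) \<in> SUPP x0"
    "\<And>f. f \<in> WAc \<Longrightarrow> altf q (DLj k) (DLj j) f \<in> WAc"
    "\<And>f. f \<in> WAc \<Longrightarrow>
      SS.ACT (list_mult (smash D) (map (T_check D) (altl q k j))) (\<iota> f) = \<iota> (altf q (DLj k) (DLj j) f)"
    using Suc by auto
  then show ?case
    using Suc.prems by (auto simp: SUPP_mult SUPP_T DLj_closed ACT_mult' T_check_closed SUPP_SC[OF IH(1)] ACT_T_check)
qed

lemma T_check_braid:
  assumes jk: "j \<le> DIM('v)" "k \<le> DIM('v)" "j \<noteq> k" and ord: "coxeter_order D j k \<noteq> 0"
  shows "list_mult (smash D) (map (T_check D) (altl (coxeter_order D j k) j k)) =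
    list_mult (smash D) (map (T_check D) (altl (coxeter_order D j k) k j))"
proof -
  obtain x0 where x0: "sar j x0 = 0" "sar k x0 = 0"
    using common_zero[OF jk ord] by blast
  let ?q = "coxeter_order D j k"
  have braid: "altf ?q (DLj a) (DLj b) f = altf ?q (DLj b) (DLj a) f"
    if ab: "a \<le> DIM('v)" "b \<le> DIM('v)" and f: "f \<in> WAc"
      and C: "(cartan a b, cartan b a, ?q) \<in> {(0, 0, 2), (-1, -1, 3), (-2, -1, 4), (-3, -1, 6)}" for a b f
  proof -
    interpret P: reflection_pair "alpha D a" "alpha D b" "tau D a" "tt a" "tau D b" "tt b"
      by unfold_locales (use ab cartan_Ints nonzero alpha_in tau_eq in auto)
    \<comment> \<open>Weights pair integrally with both coroots, so \<open>f\<close> lies in the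
      larger algebra to which the rank two theorem applies.\<close>
    have "f \<in> P.MM"
      using f ab alpha_in by (auto simp: WA_eq carrier_monoid_algebra P.LS_def weights_def weight_lattice_def)
    moreover have "tau D a = tau D b \<and> tt a = tt b" if "?q = 3"
    proof -
      have "weyl_orbit D (alpha D a) = weyl_orbit D (alpha D b)"
        using C that ab by (intro weyl_orbit_cartan) auto
      then show ?thesis
        by (simp add: tau_def tau_inv_def)
    qed
    ultimately show ?thesis
      unfolding DLj_def using P.braid_DL[OF C] by blast
  qed
  have "altf ?q (DLj j) (DLj k) f = altf ?q (DLj k) (DLj j) f" if "f \<in> WAc" for f
    using rank_two[OF jk ord] braid[OF jk(1,2) that] braid[OF jk(2,1) that] by auto
  then show ?thesis
    using T_word_altl[OF jk(1,2) x0, of ?q] T_word_altl[OF jk(2,1) x0(2,1), of ?q]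
    by (intro ACT_faithful[of _ x0]) auto
qed

lemma Omega_alpha:
  assumes u: "u \<in> Omega D" and j: "j \<le> DIM('v)"
  shows "alpha D (perm_index D u j) = gradient u (alpha D j)"
  using Omega_perm(2)[OF u j] by (intro affine_fun_comp_W_eqD[OF Omega_in_W[OF u]]) (simp add: simple_affine_root_def)

lemma tau_Omega:
  assumes u: "u \<in> Omega D" and j: "j \<le> DIM('v)"
  shows "tau D (perm_index D u j) = tau D j" "tau_inv D (perm_index D u j) = tau_inv D j"
  using weyl_orbit_W0[OF gradient_W(1)[OF Omega_in_W[OF u]]]
  by (simp_all add: tau_def tau_inv_def Omega_alpha[OF u j])

text \<open>The gradient of \<open>u\<close> carries \<open>alpha D j\<close> to the permuted simple
  root and preserves Weyl orbits, hence parameters. The inverse \<open>vv\<close> is transported by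
  uniqueness of inverses.\<close>

lemma Omega_cc_dd:
  assumes u: "u \<in> Omega D" and j: "j \<le> DIM('v)"
  shows "loc_act D (gradient u) (cc j) = cc (perm_index D u j)" "loc_act D (gradient u) (dd j) = dd (perm_index D u j)"
proof -
  let ?k = "perm_index D u j" and ?a = "loc_act D (gradient u)"
  have uW: "u \<in> carrier W" and k: "?k \<le> DIM('v)"
    using Omega_in_W[OF u] Omega_perm(1)[OF u j] .
  have lin: "gradient u 0 = 0" "gradient u (- alpha D j) = - alpha D ?k"
    using weyl_group_linear[OF gradient_W(1)[OF uW]] by (simp_all add: linear_0 linear_neg Omega_alpha[OF u j])
  have f: "1 - X_pow (- alpha D i) \<in> WAc" if "i \<le> DIM('v)" for i
    using that by (intro factor_WA uminus_\<Phi> alpha_in)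
  have "\<iota> (1 - X_pow (- alpha D ?k)) = ?a (\<iota> (1 - X_pow (- alpha D j)))"
    using f[OF j] uW gradient_W(1)
    by (simp add: loc_act_\<iota> weight_act_diff weight_act_one lin) (simp add: X_pow_def lin)
  then have "\<iota> (1 - X_pow (- alpha D ?k)) \<otimes>\<^bsub>LA\<^esub> ?a (vv j) = \<one>\<^bsub>LA\<^esub>"
    using f[OF j] vv[OF j] uW SS.act_times[of u "\<iota> (1 - X_pow (- alpha D j))" "vv j"] by (simp add: \<iota>_rules)
  then have v: "?a (vv j) = vv ?k"
    using vv[OF k] vv(1)[OF j] uW f[OF k] SS.A.inv_unique[of "?a (vv j)" "\<iota> (1 - X_pow (- alpha D ?k))" "vv ?k"]
    by (simp add: \<iota>_rules SS.A.m_comm)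
  have s: "?a (\<iota> (scalar l)) = \<iota> (scalar l)" if "l \<in> KK" for l
    using that uW gradient_W(1) by (simp add: loc_act_\<iota> scalar_WA lin)
  show d: "?a (dd j) = dd ?k"
    using uW vv[OF j] tt_closed[OF j] by (simp add: dd_def v s \<iota>_rules scalar_WA tau_Omega[OF u j])
  interpret h: ring_hom_ring LA LA ?a
    by (rule ring_hom_ringI2) (use SS.act_hom[OF uW] SS.A.ring_axioms in auto)
  show "?a (cc j) = cc ?k"
    using uW cc_dd_closed(1)[OF j] tau_closed(1)[OF j]
    by (simp add: cc_def a_minus_def d s \<iota>_rules scalar_WA tau_Omega[OF u j])
qed

text \<open>The element \<open>u\<close> need not fix a point of the hyperplane of
  \<open>sar j\<close>, so \<open>ACT_faithful\<close> gives no access; the two coefficients are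
  compared directly.\<close>

lemma smash_grp_T:
  assumes u: "u \<in> Omega D" and j: "j \<le> DIM('v)"
  shows "smash_grp D u \<boxdot> T_check D j = T_check D (perm_index D u j) \<boxdot> smash_grp D u"
proof -
  let ?k = "perm_index D u j"
  have uW: "u \<in> carrier W" and k: "?k \<le> DIM('v)"
    using Omega_in_W[OF u] Omega_perm(1)[OF u j] .
  have conj: "sr ?k \<circ> u = u \<circ> sr j"
    by (rule sr_conj[OF uW Omega_perm(2)[OF u j]])
  note c = cc_dd_closed[OF j] cc_dd_closed[OF k] uW sr_in_W[OF j] sr_in_W[OF k] id_W
  have one: "el \<one>\<^bsub>LA\<^esub> u \<in> SC"
    using c by (simp add: smash_eq SS.el_closed)
  have cl: "el (cc j) (sr j) \<in> SC" "el (dd j) id \<in> SC" "el (cc ?k) (sr ?k) \<in> SC" "el (dd ?k) id \<in> SC"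
    using c unfolding smash_eq by (auto intro!: SS.el_closed)
  have "smash_grp D u \<boxdot> T_check D j = el (cc ?k) (u \<circ> sr j) \<boxplus> el (dd ?k) u"
    unfolding T_check_eq[OF j] smash_grp_def SM.r_distr[OF cl(1,2) one] unfolding smash_eq
    using c by (simp add: SS.el_mult Omega_cc_dd[OF u j] del: id_apply)
  moreover have "T_check D ?k \<boxdot> smash_grp D u = el (cc ?k) (sr ?k \<circ> u) \<boxplus> el (dd ?k) u"
    unfolding T_check_eq[OF k] smash_grp_def SM.l_distr[OF cl(3,4) one] unfolding smash_eq
    using c by (simp add: SS.el_mult del: id_apply)
  ultimately show ?thesis
    by (simp only: conj)
qed

end

section \<open>The homomorphism out of the Hecke algebra\<close>

context affine_data
begin

section \<open>The free algebra on the generators\<close>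

abbreviation "FM \<equiv> {w. set (letters w) \<subseteq> daha_gens D}"
abbreviation "FA \<equiv> free_algebra D"
abbreviation "FC \<equiv> carrier (free_algebra D)"

lemma FA_eq: "FA = monoid_algebra KK FM"
  by (simp add: free_algebra_def)

lemma FA_sel [simp]: "mult FA = (*)" "one FA = 1" "zero FA = 0" "add FA = (+)"
  by (simp_all add: free_algebra_def)

lemma submonoid_FM: "submonoid_set FM"
  by (auto simp: submonoid_set_def zero_free_word_def plus_free_word_def)

lemmas FC_subring = subring_set_monoid_algebra[OF subring_KK submonoid_FM, folded FA_eq]
lemmas FC_closed = subring_setD[OF FC_subring]

sublocale FR: ring FA
  unfolding FA_eq by (rule ring_monoid_algebra[OF subring_KK submonoid_FM])

lemma FC_scalar: "l \<in> KK \<Longrightarrow> scalar l \<in> FC"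
  unfolding FA_eq using subring_KK submonoid_FM by (intro single_in_monoid_algebra) (auto simp: submonoid_set_def)

lemma FC_gen: "g \<in> daha_gens D \<Longrightarrow> gen g \<in> FC"
  unfolding FA_eq gen_def using subring_KK by (intro single_in_monoid_algebra) (auto simp: subring_setD)

lemma gens: "j \<le> DIM('v) \<Longrightarrow> Gen_T j \<in> daha_gens D" "j \<le> DIM('v) \<Longrightarrow> Gen_T_inv j \<in> daha_gens D"
  "u \<in> Omega D \<Longrightarrow> Gen_Om u \<in> daha_gens D" "u \<in> Omega D \<Longrightarrow> Gen_Om_inv u \<in> daha_gens D"
  "\<nu> \<in> PP \<Longrightarrow> Gen_X \<nu> \<in> daha_gens D"
  by (auto simp: daha_gens_def)

lemma scalar_mult_single: "scalar k * Poly_Mapping.single w l = Poly_Mapping.single w (k * l)"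
  by (simp add: mult_single)

lemma scalar_commutes: "scalar k * f = f * (scalar k :: 'v free_alg)"
  by (induction f rule: poly_mapping_single_induct) (simp_all add: distrib_left distrib_right mult_single mult.commute)

lemma free_induct [consumes 1, case_names scalar gen add mult]:
  assumes f: "f \<in> FC" and sc: "\<And>l. l \<in> KK \<Longrightarrow> P (scalar l)" and gn: "\<And>g. g \<in> daha_gens D \<Longrightarrow> P (gen g)"
    and add: "\<And>f g. f \<in> FC \<Longrightarrow> g \<in> FC \<Longrightarrow> P f \<Longrightarrow> P g \<Longrightarrow> P (f + g)"
    and mult: "\<And>f g. f \<in> FC \<Longrightarrow> g \<in> FC \<Longrightarrow> P f \<Longrightarrow> P g \<Longrightarrow> P (f * g)"
  shows "P f"
proof -
  have word: "P (Poly_Mapping.single (Word gs) 1) \<and> Poly_Mapping.single (Word gs) 1 \<in> FC" if "set gs \<subseteq> daha_gens D" for gs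
    using that
  proof (induction gs)
    case Nil
    show ?case
      using sc[of 1] FC_scalar[of 1] subring_KK by (simp add: subring_setD zero_free_word_def)
  next
    case (Cons g gs)
    have "Poly_Mapping.single (Word (g # gs)) 1 = gen g * Poly_Mapping.single (Word gs) (1 :: 'v coeff)"
      by (simp add: gen_def mult_single plus_free_word_def)
    then show ?case
      using Cons gn FC_gen mult by (simp add: FC_closed)
  qed
  show ?thesis
    using f unfolding FA_eq
  proof (induction f rule: monoid_algebra_induct)
    case zero
    show ?case
      using sc[of 0] subring_KK by (simp add: subring_setD)
  next
    case (add_single m k g)
    obtain gs where m: "m = Word gs" "set gs \<subseteq> daha_gens D"
      using add_single(1) by (cases m) auto
    have e: "Poly_Mapping.single m k = scalar k * Poly_Mapping.single (Word gs) 1"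
      using scalar_mult_single[of k "Word gs" 1] m(1) by simp
    have P: "P (Poly_Mapping.single m k)"
      unfolding e using word[OF m(2)] sc[OF add_single(2)] FC_scalar[OF add_single(2)] by (intro mult) auto
    have c: "Poly_Mapping.single m k \<in> FC"
      unfolding e using word[OF m(2)] FC_scalar[OF add_single(2)] by (intro FC_closed) auto
    show ?case
      by (rule add[OF c _ P add_single(4)]) (use add_single(3) in \<open>simp add: FA_eq\<close>)
  qed (fact subring_KK)
qed

text \<open>The formal inverse of \<open>T_j\<close> goes to \<open>T_check D j\<close> minus
  \<open>tau - 1/tau\<close>, its inverse by the quadratic relation.\<close>

fun gen_image :: "'v daha_gen \<Rightarrow> 'v smash_alg" where
  "gen_image (Gen_T j) = T_check D j"
| "gen_image (Gen_T_inv j) = T_check D j \<ominus>\<^bsub>smash D\<^esub> SL (scalar (tt j))"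
| "gen_image (Gen_Om u) = smash_grp D u"
| "gen_image (Gen_Om_inv u) = smash_grp D (inv_into UNIV u)"
| "gen_image (Gen_X \<nu>) = SL (X_pow \<nu>)"

lemma gen_image_closed: "g \<in> daha_gens D \<Longrightarrow> gen_image g \<in> SC"
  using T_check_closed SL_closed[OF scalar_WA[OF tt_closed]] smash_grp_closed Omega_in_W Omega_inverse SL_closed[OF X_pow_WA]
  by (auto simp: daha_gens_def)

section \<open>Evaluation of the free algebra in the smash product\<close>

definition word_image :: "'v daha_gen free_word \<Rightarrow> 'v smash_alg" where
  "word_image w = list_mult (smash D) (map gen_image (letters w))"

sublocale EV: monoid_algebra_maps "smash D" KK FM "smash_scalar D" word_image
proof
  show "subring_set KK" "submonoid_set FM"
    by (rule subring_KK submonoid_FM)+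
  have wi: "set (map gen_image (letters w)) \<subseteq> SC" if "w \<in> FM" for w
    using that gen_image_closed by auto
  show cl: "word_image w \<in> SC" if "w \<in> FM" for w
    unfolding word_image_def using wi[OF that] by (rule SM.list_mult_closed)
  show "word_image (v + w) = word_image v \<boxdot> word_image w" if "v \<in> FM" "w \<in> FM" for v w
    using SM.list_mult_append[OF wi[OF that(1)] wi[OF that(2)]] by (simp add: word_image_def plus_free_word_def)
  show "word_image 0 = \<one>\<^bsub>smash D\<^esub>"
    by (simp add: word_image_def zero_free_word_def)
  show "smash_scalar D k \<boxdot> word_image w = word_image w \<boxdot> smash_scalar D k" if "k \<in> KK" "w \<in> FM" for k w
    using that cl by (simp add: smash_scalar_central)
qed (simp_all add: smash_scalar_SL scalar_WA SL_closed SL_one single_add flip: SL_add SL_mult, simp add: mult_single)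

abbreviation "ev \<equiv> EV.h"

lemmas ev_closed = EV.lift_closed[folded FA_eq]
  and ev_add = EV.lift_add[folded FA_eq] and ev_mult = EV.lift_mult[folded FA_eq] and ev_hom = EV.lift_hom[folded FA_eq]

lemma ev_gen: "g \<in> daha_gens D \<Longrightarrow> ev (gen g) = gen_image g"
  unfolding gen_def using EV.lift_single[of "Word [g]" 1] subring_KK gen_image_closed[of g]
  by (simp add: subring_setD smash_scalar_SL SL_one word_image_def)

lemma ev_scalar: "l \<in> KK \<Longrightarrow> ev (scalar l) = SL (scalar l)"
  using EV.lift_single[of 0 l] submonoid_FM EV.\<phi>_zero SL_closed[OF scalar_WA]
  by (simp add: submonoid_set_def smash_scalar_SL)

lemma ev_one: "ev 1 = \<one>\<^bsub>smash D\<^esub>"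
  using ev_scalar[of 1] subring_KK by (simp add: subring_setD SL_one)

lemma ev_minus: "f \<in> FC \<Longrightarrow> g \<in> FC \<Longrightarrow> ev (f - g) = ev f \<ominus>\<^bsub>smash D\<^esub> ev g"
proof -
  assume c: "f \<in> FC" "g \<in> FC"
  have "ev (f - g) \<boxplus> ev g = ev f"
    using c FC_closed(3)[OF c] by (simp flip: ev_add)
  then show ?thesis
    using c FC_closed(3)[OF c] ev_closed by (metis SM.add.inv_solve_right a_minus_def)
qed

definition TW :: "nat list \<Rightarrow> 'v free_alg" where
  "TW js = prod_list (map (\<lambda>j. gen (Gen_T j)) js)"

lemma TW_simps [simp]: "TW [] = 1" "TW (j # js) = gen (Gen_T j) * TW js"
  by (simp_all add: TW_def)

lemma TW_append: "TW (js @ ks) = TW js * TW ks"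
  by (simp add: TW_def)

lemma alternating_TW: "alternating q (gen (Gen_T j)) (gen (Gen_T k)) = TW (altl q j k)"
  by (induction q j k rule: altl.induct) simp_all

lemma TW_closed: "set js \<subseteq> affine_indices D \<Longrightarrow> TW js \<in> FC"
  by (induction js) (auto simp: FC_closed FC_gen gens)

lemma ev_TW: "set js \<subseteq> affine_indices D \<Longrightarrow> ev (TW js) = list_mult (smash D) (map (T_check D) js)"
  by (induction js) (auto simp: ev_one ev_mult ev_gen gens FC_gen TW_closed)

text \<open>A linear lift of the weight algebra to the free algebra; it becomes multiplicative only
  modulo the relations.\<close>

definition embX :: "'v weight_alg \<Rightarrow> 'v free_alg" where
  "embX f = (\<Sum>\<nu>\<in>Poly_Mapping.keys f. scalar (Poly_Mapping.lookup f \<nu>) * gen (Gen_X \<nu>))"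

lemma embX_add: "embX (f + g) = embX f + embX g"
  unfolding embX_def by (rule sum_keys_add) (simp_all add: single_add distrib_right)

lemma embX_single: "embX (Poly_Mapping.single \<nu> l) = scalar l * gen (Gen_X \<nu>)"
  unfolding embX_def by (rule sum_keys_single) simp

lemma embX_zero: "embX 0 = 0"
  by (simp add: embX_def)

lemma embX_minus: "embX (- f) = - embX f"
  using embX_add[of f "- f"] by (simp add: embX_zero add_eq_0_iff)

lemma embX_sum: "embX (\<Sum>i\<in>B. f i) = (\<Sum>i\<in>B. embX (f i))"
  by (induction B rule: infinite_finite_induct) (simp_all add: embX_zero embX_add)

lemma eval_X_add: "eval_X (f + g) = eval_X f + eval_X g"
  unfolding eval_X_def by (rule sum_keys_add) (simp_all add: distrib_right)

lemma eval_X_single: "eval_X (Poly_Mapping.single \<nu> l) = of_int l * gen (Gen_X \<nu>)"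
  unfolding eval_X_def by (rule sum_keys_single) simp

lemma eval_X_zero: "eval_X 0 = 0"
  by (simp add: eval_X_def)

lemma eval_X_minus: "eval_X (- f) = - eval_X f"
  using eval_X_add[of f "- f"] by (simp add: eval_X_zero add_eq_0_iff)

lemma eval_X_sum: "eval_X (\<Sum>i\<in>B. f i) = (\<Sum>i\<in>B. eval_X (f i))"
  by (induction B rule: infinite_finite_induct) (simp_all add: eval_X_zero eval_X_add)

text \<open>Links the integral quotient in the defining relation to the Demazure operator: the
  coefficients of a root string come from 1 and -1, so both evaluations agree.\<close>

lemma eval_X_root_string: "eval_X (root_string \<beta> \<nu>) = embX (root_string \<beta> \<nu>)"
  by (simp add: root_string_def Let_def eval_X_minus embX_minus eval_X_sum embX_sum eval_X_single embX_single)

lemma embX_closed: "f \<in> WAc \<Longrightarrow> embX f \<in> FC"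
  unfolding WA_eq
  by (induction f rule: monoid_algebra_induct)
    (simp_all add: embX_zero embX_add embX_single FC_closed FC_scalar FC_gen gens subring_KK)

lemma ev_embX: "f \<in> WAc \<Longrightarrow> ev (embX f) = SL f"
  unfolding WA_eq
proof (induction f rule: monoid_algebra_induct)
  case zero
  show ?case
    using ev_scalar[of 0] subring_KK by (simp add: embX_zero subring_setD)
next
  case (add_single m k g)
  have e: "Poly_Mapping.single m k = scalar k * X_pow m"
    by (simp add: X_pow_def mult_single)
  have "SL (Poly_Mapping.single m k + g) = SL (scalar k) \<boxdot> SL (X_pow m) \<boxplus> SL g"
    unfolding e using add_single(1,2) add_single(3)[folded WA_eq]
    by (simp add: SL_add SL_mult scalar_WA X_pow_WA WA_closed)
  then show ?case
    using add_single(1,2,4) add_single(3)[folded WA_eq]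
    by (simp add: embX_add embX_single ev_add ev_mult FC_closed FC_scalar FC_gen gens embX_closed ev_scalar ev_gen)
qed (fact subring_KK)

lemma divided_difference_alpha:
  assumes "j \<le> DIM('v)" "\<nu> \<in> PP"
  shows "eval_X (divided_difference (alpha D j) \<nu>) = embX (demazure (alpha D j) (X_pow \<nu>))"
    "demazure (alpha D j) (X_pow \<nu>) \<in> WAc"
proof -
  interpret RL: reflection_lattice KK PP "alpha D j"
    by (rule reflection_lattice_PP[OF alpha_in[OF assms(1)]])
  show "eval_X (divided_difference (alpha D j) \<nu>) = embX (demazure (alpha D j) (X_pow \<nu>))"
    using divided_difference_eq[OF RL.\<alpha>_nz RL.S_int[OF assms(2)]]
    by (simp add: eval_X_root_string X_pow_def demazure_single)
  show "demazure (alpha D j) (X_pow \<nu>) \<in> WAc"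
    using RL.d_closed[OF RL.X_pow_closed[OF assms(2)]] by (simp add: WA_eq)
qed

lemma daha_rel_closed: "daha_rel D p q \<Longrightarrow> p \<in> FC \<and> q \<in> FC"
proof (induction rule: daha_rel.induct)
  case (braid j k)
  then show ?case
    by (auto simp: alternating_TW intro!: TW_closed dest!: subsetD[OF set_altl])
next
  case (X_zero)
  have "0 \<in> PP"
    using submonoid_PP by (simp add: submonoid_set_def)
  then show ?case
    by (simp add: FC_closed FC_gen gens)
next
  case (X_add \<nu> \<mu>)
  then show ?case
    using submonoid_PP by (simp add: FC_closed FC_gen gens submonoid_set_def)
next
  case (Om_X u \<nu>)
  then show ?case
    using PP_W0[OF gradient_W(1)[OF Omega_in_W]] by (simp add: FC_closed FC_gen gens)
next
  case (T_X j \<nu>)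
  then show ?case
    using PP_W0[OF gradient_W(1)[OF sr_in_W]]
    by (simp add: FC_closed FC_gen FC_scalar gens divided_difference_alpha embX_closed tt_closed)
qed (auto simp: FC_closed FC_gen FC_scalar gens tau_closed Omega_comp Omega_perm)

lemma T_check_inverse:
  assumes j: "j \<le> DIM('v)"
  shows "T_check D j \<boxdot> (T_check D j \<ominus>\<^bsub>smash D\<^esub> SL (scalar (tt j))) = \<one>\<^bsub>smash D\<^esub>"
    "(T_check D j \<ominus>\<^bsub>smash D\<^esub> SL (scalar (tt j))) \<boxdot> T_check D j = \<one>\<^bsub>smash D\<^esub>"
proof -
  note c = T_check_closed[OF j] SL_closed[OF scalar_WA[OF tt_closed[OF j]]]
  have comm: "T_check D j \<boxdot> SL (scalar (tt j)) = SL (scalar (tt j)) \<boxdot> T_check D j"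
    using smash_scalar_central[OF tt_closed[OF j] c(1)] by (simp add: smash_scalar_SL)
  have "a \<boxplus> \<one>\<^bsub>smash D\<^esub> \<ominus>\<^bsub>smash D\<^esub> a = \<one>\<^bsub>smash D\<^esub>" if "a \<in> SC" for a
    using that by (simp add: a_minus_def SM.a_assoc SM.r_neg SM.a_comm SM.r_neg1)
  then show "T_check D j \<boxdot> (T_check D j \<ominus>\<^bsub>smash D\<^esub> SL (scalar (tt j))) = \<one>\<^bsub>smash D\<^esub>"
    "(T_check D j \<ominus>\<^bsub>smash D\<^esub> SL (scalar (tt j))) \<boxdot> T_check D j = \<one>\<^bsub>smash D\<^esub>"
    using c T_check_square[OF j] by (simp_all add: a_minus_def SM.r_distr SM.l_distr SM.r_minus SM.l_minus comm)
qed

lemma ev_rel: "daha_rel D p q \<Longrightarrow> ev p = ev q"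
proof (induction rule: daha_rel.induct)
  case (Om_inv_right u)
  then show ?case
    using inv_W[OF Omega_in_W]
    by (simp add: ev_mult ev_gen ev_one FC_gen gens smash_grp_mult Omega_in_W smash_grp_id del: id_apply)
next
  case (Om_inv_left u)
  then show ?case
    using inv_W[OF Omega_in_W]
    by (simp add: ev_mult ev_gen ev_one FC_gen gens smash_grp_mult Omega_in_W smash_grp_id del: id_apply)
next
  case (quadratic j)
  note c = T_check_closed[OF quadratic] SL_closed[OF scalar_WA[OF tau_closed(1)[OF quadratic]]]
    SL_closed[OF scalar_WA[OF tau_closed(2)[OF quadratic]]] SL_closed[OF scalar_WA[OF tt_closed[OF quadratic]]]
  let ?T = "gen (Gen_T j) :: 'v free_alg"
  have fc: "?T \<in> FC" "scalar (tau D j) \<in> FC" "scalar (tau_inv D j) \<in> FC" "scalar (tt j) \<in> FC"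
    using quadratic by (simp_all add: FC_gen gens FC_scalar tau_closed tt_closed)
  have "(?T - scalar (tau D j)) * (?T + scalar (tau_inv D j)) =
      ?T * ?T + ?T * scalar (tau_inv D j) - scalar (tau D j) * ?T - scalar (tau D j) * scalar (tau_inv D j)"
    by (simp add: algebra_simps)
  also have "\<dots> = ?T * ?T - (scalar (tt j) * ?T + 1)"
    unfolding scalar_commutes[symmetric, where f = ?T] by (simp add: mult_single tau_tau_inv single_diff algebra_simps)
  also have "ev \<dots> = ev (?T * ?T) \<ominus>\<^bsub>smash D\<^esub> ev (scalar (tt j) * ?T + 1)"
    by (rule ev_minus) (use fc in \<open>auto simp: FC_closed\<close>)
  also have "ev (scalar (tt j) * ?T + 1) = ev (?T * ?T)"
    using fc quadratic c by (simp add: ev_add ev_mult ev_gen gens ev_scalar tt_closed FC_closed T_check_square ev_one)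
  also have "ev (?T * ?T) \<ominus>\<^bsub>smash D\<^esub> ev (?T * ?T) = ev 0"
    using ev_minus[of "?T * ?T" "?T * ?T"] fc by (simp add: FC_closed)
  finally show ?case .
next
  case (braid j k)
  then show ?case
    using set_altl[of "coxeter_order D j k" j k] set_altl[of "coxeter_order D j k" k j]
    by (subst (1 2) alternating_TW, subst (1 2) ev_TW) (auto intro!: T_check_braid)
next
  case (Om_X u \<nu>)
  then show ?case
    using PP_W0[OF gradient_W(1)[OF Omega_in_W]] smash_grp_SL[OF Omega_in_W X_pow_WA, of u \<nu>]
    by (simp add: ev_mult ev_gen FC_gen gens) (simp add: X_pow_def)
next
  case (T_X j \<nu>)
  then show ?case
    using PP_W0[OF gradient_W(1)[OF sr_in_W]] divided_difference_alpha[of j \<nu>]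
    by (simp add: ev_add ev_mult ev_gen FC_gen FC_closed FC_scalar gens embX_closed tt_closed ev_scalar ev_embX
        T_check_X gradient_sr SL_mult scalar_WA)
next
  case (X_add \<nu> \<mu>)
  have "X_pow (\<nu> + \<mu>) = X_pow \<nu> * X_pow \<mu>" for \<nu> \<mu> :: 'v
    by (simp add: X_pow_def mult_single)
  then show ?case
    using X_add submonoid_PP by (simp add: ev_mult ev_gen FC_gen gens submonoid_set_def SL_mult X_pow_WA)
next
  case X_zero
  then show ?case
    using submonoid_PP by (simp add: ev_gen gens submonoid_set_def X_pow_def SL_one ev_one)
qed (simp_all add: ev_mult ev_gen ev_one FC_gen gens T_check_inverse smash_grp_mult Omega_in_W Omega_comp smash_grp_T
    Omega_perm del: id_apply comp_apply)

section \<open>The ideal of relations and the induced map\<close>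

abbreviation "II \<equiv> daha_ideal D"

lemma ideal_II: "ideal II FA"
  unfolding daha_ideal_def using daha_rel_closed by (intro FR.genideal_ideal) (auto simp: FC_closed)

sublocale I: ideal II FA
  by (rule ideal_II)

lemma II_FC: "f \<in> II \<Longrightarrow> f \<in> FC"
  using I.a_subset by blast

lemma II_rel: "daha_rel D p q \<Longrightarrow> p - q \<in> II"
  unfolding daha_ideal_def using daha_rel_closed
  by (intro subsetD[OF FR.genideal_self]) (auto simp: FC_closed)

lemma II_zero: "0 \<in> II"
  using I.zero_closed by simp

lemma II_add: "f \<in> II \<Longrightarrow> g \<in> II \<Longrightarrow> f + g \<in> II"
  using I.a_closed by simp

lemma II_minus: "f \<in> II \<Longrightarrow> - f \<in> II"
  using I.a_inv_closed a_inv_subring_set[OF FR.ring_axioms FC_subring] II_FC by fastforce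

lemma II_mult: "f \<in> FC \<Longrightarrow> g \<in> II \<Longrightarrow> f * g \<in> II" "f \<in> FC \<Longrightarrow> g \<in> II \<Longrightarrow> g * f \<in> II"
  using I.I_l_closed I.I_r_closed by simp_all

lemma ev_II: "f \<in> II \<Longrightarrow> ev f = \<zero>\<^bsub>smash D\<^esub>"
proof -
  interpret h: ring_hom_ring FA "smash D" ev
    by (rule ring_hom_ringI2[OF FR.ring_axioms SM.ring_axioms ev_hom])
  have "II \<subseteq> a_kernel FA (smash D) ev"
    unfolding daha_ideal_def
  proof (intro FR.genideal_minimal h.kernel_is_ideal subsetI)
    fix f assume "f \<in> {p - q |p q. daha_rel D p q}"
    then obtain p q where pq: "f = p - q" "daha_rel D p q"
      by blast
    have c: "p \<in> FC" "q \<in> FC"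
      using daha_rel_closed[OF pq(2)] by auto
    have "ev f = \<zero>\<^bsub>smash D\<^esub>"
      unfolding pq(1) ev_minus[OF c] ev_rel[OF pq(2)] using ev_closed[OF c(2)] by simp
    moreover have "f \<in> FC"
      unfolding pq(1) by (rule FC_closed(3)[OF c])
    ultimately show "f \<in> a_kernel FA (smash D) ev"
      unfolding a_kernel_def' by blast
  qed
  then show "f \<in> II \<Longrightarrow> ev f = \<zero>\<^bsub>smash D\<^esub>"
    unfolding a_kernel_def' by blast
qed

lemma daha_class_eq: "daha_class D p = (\<lambda>i. i + p) ` II"
  by (auto simp: daha_class_def a_r_coset_def')

lemma daha_class_cong: 
  assumes "p - q \<in> II" 
  shows "daha_class D p = daha_class D q"
proof -
  have sub: "daha_class D a \<subseteq> daha_class D b" if "a - b \<in> II" for a b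
  proof
    fix x assume "x \<in> daha_class D a"
    then obtain i where i: "i \<in> II" "x = i + a"
      by (auto simp: daha_class_eq)
    then have "x = (i + (a - b)) + b"
      by simp
    then show "x \<in> daha_class D b"
      unfolding daha_class_eq using II_add[OF i(1) that] by blast
  qed
  show ?thesis
    using sub[OF assms] sub[of q p] II_minus[OF assms] by auto
qed

lemma class_hom: "daha_class D \<in> ring_hom FA (DAHA D)"
  unfolding DAHA_def daha_class_def by (rule I.rcos_ring_hom)

lemma carrier_DAHA: "carrier (DAHA D) = daha_class D ` FC"
  by (auto simp: DAHA_def FactRing_def A_RCOSETS_def' daha_class_def)

text \<open>The evaluation kills the ideal, so it is constant on each class and the image is a
  singleton.\<close>

definition JJ :: "'v free_alg set \<Rightarrow> 'v smash_alg" where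
  "JJ X = the_elem (ev ` X)"

lemma JJ_class: "p \<in> FC \<Longrightarrow> JJ (daha_class D p) = ev p"
proof -
  assume p: "p \<in> FC"
  have "ev ` daha_class D p = (\<lambda>i. ev p) ` II"
    unfolding daha_class_eq image_image
    by (rule image_cong) (use p II_FC ev_closed in \<open>auto simp: ev_add ev_II\<close>)
  then show ?thesis
    using II_zero by (simp add: JJ_def image_constant)
qed

lemma JJ_hom: "JJ \<in> algebra_hom (coeff_ring D) (DAHA D) (DAHA_scalar D) (smash D) (smash_scalar D)"
proof -
  have "JJ \<in> ring_hom (DAHA D) (smash D)"
  proof (rule ring_hom_memI)
    fix x assume "x \<in> carrier (DAHA D)"
    then obtain p where p: "p \<in> FC" "x = daha_class D p"
      by (auto simp: carrier_DAHA)
    then show "JJ x \<in> SC"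
      by (simp add: JJ_class ev_closed)
    fix y assume "y \<in> carrier (DAHA D)"
    then obtain q where q: "q \<in> FC" "y = daha_class D q"
      by (auto simp: carrier_DAHA)
    show "JJ (x \<otimes>\<^bsub>DAHA D\<^esub> y) = JJ x \<boxdot> JJ y"
      unfolding p q using p(1) q(1) ring_hom_mult[OF class_hom, of p q, symmetric]
      by (simp add: JJ_class FC_closed ev_mult)
    show "JJ (x \<oplus>\<^bsub>DAHA D\<^esub> y) = JJ x \<boxplus> JJ y"
      unfolding p q using p(1) q(1) ring_hom_add[OF class_hom, of p q, symmetric]
      by (simp add: JJ_class FC_closed ev_add)
  next
    show "JJ \<one>\<^bsub>DAHA D\<^esub> = \<one>\<^bsub>smash D\<^esub>"
      using ring_hom_one[OF class_hom, symmetric] by (simp add: JJ_class FC_closed ev_one)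
  qed
  then show ?thesis
    by (simp add: algebra_hom_def DAHA_scalar_def JJ_class FC_scalar ev_scalar smash_scalar_SL)
qed

lemma JJ_gens: "j \<le> DIM('v) \<Longrightarrow> JJ (DAHA_T D j) = T_check D j"
  "u \<in> Omega D \<Longrightarrow> JJ (DAHA_Om D u) = smash_grp D u"
  "\<nu> \<in> PP \<Longrightarrow> JJ (DAHA_X D \<nu>) = smash_X D \<nu>"
  by (simp_all add: DAHA_T_def DAHA_Om_def DAHA_X_def JJ_class FC_gen gens ev_gen smash_X_SL)

lemma JJ_unique:
  assumes J': "J' \<in> algebra_hom (coeff_ring D) (DAHA D) (DAHA_scalar D) (smash D) (smash_scalar D)"
    and T: "\<And>j. j \<le> DIM('v) \<Longrightarrow> J' (DAHA_T D j) = T_check D j"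
    and Om: "\<And>u. u \<in> Omega D \<Longrightarrow> J' (DAHA_Om D u) = smash_grp D u"
    and X: "\<And>\<nu>. \<nu> \<in> PP \<Longrightarrow> J' (DAHA_X D \<nu>) = smash_X D \<nu>"
    and x: "x \<in> carrier (DAHA D)"
  shows "J' x = JJ x"
proof -
  have "J' \<in> ring_hom (DAHA D) (smash D)"
    using J' by (simp add: algebra_hom_def)
  then have h: "J' \<circ> daha_class D \<in> ring_hom FA (smash D)"
    by (rule ring_hom_trans[OF class_hom])
  let ?h = "\<lambda>p. J' (daha_class D p)"
  have hc: "?h p \<in> SC" if "p \<in> FC" for p
    using ring_hom_closed[OF h that] by simp
  have hm: "?h (p * q) = ?h p \<boxdot> ?h q" "?h (p + q) = ?h p \<boxplus> ?h q" if "p \<in> FC" "q \<in> FC" for p q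
    using ring_hom_mult[OF h that] ring_hom_add[OF h that] by simp_all
  have h1: "?h 1 = \<one>\<^bsub>smash D\<^esub>"
    using ring_hom_one[OF h] by simp
  have hrel: "?h p = ?h q" if "daha_rel D p q" for p q
    using daha_class_cong[OF II_rel[OF that]] by simp
  \<comment> \<open>The values on the inverse generators are not prescribed; uniqueness of inverses
    in the target forces them.\<close>
  have inverse: "?h q = ev q" if pq: "p \<in> FC" "q \<in> FC" "daha_rel D (p * q) 1" "daha_rel D (q * p) 1" "?h p = ev p" for p q
  proof (rule SM.inv_unique[of "?h q" "ev p" "ev q"])
    show "?h q \<boxdot> ev p = \<one>\<^bsub>smash D\<^esub>"
      using hrel[OF pq(4)] pq h1 by (simp add: hm)
    show "ev p \<boxdot> ev q = \<one>\<^bsub>smash D\<^esub>"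
      using ev_rel[OF pq(3)] pq by (simp add: ev_mult ev_one)
  qed (use pq hc ev_closed in auto)
  have Tj: "?h (gen (Gen_T j)) = ev (gen (Gen_T j))" if "j \<le> DIM('v)" for j
    using T[OF that] that by (simp add: DAHA_T_def ev_gen gens)
  have Omu: "?h (gen (Gen_Om u)) = ev (gen (Gen_Om u))" if "u \<in> Omega D" for u
    using Om[OF that] that by (simp add: DAHA_Om_def ev_gen gens)
  have "?h p = ev p" if "p \<in> FC" for p
    using that
  proof (induction p rule: free_induct)
    case (scalar l)
    then show ?case
      using J' by (simp add: algebra_hom_def DAHA_scalar_def ev_scalar flip: smash_scalar_SL)
  next
    case (gen g)
    then consider (T) j where "j \<le> DIM('v)" "g = Gen_T j" | (Ti) j where "j \<le> DIM('v)" "g = Gen_T_inv j"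
      | (O) u where "u \<in> Omega D" "g = Gen_Om u" | (Oi) u where "u \<in> Omega D" "g = Gen_Om_inv u"
      | (X) \<nu> where "\<nu> \<in> PP" "g = Gen_X \<nu>"
      by (auto simp: daha_gens_def)
    then show ?case
    proof cases
      case Ti
      then show ?thesis
        using inverse[of "Defs.gen (Gen_T j)" "Defs.gen (Gen_T_inv j)"] Tj
        by (simp add: FC_gen gens daha_rel.intros)
    next
      case Oi
      then show ?thesis
        using inverse[of "Defs.gen (Gen_Om u)" "Defs.gen (Gen_Om_inv u)"] Omu
        by (simp add: FC_gen gens daha_rel.intros)
    next
      case (X \<nu>)
      then show ?thesis
        using assms(4)[of \<nu>] by (simp add: DAHA_X_def ev_gen gens smash_X_SL)
    qed (simp_all add: Tj Omu)
  qed (simp_all add: hm ev_add ev_mult)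
  then show ?thesis
    using x by (auto simp: carrier_DAHA JJ_class)
qed

lemma JJ_inj:
  assumes "\<And>p. p \<in> FC \<Longrightarrow> ev p = \<zero>\<^bsub>smash D\<^esub> \<Longrightarrow> p \<in> II"
  shows "inj_on JJ (carrier (DAHA D))"
proof (rule inj_onI)
  fix x y assume "x \<in> carrier (DAHA D)" "y \<in> carrier (DAHA D)" and eq: "JJ x = JJ y"
  then obtain p q where pq: "p \<in> FC" "q \<in> FC" "x = daha_class D p" "y = daha_class D q"
    by (auto simp: carrier_DAHA)
  have "ev (p - q) = \<zero>\<^bsub>smash D\<^esub>"
    using eq pq ev_closed[OF pq(2)] by (simp add: JJ_class ev_minus SM.r_right_minus_eq)
  then show "x = y"
    using assms[of "p - q"] pq by (simp add: FC_closed daha_class_cong)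
qed

end

section \<open>Normal forms in the Hecke algebra\<close>

context affine_data
begin

definition cg :: "'v free_alg \<Rightarrow> 'v free_alg \<Rightarrow> bool" (infix \<open>\<approx>\<close> 50) where
  "p \<approx> q \<longleftrightarrow> p \<in> FC \<and> q \<in> FC \<and> p - q \<in> II"

lemma cgD: "p \<approx> q \<Longrightarrow> p \<in> FC" "p \<approx> q \<Longrightarrow> q \<in> FC"
  by (auto simp: cg_def)

lemma cg_refl: "p \<in> FC \<Longrightarrow> p \<approx> p"
  by (simp add: cg_def II_zero)

lemma cg_sym: "p \<approx> q \<Longrightarrow> q \<approx> p"
  using II_minus[of "p - q"] by (simp add: cg_def)

lemma cg_trans [trans]: "p \<approx> q \<Longrightarrow> q \<approx> r \<Longrightarrow> p \<approx> r"
  using II_add[of "p - q" "q - r"] by (simp add: cg_def)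

lemma cg_add: "p \<approx> q \<Longrightarrow> p' \<approx> q' \<Longrightarrow> p + p' \<approx> q + q'"
  using II_add[of "p - q" "p' - q'"] by (simp add: cg_def FC_closed algebra_simps)

lemma cg_minus: "p \<approx> q \<Longrightarrow> p' \<approx> q' \<Longrightarrow> p - p' \<approx> q - q'"
  using II_add[of "p - q" "- (p' - q')"] II_minus[of "p' - q'"] by (simp add: cg_def FC_closed algebra_simps)

lemma cg_mult: "p \<approx> q \<Longrightarrow> p' \<approx> q' \<Longrightarrow> p * p' \<approx> q * q'"
proof -
  assume a: "p \<approx> q" "p' \<approx> q'"
  have "p * p' - q * q' = (p - q) * p' + q * (p' - q')"
    by (simp add: algebra_simps)
  then show ?thesis
    using a II_mult(1)[of q "p' - q'"] II_mult(2)[of p' "p - q"] by (simp add: cg_def FC_closed II_add)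
qed

lemma cg_rel: "daha_rel D p q \<Longrightarrow> p \<approx> q"
  using daha_rel_closed II_rel by (simp add: cg_def)

abbreviation "gT j \<equiv> gen (Gen_T j) :: 'v free_alg"
abbreviation "gO u \<equiv> gen (Gen_Om u) :: 'v free_alg"
abbreviation "gX \<nu> \<equiv> gen (Gen_X \<nu>) :: 'v free_alg"

lemma scalar_left_commute: "x * (scalar k * y) = scalar k * (x * y)" for x y :: "'v free_alg"
  by (simp only: mult.assoc[symmetric] scalar_commutes[symmetric, where f = x])

lemmas FCs = FC_closed FC_gen gens FC_scalar embX_closed tt_closed tau_closed

lemma inverse_unique_cg:
  assumes "x * y \<approx> 1" "z * x \<approx> 1" "x \<in> FC" "y \<in> FC" "z \<in> FC"
  shows "z \<approx> y"
proof -
  have "z * (x * y) \<approx> z * 1"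
    by (intro cg_mult cg_refl assms)
  then have "z \<approx> (z * x) * y"
    by (simp add: cg_sym mult.assoc)
  also have "\<dots> \<approx> 1 * y"
    by (intro cg_mult cg_refl assms)
  finally show ?thesis by simp
qed

lemma T_square_cg: "j \<le> DIM('v) \<Longrightarrow> gT j * gT j \<approx> scalar (tt j) * gT j + 1"
proof -
  assume j: "j \<le> DIM('v)"
  have "(gT j - scalar (tau D j)) * (gT j + scalar (tau_inv D j)) =
      gT j * gT j + gT j * scalar (tau_inv D j) - scalar (tau D j) * gT j - scalar (tau D j) * scalar (tau_inv D j)"
    by (simp add: algebra_simps)
  also have "\<dots> = gT j * gT j - (scalar (tt j) * gT j + 1)"
    unfolding scalar_commutes[symmetric, where f = "gT j"] by (simp add: mult_single tau_tau_inv single_diff algebra_simps)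
  finally show ?thesis
    using cg_rel[OF daha_rel.quadratic[OF j]] j by (simp add: cg_def FCs)
qed

lemma T_inv_cg:
  assumes j: "j \<le> DIM('v)"
  shows "gen (Gen_T_inv j) \<approx> gT j - scalar (tt j)"
proof (rule inverse_unique_cg[of "gT j"])
  have "gT j * (gT j - scalar (tt j)) = gT j * gT j - scalar (tt j) * gT j"
    by (simp add: right_diff_distrib scalar_commutes)
  also have "\<dots> \<approx> (scalar (tt j) * gT j + 1) - scalar (tt j) * gT j"
    using j by (intro cg_minus T_square_cg cg_refl) (simp_all add: FCs)
  finally show "gT j * (gT j - scalar (tt j)) \<approx> 1"
    by simp
qed (use j in \<open>auto intro: cg_rel daha_rel.T_inv_left simp: FCs\<close>)

text \<open>No relation names the unit of \<open>Omega D\<close>: \<open>gO id\<close> is idempotent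
  by multiplicativity and has a left inverse, hence is congruent to 1.\<close>

lemma Om_id_cg: "gO id \<approx> 1"
proof -
  have c: "gO id \<in> FC" "gen (Gen_Om_inv id) \<in> FC"
    by (simp_all add: FCs id_Omega)
  have 1: "gO id * gO id \<approx> gO id"
    using cg_rel[OF daha_rel.Om_mult[OF id_Omega id_Omega]] by (simp only: id_comp)
  have inv: "gen (Gen_Om_inv id) * gO id \<approx> 1"
    by (rule cg_rel[OF daha_rel.Om_inv_left[OF id_Omega]])
  have "gO id = 1 * gO id"
    by simp
  also have "\<dots> \<approx> (gen (Gen_Om_inv id) * gO id) * gO id"
    by (intro cg_mult cg_sym[OF inv] cg_refl c)
  also have "(gen (Gen_Om_inv id) * gO id) * gO id = gen (Gen_Om_inv id) * (gO id * gO id)"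
    by (rule mult.assoc)
  also have "\<dots> \<approx> gen (Gen_Om_inv id) * gO id"
    by (intro cg_mult 1 cg_refl c)
  also have "\<dots> \<approx> 1"
    by (rule inv)
  finally show ?thesis .
qed

lemma Om_inv_cg:
  assumes u: "u \<in> Omega D"
  shows "gen (Gen_Om_inv u) \<approx> gO (inv_into UNIV u)"
proof (rule inverse_unique_cg[of "gO u"])
  have "gO u * gO (inv_into UNIV u) \<approx> gO (u \<circ> inv_into UNIV u)"
    by (rule cg_rel[OF daha_rel.Om_mult[OF u Omega_inverse[OF u]]])
  also have "\<dots> \<approx> 1"
    using Om_id_cg by (simp only: inv_W(2)[OF Omega_in_W[OF u]])
  finally show "gO u * gO (inv_into UNIV u) \<approx> 1" .
qed (use u Omega_inverse[OF u] in \<open>auto intro: cg_rel daha_rel.Om_inv_left simp: FCs\<close>)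

lemma scalar_embX: "scalar l * embX g = embX (scalar l * g)"
  by (induction g rule: poly_mapping_single_induct)
    (simp_all add: embX_zero embX_add embX_single distrib_left mult_single flip: mult.assoc)

lemma X_embX:
  assumes \<nu>: "\<nu> \<in> PP" and g: "g \<in> WAc"
  shows "gX \<nu> * embX g \<approx> embX (X_pow \<nu> * g)"
  using g unfolding WA_eq
proof (induction g rule: monoid_algebra_induct)
  case zero
  then show ?case
    by (simp add: embX_zero cg_refl FCs)
next
  case (add_single m k g)
  have c: "\<nu> + m \<in> PP"
    using submonoid_PP \<nu> add_single(1) by (simp add: submonoid_set_def)
  have "gX \<nu> * (scalar k * gX m) = scalar k * (gX \<nu> * gX m)"
    by (rule scalar_left_commute)
  also have "\<dots> \<approx> scalar k * gX (\<nu> + m)"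
    using \<nu> add_single by (intro cg_mult cg_refl cg_rel daha_rel.X_add) (simp_all add: FCs)
  finally have "gX \<nu> * (scalar k * gX m) + gX \<nu> * embX g \<approx> scalar k * gX (\<nu> + m) + embX (X_pow \<nu> * g)"
    by (rule cg_add[OF _ add_single(4)])
  then show ?case
    by (simp add: embX_add embX_single distrib_left X_pow_def mult_single)
qed (fact subring_KK)

lemma Om_embX:
  assumes u: "u \<in> Omega D" and g: "g \<in> WAc"
  shows "gO u * embX g \<approx> embX (weight_act (gradient u) g) * gO u"
  using g unfolding WA_eq
proof (induction g rule: monoid_algebra_induct)
  case zero
  then show ?case
    by (simp add: embX_zero cg_refl FCs)
next
  case (add_single m k g)
  have c: "gradient u m \<in> PP"
    by (rule PP_W0[OF gradient_W(1)[OF Omega_in_W[OF u]] add_single(1)])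
  have "gO u * (scalar k * gX m) = scalar k * (gO u * gX m)"
    by (rule scalar_left_commute)
  also have "\<dots> \<approx> scalar k * (gX (gradient u m) * gO u)"
    using u add_single by (intro cg_mult cg_refl cg_rel daha_rel.Om_X) (simp_all add: FCs)
  finally have "gO u * (scalar k * gX m) + gO u * embX g \<approx>
      scalar k * (gX (gradient u m) * gO u) + embX (weight_act (gradient u) g) * gO u"
    by (rule cg_add[OF _ add_single(4)])
  then show ?case
    by (simp add: embX_add embX_single distrib_left distrib_right weight_act_add mult.assoc)
qed (fact subring_KK)

lemma T_embX:
  assumes j: "j \<le> DIM('v)" and g: "g \<in> WAc"
  shows "gT j * embX g \<approx> embX (weight_act (reflection (alpha D j)) g) * gT j + embX (scalar (tt j) * demazure (alpha D j) g)"
  using g unfolding WA_eq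
proof (induction g rule: monoid_algebra_induct)
  case zero
  then show ?case
    by (simp add: embX_zero cg_refl FCs demazure_def)
next
  case (add_single m k g)
  let ?s = "reflection (alpha D j)"
  have c: "?s m \<in> PP"
    using PP_W0[OF gradient_W(1)[OF sr_in_W[OF j]] add_single(1)] by (simp add: gradient_sr)
  have dd: "demazure (alpha D j) (X_pow m) \<in> WAc" "eval_X (divided_difference (alpha D j) m) = embX (demazure (alpha D j) (X_pow m))"
    using divided_difference_alpha[OF j add_single(1)] by auto
  have "gT j * gX m \<approx> gX (?s m) * gT j + scalar (tt j) * embX (demazure (alpha D j) (X_pow m))"
    using cg_rel[OF daha_rel.T_X[OF j add_single(1)]] by (simp add: gradient_sr dd)
  then have 1: "scalar k * (gT j * gX m) \<approx> scalar k * (gX (?s m) * gT j + scalar (tt j) * embX (demazure (alpha D j) (X_pow m)))"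
    using add_single(2) by (intro cg_mult cg_refl) (simp_all add: FCs)
  have k: "scalar k * demazure (alpha D j) (X_pow m) = demazure (alpha D j) (Poly_Mapping.single m k)"
    by (simp add: X_pow_def demazure_single)
  have "gT j * (scalar k * gX m) = scalar k * (gT j * gX m)"
    by (rule scalar_left_commute)
  also note 1
  also have "scalar k * (gX (?s m) * gT j + scalar (tt j) * embX (demazure (alpha D j) (X_pow m))) =
      scalar k * gX (?s m) * gT j + embX (scalar (tt j) * demazure (alpha D j) (Poly_Mapping.single m k))"
    by (simp add: distrib_left mult.assoc scalar_embX k[symmetric] mult.left_commute)
  finally have "gT j * (scalar k * gX m) + gT j * embX g \<approx>
      scalar k * gX (?s m) * gT j + embX (scalar (tt j) * demazure (alpha D j) (Poly_Mapping.single m k)) +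
      (embX (weight_act ?s g) * gT j + embX (scalar (tt j) * demazure (alpha D j) g))"
    by (rule cg_add[OF _ add_single(4)])
  then show ?case
    by (simp add: embX_add embX_single distrib_left distrib_right weight_act_add demazure_add ac_simps del: scalar_mult_single)
qed (fact subring_KK)

lemma TW_matsumoto:
  assumes "invol.reduced_word js" "invol.reduced_word ks" "wd js = wd ks"
  shows "TW js \<approx> TW ks"
proof -
  \<comment> \<open>Equality is added because \<open>matsumoto\<close> asks for reflexivity on all
    lists, while \<open>\<approx>\<close> is reflexive only on the free algebra over the admissible
    generators.\<close>
  define rel where "rel js ks \<longleftrightarrow> js = ks \<or> TW js \<approx> TW ks" for js ks
  have "rel js ks"
    using _ _ _ _ _ _ assms
  proof (rule exch.matsumoto)
    show "rel xs zs" if "rel xs ys" "rel ys zs" for xs ys zs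
      using that cg_trans unfolding rel_def by blast
    show "rel (j # xs) (j # ys)" if "j \<in> affine_indices D" "rel xs ys" for j xs ys
      using that unfolding rel_def by (auto intro!: cg_mult cg_refl simp: FCs)
    show "rel (xs @ [j]) (ys @ [j])" if "j \<in> affine_indices D" "rel xs ys" for j xs ys
      using that unfolding rel_def by (auto intro!: cg_mult cg_refl simp: FCs TW_append)
    show "rel (altl q a b) (altl q b a)"
      if "a \<in> affine_indices D" "b \<in> affine_indices D" "a \<noteq> b" "invol.reduced_word (altl q a b)"
        "wd (altl q a b) = wd (altl q b a)" for a b q
    proof (cases "q = 0")
      case False
      then have "coxeter_order D a b = q"
        using that by (intro coxeter_order_reduced) auto
      then show ?thesis
        using cg_rel[OF daha_rel.braid[of a b D]] that False by (simp add: rel_def alternating_TW)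
    qed (simp add: rel_def)
  qed (auto simp: rel_def cg_sym)
  then show ?thesis
    using cg_refl[OF TW_closed[OF invol.reduced_word_set[OF assms(1)]]] by (auto simp: rel_def)
qed

text \<open>Exchange deletes a letter of \<open>js\<close> in exchange for \<open>j\<close>; putting
  \<open>j\<close> in front again gives a word for the same element that is no longer than
  \<open>js\<close>.\<close>

lemma descent_word:
  assumes r: "invol.reduced_word js" and j: "j \<le> DIM('v)" and nr: "\<not> invol.reduced_word (j # js)"
  obtains ks where "invol.reduced_word (j # ks)" "wd (j # ks) = wd js"
proof -
  have S: "set js \<subseteq> affine_indices D" "set (j # js) \<subseteq> affine_indices D"
    using invol.reduced_word_set[OF r] j by auto
  obtain t where t: "t < length js" "wd (j # js) = wd (take t js @ drop (Suc t) js)"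
    using exch.exchange[OF r _ nr] j by auto
  define ks where "ks = take t js @ drop (Suc t) js"
  have kS: "set (j # ks) \<subseteq> affine_indices D"
    using S j set_take_subset[of t js] set_drop_subset[of "Suc t" js] by (auto simp: ks_def)
  have eq: "wd (j # ks) = wd js"
    using t(2) j invol.wd_cancel[of j "wd js"] by (simp add: ks_def)
  have len: "length (j # ks) \<le> length js"
    using t(1) by (simp add: ks_def)
  show ?thesis
    by (rule that[OF invol.reduced_word_same[OF r kS eq len] eq])
qed

section \<open>Normal form terms and the stability of their span\<close>

definition Om_T_term :: "'v weight_alg \<Rightarrow> ('v \<Rightarrow> 'v) \<Rightarrow> nat list \<Rightarrow> 'v free_alg" where
  "Om_T_term g u js = embX g * gO u * TW js"

definition canonical :: "nat list \<Rightarrow> bool" where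
  "canonical js \<longleftrightarrow> invol.reduced_word js \<and> js = (SOME ks. invol.reduced_word ks \<and> wd ks = wd js)"

lemma canonical_exists:
  assumes "invol.reduced_word js"
  obtains ks where "canonical ks" "wd ks = wd js"
proof -
  define ks where "ks = (SOME ks. invol.reduced_word ks \<and> wd ks = wd js)"
  have "invol.reduced_word ks \<and> wd ks = wd js"
    unfolding ks_def using someI[of "\<lambda>ks. invol.reduced_word ks \<and> wd ks = wd js" js] assms by simp
  then show ?thesis
    using that[of ks] by (simp add: canonical_def ks_def)
qed

lemma canonical_unique: "canonical js \<Longrightarrow> canonical ks \<Longrightarrow> wd js = wd ks \<Longrightarrow> js = ks"
  by (metis canonical_def)

definition NF :: "'v free_alg set" where
  "NF = {p. \<exists>S g. finite S \<and> S \<subseteq> Omega D \<times> Collect canonical \<and> range g \<subseteq> WAc \<and>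
     p \<approx> (\<Sum>(u, js)\<in>S. Om_T_term (g (u, js)) u js)}"

lemma Om_T_term_closed:
  "g \<in> WAc \<Longrightarrow> u \<in> Omega D \<Longrightarrow> set js \<subseteq> affine_indices D \<Longrightarrow> Om_T_term g u js \<in> FC"
  by (simp add: Om_T_term_def FCs TW_closed)

lemma Om_T_term_add: "Om_T_term (f + g) u js = Om_T_term f u js + Om_T_term g u js"
  by (simp add: Om_T_term_def embX_add distrib_right)

lemma Om_T_term_zero: "Om_T_term 0 u js = 0"
  by (simp add: Om_T_term_def embX_zero)

lemma NF_cong: "p \<in> NF \<Longrightarrow> q \<approx> p \<Longrightarrow> q \<in> NF"
  unfolding NF_def using cg_trans by blast

lemma NF_add:
  assumes "p \<in> NF" "q \<in> NF"
  shows "p + q \<in> NF"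
proof -
  let ?t = "\<lambda>g (u, js). Om_T_term (g (u, js)) u js"
  obtain S g where S: "finite S" "S \<subseteq> Omega D \<times> Collect canonical" "range g \<subseteq> WAc" "p \<approx> (\<Sum>b\<in>S. ?t g b)"
    using assms(1) by (auto simp: NF_def)
  obtain T h where T: "finite T" "T \<subseteq> Omega D \<times> Collect canonical" "range h \<subseteq> WAc" "q \<approx> (\<Sum>b\<in>T. ?t h b)"
    using assms(2) by (auto simp: NF_def)
  define g' where "g' b = (if b \<in> S then g b else 0)" for b
  define h' where "h' b = (if b \<in> T then h b else 0)" for b
  have s: "(\<Sum>b\<in>S. ?t g b) = (\<Sum>b\<in>S \<union> T. ?t g' b)"
    by (rule sum.mono_neutral_cong_left) (use S(1) T(1) in \<open>auto simp: g'_def Om_T_term_zero\<close>)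
  have t: "(\<Sum>b\<in>T. ?t h b) = (\<Sum>b\<in>S \<union> T. ?t h' b)"
    by (rule sum.mono_neutral_cong_left) (use S(1) T(1) in \<open>auto simp: h'_def Om_T_term_zero\<close>)
  have "p + q \<approx> (\<Sum>b\<in>S \<union> T. ?t (\<lambda>b. g' b + h' b) b)"
    using cg_add[OF S(4) T(4)] unfolding s t by (simp add: Om_T_term_add case_prod_unfold flip: sum.distrib)
  moreover have "range (\<lambda>b. g' b + h' b) \<subseteq> WAc"
    using S(3) T(3) by (auto simp: g'_def h'_def WA_closed image_subset_iff)
  ultimately show ?thesis
    unfolding NF_def using S(1,2) T(1,2) by blast
qed

lemma NF_zero: "0 \<in> NF"
proof -
  have "0 \<approx> (\<Sum>(u, js)\<in>{}. Om_T_term 0 u js)"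
    by (simp add: cg_refl FCs)
  then show ?thesis
    unfolding NF_def by (auto intro!: exI[of _ "{}"] exI[of _ "\<lambda>_. 0"] simp: WA_closed)
qed

lemma NF_term:
  assumes g: "g \<in> WAc" and u: "u \<in> Omega D" and js: "invol.reduced_word js"
  shows "Om_T_term g u js \<in> NF"
proof -
  obtain ks where ks: "canonical ks" "wd ks = wd js"
    using canonical_exists[OF js] .
  have "TW js \<approx> TW ks"
    using ks by (intro TW_matsumoto js) (auto simp: canonical_def)
  then have "Om_T_term g u js \<approx> Om_T_term g u ks"
    unfolding Om_T_term_def using g u by (intro cg_mult cg_refl) (simp_all add: FCs)
  then have "Om_T_term g u js \<approx> (\<Sum>(v, ls)\<in>{(u, ks)}. Om_T_term g v ls)"
    by simp
  then show ?thesis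
    unfolding NF_def using u ks g by (intro CollectI exI[of _ "{(u, ks)}"] exI[of _ "\<lambda>_. g"]) auto
qed

text \<open>Checked on every kind of generator, this makes \<open>NF\<close> stable under left
  multiplication by the free algebra; containing 1, it is then everything.\<close>

lemma NF_left_mult:
  assumes f: "f \<in> FC" and p: "p \<in> NF"
    and terms: "\<And>g u js. g \<in> WAc \<Longrightarrow> u \<in> Omega D \<Longrightarrow> invol.reduced_word js \<Longrightarrow> f * Om_T_term g u js \<in> NF"
  shows "f * p \<in> NF"
proof -
  obtain S g where S: "finite S" "S \<subseteq> Omega D \<times> Collect canonical" "range g \<subseteq> WAc"
    "p \<approx> (\<Sum>(u, js)\<in>S. Om_T_term (g (u, js)) u js)"
    using p by (auto simp: NF_def)
  have "f * (\<Sum>(u, js)\<in>S. Om_T_term (g (u, js)) u js) \<in> NF"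
    using S(1,2)
  proof (induction S)
    case (insert b S)
    obtain u js where b: "b = (u, js)" "u \<in> Omega D" "canonical js"
      using insert.prems by auto
    have "f * Om_T_term (g (u, js)) u js \<in> NF"
      using S(3) b by (intro terms) (auto simp: canonical_def)
    then show ?case
      using insert b by (simp add: distrib_left NF_add)
  qed (simp add: NF_zero)
  then show ?thesis
    by (rule NF_cong[OF _ cg_mult[OF cg_refl[OF f] S(4)]])
qed

lemma NF_scalar: "l \<in> KK \<Longrightarrow> p \<in> NF \<Longrightarrow> scalar l * p \<in> NF"
proof (rule NF_left_mult)
  fix g u js assume *: "l \<in> KK" "g \<in> WAc" "u \<in> Omega D" "invol.reduced_word js"
  have "scalar l * Om_T_term g u js = Om_T_term (scalar l * g) u js"
    by (simp add: Om_T_term_def scalar_embX flip: mult.assoc)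
  then show "scalar l * Om_T_term g u js \<in> NF"
    using * by (simp add: NF_term WA_closed scalar_WA)
qed (simp_all add: FCs)

lemma NF_minus: "p \<in> NF \<Longrightarrow> q \<in> NF \<Longrightarrow> p - q \<in> NF"
  using NF_add[of p "scalar (- 1) * q"] NF_scalar[of "- 1" q] subring_KK
  by (simp add: subring_setD single_uminus)

lemma NF_X: "\<nu> \<in> PP \<Longrightarrow> p \<in> NF \<Longrightarrow> gX \<nu> * p \<in> NF"
proof (rule NF_left_mult)
  fix g u js assume *: "\<nu> \<in> PP" "g \<in> WAc" "u \<in> Omega D" "invol.reduced_word js"
  have "gX \<nu> * Om_T_term g u js = gX \<nu> * embX g * gO u * TW js"
    by (simp add: Om_T_term_def mult.assoc)
  also have "\<dots> \<approx> Om_T_term (X_pow \<nu> * g) u js"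
    unfolding Om_T_term_def using * invol.reduced_word_set[OF *(4)]
    by (intro cg_mult X_embX cg_refl) (simp_all add: FCs TW_closed)
  finally show "gX \<nu> * Om_T_term g u js \<in> NF"
    by (rule NF_cong[rotated]) (use * in \<open>simp add: NF_term WA_closed X_pow_WA\<close>)
qed (simp_all add: FCs)

lemma NF_Om: "v \<in> Omega D \<Longrightarrow> p \<in> NF \<Longrightarrow> gO v * p \<in> NF"
proof (rule NF_left_mult)
  fix g u js assume *: "v \<in> Omega D" "g \<in> WAc" "u \<in> Omega D" "invol.reduced_word js"
  let ?g = "weight_act (gradient v) g"
  have c: "?g \<in> WAc"
    by (rule weight_act_WA[OF gradient_W(1)[OF Omega_in_W[OF *(1)]] *(2)])
  have "gO v * Om_T_term g u js = gO v * embX g * (gO u * TW js)"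
    by (simp add: Om_T_term_def mult.assoc)
  also have "\<dots> \<approx> embX ?g * gO v * (gO u * TW js)"
    using * invol.reduced_word_set[OF *(4)] by (intro cg_mult Om_embX cg_refl) (simp_all add: FCs TW_closed)
  also have "\<dots> = embX ?g * (gO v * gO u) * TW js"
    by (simp add: mult.assoc)
  also have "\<dots> \<approx> Om_T_term ?g (v \<circ> u) js"
    unfolding Om_T_term_def using * c invol.reduced_word_set[OF *(4)]
    by (intro cg_mult cg_rel daha_rel.Om_mult cg_refl) (simp_all add: FCs TW_closed)
  finally show "gO v * Om_T_term g u js \<in> NF"
    by (rule NF_cong[rotated]) (use * c in \<open>simp add: NF_term Omega_comp\<close>)
qed (simp_all add: FCs)

lemma NF_T: "j \<le> DIM('v) \<Longrightarrow> p \<in> NF \<Longrightarrow> gT j * p \<in> NF"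
proof (rule NF_left_mult)
  fix g u js assume *: "j \<le> DIM('v)" "g \<in> WAc" "u \<in> Omega D" "invol.reduced_word js"
  interpret RL: reflection_lattice KK PP "alpha D j"
    by (rule reflection_lattice_PP[OF alpha_in[OF *(1)]])
  note S = invol.reduced_word_set[OF *(4)]
  define s where "s = RL.s g"
  define d where "d = scalar (tt j) * RL.d g"
  have c: "s \<in> WAc" "d \<in> WAc"
    using RL.s_closed[of g] RL.d_closed[of g] * unfolding s_def d_def
    by (simp_all add: WA_closed scalar_WA tt_closed flip: WA_eq)
  \<comment> \<open>Moving \<open>T_j\<close> to the right past \<open>T_u\<close> turns it into
    \<open>T_k\<close>, where \<open>u\<close> carries \<open>sar k\<close> to \<open>sar j\<close>;
    the parameters of \<open>j\<close> and \<open>k\<close> agree.\<close>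
  obtain k where k: "k \<le> DIM('v)" "perm_index D u k = j"
    using Omega_perm_surj[OF *(3,1)] by blast
  have tk: "tt j = tt k"
    using tau_Omega[OF *(3) k(1)] k(2) by simp
  have Om_T: "gT j * gO u \<approx> gO u * gT k"
    using cg_rel[OF daha_rel.Om_T[OF *(3) k(1)]] k(2) by (simp add: cg_sym)
  have main: "embX s * gO u * TW (k # js) \<in> NF"
  proof (cases "invol.reduced_word (k # js)")
    case True
    then show ?thesis
      using NF_term[OF c(1) *(3) True] by (simp add: Om_T_term_def)
  next
    \<comment> \<open>The length drops, so \<open>js\<close> is replaced by a reduced word starting
      with \<open>k\<close>; the quadratic relation then leaves terms with the reduced words
      \<open>k # ks\<close> and \<open>ks\<close>.\<close>
    case False
    obtain ks where ks: "invol.reduced_word (k # ks)" "wd (k # ks) = wd js"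
      using descent_word[OF *(4) k(1) False] .
    note kS = invol.reduced_word_set[OF ks(1)]
    have "TW (k # js) \<approx> gT k * TW (k # ks)"
      using k S TW_matsumoto[OF *(4) ks(1) ks(2)[symmetric]] unfolding TW_simps(2)[of k js]
      by (intro cg_mult cg_refl) (simp_all add: FCs)
    also have "gT k * TW (k # ks) = (gT k * gT k) * TW ks"
      by (simp add: mult.assoc)
    also have "\<dots> \<approx> (scalar (tt k) * gT k + 1) * TW ks"
      using k kS by (intro cg_mult T_square_cg cg_refl) (simp_all add: TW_closed)
    also have "(scalar (tt k) * gT k + 1) * TW ks = scalar (tt k) * TW (k # ks) + TW ks"
      by (simp add: distrib_right mult.assoc)
    finally have "embX s * gO u * TW (k # js) \<approx> embX s * gO u * (scalar (tt k) * TW (k # ks) + TW ks)"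
      using c * by (intro cg_mult cg_refl) (simp_all add: FCs)
    also have "embX s * gO u * (scalar (tt k) * TW (k # ks) + TW ks) =
        scalar (tt k) * Om_T_term s u (k # ks) + Om_T_term s u ks"
      unfolding Om_T_term_def distrib_left by (simp only: scalar_left_commute)
    finally show ?thesis
      by (rule NF_cong[rotated])
        (use c * ks invol.reduced_word_Cons[OF ks(1)] tt_closed[OF k(1)] in \<open>intro NF_add NF_scalar NF_term\<close>)
  qed
  have "gT j * Om_T_term g u js = gT j * embX g * (gO u * TW js)"
    by (simp add: Om_T_term_def mult.assoc)
  also have "\<dots> \<approx> (embX s * gT j + embX d) * (gO u * TW js)"
    unfolding s_def d_def using * S by (intro cg_mult T_embX cg_refl) (simp_all add: FCs TW_closed)
  also have "\<dots> = embX s * (gT j * gO u) * TW js + Om_T_term d u js"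
    by (simp add: Om_T_term_def distrib_right mult.assoc)
  also have "\<dots> \<approx> embX s * (gO u * gT k) * TW js + Om_T_term d u js"
    using * c S by (intro cg_add cg_mult Om_T cg_refl) (simp_all add: FCs TW_closed Om_T_term_closed)
  also have "embX s * (gO u * gT k) * TW js = embX s * gO u * TW (k # js)"
    by (simp add: mult.assoc)
  finally show "gT j * Om_T_term g u js \<in> NF"
    by (rule NF_cong[rotated]) (use main * c in \<open>intro NF_add NF_term\<close>)
qed (simp_all add: FCs)

lemma NF_one: "1 \<in> NF"
proof -
  have "1 \<approx> gX 0"
    by (rule cg_sym[OF cg_rel[OF daha_rel.X_zero]])
  then have "1 * 1 \<approx> gX 0 * gO id"
    by (rule cg_mult[OF _ cg_sym[OF Om_id_cg]])
  moreover have "Om_T_term 1 id [] = gX 0 * gO id"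
    using embX_single[of 0 1] by (simp add: Om_T_term_def del: id_apply)
  moreover have "invol.reduced_word []"
    by (simp add: invol.reduced_word_def)
  ultimately show ?thesis
    using NF_cong[OF NF_term[OF _ id_Omega, of 1 "[]"], of 1] by (simp add: WA_closed del: id_apply)
qed

lemma free_algebra_NF:
  assumes "f \<in> FC"
  shows "f \<in> NF"
proof -
  have "\<forall>p\<in>NF. f * p \<in> NF"
    using assms
  proof (induction f rule: free_induct)
    case (gen g)
    then consider (T) j where "j \<le> DIM('v)" "g = Gen_T j" | (Ti) j where "j \<le> DIM('v)" "g = Gen_T_inv j"
      | (O) u where "u \<in> Omega D" "g = Gen_Om u" | (Oi) u where "u \<in> Omega D" "g = Gen_Om_inv u"
      | (X) \<nu> where "\<nu> \<in> PP" "g = Gen_X \<nu>"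
      by (auto simp: daha_gens_def)
    then show ?case
    proof cases
      case Ti
      have "Defs.gen g * p \<in> NF" if p: "p \<in> NF" for p
      proof (rule NF_cong)
        have "p \<in> FC"
          using p cgD(1) by (auto simp: NF_def)
        then show "Defs.gen g * p \<approx> (gT j - scalar (tt j)) * p"
          unfolding Ti(2) using Ti(1) by (intro cg_mult T_inv_cg cg_refl)
        show "(gT j - scalar (tt j)) * p \<in> NF"
          unfolding left_diff_distrib using p Ti(1) by (intro NF_minus NF_T NF_scalar tt_closed)
      qed
      then show ?thesis by blast
    next
      case Oi
      have "Defs.gen g * p \<in> NF" if p: "p \<in> NF" for p
      proof (rule NF_cong)
        have "p \<in> FC"
          using p cgD(1) by (auto simp: NF_def)
        then show "Defs.gen g * p \<approx> gO (inv_into UNIV u) * p"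
          unfolding Oi(2) using Oi(1) by (intro cg_mult Om_inv_cg cg_refl)
        show "gO (inv_into UNIV u) * p \<in> NF"
          by (rule NF_Om[OF Omega_inverse[OF Oi(1)] p])
      qed
      then show ?thesis by blast
    qed (simp_all add: NF_T NF_Om NF_X)
  qed (simp_all add: NF_scalar NF_add distrib_right mult.assoc)
  then show ?thesis
    using NF_one by force
qed

end

section \<open>Leading coefficients and injectivity\<close>

context affine_data
begin

definition LA_regular :: "'v loc_alg \<Rightarrow> bool" where
  "LA_regular a \<longleftrightarrow> a \<in> carrier LA \<and> (\<forall>x\<in>carrier LA. a \<otimes>\<^bsub>LA\<^esub> x = \<zero>\<^bsub>LA\<^esub> \<longrightarrow> x = \<zero>\<^bsub>LA\<^esub>)"

lemma LA_regular_mult: "LA_regular a \<Longrightarrow> LA_regular b \<Longrightarrow> LA_regular (a \<otimes>\<^bsub>LA\<^esub> b)"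
  unfolding LA_regular_def by (metis SS.A.m_assoc SS.A.m_closed)

lemma LA_regular_act:
  assumes w: "w \<in> carrier W" and a: "LA_regular a"
  shows "LA_regular (loc_act D (gradient w) a)"
  unfolding LA_regular_def
proof (intro conjI ballI impI)
  let ?A = "loc_act D (gradient w)" and ?B = "loc_act D (gradient (inv_into UNIV w))"
  have ac: "a \<in> carrier LA"
    using a by (simp add: LA_regular_def)
  show "?A a \<in> carrier LA"
    using w ac by simp
  fix x assume x: "x \<in> carrier LA" "?A a \<otimes>\<^bsub>LA\<^esub> x = \<zero>\<^bsub>LA\<^esub>"
  note i = inv_W[OF w]
  have BA: "?B (?A y) = y" "?A (?B y) = y" if "y \<in> carrier LA" for y
    using SS.act_mult[OF i(1) w that] SS.act_mult[OF w i(1) that] act_id[OF that] by (simp_all add: i)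
  have "?B (?A a \<otimes>\<^bsub>LA\<^esub> x) = \<zero>\<^bsub>LA\<^esub>"
    using x(2) i(1) by simp
  then have "a \<otimes>\<^bsub>LA\<^esub> ?B x = \<zero>\<^bsub>LA\<^esub>"
    using w i(1) ac x(1) by (simp add: BA)
  then have "?B x = \<zero>\<^bsub>LA\<^esub>"
    using a x(1) i(1) by (simp add: LA_regular_def)
  then show "x = \<zero>\<^bsub>LA\<^esub>"
    using BA(2)[OF x(1)] w by simp
qed

text \<open>Clearing the denominator turns \<open>cc j\<close> into the unit \<open>1/tau\<close>
  times a binomial with nonzero exponent, which is regular.\<close>

lemma cc_regular:
  assumes j: "j \<le> DIM('v)"
  shows "LA_regular (cc j)"
  unfolding LA_regular_def
proof (intro conjI ballI impI)
  show "cc j \<in> carrier LA"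
    by (rule cc_dd_closed[OF j])
  let ?u = "1 - X_pow (- alpha D j) :: 'v weight_alg"
  let ?r = "scalar (tau_inv D j) * (1 - Poly_Mapping.single (- alpha D j) (tau D j * tau D j))"
  have u: "?u \<in> WAc"
    by (rule factor_WA[OF uminus_\<Phi>[OF alpha_in[OF j]]])
  have eq: "?u * scalar (tau D j) - scalar (tt j) = ?r"
    using tau_tau_inv[of j] by (simp add: X_pow_def algebra_simps mult_single single_diff)
  have r: "regular ?r"
  proof (rule regular_mult)
    have "regular (scalar (tau D j) * scalar (tau_inv D j) :: 'v weight_alg)"
      by (simp add: mult_single tau_tau_inv regular_1)
    then show "regular (scalar (tau_inv D j) :: 'v weight_alg)"
      by (rule regular_mult_left)
    show "regular (1 - Poly_Mapping.single (- alpha D j) (tau D j * tau D j))"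
      using nonzero[OF alpha_in[OF j]] by (intro regular_binomial) simp
  qed
  have s: "scalar (tt j) \<in> WAc" "scalar (tau D j) \<in> WAc"
    by (simp_all add: scalar_WA tt_closed tau_closed j)
  have uc: "\<iota> ?u \<otimes>\<^bsub>LA\<^esub> cc j = \<iota> ?r"
    unfolding \<iota>_cc[OF j] eq[symmetric]
    by (simp only: \<iota>_rules(6)[OF WA_closed(4)[OF u s(2)] s(1)] \<iota>_rules(3)[OF u s(2)])
  have c: "\<iota> ?u \<in> carrier LA"
    by (rule \<iota>_rules(1)[OF u])
  fix x assume x: "x \<in> carrier LA" "cc j \<otimes>\<^bsub>LA\<^esub> x = \<zero>\<^bsub>LA\<^esub>"
  have "\<iota> ?r \<otimes>\<^bsub>LA\<^esub> x = \<iota> ?u \<otimes>\<^bsub>LA\<^esub> (cc j \<otimes>\<^bsub>LA\<^esub> x)"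
    unfolding uc[symmetric] using c cc_dd_closed(2)[OF j] x(1) by (simp add: SS.A.m_assoc)
  then have "\<iota> ?r \<otimes>\<^bsub>LA\<^esub> x = \<zero>\<^bsub>LA\<^esub>"
    using x(2) c by simp
  moreover have "?r \<in> WAc"
    unfolding eq[symmetric] by (rule WA_closed(3)[OF WA_closed(4)[OF u s(2)] s(1)])
  ultimately show "x = \<zero>\<^bsub>LA\<^esub>"
    using LA_cancel[OF _ r x(1)] by blast
qed

section \<open>Triangularity with respect to length\<close>

abbreviation "TC js \<equiv> list_mult (smash D) (map (T_check D) js)"

text \<open>The words \<open>ks\<close> need not be reduced, which makes the set easy to propagate;
  for a reduced \<open>js\<close> the element \<open>wd js\<close> still lies outside.\<close>

definition lower :: "nat list \<Rightarrow> ('v \<Rightarrow> 'v) set" where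
  "lower js = {wd ks |ks. set ks \<subseteq> affine_indices D \<and> length ks < length js}"

lemma smash_apply: "(F \<boxplus> H) x = F x \<oplus>\<^bsub>LA\<^esub> H x" "\<zero>\<^bsub>smash D\<^esub> x = \<zero>\<^bsub>LA\<^esub>"
  by (simp_all add: smash_eq SS.add_SP SS.zero_SP)

lemma SUPP_mono: "F \<in> SS.supported A \<Longrightarrow> A \<subseteq> B \<Longrightarrow> F \<in> SS.supported B"
  by (auto simp: SS.supported_def)

text \<open>Each factor either multiplies by its reflection with coefficient \<open>cc j\<close> or
  drops the letter. The leading coefficient is a product of twisted \<open>cc j\<close>, hence
  regular. If \<open>js\<close> is reduced, the remainder cannot reach \<open>wd js\<close>.\<close>

lemma TC_leading:
  assumes "set js \<subseteq> affine_indices D"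
  shows "\<exists>a R. LA_regular a \<and> R \<in> SS.supported (lower js) \<and> TC js = el a (wd js) \<boxplus> R"
  using assms
proof (induction js)
  case Nil
  have z: "\<zero>\<^bsub>smash D\<^esub> \<in> SS.supported (lower [])"
    using SM.zero_closed by (simp add: SS.supported_def smash_eq) (simp add: SS.zero_SP)
  have "TC [] = el \<one>\<^bsub>LA\<^esub> id \<boxplus> \<zero>\<^bsub>smash D\<^esub>"
    using smash_grp_id smash_grp_closed[OF id_W] by (simp add: smash_grp_def del: id_apply)
  then show ?case
    using z by (intro exI[of _ "\<one>\<^bsub>LA\<^esub>"] exI[of _ "\<zero>\<^bsub>smash D\<^esub>"]) (simp add: LA_regular_def del: id_apply)
next
  case (Cons j js)
  have j: "j \<le> DIM('v)" and S: "set js \<subseteq> affine_indices D"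
    using Cons.prems by auto
  obtain a R where IH: "LA_regular a" "R \<in> SS.supported (lower js)" "TC js = el a (wd js) \<boxplus> R"
    using Cons.IH[OF S] by blast
  have ac: "a \<in> carrier LA"
    using IH(1) by (simp add: LA_regular_def)
  note W = sr_in_W[OF j] id_W wd_in_W[OF S]
  note cd = cc_dd_closed[OF j]
  have R: "R \<in> SC"
    using SS.supported_carrier[OF IH(2)] by (simp add: smash_eq)
  have e: "el a (wd js) \<in> SC" "el (cc j) (sr j) \<in> SC" "el (dd j) id \<in> SC"
    unfolding smash_eq using ac cd W by (auto intro!: SS.el_closed)
  let ?b = "cc j \<otimes>\<^bsub>LA\<^esub> loc_act D (gradient (sr j)) a"
  let ?R = "el (dd j \<otimes>\<^bsub>LA\<^esub> a) (wd js) \<boxplus> T_check D j \<boxdot> R"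
  have "T_check D j \<boxdot> el a (wd js) = el ?b (wd (j # js)) \<boxplus> el (dd j \<otimes>\<^bsub>LA\<^esub> a) (wd js)"
    unfolding T_check_eq[OF j] SM.l_distr[OF e(2,3,1)] unfolding smash_eq using ac cd W
    by (simp add: SS.el_mult act_id del: id_apply)
  then have "TC (j # js) = el ?b (wd (j # js)) \<boxplus> el (dd j \<otimes>\<^bsub>LA\<^esub> a) (wd js) \<boxplus> T_check D j \<boxdot> R"
    using IH(3) e R T_check_closed[OF j] by (simp add: SM.r_distr)
  moreover have "el ?b (wd (j # js)) \<in> SC" "el (dd j \<otimes>\<^bsub>LA\<^esub> a) (wd js) \<in> SC"
    unfolding smash_eq using ac cd W wd_in_W[OF Cons.prems] by (auto intro!: SS.el_closed simp del: invol.wd.simps)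
  ultimately have "TC (j # js) = el ?b (wd (j # js)) \<boxplus> ?R"
    using T_check_closed[OF j] R by (simp add: SM.a_assoc)
  moreover have "LA_regular ?b"
    by (intro LA_regular_mult cc_regular[OF j] LA_regular_act IH(1) W)
  moreover have "?R \<in> SS.supported (lower (j # js))"
    unfolding smash_eq
  proof (rule SS.supported_add)
    show "el (dd j \<otimes>\<^bsub>LA\<^esub> a) (wd js) \<in> SS.supported (lower (j # js))"
      using ac cd W S by (intro SS.supported_el) (auto simp: lower_def)
    have T: "T_check D j \<in> SS.supported {sr j, id}"
      unfolding T_check_eq[OF j, unfolded smash_eq] using cd W
      by (intro SS.supported_add SS.supported_el) auto
    show "T_check D j \<otimes>\<^bsub>SS.SP\<^esub> R \<in> SS.supported (lower (j # js))"
    proof (rule SS.supported_mult[OF T IH(2)])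
      fix x y assume "x \<in> {sr j, id}" "y \<in> lower js"
      then obtain ks where ks: "set ks \<subseteq> affine_indices D" "length ks < length js" "y = wd ks" and x: "x = sr j \<or> x = id"
        by (auto simp: lower_def)
      have "\<exists>ls\<in>{j # ks, ks}. x \<circ> y = wd ls"
        using x ks(3) by auto
      moreover have "set ls \<subseteq> affine_indices D \<and> length ls < length (j # js)" if "ls \<in> {j # ks, ks}" for ls
        using that ks(1,2) j by auto
      ultimately show "x \<otimes>\<^bsub>W\<^esub> y \<in> lower (j # js)"
        unfolding lower_def W_sel by blast
    qed
  qed
  ultimately show ?case by blast
qed

lemma ev_term_leading:
  assumes g: "g \<in> WAc" and u: "u \<in> Omega D" and js: "set js \<subseteq> affine_indices D"
  shows "\<exists>a R. LA_regular a \<and> R \<in> SS.supported ((\<lambda>x. u \<circ> x) ` lower js) \<and>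
    ev (Om_T_term g u js) = el (\<iota> g \<otimes>\<^bsub>LA\<^esub> a) (u \<circ> wd js) \<boxplus> R"
proof -
  obtain a R where T: "LA_regular a" "R \<in> SS.supported (lower js)" "TC js = el a (wd js) \<boxplus> R"
    using TC_leading[OF js] by blast
  have ac: "a \<in> carrier LA"
    using T(1) by (simp add: LA_regular_def)
  have uW: "u \<in> carrier W"
    by (rule Omega_in_W[OF u])
  have R: "R \<in> SC"
    using SS.supported_carrier[OF T(2)] by (simp add: smash_eq)
  let ?e = "el (\<iota> g) u"
  have e: "SL g \<boxdot> smash_grp D u = ?e"
    unfolding SL_el smash_grp_def smash_eq using g uW by (simp add: SS.el_mult id_W act_id \<iota>_rules del: id_apply)
  have c: "el a (wd js) \<in> SC" "?e \<in> SC" "\<iota> g \<in> carrier LA"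
    unfolding smash_eq using ac wd_in_W[OF js] uW g by (simp_all add: SS.el_closed \<iota>_rules)
  have "ev (Om_T_term g u js) = ?e \<boxdot> TC js"
    using g u js by (simp add: Om_T_term_def ev_mult FCs TW_closed ev_embX ev_gen ev_TW e)
  also have "\<dots> = ?e \<boxdot> el a (wd js) \<boxplus> ?e \<boxdot> R"
    unfolding T(3) using c R by (simp add: SM.r_distr)
  also have "?e \<boxdot> el a (wd js) = el (\<iota> g \<otimes>\<^bsub>LA\<^esub> loc_act D (gradient u) a) (u \<circ> wd js)"
    unfolding smash_eq using ac c uW wd_in_W[OF js] by (simp add: SS.el_mult)
  finally have eq: "ev (Om_T_term g u js) =
      el (\<iota> g \<otimes>\<^bsub>LA\<^esub> loc_act D (gradient u) a) (u \<circ> wd js) \<boxplus> ?e \<boxdot> R" .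
  have "?e \<in> SS.supported {u}"
    using c uW by (intro SS.supported_el) simp_all
  then have "?e \<boxdot> R \<in> SS.supported ((\<lambda>x. u \<circ> x) ` lower js)"
    unfolding smash_eq by (rule SS.supported_mult[OF _ T(2)]) auto
  with eq show ?thesis
    using LA_regular_act[OF uW T(1)] by blast
qed

lemma ev_sum_zero:
  assumes S: "finite S" "S \<subseteq> Omega D \<times> Collect canonical" and g: "range g \<subseteq> WAc"
    and zero: "ev (\<Sum>(u, js)\<in>S. Om_T_term (g (u, js)) u js) = \<zero>\<^bsub>smash D\<^esub>" and b: "b \<in> S"
  shows "g b = 0"
proof (rule ccontr)
  assume nz: "g b \<noteq> 0"
  let ?t = "\<lambda>(u, js). Om_T_term (g (u, js)) u js"
  let ?B = "{b \<in> S. g b \<noteq> 0}"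
  let ?l = "\<lambda>b. length (snd b)"
  have fin: "finite (?l ` ?B)"
    using S(1) by simp
  moreover have "?l ` ?B \<noteq> {}"
    using b nz by blast
  ultimately have "Max (?l ` ?B) \<in> ?l ` ?B"
    by (rule Max_in)
  then obtain b0 where b0: "b0 \<in> ?B" and "Max (?l ` ?B) = ?l b0"
    by blast
  then have max: "length (snd b) \<le> length (snd b0)" if "b \<in> ?B" for b
    using Max_ge[OF fin imageI[OF that]] by simp
  obtain u0 js0 where b0_eq: "b0 = (u0, js0)"
    by (cases b0)
  have u0: "u0 \<in> Omega D" and js0: "canonical js0" and bS: "(u0, js0) \<in> S" and nz0: "g (u0, js0) \<noteq> 0"
    using b0 b0_eq S(2) by auto
  have r0: "invol.reduced_word js0"
    using js0 by (simp add: canonical_def)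
  note s0 = invol.reduced_word_set[OF r0]
  let ?z = "u0 \<circ> wd js0"
  have gW: "g b \<in> WAc" for b
    using g by auto
  \<comment> \<open>Unique factorization would produce a word for \<open>wd js0\<close> shorter than
    the reduced word \<open>js0\<close>.\<close>
  have not_lower: "?z \<notin> (\<lambda>x. u \<circ> x) ` lower js" if "u \<in> Omega D" "length js \<le> length js0" for u js
  proof
    assume "?z \<in> (\<lambda>x. u \<circ> x) ` lower js"
    then obtain ks where ks: "set ks \<subseteq> affine_indices D" "length ks < length js" "?z = u \<circ> wd ks"
      by (auto simp: lower_def)
    have "wd ks = wd js0"
      using Omega_wd_unique(2)[OF u0 that(1) s0 ks(1,3)] by simp
    then show False
      using invol.reduced_wordD[OF r0 ks(1)] ks(2) that(2) by simp
  qed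
  \<comment> \<open>The leading element of another term differs from \<open>?z\<close>, since a
    canonical word is determined by its value; the lower part is excluded because \<open>js0\<close>
    has maximal length among the nonzero terms.\<close>
  have other: "ev (?t b) \<in> SS.supported (- {?z})" if b: "b \<in> S" "b \<noteq> b0" for b
  proof -
    obtain u js where eq: "b = (u, js)" "u \<in> Omega D" "canonical js"
      using b(1) S(2) by auto
    have r: "invol.reduced_word js"
      using eq(3) by (simp add: canonical_def)
    show ?thesis
    proof (cases "g b = 0")
      case True
      then have "ev (?t b) = \<zero>\<^bsub>smash D\<^esub>"
        using eq(1) ev_II[OF II_zero] by (simp add: Om_T_term_zero)
      then show ?thesis
        using SM.zero_closed by (simp add: SS.supported_def smash_eq) (simp add: SS.zero_SP)
    next
      case False
      then have len: "length js \<le> length js0"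
        using max[of b] b eq b0_eq by simp
      obtain a R where T: "LA_regular a" "R \<in> SS.supported ((\<lambda>x. u \<circ> x) ` lower js)"
        "ev (Om_T_term (g b) u js) = el (\<iota> (g b) \<otimes>\<^bsub>LA\<^esub> a) (u \<circ> wd js) \<boxplus> R"
        using ev_term_leading[OF gW eq(2) invol.reduced_word_set[OF r]] by blast
      have "u \<circ> wd js \<noteq> ?z"
      proof
        assume z: "u \<circ> wd js = ?z"
        then have "u = u0" "wd js = wd js0"
          using Omega_wd_unique[OF eq(2) u0 invol.reduced_word_set[OF r] s0] by auto
        then show False
          using canonical_unique[OF eq(3) js0] b(2) eq(1) b0_eq by simp
      qed
      moreover have "u \<circ> wd js \<in> carrier W"
        by (intro carrier_W_comp Omega_in_W eq wd_in_W invol.reduced_word_set[OF r])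
      moreover have "\<iota> (g b) \<otimes>\<^bsub>LA\<^esub> a \<in> carrier LA"
        using T(1) gW[of b] by (simp add: LA_regular_def \<iota>_rules)
      ultimately have "el (\<iota> (g b) \<otimes>\<^bsub>LA\<^esub> a) (u \<circ> wd js) \<boxplus> R \<in> SS.supported (- {?z})"
        unfolding smash_eq using not_lower[OF eq(2) len]
        by (intro SS.supported_add SS.supported_el SUPP_mono[OF T(2)]) auto
      then show ?thesis
        using T(3) eq(1) by simp
    qed
  qed
  have t_FC: "?t b \<in> FC" if b: "b \<in> S" for b
  proof -
    obtain u js where "b = (u, js)" "u \<in> Omega D" "canonical js"
      using b S(2) by auto
    then show ?thesis
      using gW[of b] invol.reduced_word_set[of js] by (simp add: canonical_def Om_T_term_closed)
  qed
  have rest: "(\<Sum>b\<in>T. ?t b) \<in> FC \<and> ev (\<Sum>b\<in>T. ?t b) \<in> SS.supported (- {?z})" if "finite T" "T \<subseteq> S - {b0}" for T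
    using that
  proof (induction T)
    case empty
    have "\<zero>\<^bsub>smash D\<^esub> \<in> SS.supported (- {?z})"
      using SM.zero_closed by (simp add: SS.supported_def smash_eq) (simp add: SS.zero_SP)
    then show ?case
      using ev_II[OF II_zero] FC_closed(2) by (simp only: sum.empty simp_thms)
  next
    case (insert b T)
    then have b: "b \<in> S" "b \<noteq> b0"
      by auto
    have IH: "(\<Sum>b\<in>T. ?t b) \<in> FC" "ev (\<Sum>b\<in>T. ?t b) \<in> SS.supported (- {?z})"
      using insert.IH insert.prems by blast+
    have "ev (?t b + (\<Sum>b\<in>T. ?t b)) \<in> SS.supported (- {?z})"
      unfolding ev_add[OF t_FC[OF b(1)] IH(1)]
      by (rule SS.supported_add[folded smash_eq, OF other[OF b] IH(2)])
    moreover have "?t b + (\<Sum>b\<in>T. ?t b) \<in> FC"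
      by (rule FC_closed(6)[OF t_FC[OF b(1)] IH(1)])
    ultimately show ?case
      unfolding sum.insert[OF insert.hyps] by blast
  qed
  let ?rest = "ev (\<Sum>b\<in>S - {b0}. ?t b)"
  have rest: "(\<Sum>b\<in>S - {b0}. ?t b) \<in> FC" "?rest \<in> SS.supported (- {?z})"
    using rest[of "S - {b0}"] S(1) by blast+
  obtain a R where T: "LA_regular a" "R \<in> SS.supported ((\<lambda>x. u0 \<circ> x) ` lower js0)"
    "ev (Om_T_term (g b0) u0 js0) = el (\<iota> (g b0) \<otimes>\<^bsub>LA\<^esub> a) ?z \<boxplus> R"
    using ev_term_leading[OF gW u0 s0] by blast
  have "(\<Sum>b\<in>S. ?t b) = ?t b0 + (\<Sum>b\<in>S - {b0}. ?t b)"
    using b0 by (intro sum.remove S(1)) simp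
  then have "\<zero>\<^bsub>smash D\<^esub> = ev (?t b0) \<boxplus> ?rest"
    using zero ev_add[OF t_FC rest(1), of b0] b0 by simp
  also have "ev (?t b0) = el (\<iota> (g b0) \<otimes>\<^bsub>LA\<^esub> a) ?z \<boxplus> R"
    using T(3) by (simp add: b0_eq)
  \<comment> \<open>Evaluation at \<open>?z\<close> isolates the leading coefficient of the term
    \<open>b0\<close>; regularity of \<open>a\<close> then forces \<open>g b0\<close> to
    vanish.\<close>
  finally have "\<zero>\<^bsub>smash D\<^esub> ?z = (el (\<iota> (g b0) \<otimes>\<^bsub>LA\<^esub> a) ?z \<boxplus> R \<boxplus> ?rest) ?z"
    by (rule fun_cong)
  moreover have "R ?z = \<zero>\<^bsub>LA\<^esub>" "?rest ?z = \<zero>\<^bsub>LA\<^esub>"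
    using T(2) rest(2) not_lower[OF u0 order_refl] by (auto simp: SS.supported_def)
  moreover have ga: "a \<in> carrier LA" "\<iota> (g b0) \<in> carrier LA"
    using T(1) gW[of b0] by (simp_all add: LA_regular_def \<iota>_rules)
  ultimately have "\<iota> (g b0) \<otimes>\<^bsub>LA\<^esub> a = \<zero>\<^bsub>LA\<^esub>"
    by (simp only: smash_apply smash_elem_def if_True simp_thms SS.A.r_zero SS.A.m_closed SS.A.zero_closed)
  then have "\<iota> (g b0) = \<zero>\<^bsub>LA\<^esub>"
    using T(1) ga by (simp add: LA_regular_def SS.A.m_comm)
  then have "g b0 = 0"
    using Lz.emb_inj[of "g b0" 0] gW[of b0] \<iota>_rules(5) by (simp add: \<iota>_eq LA_eq WA_closed)
  then show False
    using b0 by simp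
qed

lemma ev_kernel:
  assumes p: "p \<in> FC" and zero: "ev p = \<zero>\<^bsub>smash D\<^esub>"
  shows "p \<in> II"
proof -
  obtain S g where S: "finite S" "S \<subseteq> Omega D \<times> Collect canonical" "range g \<subseteq> WAc"
    "p \<approx> (\<Sum>(u, js)\<in>S. Om_T_term (g (u, js)) u js)" (is "p \<approx> ?q")
    using free_algebra_NF[OF p] by (auto simp: NF_def)
  have q: "?q \<in> FC" "p - ?q \<in> II"
    using S(4) by (auto simp: cg_def)
  have "ev p = ev (p - ?q) \<boxplus> ev ?q"
    using ev_add[OF FC_closed(3)[OF p q(1)] q(1)] by simp
  then have "ev ?q = \<zero>\<^bsub>smash D\<^esub>"
    using zero ev_II[OF q(2)] ev_closed[OF q(1)] by simp
  then have "g b = 0" if "b \<in> S" for b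
    using ev_sum_zero[OF S(1,2,3)] that by blast
  then have "?q = 0"
    by (intro sum.neutral) (auto simp: Om_T_term_zero)
  then show ?thesis
    using q(2) by simp
qed

end

theorem theorem3p2:
  fixes D :: "'v::euclidean_space affine_datum"
  assumes "affine_datum D"
  shows "\<exists>J \<in> algebra_hom (coeff_ring D) (DAHA D) (DAHA_scalar D) (smash D) (smash_scalar D).
    (\<forall>j\<le>DIM('v). J (DAHA_T D j) = T_check D j) \<and>
    (\<forall>u\<in>Omega D. J (DAHA_Om D u) = smash_grp D u) \<and>
    (\<forall>\<nu>\<in>weights D. J (DAHA_X D \<nu>) = smash_X D \<nu>) \<and>
    inj_on J (carrier (DAHA D)) \<and>
    (\<forall>J' \<in> algebra_hom (coeff_ring D) (DAHA D) (DAHA_scalar D) (smash D) (smash_scalar D).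
       (\<forall>j\<le>DIM('v). J' (DAHA_T D j) = T_check D j) \<and>
       (\<forall>u\<in>Omega D. J' (DAHA_Om D u) = smash_grp D u) \<and>
       (\<forall>\<nu>\<in>weights D. J' (DAHA_X D \<nu>) = smash_X D \<nu>) \<longrightarrow>
       (\<forall>x\<in>carrier (DAHA D). J' x = J x))"
proof -
  interpret affine_data D
    by unfold_locales (rule assms)
  show ?thesis
  proof (intro bexI[OF _ JJ_hom] conjI allI ballI impI)
    show "inj_on JJ (carrier (DAHA D))"
      by (rule JJ_inj[OF ev_kernel])
  next
    fix J' x
    assume J': "J' \<in> algebra_hom (coeff_ring D) (DAHA D) (DAHA_scalar D) (smash D) (smash_scalar D)"
      and gens: "(\<forall>j\<le>DIM('v). J' (DAHA_T D j) = T_check D j) \<and> (\<forall>u\<in>Omega D. J' (DAHA_Om D u) = smash_grp D u) \<and>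
        (\<forall>\<nu>\<in>weights D. J' (DAHA_X D \<nu>) = smash_X D \<nu>)"
      and x: "x \<in> carrier (DAHA D)"
    show "J' x = JJ x"
      by (rule JJ_unique[OF J' _ _ _ x]) (use gens in simp_all)
  qed (simp_all add: JJ_gens)
qed

end
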